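(* Let $k$ be an algebraically closed field of characteristic zero, let $C$ be a smooth irreducible projective curve over $k$ that possesses a Galois embedding with Galois group $G$, and let $d\geq 1$ be an integer. Then $C^d$ possesses a Galois embedding with Galois group $G^d\rtimes S_d$, where $S_d$ is the symmetric group on $d$ letters (acting on $G^d$ by permuting the factors).
   Context: Let $X$ be a smooth irreducible projective variety of dimension $m$ over an algebraically closed field $k$ of characteristic zero, with function field $k(X)$. Let $D$ be a very ample divisor on $X$, and let $\varphi_D:X\hookrightarrow\mathbb{P}^N$ be the embedding it induces (given by the complete linear system $|D|$, so $N=\dim H^0(X,\mathcal{O}_X(D))-1$). Let $W\subseteq\mathbb{P}^N$ be a linear subvariety of dimension $N-m-1$ disjoint from $\varphi_D(X)$ (empty if $N=m$), and let $W_0\simeq\mathbb{P}^m$ be a linear subvariety of $\mathbb{P}^N$ of dimension $m$ disjoint from $W$. Let $\pi_W:\mathbb{P}^N\dashrightarrow W_0$ be the linear projection with center $W$, and let $f_W=\pi_W\varphi_D:X\to W_0\simeq\mathbb{P}^m$, which is a morphism. The embedding $\varphi_D$ is called Galois if there exists such a $W$ for which the field extension $f_W^*k(\mathbb{P}^m)\subseteq k(X)$ is Galois; such a $W$ is called a Galois subspace for $D$, and the Galois group of this extension is called the Galois group of the Galois embedding. One says that $X$ possesses a Galois embedding with Galois group $G$ if there is a very ample divisor $D$ on $X$ such that $\varphi_D$ is Galois with a Galois subspace whose Galois group is isomorphic to $G$. *)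

theory Defs
  imports
    "HOL-Algebra.Algebra"
    "HOL-Computational_Algebra.Polynomial"
    "HOL-Library.Poly_Mapping"
    "HOL-Library.Function_Algebras"
begin

text \<open>
  Classical projective varieties over an algebraically closed field \<open>'k\<close>, in the sense of
  Hartshorne, Chapter I.  The projective space \<open>P(I)\<close> has one homogeneous coordinate for each
  element of a finite set \<open>I\<close>, so projective \<open>N\<close>-space is \<open>P({..<Suc N})\<close>.  Allowing an arbitrary
  coordinate set makes the Segre product easy to write down.
\<close>

section \<open>Projective space\<close>

definition scal :: "'k::field \<Rightarrow> ('i \<Rightarrow> 'k) \<Rightarrow> ('i \<Rightarrow> 'k)"
  where "scal c x = (\<lambda>i. c * x i)"

global_interpretation cvec: vector_space scal
  by unfold_locales (auto simp: scal_def fun_eq_iff algebra_simps)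

definition coord_space :: "'i set \<Rightarrow> ('i \<Rightarrow> 'k::field) set"
  where "coord_space I = {x. \<forall>i. i \<notin> I \<longrightarrow> x i = 0}"

text \<open>
  A point is the set of all its homogeneous coordinate vectors: a line without the origin.
  Hence \<open>\<Union>V\<close> is the affine cone over a set \<open>V\<close> of points, without its vertex.
\<close>

type_synonym ('i, 'k) point = "('i \<Rightarrow> 'k) set"

definition pt :: "('i \<Rightarrow> 'k::field) \<Rightarrow> ('i, 'k) point"
  where "pt x = {scal c x | c. c \<noteq> 0}"

definition proj_space :: "'i set \<Rightarrow> ('i, 'k::field) point set"
  where "proj_space I = {pt x | x. x \<in> coord_space I \<and> x \<noteq> 0}"

section \<open>Polynomials and the Zariski topology\<close>

type_synonym ('i, 'k) mvpoly = "('i \<Rightarrow>\<^sub>0 nat) \<Rightarrow>\<^sub>0 'k"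

definition mv_eval :: "('i, 'k::field) mvpoly \<Rightarrow> ('i \<Rightarrow> 'k) \<Rightarrow> 'k"
  where "mv_eval F x =
    (\<Sum>m\<in>Poly_Mapping.keys F. Poly_Mapping.lookup F m *
      (\<Prod>i\<in>Poly_Mapping.keys m. x i ^ Poly_Mapping.lookup m i))"

text \<open>The value at \<open>x\<close> of the formal partial derivative of \<open>F\<close> with respect to the variable \<open>i\<close>.\<close>

definition mv_partial :: "('i, 'k::field) mvpoly \<Rightarrow> 'i \<Rightarrow> ('i \<Rightarrow> 'k) \<Rightarrow> 'k"
  where "mv_partial F i x =
    (\<Sum>m\<in>Poly_Mapping.keys F. Poly_Mapping.lookup F m * of_nat (Poly_Mapping.lookup m i) *
      (\<Prod>j\<in>Poly_Mapping.keys m. x j ^ (Poly_Mapping.lookup m j - (if j = i then 1 else 0))))"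

definition hom_poly :: "'i set \<Rightarrow> nat \<Rightarrow> ('i, 'k::field) mvpoly \<Rightarrow> bool"
  where "hom_poly I n F \<longleftrightarrow>
    (\<forall>m\<in>Poly_Mapping.keys F. Poly_Mapping.keys m \<subseteq> I \<and>
      (\<Sum>i\<in>Poly_Mapping.keys m. Poly_Mapping.lookup m i) = n)"

definition zclosed :: "'i set \<Rightarrow> ('i, 'k::field) point set \<Rightarrow> bool"
  where "zclosed I Z \<longleftrightarrow>
    (\<exists>S. (\<forall>F\<in>S. \<exists>n. hom_poly I n F) \<and>
         Z = {p \<in> proj_space I. \<forall>F\<in>S. \<forall>x\<in>p. mv_eval F x = 0})"

text \<open>Used only for \<open>V\<close> closed in \<open>P(I)\<close>; then this is the subspace topology.\<close>

definition zopen :: "'i set \<Rightarrow> ('i, 'k::field) point set \<Rightarrow> ('i, 'k) point set \<Rightarrow> bool"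
  where "zopen I V U \<longleftrightarrow> U \<subseteq> V \<and> zclosed I (V - U)"

definition irreducible_closed :: "'i set \<Rightarrow> ('i, 'k::field) point set \<Rightarrow> bool"
  where "irreducible_closed I V \<longleftrightarrow> zclosed I V \<and> V \<noteq> {} \<and>
    (\<forall>A B. zclosed I A \<longrightarrow> zclosed I B \<longrightarrow> V = A \<union> B \<longrightarrow> V = A \<or> V = B)"

section \<open>Regular functions and morphisms\<close>

definition regular_on ::
    "'i set \<Rightarrow> ('i, 'k::field) point set \<Rightarrow> ('i, 'k) point set \<Rightarrow> (('i, 'k) point \<Rightarrow> 'k) \<Rightarrow> bool"
  where "regular_on I V U f \<longleftrightarrow> zopen I V U \<and>
    (\<forall>p\<in>U. \<exists>T. zopen I V T \<and> p \<in> T \<and> T \<subseteq> U \<and>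
      (\<exists>n F H. hom_poly I n F \<and> hom_poly I n H \<and>
        (\<forall>q\<in>T. \<forall>x\<in>q. mv_eval H x \<noteq> 0 \<and> f q = mv_eval F x / mv_eval H x)))"

definition morphism ::
    "'i set \<Rightarrow> ('i, 'k::field) point set \<Rightarrow> 'j set \<Rightarrow> ('j, 'k) point set \<Rightarrow>
      (('i, 'k) point \<Rightarrow> ('j, 'k) point) \<Rightarrow> bool"
  where "morphism I V J Y \<phi> \<longleftrightarrow> \<phi> ` V \<subseteq> Y \<and>
    (\<forall>T. zopen J Y T \<longrightarrow> zopen I V {p \<in> V. \<phi> p \<in> T}) \<and>
    (\<forall>T g. regular_on J Y T g \<longrightarrow> regular_on I V {p \<in> V. \<phi> p \<in> T} (\<lambda>p. g (\<phi> p)))"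

definition closed_embedding ::
    "'i set \<Rightarrow> ('i, 'k::field) point set \<Rightarrow> 'j set \<Rightarrow> (('i, 'k) point \<Rightarrow> ('j, 'k) point) \<Rightarrow> bool"
  where "closed_embedding I V J \<phi> \<longleftrightarrow> zclosed J (\<phi> ` V) \<and> inj_on \<phi> V \<and>
    morphism I V J (\<phi> ` V) \<phi> \<and> morphism J (\<phi> ` V) I V (inv_into V \<phi>)"

section \<open>The function field\<close>

text \<open>
  A rational function is an equivalence class of pairs \<open>(U, f)\<close> with \<open>U\<close> nonempty open and \<open>f\<close>
  regular on \<open>U\<close>, two pairs being equivalent if the functions agree where both are defined.  The
  values of \<open>f\<close> outside \<open>U\<close> are irrelevant, and a class contains all pairs that differ only there.
\<close>

type_synonym ('i, 'k) ratfun = "(('i, 'k) point set \<times> (('i, 'k) point \<Rightarrow> 'k)) set"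

definition reg_pairs :: "'i set \<Rightarrow> ('i, 'k::field) point set \<Rightarrow> ('i, 'k) ratfun"
  where "reg_pairs I V = {(U, f). U \<noteq> {} \<and> regular_on I V U f}"

definition rat_class ::
    "'i set \<Rightarrow> ('i, 'k::field) point set \<Rightarrow>
      ('i, 'k) point set \<Rightarrow> (('i, 'k) point \<Rightarrow> 'k) \<Rightarrow> ('i, 'k) ratfun"
  where "rat_class I V U f = {(T, g) \<in> reg_pairs I V. \<forall>p\<in>U \<inter> T. f p = g p}"

definition const_rat :: "'i set \<Rightarrow> ('i, 'k::field) point set \<Rightarrow> 'k \<Rightarrow> ('i, 'k) ratfun"
  where "const_rat I V c = rat_class I V V (\<lambda>_. c)"

definition constants :: "'i set \<Rightarrow> ('i, 'k::field) point set \<Rightarrow> ('i, 'k) ratfun set"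
  where "constants I V = range (const_rat I V)"

definition funfield :: "'i set \<Rightarrow> ('i, 'k::field) point set \<Rightarrow> ('i, 'k) ratfun ring"
  where "funfield I V =
    \<lparr>carrier = {rat_class I V U f | U f. (U, f) \<in> reg_pairs I V},
     monoid.mult = (\<lambda>a b. {(T, h) \<in> reg_pairs I V.
        \<exists>(U, f)\<in>a. \<exists>(U', g)\<in>b. \<forall>p\<in>U \<inter> U' \<inter> T. h p = f p * g p}),
     monoid.one = const_rat I V 1,
     ring.zero = const_rat I V 0,
     ring.add = (\<lambda>a b. {(T, h) \<in> reg_pairs I V.
        \<exists>(U, f)\<in>a. \<exists>(U', g)\<in>b. \<forall>p\<in>U \<inter> U' \<inter> T. h p = f p + g p})\<rparr>"

text \<open>The local ring of \<open>V\<close> at the point \<open>p\<close>, as a subring of the function field.\<close>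

definition local_ring ::
    "'i set \<Rightarrow> ('i, 'k::field) point set \<Rightarrow> ('i, 'k) point \<Rightarrow> ('i, 'k) ratfun set"
  where "local_ring I V p = {a \<in> carrier (funfield I V). \<exists>(U, f)\<in>a. p \<in> U}"

definition rat_value :: "('i, 'k) ratfun \<Rightarrow> ('i, 'k) point \<Rightarrow> 'k"
  where "rat_value a p = (THE c. \<exists>(U, f)\<in>a. p \<in> U \<and> f p = c)"

text \<open>
  The image of the function field of \<open>Y\<close> in that of \<open>V\<close> under a dominant morphism \<open>\<phi>\<close>.
\<close>

definition pullback_field ::
    "'i set \<Rightarrow> ('i, 'k::field) point set \<Rightarrow> 'j set \<Rightarrow> ('j, 'k) point set \<Rightarrow>
      (('i, 'k) point \<Rightarrow> ('j, 'k) point) \<Rightarrow> ('i, 'k) ratfun set"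
  where "pullback_field I V J Y \<phi> =
    {rat_class I V {p \<in> V. \<phi> p \<in> T} (\<lambda>p. g (\<phi> p)) | T g. (T, g) \<in> reg_pairs J Y}"

section \<open>Dimension and smoothness\<close>

definition alg_independent ::
    "'i set \<Rightarrow> ('i, 'k::field) point set \<Rightarrow> nat \<Rightarrow> (nat \<Rightarrow> ('i, 'k) ratfun) \<Rightarrow> bool"
  where "alg_independent I V n t \<longleftrightarrow> (\<forall>i<n. t i \<in> carrier (funfield I V)) \<and>
    (\<forall>F :: (nat, 'k) mvpoly.
      (\<forall>m\<in>Poly_Mapping.keys F. Poly_Mapping.keys m \<subseteq> {..<n}) \<longrightarrow>
      finsum (funfield I V)
        (\<lambda>m. const_rat I V (Poly_Mapping.lookup F m) \<otimes>\<^bsub>funfield I V\<^esub>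
          finprod (funfield I V)
            (\<lambda>i. t i [^]\<^bsub>funfield I V\<^esub> Poly_Mapping.lookup m i) (Poly_Mapping.keys m))
        (Poly_Mapping.keys F) = \<zero>\<^bsub>funfield I V\<^esub> \<longrightarrow>
      F = 0)"

text \<open>The dimension of an irreducible variety: the transcendence degree of its function field.\<close>

definition variety_dim :: "'i set \<Rightarrow> ('i, 'k::field) point set \<Rightarrow> nat"
  where "variety_dim I V = (GREATEST n. \<exists>t. alg_independent I V n t)"

text \<open>The tangent space at \<open>x\<close> of the affine cone over \<open>V\<close>: the kernel of the Jacobian matrix of
  the homogeneous ideal of \<open>V\<close>.  Its dimension exceeds that of the tangent space of \<open>V\<close> by one.\<close>

definition cone_tangent_space ::
    "'i set \<Rightarrow> ('i, 'k::field) point set \<Rightarrow> ('i \<Rightarrow> 'k) \<Rightarrow> ('i \<Rightarrow> 'k) set"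
  where "cone_tangent_space I V x = {v \<in> coord_space I.
    \<forall>n F. hom_poly I n F \<and> (\<forall>y\<in>\<Union>V. mv_eval F y = 0) \<longrightarrow>
      (\<Sum>i\<in>I. mv_partial F i x * v i) = 0}"

definition smooth_projective_variety :: "'i set \<Rightarrow> ('i, 'k::field) point set \<Rightarrow> bool"
  where "smooth_projective_variety I V \<longleftrightarrow> finite I \<and> irreducible_closed I V \<and>
    (\<forall>x\<in>\<Union>V. cvec.dim (cone_tangent_space I V x) = variety_dim I V + 1)"

definition smooth_projective_curve :: "'i set \<Rightarrow> ('i, 'k::field) point set \<Rightarrow> bool"
  where "smooth_projective_curve I C \<longleftrightarrow> smooth_projective_variety I C \<and> variety_dim I C = 1"

section \<open>Divisors and complete linear systems\<close>

text \<open>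
  A (Cartier) divisor is given by a local equation \<open>D p\<close> at each point \<open>p\<close>, such that near \<open>p\<close> the
  equation \<open>D p\<close> also defines the divisor, i.e. it differs from \<open>D q\<close> by a unit of the local ring
  at \<open>q\<close> for all \<open>q\<close> in a neighbourhood of \<open>p\<close>.  On a smooth variety, Cartier and Weil divisors
  coincide.
\<close>

type_synonym ('i, 'k) divisor = "('i, 'k) point \<Rightarrow> ('i, 'k) ratfun"

definition is_divisor ::
    "'i set \<Rightarrow> ('i, 'k::field) point set \<Rightarrow> ('i, 'k) divisor \<Rightarrow> bool"
  where "is_divisor I V D \<longleftrightarrow>
    (\<forall>p\<in>V. D p \<in> carrier (funfield I V) - {\<zero>\<^bsub>funfield I V\<^esub>}) \<and>
    (\<forall>p\<in>V. \<exists>U. zopen I V U \<and> p \<in> U \<and>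
      (\<forall>q\<in>U. D p \<otimes>\<^bsub>funfield I V\<^esub> inv\<^bsub>funfield I V\<^esub> (D q) \<in> local_ring I V q \<and>
             D q \<otimes>\<^bsub>funfield I V\<^esub> inv\<^bsub>funfield I V\<^esub> (D p) \<in> local_ring I V q))"

text \<open>\<open>H\<^sup>0(V, O(D))\<close>: the rational functions \<open>s\<close> with \<open>s = 0\<close> or \<open>div(s) + D \<ge> 0\<close>.\<close>

definition global_sections ::
    "'i set \<Rightarrow> ('i, 'k::field) point set \<Rightarrow> ('i, 'k) divisor \<Rightarrow> ('i, 'k) ratfun set"
  where "global_sections I V D = {s \<in> carrier (funfield I V).
    \<forall>p\<in>V. s \<otimes>\<^bsub>funfield I V\<^esub> D p \<in> local_ring I V p}"

definition section_basis ::
    "'i set \<Rightarrow> ('i, 'k::field) point set \<Rightarrow> ('i, 'k) divisor \<Rightarrow> ('i, 'k) ratfun list \<Rightarrow> bool"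
  where "section_basis I V D ss \<longleftrightarrow>
    ring.independent (funfield I V) (constants I V) ss \<and>
    ring.Span (funfield I V) (constants I V) ss = global_sections I V D"

text \<open>
  The map \<open>p \<mapsto> (s\<^sub>0(p) : \<dots> : s\<^sub>N(p))\<close>, each section being evaluated in the trivialization of
  \<open>O(D)\<close> at \<open>p\<close> given by \<open>D p\<close>.  If all sections vanish at \<open>p\<close>, the value is not a point of
  projective space.
\<close>

definition linsys_map ::
    "'i set \<Rightarrow> ('i, 'k::field) point set \<Rightarrow> ('i, 'k) divisor \<Rightarrow> ('i, 'k) ratfun list \<Rightarrow>
      ('i, 'k) point \<Rightarrow> (nat, 'k) point"
  where "linsys_map I V D ss p =
    pt (\<lambda>i. if i < length ss then rat_value (ss ! i \<otimes>\<^bsub>funfield I V\<^esub> D p) p else 0)"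

text \<open>
  \<open>D\<close> is very ample, with \<open>\<phi>\<^sub>D\<close> written in coordinates by means of the basis \<open>ss\<close>.  A change of
  basis changes \<open>\<phi>\<^sub>D\<close> by a linear automorphism of the projective space.
\<close>

definition very_ample_via ::
    "'i set \<Rightarrow> ('i, 'k::field) point set \<Rightarrow> ('i, 'k) divisor \<Rightarrow> ('i, 'k) ratfun list \<Rightarrow> bool"
  where "very_ample_via I V D ss \<longleftrightarrow> is_divisor I V D \<and> section_basis I V D ss \<and>
    closed_embedding I V {..<length ss} (linsys_map I V D ss)"

section \<open>Linear projections\<close>

text \<open>The dimension \<open>r\<close> is an integer; the empty set is the linear subvariety of dimension \<open>-1\<close>.\<close>

definition linear_subvariety :: "'i set \<Rightarrow> int \<Rightarrow> ('i, 'k::field) point set \<Rightarrow> bool"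
  where "linear_subvariety I r L \<longleftrightarrow>
    (\<exists>E. cvec.subspace E \<and> E \<subseteq> coord_space I \<and> int (cvec.dim E) = r + 1 \<and>
         L = {pt x | x. x \<in> E \<and> x \<noteq> 0})"

text \<open>The point where \<open>W\<^sub>0\<close> meets the linear span of \<open>W\<close> and \<open>p\<close>.\<close>

definition linear_projection ::
    "('i, 'k::field) point set \<Rightarrow> ('i, 'k) point set \<Rightarrow> ('i, 'k) point \<Rightarrow> ('i, 'k) point"
  where "linear_projection W W\<^sub>0 p = (THE q. q \<in> W\<^sub>0 \<and> q \<subseteq> cvec.span (\<Union>W \<union> p))"

section \<open>Galois embeddings\<close>

definition galois_group :: "'a ring \<Rightarrow> 'a set \<Rightarrow> ('a \<Rightarrow> 'a) monoid"
  where "galois_group L K = BijGroup (carrier L)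
    \<lparr>carrier := {\<sigma> \<in> Bij (carrier L). \<sigma> \<in> ring_hom L L \<and> (\<forall>x\<in>K. \<sigma> x = x)}\<rparr>"

definition galois_extension :: "'a ring \<Rightarrow> 'a set \<Rightarrow> bool"
  where "galois_extension L K \<longleftrightarrow> field L \<and> subfield K L \<and>
    (\<forall>x\<in>carrier L. ring.algebraic L K x) \<and>
    {x \<in> carrier L. \<forall>\<sigma>\<in>carrier (galois_group L K). \<sigma> x = x} = K"

text \<open>
  \<open>W\<close> is a Galois subspace, with group isomorphic to \<open>G\<close>, for the embedding \<open>\<phi>\<close> of \<open>V\<close> into
  projective \<open>N\<close>-space.  The choice of \<open>W\<^sub>0\<close> does not affect the field extension.
\<close>

definition galois_subspace ::
    "'i set \<Rightarrow> ('i, 'k::field) point set \<Rightarrow> int \<Rightarrow> (('i, 'k) point \<Rightarrow> (nat, 'k) point) \<Rightarrow>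
      (nat, 'k) point set \<Rightarrow> 'g monoid \<Rightarrow> bool"
  where "galois_subspace I V N \<phi> W G \<longleftrightarrow>
    (let J = {i. int i \<le> N}; m = int (variety_dim I V) in
      linear_subvariety J (N - m - 1) W \<and> W \<inter> \<phi> ` V = {} \<and>
      (\<exists>W\<^sub>0. linear_subvariety J m W\<^sub>0 \<and> W\<^sub>0 \<inter> W = {} \<and>
        (let K = pullback_field I V J W\<^sub>0 (\<lambda>p. linear_projection W W\<^sub>0 (\<phi> p)) in
          galois_extension (funfield I V) K \<and> galois_group (funfield I V) K \<cong> G)))"

definition possesses_galois_embedding ::
    "'i set \<Rightarrow> ('i, 'k::field) point set \<Rightarrow> 'g monoid \<Rightarrow> bool"
  where "possesses_galois_embedding I V G \<longleftrightarrow> smooth_projective_variety I V \<and>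
    (\<exists>D ss W. very_ample_via I V D ss \<and>
      galois_subspace I V (int (length ss) - 1) (linsys_map I V D ss) W G)"

section \<open>Powers of varieties and wreath products\<close>

text \<open>
  The \<open>d\<close>-fold power of \<open>V\<close> in its Segre embedding: the coordinates are indexed by \<open>d\<close>-tuples of
  elements of \<open>I\<close>, and the coordinate of the point \<open>(x\<^sub>1, \<dots>, x\<^sub>d)\<close> with index
  \<open>(a\<^sub>1, \<dots>, a\<^sub>d)\<close> is the product of the coordinates of \<open>x\<^sub>j\<close> with index \<open>a\<^sub>j\<close>.
\<close>

definition power_index :: "'i set \<Rightarrow> nat \<Rightarrow> (nat \<Rightarrow> 'i) set"
  where "power_index I d = (\<Pi>\<^sub>E j\<in>{1..d}. I)"

definition segre :: "'i set \<Rightarrow> nat \<Rightarrow> (nat \<Rightarrow> 'i \<Rightarrow> 'k::field) \<Rightarrow> (nat \<Rightarrow> 'i) \<Rightarrow> 'k"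
  where "segre I d x = (\<lambda>a. if a \<in> power_index I d then (\<Prod>j\<in>{1..d}. x j (a j)) else 0)"

definition variety_power ::
    "'i set \<Rightarrow> ('i, 'k::field) point set \<Rightarrow> nat \<Rightarrow> (nat \<Rightarrow> 'i, 'k) point set"
  where "variety_power I V d = {pt (segre I d x) | x. \<forall>j\<in>{1..d}. x j \<in> \<Union>V}"

definition semidirect_product ::
    "'n monoid \<Rightarrow> 'h monoid \<Rightarrow> ('h \<Rightarrow> 'n \<Rightarrow> 'n) \<Rightarrow> ('n \<times> 'h) monoid"
  where "semidirect_product N H \<theta> =
    \<lparr>carrier = carrier N \<times> carrier H,
     monoid.mult = (\<lambda>(a, s) (b, t). (a \<otimes>\<^bsub>N\<^esub> \<theta> s b, s \<otimes>\<^bsub>H\<^esub> t)),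
     monoid.one = (\<one>\<^bsub>N\<^esub>, \<one>\<^bsub>H\<^esub>)\<rparr>"

definition permute_factors :: "nat \<Rightarrow> (nat \<Rightarrow> nat) \<Rightarrow> (nat \<Rightarrow> 'g) \<Rightarrow> (nat \<Rightarrow> 'g)"
  where "permute_factors d \<sigma> g = (\<lambda>j\<in>{1..d}. g (inv' \<sigma> j))"

definition wreath_sym :: "'g monoid \<Rightarrow> nat \<Rightarrow> ((nat \<Rightarrow> 'g) \<times> (nat \<Rightarrow> nat)) monoid"
  where "wreath_sym G d =
    semidirect_product (product_group {1..d} (\<lambda>_. G)) (sym_group d) (permute_factors d)"

end

theory Submission
  imports Defs
begin

text \<open>
  Let \<open>f = (t0 : t1)\<close> be the projection of the curve to the projective line. The product of \<open>f\<close> with itself \<open>d\<close> times,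
  followed by the quotient of the \<open>d\<close>-fold power of the line by the symmetric group, is the map to projective \<open>d\<close>-space
  given by the coefficients of \<open>\<Prod>j. (t0 (p j) + t1 (p j) T)\<close>. These are linear in the products of sections of \<open>D\<close>, which
  by the Kuenneth formula form a basis of the sections of the divisor \<open>D'\<close> on the power with local equations
  \<open>\<Prod>j. D (p j)\<close>; so the map is a linear projection of the embedding by \<open>D'\<close>, and the wreath product acts on its fibres.

  Rational functions are represented by functions on points modulo equality on a nonempty open set (\<open>gen\<close>), and
  automorphisms of the function field by rational self-maps. A function invariant under the wreath product is a quotient
  of averages of products of functions of one coordinate each; by Ryser's formula for permanents such an average is a
  polynomial in the norms \<open>\<Prod>j. w (p j)\<close> with \<open>w\<close> invariant on the curve, and these lie in the pulled back field because
  binary forms split into linear factors. The rest of Galois theory is Artin's theorem.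
\<close>

text \<open>Functions and maps are only controlled on nonempty open sets, so identities between
  self-maps are generic, and automorphisms, acting by precomposition, reverse the order of
  composition. The fixed field is found without computing any degree: an invariant quotient is
  expanded by the conjugates of its denominator, and an invariant numerator equals its own average,
  which uses that the group order is invertible in characteristic zero.

  The definitions create the other obstacles. A class pulled back along a map that is not dominant
  may fall outside the function field, so dominance on the power is proved; it rests on the
  infinitely many values of \<open>t1 / t0\<close> on the curve. That \<open>t0\<close> and
  \<open>t1\<close> satisfy no linear relation is a dimension argument: otherwise every rational
  function on the curve would be constant. Dimension is a transcendence degree, so \<open>d\<close>
  is bounded from above by counting monomials and from below by separating variables. Smoothness
  speaks of all forms vanishing on the Segre cone, whose ideal is never determined: explicit forms
  bound the tangent space from above, linear copies of the cone over the curve from below.\<close>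

abbreviation (input) "mkeys == Poly_Mapping.keys"
abbreviation (input) "mlookup == Poly_Mapping.lookup"
abbreviation (input) "msingle == Poly_Mapping.single"
abbreviation (input) "pcoeff == Polynomial.coeff"
abbreviation (input) "psmult == Polynomial.smult"
abbreviation (input) "cspace == coord_space"
abbreviation (input) "pspace == proj_space"
abbreviation (input) "tangent == cone_tangent_space"

section \<open>Polynomial functions\<close>

definition mval :: "('i \<Rightarrow>\<^sub>0 nat) => ('i => 'k::field) => 'k"
 where "mval m x = (PROD i:mkeys m. x i ^ mlookup m i)"

definition mdeg :: "('i \<Rightarrow>\<^sub>0 nat) => nat"
 where "mdeg m = (SUM i:mkeys m. mlookup m i)"

text \<open>A form is kept as a function, because products and substitutions are then plain function
  expressions. The degree is a parameter and not an attribute: the zero function has every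
  degree.\<close>

definition hompf :: "'i set => nat => (('i => 'k::field) => 'k) => bool"
 where "hompf I n f \<longleftrightarrow> (EX F. hom_poly I n F & f = mv_eval F)"

lemma mval_superset:
 assumes "finite S" "mkeys m <= S"
 shows "mval m x = (PROD i:S. x i ^ mlookup m i)" unfolding mval_def using assms by (intro prod.mono_neutral_left) (auto simp: in_keys_iff)

lemma mdeg_superset:
 assumes "finite S" "mkeys m <= S"
 shows "mdeg m = (SUM i:S. mlookup m i)" unfolding mdeg_def using assms by (intro sum.mono_neutral_left) (auto simp: in_keys_iff)

lemma keys_add_nat: "mkeys (m + m' :: 'i \<Rightarrow>\<^sub>0 nat) = mkeys m Un mkeys m'" by (auto simp: in_keys_iff lookup_add)

lemma mval_add: "mval (m + m') x = mval m x * mval m' x"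
proof -
 let ?S = "mkeys m Un mkeys m'"
 have f: "finite ?S" by simp
 have "mval (m + m') x = (PROD i:?S. x i ^ mlookup (m + m') i)" by (rule mval_superset[OF f]) (simp add: keys_add_nat)
 then show ?thesis by (simp add: mval_superset[OF f, of m] mval_superset[OF f, of m'] lookup_add power_add prod.distrib)
qed

lemma mdeg_add: "mdeg (m + m') = mdeg m + mdeg m'"
proof -
 let ?S = "mkeys m Un mkeys m'"
 have f: "finite ?S" by simp
 have "mdeg (m + m') = (SUM i:?S. mlookup (m + m') i)" by (rule mdeg_superset[OF f]) (simp add: keys_add_nat)
 then show ?thesis by (simp add: mdeg_superset[OF f, of m] mdeg_superset[OF f, of m'] lookup_add sum.distrib)
qed

lemma mval_0 [simp]: "mval 0 x = 1" and mdeg_0 [simp]: "mdeg 0 = 0" by (auto simp: mval_def mdeg_def)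

lemma mval_single: "mval (msingle i n) x = x i ^ n"
 and mdeg_single: "mdeg (msingle i n) = n" by (cases "n = 0"; simp add: mval_def mdeg_def)+

lemma mv_eval_mval: "mv_eval F x = (SUM m:mkeys F. mlookup F m * mval m x)" by (simp add: mv_eval_def mval_def)

lemma mv_eval_superset:
 assumes "finite S" "mkeys F <= S"
 shows "mv_eval F x = (SUM m:S. mlookup F m * mval m x)" unfolding mv_eval_mval using assms by (intro sum.mono_neutral_left) (auto simp: in_keys_iff)

lemma mv_eval_add: "mv_eval (F + G :: ('i, 'k::field) mvpoly) x = mv_eval F x + mv_eval G x"
proof -
 let ?S = "mkeys F Un mkeys G"
 have f: "finite ?S" by simp
 have "mv_eval (F + G) x = (SUM m:?S. mlookup (F + G) m * mval m x)" by (rule mv_eval_superset[OF f]) (rule Poly_Mapping.keys_add)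
 then show ?thesis by (simp add: mv_eval_superset[OF f, of F] mv_eval_superset[OF f, of G] lookup_add algebra_simps sum.distrib)
qed

lemma mv_eval_0 [simp]: "mv_eval 0 x = 0" by (simp add: mv_eval_def)

lemma mv_eval_single: "mv_eval (msingle m c) x = c * mval m x" by (cases "c = 0") (auto simp: mv_eval_mval)

lemma mv_eval_sum: "mv_eval (SUM a:A. F a) (x :: 'i => 'k::field) = (SUM a:A. mv_eval (F a) x)" by (induction A rule: infinite_finite_induct) (auto simp: mv_eval_add)

lemma hom_poly_add: "hom_poly I n F ==> hom_poly I n G ==> hom_poly I n (F + G)" using Poly_Mapping.keys_add[of F G] by (auto simp: hom_poly_def)

lemma hom_poly_0 [simp]: "hom_poly I n 0" by (simp add: hom_poly_def)

lemma hom_poly_single: "mkeys m <= I ==> mdeg m = n ==> hom_poly I n (msingle m c)" by (cases "c = 0") (auto simp: hom_poly_def mdeg_def)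

lemma hompf_monomial: "mkeys m <= I ==> mdeg m = n ==> hompf I n (%x. c * mval m x)" unfolding hompf_def by (intro exI[of _ "msingle m c"]) (auto simp: hom_poly_single mv_eval_single)

lemma hompf_zero: "hompf I n (%_. 0)" unfolding hompf_def by (intro exI[of _ 0]) (auto)

lemma hompf_add:
 assumes "hompf I n f" "hompf I n g" shows "hompf I n (%x. f x + g x)"
proof -
 obtain F G where "hom_poly I n F" "f = mv_eval F" "hom_poly I n G" "g = mv_eval G" using assms by (auto simp: hompf_def)
 then show ?thesis unfolding hompf_def by (intro exI[of _ "F + G"]) (auto simp: hom_poly_add mv_eval_add fun_eq_iff)
qed

lemma hompf_sum: "(!!a. a : A ==> hompf I n (f a)) ==> hompf I n (%x. SUM a:A. f a x)"
proof (induction A rule: infinite_finite_induct)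
 case (insert a A)
 then show ?case using hompf_add[of I n "f a" "%x. SUM a:A. f a x"] by simp
qed (simp_all add: hompf_zero)

lemma hompf_repr:
 assumes "hompf I n f"
 obtains S c where "finite S" "!!m. m : S ==> mkeys m <= I" "!!m. m : S ==> mdeg m = n"
  "f = (%x. SUM m:S. c m * mval m x)"
proof -
 obtain F where "hom_poly I n F" "f = mv_eval F" using assms by (auto simp: hompf_def)
 then show thesis by (intro that[of "mkeys F" "mlookup F"])
   (auto simp: hom_poly_def mdeg_def mv_eval_mval fun_eq_iff)
qed

lemma hompf_mult:
 assumes "hompf I n f" "hompf I k g"
 shows "hompf I (n + k) (%x. f x * g x)"
proof -
 obtain S c where S: "finite S" "!!m. m : S ==> mkeys m <= I" "!!m. m : S ==> mdeg m = n"
  "f = (%x. SUM m:S. c m * mval m x)" using hompf_repr[OF assms(1)] by blast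
 obtain T e where T: "finite T" "!!m. m : T ==> mkeys m <= I" "!!m. m : T ==> mdeg m = k"
  "g = (%x. SUM m:T. e m * mval m x)" using hompf_repr[OF assms(2)] by blast
 have "(%x. f x * g x) = (%x. SUM m:S. SUM m':T. (c m * e m') * mval (m + m') x)" by (auto simp: S(4) T(4) sum_product mval_add fun_eq_iff algebra_simps)
 then show ?thesis by (simp add: S T keys_add_nat mdeg_add hompf_sum hompf_monomial)
qed

lemma hompf_const: "hompf I 0 (%_. c)" using hompf_monomial[of 0 I 0 c] by simp

lemma hompf_cmult: "hompf I n f ==> hompf I n (%x. c * f x)" using hompf_mult[OF hompf_const, of I n f c] by simp

lemma hompf_diff: "hompf I n f ==> hompf I n g ==> hompf I n (%x. f x - g x)" using hompf_add[OF _ hompf_cmult[of I n g "-1"], of f] by simp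

lemma hompf_coord: "i : I ==> hompf I 1 (%x. x i)" using hompf_monomial[of "msingle i 1" I 1 1] by (simp add: mval_single mdeg_single)

lemma hompf_prod: "(!!a. a : A ==> hompf I (n a) (f a)) ==> hompf I (SUM a:A. n a) (%x. PROD a:A. f a x)"
proof (induction A rule: infinite_finite_induct)
 case (insert a A)
 then show ?case using hompf_mult[of I "n a" "f a" "SUM a:A. n a" "%x. PROD a:A. f a x"] by simp
qed (simp_all add: hompf_const)

lemma hompf_power: "hompf I n f ==> hompf I (k * n) (%x. f x ^ k)"
proof (induction k)
 case (Suc k)
 then show ?case using hompf_mult[of I n f "k * n" "%x. f x ^ k"] by simp
qed (simp add: hompf_const)

text \<open>All substituted forms have one common degree \<open>k\<close>, so each monomial of
  degree \<open>n\<close> becomes a form of degree \<open>n * k\<close> and the sum stays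
  homogeneous.\<close>

lemma hompf_compose:
 assumes "hompf J n f" "!!i. i : J ==> hompf I k (g i)"
 shows "hompf I (n * k) (%x. f (%i. g i x))"
proof -
 obtain S c where S: "finite S" "!!m. m : S ==> mkeys m <= J" "!!m. m : S ==> mdeg m = n"
  "f = (%x. SUM m:S. c m * mval m x)" using hompf_repr[OF assms(1)] by blast
 have "hompf I (n * k) (%x. mval m (%i. g i x))" if "m : S" for m
 proof -
  have "n * k = (SUM i:mkeys m. mlookup m i * k)" using S(3)[OF that] by (auto simp: mdeg_def sum_distrib_right)
  then show ?thesis using S(2)[OF that] assms(2) unfolding mval_def by (auto intro!: hompf_prod hompf_power)
 qed
 then show ?thesis unfolding S(4) by (intro hompf_sum hompf_cmult)
qed

lemma hompf_scale:
 assumes "hompf I n f"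
 shows "f (scal c x) = c ^ n * f x"
proof -
 obtain S e where S: "finite S" "!!m. m : S ==> mkeys m <= I" "!!m. m : S ==> mdeg m = n"
  "f = (%x. SUM m:S. e m * mval m x)" using hompf_repr[OF assms(1)] by blast
 have "mval m (scal c x) = c ^ n * mval m x" if "m : S" for m using S(3)[OF that] by (auto simp: mval_def scal_def power_mult_distrib prod.distrib mdeg_def power_sum)
 then show ?thesis by (auto simp: S(4) sum_distrib_left algebra_simps intro!: sum.cong)
qed

lemma hompf_cong_on:
 assumes "hompf I n f" "!!i. i : I ==> x i = y i"
 shows "f x = f y"
proof -
 obtain S e where S: "finite S" "!!m. m : S ==> mkeys m <= I" "!!m. m : S ==> mdeg m = n"
  "f = (%x. SUM m:S. e m * mval m x)" using hompf_repr[OF assms(1)] by blast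
 have "mval m x = mval m y" if "m : S" for m using S(2)[OF that] assms(2) by (auto simp: mval_def intro!: prod.cong)
 then show ?thesis by (auto simp: S(4) intro!: sum.cong)
qed

lemma hom_poly_hompf: "hom_poly I n F ==> hompf I n (mv_eval F)" by (auto simp: hompf_def)

section \<open>Points, basic open sets and regular functions\<close>

text \<open>One arbitrary coordinate vector of a point. Vanishing of a form and quotients of forms
  of equal degree do not depend on the choice, by \<open>hompf_mem_zero_iff\<close> and
  \<open>hompf_quotient_mem\<close>; every later notion uses \<open>rep\<close> only in these two
  ways or divides by one of its coordinates.\<close>

definition rep :: "('i, 'k::field) point => 'i => 'k"
 where "rep p = (SOME x. x : p)"

text \<open>The nonvanishing sets of single forms are a basis of the Zariski topology. Working with
  this basis turns intersections into products of forms; the link to \<open>zopen\<close> is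
  \<open>zopen_iff_near\<close>.\<close>

definition near :: "'i set => ('i, 'k::field) point set => ('i, 'k) point => (('i, 'k) point => bool) => bool"
 where "near I V p P \<longleftrightarrow> p : V & (EX n h. hompf I n h & h (rep p) ~= 0 & (ALL q:V. h (rep q) ~= 0 --> P q))"

text \<open>A nonempty open set is encoded by one basic neighbourhood of one point. That two generic
  statements hold simultaneously is exactly what irreducibility provides.\<close>

definition gen :: "'i set => ('i, 'k::field) point set => (('i, 'k) point => bool) => bool"
 where "gen I V P \<longleftrightarrow> (EX p. near I V p P)"

text \<open>Regularity at a single point depends only on the germ of \<open>f\<close> there
  (\<open>rg_cong\<close>) and is an open condition (\<open>rg_near\<close>), so no domain of
  definition has to be carried along.\<close>

definition rg :: "'i set => ('i, 'k::field) point set => ('i, 'k) point => (('i, 'k) point => 'k) => bool"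
 where "rg I V p f \<longleftrightarrow> (EX n F H. hompf I n F & hompf I n H &
  near I V p (%q. H (rep q) ~= 0 & f q = F (rep q) / H (rep q)))"

definition ratl :: "'i set => ('i, 'k::field) point set => (('i, 'k) point => 'k) => bool"
 where "ratl I V f \<longleftrightarrow> (EX p. rg I V p f)"

lemma scal_1 [simp]: "scal 1 x = x" and scal_scal: "scal a (scal b x) = scal (a * b) x"
 and scal_eq_0: "scal c x = 0 \<longleftrightarrow> c = 0 \<or> x = 0" by (auto simp: scal_def fun_eq_iff)

lemma in_pt_self: "x : pt x" unfolding pt_def by (auto intro!: exI[of _ 1])

lemma pt_scal: "c ~= (0::'k::field) ==> pt (scal c x) = pt x" unfolding pt_def
proof safe
 fix d :: 'k assume "c ~= 0" "d ~= 0"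
 then show "EX e. scal d (scal c x) = scal e x & e ~= 0" by (intro exI[of _ "d * c"]) (auto simp: scal_scal)
 show "EX e. scal d x = scal e (scal c x) & e ~= 0" using `c ~= 0` `d ~= 0` by (intro exI[of _ "d / c"]) (auto simp: scal_scal)
qed

lemma pt_eq_of_mem:
 assumes "y : pt x" shows "pt y = pt x"
proof -
 obtain c where "c ~= 0" "y = scal c x" using assms by (auto simp: pt_def)
 then show ?thesis by (simp add: pt_scal)
qed

lemma pt_eq_iff: "pt x = pt y \<longleftrightarrow> (EX c. c ~= 0 & x = scal c y)"
proof
 assume "pt x = pt y"
 then have "x : pt y" using in_pt_self by metis
 then show "EX c. c ~= 0 & x = scal c y" by (auto simp: pt_def)
qed (auto simp: pt_scal)

lemma proj_space_rep:
 assumes "p : pspace I"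
 shows "rep p : p" "pt (rep p) = p" "rep p ~= 0" "rep p : cspace I"
proof -
 obtain x where x: "p = pt x" "x : cspace I" "x ~= 0" using assms by (auto simp: proj_space_def)
 have "x : p" using x in_pt_self by auto
 then show r: "rep p : p" unfolding rep_def by (rule someI[of "%x. x : p"])
 then show "pt (rep p) = p" using x pt_eq_of_mem by auto
 obtain c where c: "c ~= 0" "rep p = scal c x" using r x by (auto simp: pt_def)
 then show "rep p ~= 0" "rep p : cspace I" using x by (auto simp: scal_eq_0, auto simp: scal_def coord_space_def)
qed

lemma proj_space_mem:
 assumes "p : pspace I" "x : p"
 shows "pt x = p" "x ~= 0" "x : cspace I" "EX c. c ~= 0 & x = scal c (rep p)" "EX c. c ~= 0 & rep p = scal c x"
proof -
 obtain y where y: "p = pt y" "y : cspace I" "y ~= 0" using assms by (auto simp: proj_space_def)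
 obtain c where c: "c ~= 0" "x = scal c y" using assms y by (auto simp: pt_def)
 then show 1: "pt x = p" "x ~= 0" "x : cspace I" using y by (auto simp: scal_eq_0 pt_scal, auto simp: scal_def coord_space_def)
 have "pt x = pt (rep p)" using 1 proj_space_rep[OF assms(1)] by simp
 then show "EX c. c ~= 0 & x = scal c (rep p)" "EX c. c ~= 0 & rep p = scal c x" by (metis pt_eq_iff)+
qed

lemma hompf_mem_zero_iff:
 assumes "p : pspace I" "x : p" "hompf I n h"
 shows "h x = 0 \<longleftrightarrow> h (rep p) = 0"
proof -
 obtain c where "c ~= 0" "x = scal c (rep p)" using proj_space_mem[OF assms(1,2)] by auto
 then show ?thesis using hompf_scale[OF assms(3)] by auto
qed

lemma hompf_quotient_mem:
 assumes "p : pspace I" "x : p" "hompf I n F" "hompf I n H"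
 shows "F x / H x = F (rep p) / H (rep p)"
proof -
 obtain c where "c ~= 0" "x = scal c (rep p)" using proj_space_mem[OF assms(1,2)] by auto
 then show ?thesis using hompf_scale[OF assms(3)] hompf_scale[OF assms(4)] by auto
qed

lemma near_mono: "near I V p P ==> (!!q. q : V ==> P q ==> Q q) ==> near I V p Q" unfolding near_def by blast

lemma near_self: "near I V p P ==> P p" unfolding near_def by blast

lemma near_conj: "near I V p P ==> near I V p Q ==> near I V p (%q. P q & Q q)" unfolding near_def
proof (elim conjE exE, intro conjI)
 fix n h m g assume h: "hompf I n h" "h (rep p) ~= 0" "ALL q:V. h (rep q) ~= 0 --> P q"
  "hompf I m g" "g (rep p) ~= 0" "ALL q:V. g (rep q) ~= 0 --> Q q"
 show "EX n h. hompf I n h & h (rep p) ~= 0 & (ALL q:V. h (rep q) ~= 0 --> P q & Q q)" using h by (intro exI[of _ "n + m"] exI[of _ "%x. h x * g x"]) (auto intro: hompf_mult)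
qed

lemma near_conj3: "near I V p P ==> near I V p Q ==> (!!q. q : V ==> P q ==> Q q ==> R q) ==> near I V p R" by (drule (1) near_conj, erule near_mono) auto

lemma near_all: "p : V ==> (!!q. q : V ==> P q) ==> near I V p P" unfolding near_def using hompf_const[of I 1] by (auto intro!: exI[of _ 0] exI[of _ "%_. 1"])

lemma near_ball: "finite A ==> p : V ==> (!!a. a : A ==> near I V p (P a)) ==> near I V p (%q. ALL a:A. P a q)"
proof (induction A rule: finite_induct)
 case empty then show ?case by (intro near_all) auto
next
 case (insert a A)
 show ?case by (rule near_conj3[of I V p "P a" "%q. ALL a:A. P a q"]) (use insert in auto)
qed

lemma near_near: "near I V p P ==> near I V p (%q. near I V q P)" unfolding near_def by blast

lemma near_form: "p : V ==> hompf I n h ==> h (rep p) ~= 0 ==> near I V p (%q. h (rep q) ~= 0)" unfolding near_def by blast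

lemma near_in: "near I V p P ==> p : V" unfolding near_def by blast

lemma rg_in: "rg I V p f ==> p : V" unfolding rg_def by (auto dest: near_in)

lemma rg_near: "rg I V p f ==> near I V p (%q. rg I V q f)" unfolding rg_def by (elim exE conjE, drule near_near) (erule near_mono, blast)

lemma rg_cong: "rg I V p f ==> near I V p (%q. f q = g q) ==> rg I V p g" unfolding rg_def
proof (elim exE conjE)
 fix n F H assume "hompf I n F" "hompf I n H"
  and 1: "near I V p (%q. H (rep q) ~= 0 & f q = F (rep q) / H (rep q))" and 2: "near I V p (%q. f q = g q)"
 then show "EX n F H. hompf I n F & hompf I n H & near I V p (%q. H (rep q) ~= 0 & g q = F (rep q) / H (rep q))" by (intro exI[of _ n] exI[of _ F] exI[of _ H] conjI near_conj3[OF 1 2]) auto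
qed

lemma rg_quotient: "p : V ==> hompf I n F ==> hompf I n H ==> H (rep p) ~= 0 ==> rg I V p (%q. F (rep q) / H (rep q))" unfolding rg_def by (intro exI[of _ n] exI[of _ F] exI[of _ H]) (auto dest: near_form)

lemma rg_const: "p : V ==> rg I V p (%_. c)" using rg_quotient[OF _ hompf_const[of I c] hompf_const[of I 1], of p V] by simp

lemma rg_add:
 assumes "rg I V p f" "rg I V p g" shows "rg I V p (%q. f q + g q)"
proof -
 obtain n F H where 1: "hompf I n F" "hompf I n H" "near I V p (%q. H (rep q) ~= 0 & f q = F (rep q) / H (rep q))" using assms by (auto simp: rg_def)
 obtain m K L where 2: "hompf I m K" "hompf I m L" "near I V p (%q. L (rep q) ~= 0 & g q = K (rep q) / L (rep q))" using assms by (auto simp: rg_def)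
 show ?thesis unfolding rg_def by (rule exI[of _ "n + m"], rule exI[of _ "%x. F x * L x + H x * K x"], rule exI[of _ "%x. H x * L x"],
   intro conjI hompf_add hompf_mult 1 2 near_conj3[OF 1(3) 2(3)]) (auto simp: field_simps)
qed

lemma rg_mult:
 assumes "rg I V p f" "rg I V p g" shows "rg I V p (%q. f q * g q)"
proof -
 obtain n F H where 1: "hompf I n F" "hompf I n H" "near I V p (%q. H (rep q) ~= 0 & f q = F (rep q) / H (rep q))" using assms by (auto simp: rg_def)
 obtain m K L where 2: "hompf I m K" "hompf I m L" "near I V p (%q. L (rep q) ~= 0 & g q = K (rep q) / L (rep q))" using assms by (auto simp: rg_def)
 show ?thesis unfolding rg_def by (rule exI[of _ "n + m"], rule exI[of _ "%x. F x * K x"], rule exI[of _ "%x. H x * L x"],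
   intro conjI hompf_add hompf_mult 1 2 near_conj3[OF 1(3) 2(3)]) (auto simp: field_simps)
qed

lemma rg_nonzero_near:
 assumes "rg I V p f" "f p ~= 0" shows "near I V p (%q. f q ~= 0)"
proof -
 obtain n F H where 1: "hompf I n F" "hompf I n H" "near I V p (%q. H (rep q) ~= 0 & f q = F (rep q) / H (rep q))" using assms by (auto simp: rg_def)
 have "F (rep p) ~= 0" using near_self[OF 1(3)] assms(2) by auto
 from near_conj3[OF 1(3) near_form[OF near_in[OF 1(3)] 1(1) this]] show ?thesis by auto
qed

lemma rg_inverse:
 assumes "rg I V p f" "f p ~= 0" shows "rg I V p (%q. inverse (f q))"
proof -
 obtain n F H where 1: "hompf I n F" "hompf I n H" "near I V p (%q. H (rep q) ~= 0 & f q = F (rep q) / H (rep q))" using assms by (auto simp: rg_def)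
 have "F (rep p) ~= 0" using near_self[OF 1(3)] assms(2) by auto
 note 2 = near_form[OF near_in[OF 1(3)] 1(1) this]
 show ?thesis unfolding rg_def by (rule exI[of _ "n"], rule exI[of _ H], rule exI[of _ F],
   intro conjI 1 2 near_conj3[OF 1(3) 2]) auto
qed

lemma rg_divide: "rg I V p f ==> rg I V p g ==> g p ~= 0 ==> rg I V p (%q. f q / g q)" unfolding divide_inverse by (intro rg_mult rg_inverse)

lemma rg_uminus: "rg I V p f ==> rg I V p (%q. - f q)" using rg_mult[OF rg_const[of p V I "-1"], of f] by (auto dest: rg_in)

lemma rg_diff: "rg I V p f ==> rg I V p g ==> rg I V p (%q. f q - g q)" using rg_add[OF _ rg_uminus] by fastforce

lemma rg_sum: "p : V ==> (!!a. a : A ==> rg I V p (f a)) ==> rg I V p (%q. SUM a:A. f a q)"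
proof (induction A rule: infinite_finite_induct)
 case (insert a A)
 then show ?case using rg_add[of I V p "f a" "%x. SUM a:A. f a x"] by simp
qed (simp_all add: rg_const)

lemma rg_prod: "p : V ==> (!!a. a : A ==> rg I V p (f a)) ==> rg I V p (%q. PROD a:A. f a q)"
proof (induction A rule: infinite_finite_induct)
 case (insert a A)
 then show ?case using rg_mult[of I V p "f a" "%x. PROD a:A. f a x"] by simp
qed (simp_all add: rg_const)

lemma rg_power: "rg I V p f ==> rg I V p (%q. f q ^ n)"
proof (induction n)
 case (Suc n)
 then show ?case using rg_mult[of I V p f "%q. f q ^ n"] by simp
qed (simp add: rg_const rg_in)

lemma rg_mv_eval:
 assumes "p : V" "!!i m. m : mkeys F ==> i : mkeys m ==> rg I V p (r i)"
 shows "rg I V p (%q. mv_eval F (%i. r i q))" unfolding mv_eval_def using assms by (intro rg_sum rg_mult rg_const rg_prod rg_power) auto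

lemma rg_hompf:
 assumes "p : V" "hompf J n f" "!!i. i : J ==> rg I V p (r i)"
 shows "rg I V p (%q. f (%i. r i q))"
proof -
 obtain F where "hom_poly J n F" "f = mv_eval F" using assms(2) by (auto simp: hompf_def)
 then show ?thesis using assms by (auto simp: hom_poly_def intro!: rg_mv_eval)
qed

lemma ratl_repr:
 assumes "ratl I V f"
 obtains p n F H where "p : V" "hompf I n F" "hompf I n H" "H (rep p) ~= 0"
  "!!q. q : V ==> H (rep q) ~= 0 ==> f q = F (rep q) / H (rep q)"
proof -
 obtain p n F H where 1: "hompf I n F" "hompf I n H" "near I V p (%q. H (rep q) ~= 0 & f q = F (rep q) / H (rep q))" using assms by (auto simp: ratl_def rg_def)
 obtain m h where h: "hompf I m h" "h (rep p) ~= 0" "p : V" "!!q. q : V ==> h (rep q) ~= 0 ==> H (rep q) ~= 0 & f q = F (rep q) / H (rep q)" using 1(3) by (auto simp: near_def)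
 show thesis
 proof (rule that)
  \<comment> \<open>Expanding the quotient by \<open>h\<close> shrinks the nonvanishing set of the
    denominator to a set on which the quotient represents \<open>f\<close>; one form then serves as
    denominator and as description of the domain.\<close>
  show "hompf I (n + m) (%x. F x * h x)" "hompf I (n + m) (%x. H x * h x)" by (intro hompf_mult 1 h)+
 qed (use h in auto)
qed

section \<open>The Zariski topology by basic open sets\<close>

lemma zclosed_subset: "zclosed I Z ==> Z <= pspace I" by (auto simp: zclosed_def)

lemma zclosed_forms:
 assumes "!!f. f : S ==> EX n. hompf I n f"
 shows "zclosed I {p : pspace I. ALL f:S. f (rep p) = 0}"
proof -
 let ?S = "{F. (EX n. hom_poly I n F) & mv_eval F : S}"
 have "{p : pspace I. ALL f:S. f (rep p) = 0} = {p : pspace I. ALL F:?S. ALL x:p. mv_eval F x = 0}"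
 proof safe
  fix p F x n assume "p : pspace I" "x : p" "hom_poly I n F" "mv_eval F : S" "ALL f:S. f (rep p) = 0"
  then show "mv_eval F x = 0" using hompf_mem_zero_iff[of p I x n "mv_eval F"] by (auto intro: hom_poly_hompf)
 next
  fix p f assume "p : pspace I" "f : S" "ALL F:?S. ALL x:p. mv_eval F x = 0"
  moreover obtain n F where "hom_poly I n F" "f = mv_eval F" using assms[OF `f : S`] by (auto simp: hompf_def)
  ultimately show "f (rep p) = 0" using proj_space_rep(1)[of p I] by auto
 qed
 then show ?thesis unfolding zclosed_def by (intro exI[of _ ?S]) auto
qed

lemma zclosed_formsE:
 assumes "zclosed I Z"
 obtains S where "!!f. f : S ==> EX n. hompf I n f" "Z = {p : pspace I. ALL f:S. f (rep p) = 0}"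
proof -
 obtain S where S: "!!F. F : S ==> EX n. hom_poly I n F" "Z = {p : pspace I. ALL F:S. ALL x:p. mv_eval F x = 0}" using assms by (auto simp: zclosed_def)
 show thesis
 proof (rule that)
  show "EX n. hompf I n f" if "f : mv_eval ` S" for f using that S(1) by (auto dest: hom_poly_hompf)
  show "Z = {p : pspace I. ALL f:mv_eval ` S. f (rep p) = 0}" unfolding S(2)
  proof safe
   fix p F assume "p : pspace I" "F : S" "ALL F:S. ALL x:p. mv_eval F x = 0"
   then show "mv_eval F (rep p) = 0" using proj_space_rep(1) by blast
  next
   fix p F x assume "p : pspace I" "F : S" "x : p" "ALL f:mv_eval ` S. f (rep p) = 0"
   then show "mv_eval F x = 0" using S(1) hompf_mem_zero_iff[of p I x _ "mv_eval F"] hom_poly_hompf by blast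
  qed
 qed
qed

lemma zclosed_eq_points:
 assumes "zclosed I Z" "p : pspace I" "!!n f. hompf I n f ==> (!!q. q : Z ==> f (rep q) = 0) ==> f (rep p) = 0"
 shows "p : Z"
proof -
 obtain S where S: "!!f. f : S ==> EX n. hompf I n f" "Z = {p : pspace I. ALL f:S. f (rep p) = 0}" by (rule zclosed_formsE[OF assms(1)], rule that)
 have "f (rep p) = 0" if f: "f : S" for f
 proof -
  obtain n where n: "hompf I n f" using S(1)[OF f] by blast
  show ?thesis
  proof (rule assms(3)[OF n])
   fix q assume "q : Z" then show "f (rep q) = 0" using f by (simp add: S(2))
  qed
 qed
 then show ?thesis using assms(2) by (simp add: S(2))
qed

lemma zclosed_Int_form:
 assumes "zclosed I Z" "hompf I n h" shows "zclosed I {p : Z. h (rep p) = 0}"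
proof -
 obtain S where S: "!!f. f : S ==> EX n. hompf I n f" "Z = {p : pspace I. ALL f:S. f (rep p) = 0}" by (rule zclosed_formsE[OF assms(1)], rule that)
 have "{p : Z. h (rep p) = 0} = {p : pspace I. ALL f:insert h S. f (rep p) = 0}" unfolding S(2) by auto
 moreover have "EX n. hompf I n f" if "f : insert h S" for f using that S(1) assms(2) by blast
 ultimately show ?thesis using zclosed_forms[of "insert h S" I] by metis
qed

lemma zopen_iff_near:
 assumes "zclosed I V"
 shows "zopen I V U \<longleftrightarrow> U <= V & (ALL p:U. near I V p (%q. q : U))"
proof safe
 fix p assume o: "zopen I V U" and "p : U"
 then show "p : V" by (auto simp: zopen_def)
 have cl: "zclosed I (V - U)" using o by (auto simp: zopen_def)
 obtain S where S: "!!f. f : S ==> EX n. hompf I n f" "V - U = {p : pspace I. ALL f:S. f (rep p) = 0}" by (rule zclosed_formsE[OF cl], rule that)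
 have "p : pspace I" "p ~: V - U" using `p : V` `p : U` zclosed_subset[OF assms] by auto
 then obtain f where f: "f : S" "f (rep p) ~= 0" using S by auto
 have "q : U" if "q : V" "f (rep q) ~= 0" for q using that S f by auto
 then show "near I V p (%q. q : U)" unfolding near_def using f S(1)[OF f(1)] `p : V` by auto
next
 assume U: "U <= V" "ALL p:U. near I V p (%q. q : U)"
 obtain S where S: "!!f. f : S ==> EX n. hompf I n f" "V = {p : pspace I. ALL f:S. f (rep p) = 0}" by (rule zclosed_formsE[OF assms], rule that)
 \<comment> \<open>The complement of \<open>U\<close> in \<open>V\<close> is cut out by the largest
   possible system: the equations of \<open>V\<close> together with all forms vanishing on that
   complement.\<close>
 let ?T = "S Un {f. (EX n. hompf I n f) & (ALL q:V - U. f (rep q) = 0)}"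
 have T: "EX n. hompf I n f" if "f : ?T" for f using that S(1) by (elim UnE) simp_all
 have V: "p : V \<longleftrightarrow> p : pspace I & (ALL f:S. f (rep p) = 0)" for p by (subst S(2)) simp
 have "V - U = {p : pspace I. ALL f:?T. f (rep p) = 0}"
 proof (intro equalityI subsetI)
  fix p assume "p : V - U"
  then show "p : {p : pspace I. ALL f:?T. f (rep p) = 0}" using V[of p] by blast
 next
  fix p assume p: "p : {p : pspace I. ALL f:?T. f (rep p) = 0}"
  then have "p : V" unfolding V by simp
  moreover have "p ~: U"
  proof
   assume "p : U"
   then have "near I V p (%q. q : U)" using U by blast
   then obtain n h where h: "hompf I n h" "h (rep p) ~= 0" "ALL q:V. h (rep q) ~= 0 --> q : U" unfolding near_def by blast
   then have "h : ?T" by blast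
   then show False using p h(2) by blast
  qed
  ultimately show "p : V - U" by blast
 qed
 then show "zopen I V U" unfolding zopen_def using U(1) zclosed_forms[of ?T I, OF T] by simp
qed

lemma regular_on_iff:
 assumes "zclosed I V"
 shows "regular_on I V U f \<longleftrightarrow> zopen I V U & (ALL p:U. rg I V p f)"
proof safe
 assume r: "regular_on I V U f"
 then show "zopen I V U" by (auto simp: regular_on_def)
 fix p assume "p : U"
 from r have "ALL p:U. EX T. zopen I V T & p : T & T <= U &
   (EX n F H. hom_poly I n F & hom_poly I n H &
   (ALL q:T. ALL x:q. mv_eval H x ~= 0 & f q = mv_eval F x / mv_eval H x))" unfolding regular_on_def by (rule conjunct2)
 from bspec[OF this `p : U`] obtain T n F H where T: "zopen I V T" "p : T" "hom_poly I n F" "hom_poly I n H"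
  and FH: "ALL q:T. ALL x:q. mv_eval H x ~= 0 & f q = mv_eval F x / mv_eval H x" by (elim exE conjE)
 have "near I V p (%q. q : T)" using T(1,2) unfolding zopen_iff_near[OF assms] by simp
 then have N: "near I V p (%q. mv_eval H (rep q) ~= 0 & f q = mv_eval F (rep q) / mv_eval H (rep q))"
 proof (rule near_mono)
  fix q assume "q : V" "q : T"
  moreover have "rep q : q" by (rule proj_space_rep(1)[OF subsetD[OF zclosed_subset[OF assms] `q : V`]])
  ultimately show "mv_eval H (rep q) ~= 0 & f q = mv_eval F (rep q) / mv_eval H (rep q)" using FH by blast
 qed
 show "rg I V p f" unfolding rg_def by (intro exI conjI) (rule hom_poly_hompf[OF T(3)], rule hom_poly_hompf[OF T(4)], rule N)
next
 assume o: "zopen I V U" and r: "ALL p:U. rg I V p f"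
 have "EX T. zopen I V T & p : T & T <= U &
   (EX n F H. hom_poly I n F & hom_poly I n H &
   (ALL q:T. ALL x:q. mv_eval H x ~= 0 & f q = mv_eval F x / mv_eval H x))" if pU: "p : U" for p
 proof -
  obtain n F H where 1: "hompf I n F" "hompf I n H" "near I V p (%q. H (rep q) ~= 0 & f q = F (rep q) / H (rep q))" using bspec[OF r pU] unfolding rg_def by (elim exE conjE)
  obtain F' H' where 2: "hom_poly I n F'" "hom_poly I n H'" "F = mv_eval F'" "H = mv_eval H'" using 1(1,2) unfolding hompf_def by (elim exE conjE)
  have "near I V p (%q. q : U)" using o pU unfolding zopen_iff_near[OF assms] by simp
  note N = near_near[OF near_conj[OF this 1(3)]]
  let ?T = "{q. near I V q (%q. q : U & H (rep q) ~= 0 & f q = F (rep q) / H (rep q))}"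
  have s: "q : U" "q : V" "H (rep q) ~= 0" "f q = F (rep q) / H (rep q)" if "q : ?T" for q using that near_self[of I V q "%q. q : U & H (rep q) ~= 0 & f q = F (rep q) / H (rep q)"] near_in by (simp_all, blast)
  have "zopen I V ?T" unfolding zopen_iff_near[OF assms]
  proof (intro conjI subsetI ballI)
   fix q assume "q : ?T"
   then show "q : V" by (rule s(2))
  next
   fix q assume "q : ?T"
   then show "near I V q (%q. q : ?T)" using near_near[of I V q] by simp
  qed
  moreover have "p : ?T" using near_self[OF N] by simp
  moreover have "ALL q:?T. ALL x:q. mv_eval H' x ~= 0 & f q = mv_eval F' x / mv_eval H' x"
  proof (intro ballI)
   fix q x assume q: "q : ?T" "x : q"
   have "q : pspace I" using s(2)[OF q(1)] zclosed_subset[OF assms] by blast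
   then show "mv_eval H' x ~= 0 & f q = mv_eval F' x / mv_eval H' x" using s[OF q(1)] hompf_quotient_mem[OF _ q(2) 1(1,2)] hompf_mem_zero_iff[OF _ q(2) 1(2)] 2(3,4) by simp
  qed
  ultimately show ?thesis using s(1) 2(1,2) by (intro exI[of _ ?T] conjI exI[of _ n] exI[of _ F'] exI[of _ H'] subsetI)
 qed
 then show "regular_on I V U f" using o unfolding regular_on_def by simp
qed

section \<open>The function field as functions modulo generic equality\<close>

text \<open>In contrast to \<open>rat_class\<close> no domain of \<open>f\<close> is named, which
  removes open sets from calculations in the function field. If \<open>f\<close> is not rational the
  class is empty.\<close>

definition cls :: "'i set => ('i, 'k::field) point set => (('i, 'k) point => 'k) => ('i, 'k) ratfun"
 where "cls I V f = {(T, g) : reg_pairs I V. gen I V (%p. f p = g p)}"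

locale proj_variety =
 fixes I :: "'i set" and V :: "('i, 'k::field) point set"
 assumes finite_I: "finite I" and irreducible: "irreducible_closed I V"
begin

abbreviation L where "L == funfield I V"

lemma closed: "zclosed I V" and nonempty: "V ~= {}" using irreducible by (auto simp: irreducible_closed_def)

lemma in_proj: "p : V ==> p : pspace I" using zclosed_subset[OF closed] by blast

text \<open>If the two basic open sets did not meet, \<open>V\<close> would be the union of the zero
  sets of their forms \<open>h\<close> and \<open>g\<close>, hence equal to one of them.\<close>

lemma near_inter:
 assumes "near I V p P" "near I V q Q"
 shows "EX r. near I V r (%x. P x & Q x)"
proof -
 obtain n h where h: "hompf I n h" "h (rep p) ~= 0" "ALL q:V. h (rep q) ~= 0 --> P q" "p : V" using assms(1) unfolding near_def by blast
 obtain m g where g: "hompf I m g" "g (rep q) ~= 0" "ALL q:V. g (rep q) ~= 0 --> Q q" "q : V" using assms(2) unfolding near_def by blast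
 have "EX r:V. h (rep r) ~= 0 & g (rep r) ~= 0"
 proof (rule ccontr)
  assume "~ ?thesis"
  then have "V = {r : V. h (rep r) = 0} Un {r : V. g (rep r) = 0}" by blast
  moreover have "zclosed I {r : V. h (rep r) = 0}" "zclosed I {r : V. g (rep r) = 0}" using zclosed_Int_form[OF closed] h(1) g(1) by blast+
  ultimately have "V = {r : V. h (rep r) = 0} \<or> V = {r : V. g (rep r) = 0}" using irreducible unfolding irreducible_closed_def by blast
  then show False using h(2,4) g(2,4) by blast
 qed
 then obtain r where r: "r : V" "h (rep r) ~= 0" "g (rep r) ~= 0" by blast
 have "near I V r P" "near I V r Q" unfolding near_def using r h g by blast+
 then show ?thesis using near_conj by blast
qed

lemma near_gen: "near I V p P ==> gen I V P" unfolding gen_def by blast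

lemma gen_conj: "gen I V P ==> gen I V Q ==> gen I V (%x. P x & Q x)" unfolding gen_def using near_inter by blast

lemma gen_mono: "gen I V P ==> (!!q. q : V ==> P q ==> Q q) ==> gen I V Q" unfolding gen_def using near_mono by blast

lemma gen_mono2: "gen I V P ==> gen I V Q ==> (!!q. q : V ==> P q ==> Q q ==> R q) ==> gen I V R" by (drule (1) gen_conj, erule gen_mono) simp

lemma gen_mono3:
 "gen I V P ==> gen I V Q ==> gen I V R ==> (!!q. q : V ==> P q ==> Q q ==> R q ==> S q) ==> gen I V S" by (drule (1) gen_conj, drule (1) gen_conj, erule gen_mono) simp

lemma gen_ex: assumes "gen I V P" shows "EX p:V. P p"
proof -
 obtain p where p: "near I V p P" using assms by (auto simp: gen_def)
 show ?thesis using near_in[OF p] near_self[OF p] by blast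
qed

lemma gen_False [simp]: "~ gen I V (%_. False)" using gen_ex by blast

lemma gen_const [simp]: "gen I V (%_. b) \<longleftrightarrow> b"
proof
 assume b: b
 obtain p where "p : V" using nonempty by blast
 then show "gen I V (%_. b)" by (intro near_gen[of p] near_all) (simp_all add: b)
qed (use gen_ex in blast)

lemma gen_all: "(!!q. q : V ==> P q) ==> gen I V P" by (rule gen_mono[of "%_. True"]) simp_all

lemma gen_ball: "finite A ==> (!!a. a : A ==> gen I V (P a)) ==> gen I V (%q. ALL a:A. P a q)"
proof (induction A rule: finite_induct)
 case (insert a A)
 show ?case by (rule gen_mono2[of "P a" "%q. ALL a:A. P a q"]) (use insert in auto)
qed simp

lemma gen_near: assumes "gen I V P" shows "gen I V (%p. near I V p P)" using assms near_near unfolding gen_def by blast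

lemma ratl_gen: "ratl I V f ==> gen I V (%p. rg I V p f)" unfolding ratl_def using rg_near near_gen by blast

lemma gen_ratl: "gen I V (%p. rg I V p f) ==> ratl I V f" unfolding ratl_def using gen_ex by blast

lemma rg_ratl: "rg I V p f ==> ratl I V f" unfolding ratl_def by blast

lemma ratl_cong: "ratl I V f ==> gen I V (%p. f p = g p) ==> ratl I V g" by (rule gen_ratl, drule ratl_gen, drule gen_near[where P = "%p. f p = g p"], erule (1) gen_mono2) (rule rg_cong)

lemma ratl_const: "ratl I V (%_. c)" using rg_const nonempty rg_ratl by blast

lemma ratl_add: "ratl I V f ==> ratl I V g ==> ratl I V (%p. f p + g p)" by (rule gen_ratl, drule ratl_gen, drule ratl_gen, erule (1) gen_mono2) (rule rg_add)

lemma ratl_mult: "ratl I V f ==> ratl I V g ==> ratl I V (%p. f p * g p)" by (rule gen_ratl, drule ratl_gen, drule ratl_gen, erule (1) gen_mono2) (rule rg_mult)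

lemma ratl_uminus: "ratl I V f ==> ratl I V (%p. - f p)" by (rule gen_ratl, drule ratl_gen, erule gen_mono) (rule rg_uminus)

lemma ratl_diff: "ratl I V f ==> ratl I V g ==> ratl I V (%p. f p - g p)" by (rule gen_ratl, drule ratl_gen, drule ratl_gen, erule (1) gen_mono2) (rule rg_diff)

lemma ratl_sum: "(!!a. a : A ==> ratl I V (f a)) ==> ratl I V (%p. SUM a:A. f a p)"
proof (induction A rule: infinite_finite_induct)
 case (insert a A)
 then show ?case using ratl_add[of "f a" "%p. SUM a:A. f a p"] by simp
qed (simp_all add: ratl_const)

lemma ratl_prod: "(!!a. a : A ==> ratl I V (f a)) ==> ratl I V (%p. PROD a:A. f a p)"
proof (induction A rule: infinite_finite_induct)
 case (insert a A)
 then show ?case using ratl_mult[of "f a" "%p. PROD a:A. f a p"] by simp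
qed (simp_all add: ratl_const)

lemma ratl_power: "ratl I V f ==> ratl I V (%p. f p ^ n)"
proof (induction n)
 case (Suc n)
 then show ?case using ratl_mult[of f "%p. f p ^ n"] by simp
qed (simp add: ratl_const)

lemma ratl_zero_or_nonzero:
 assumes "ratl I V f"
 shows "gen I V (%p. f p = 0) \<or> gen I V (%p. f p ~= 0)"
proof (cases "gen I V (%p. f p = 0)")
 case False
 obtain p where p: "near I V p (%q. rg I V q f)" using ratl_gen[OF assms] by (auto simp: gen_def)
 have "EX q. rg I V q f & f q ~= 0"
 proof (rule ccontr)
  assume "~ ?thesis"
  then have "near I V p (%p. f p = 0)" by (intro near_mono[OF p]) blast
  then show False using near_gen False by blast
 qed
 then show ?thesis using rg_nonzero_near near_gen by blast
qed simp

lemma gen_not_zero: "ratl I V f ==> ~ gen I V (%p. f p = 0) \<longleftrightarrow> gen I V (%p. f p ~= 0)"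
proof
 assume "gen I V (%p. f p ~= 0)"
 then show "~ gen I V (%p. f p = 0)" using gen_conj[of "%p. f p ~= 0" "%p. f p = 0"] gen_ex by blast
qed (use ratl_zero_or_nonzero in blast)

lemma ratl_inverse: assumes "ratl I V f" shows "ratl I V (%p. inverse (f p))" using ratl_zero_or_nonzero[OF assms]
proof
 assume "gen I V (%p. f p = 0)"
 then show ?thesis using ratl_cong[OF ratl_const[of 0]] gen_mono by (metis (mono_tags, lifting) inverse_zero)
next
 assume "gen I V (%p. f p ~= 0)"
 then have "gen I V (%p. rg I V p (%p. inverse (f p)))" by (rule gen_mono2[OF _ ratl_gen[OF assms]]) (rule rg_inverse)
 then show ?thesis by (rule gen_ratl)
qed

lemma ratl_divide: "ratl I V f ==> ratl I V g ==> ratl I V (%p. f p / g p)" unfolding divide_inverse by (intro ratl_mult ratl_inverse)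

lemma ratl_hompf:
 assumes "hompf J n f" "finite J" "!!i. i : J ==> ratl I V (r i)"
 shows "ratl I V (%q. f (%i. r i q))"
proof (rule gen_ratl)
 have "gen I V (%p. ALL i:J. rg I V p (r i))" using assms by (intro gen_ball ratl_gen) auto
 then show "gen I V (%p. rg I V p (%q. f (%i. r i q)))" by (rule gen_mono) (rule rg_hompf[OF _ assms(1)], auto)
qed

text \<open>The identity principle: a nonzero value at a regular point would persist on an open set
  and contradict generic vanishing.\<close>

lemma rg_zero: assumes "rg I V p f" "gen I V (%q. f q = 0)" shows "f p = 0"
proof (rule ccontr)
 assume "f p ~= 0"
 then have "gen I V (%q. f q ~= 0)" using rg_nonzero_near[OF assms(1)] near_gen by blast
 then show False using gen_not_zero rg_ratl assms by blast
qed

lemma rg_unique: assumes "rg I V p f" "rg I V p g" "gen I V (%q. f q = g q)" shows "f p = g p" using rg_zero[OF rg_diff[OF assms(1,2)]] gen_mono[OF assms(3), of "%q. f q - g q = 0"] by simp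

lemma zopen_iff: "zopen I V U \<longleftrightarrow> U <= V & (ALL p:U. near I V p (%q. q : U))" by (rule zopen_iff_near[OF closed])

lemma reg_pairs_iff: "(U, f) : reg_pairs I V \<longleftrightarrow> U ~= {} & zopen I V U & (ALL p:U. rg I V p f)" by (simp add: reg_pairs_def regular_on_iff[OF closed])

lemma reg_pairs_gen: "(U, f) : reg_pairs I V ==> gen I V (%p. p : U)" unfolding reg_pairs_iff zopen_iff using near_gen by blast

lemma reg_pairs_rdom: assumes "ratl I V f" shows "({q. rg I V q f}, f) : reg_pairs I V" unfolding reg_pairs_iff zopen_iff using assms rg_near rg_in unfolding ratl_def by auto

text \<open>\<open>rat_class\<close> demands agreement on the whole overlap of the domains,
  \<open>cls\<close> only generic agreement; by the identity principle the two conditions coincide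
  for regular functions.\<close>

lemma rat_class_eq_cls:
 assumes "(U, f) : reg_pairs I V" shows "rat_class I V U f = cls I V f"
proof -
 have "(ALL p:U Int T. f p = g p) \<longleftrightarrow> gen I V (%p. f p = g p)" if g: "(T, g) : reg_pairs I V" for T g
 proof
  assume "ALL p:U Int T. f p = g p"
  then show "gen I V (%p. f p = g p)" by (intro gen_mono2[OF reg_pairs_gen[OF assms] reg_pairs_gen[OF g]]) blast
 next
  assume e: "gen I V (%p. f p = g p)"
  show "ALL p:U Int T. f p = g p"
  proof
   fix p assume "p : U Int T"
   then show "f p = g p" using rg_unique[OF _ _ e, of p] assms g unfolding reg_pairs_iff by blast
  qed
 qed
 then show ?thesis unfolding rat_class_def cls_def by blast
qed

lemma carrier_L: "carrier L = cls I V ` {f. ratl I V f}"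
proof -
 have "carrier L = {rat_class I V U f | U f. (U, f) : reg_pairs I V}" by (simp add: funfield_def)
 also have "... = cls I V ` {f. ratl I V f}"
 proof safe
  fix U f assume U: "(U, f) : reg_pairs I V"
  then have "ratl I V f" unfolding reg_pairs_iff ratl_def by blast
  then show "rat_class I V U f : cls I V ` {f. ratl I V f}" using rat_class_eq_cls[OF U] by blast
 next
  fix f assume "ratl I V f"
  then have U: "({q. rg I V q f}, f) : reg_pairs I V" by (rule reg_pairs_rdom)
  then show "EX U g. cls I V f = rat_class I V U g & (U, g) : reg_pairs I V" using rat_class_eq_cls[OF U] by blast
 qed
 finally show ?thesis .
qed

lemma cls_carrier: "ratl I V f ==> cls I V f : carrier L" by (simp add: carrier_L)

lemma carrierE: "x : carrier L ==> EX f. ratl I V f & x = cls I V f" by (auto simp: carrier_L)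

lemma cls_cong: "gen I V (%p. f p = g p) ==> cls I V f = cls I V g"
proof -
 assume e: "gen I V (%p. f p = g p)"
 have "gen I V (%p. f p = h p) \<longleftrightarrow> gen I V (%p. g p = h p)" for h using gen_mono2[OF e, of "%p. f p = h p" "%p. g p = h p"] gen_mono2[OF e, of "%p. g p = h p" "%p. f p = h p"] by auto
 then show ?thesis by (simp add: cls_def)
qed

lemma rdom_in_cls: "ratl I V f ==> ({q. rg I V q f}, f) : cls I V f" by (simp add: cls_def reg_pairs_rdom)

lemma cls_eq_iff: assumes "ratl I V f" shows "cls I V f = cls I V g \<longleftrightarrow> gen I V (%p. f p = g p)"
proof
 assume "cls I V f = cls I V g"
 then have "({q. rg I V q f}, f) : cls I V g" using rdom_in_cls[OF assms] by simp
 then show "gen I V (%p. f p = g p)" by (auto simp: cls_def elim: gen_mono)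
qed (rule cls_cong)

lemma const_rat_eq: "const_rat I V c = cls I V (%_. c)"
proof -
 have "(V, %_. c) : reg_pairs I V" unfolding reg_pairs_iff zopen_iff using nonempty by (auto intro: rg_const near_all)
 then show ?thesis unfolding const_rat_def by (rule rat_class_eq_cls)
qed

lemma cls_binop:
 assumes "ratl I V f" "ratl I V g"
 shows "{(T, h) : reg_pairs I V. EX (U, f'):cls I V f. EX (U', g'):cls I V g. ALL p:U Int U' Int T. h p = op (f' p) (g' p)}
  = cls I V (%p. op (f p) (g p))"
proof (intro equalityI subsetI)
 fix Th assume "Th : {(T, h) : reg_pairs I V. EX (U, f'):cls I V f. EX (U', g'):cls I V g. ALL p:U Int U' Int T. h p = op (f' p) (g' p)}"
 then obtain T h U f' U' g' where 1: "Th = (T, h)" "(T, h) : reg_pairs I V" "(U, f') : cls I V f" "(U', g') : cls I V g"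
  "ALL p:U Int U' Int T. h p = op (f' p) (g' p)" by auto
 have 2: "(U, f') : reg_pairs I V" "(U', g') : reg_pairs I V" "gen I V (%p. f p = f' p)" "gen I V (%p. g p = g' p)" using 1 by (auto simp: cls_def)
 have "gen I V (%p. p : U Int U' Int T)" by (rule gen_mono3[OF reg_pairs_gen[OF 2(1)] reg_pairs_gen[OF 2(2)] reg_pairs_gen[OF 1(2)]]) blast
 then have "gen I V (%p. op (f p) (g p) = h p)" by (rule gen_mono3[OF _ 2(3,4)]) (use 1(5) in simp)
 then show "Th : cls I V (%p. op (f p) (g p))" using 1(1,2) by (simp add: cls_def)
next
 fix Th assume "Th : cls I V (%p. op (f p) (g p))"
 then obtain T h where 1: "Th = (T, h)" "(T, h) : reg_pairs I V" "gen I V (%p. op (f p) (g p) = h p)" by (auto simp: cls_def)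
 have "gen I V (%p. near I V p (%p. op (f p) (g p) = h p))" by (rule gen_near[OF 1(3)])
 then obtain q where q: "near I V q (%p. op (f p) (g p) = h p)" using gen_ex by blast
 \<comment> \<open>The operations of \<open>funfield\<close> ask for equality on the entire overlap
   of the domains. As \<open>op\<close> is arbitrary, the identity principle does not apply; instead
   the domain of \<open>f\<close> is shrunk to the points near which the equality holds.\<close>
 let ?A = "{p. rg I V p f & near I V p (%p. op (f p) (g p) = h p)}"
 have "(?A, f) : reg_pairs I V" unfolding reg_pairs_iff zopen_iff
 proof (intro conjI ballI subsetI)
  show "?A ~= {}" using gen_ex[OF gen_conj[OF ratl_gen[OF assms(1)] gen_near[OF 1(3)]]] by blast
  fix p assume p: "p : ?A"
  show "p : V" "rg I V p f" using p rg_in by auto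
  have "near I V p (%q. rg I V q f & near I V q (%p. op (f p) (g p) = h p))" using p by (intro near_conj rg_near near_near) auto
  then show "near I V p (%q. q : ?A)" by simp
 qed
 then have A: "(?A, f) : cls I V f" by (simp add: cls_def)
 have B: "({q. rg I V q g}, g) : cls I V g" by (rule rdom_in_cls[OF assms(2)])
 have "ALL p:?A Int {q. rg I V q g} Int T. h p = op (f p) (g p)" using near_self[of I V _ "%p. op (f p) (g p) = h p"] by fastforce
 then show "Th : {(T, h) : reg_pairs I V. EX (U, f'):cls I V f. EX (U', g'):cls I V g. ALL p:U Int U' Int T. h p = op (f' p) (g' p)}" using A B 1(1,2) by blast
qed

lemma mult_cls: "ratl I V f ==> ratl I V g ==> cls I V f \<otimes>\<^bsub>L\<^esub> cls I V g = cls I V (%p. f p * g p)" using cls_binop[of f g "(*)"] by (simp add: funfield_def)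

lemma add_cls: "ratl I V f ==> ratl I V g ==> cls I V f \<oplus>\<^bsub>L\<^esub> cls I V g = cls I V (%p. f p + g p)" using cls_binop[of f g "(+)"] by (simp add: funfield_def)

lemma one_L: "\<one>\<^bsub>L\<^esub> = cls I V (%_. 1)" and zero_L: "\<zero>\<^bsub>L\<^esub> = cls I V (%_. 0)" by (simp_all add: funfield_def const_rat_eq)

lemma constants_eq: "constants I V = {cls I V (%_. c) | c. True}" by (auto simp: constants_def const_rat_eq)

lemma cring_L: "cring L"
proof (rule cringI)
 show "abelian_group L"
 proof (rule abelian_groupI)
  fix x y z assume "x : carrier L" "y : carrier L" "z : carrier L"
  then obtain f g h where f: "ratl I V f" "ratl I V g" "ratl I V h" "x = cls I V f" "y = cls I V g" "z = cls I V h" using carrierE by metis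
  show "x \<oplus>\<^bsub>L\<^esub> y : carrier L" using f by (simp add: add_cls cls_carrier ratl_add)
  show "x \<oplus>\<^bsub>L\<^esub> y \<oplus>\<^bsub>L\<^esub> z = x \<oplus>\<^bsub>L\<^esub> (y \<oplus>\<^bsub>L\<^esub> z)" using f by (simp add: add_cls ratl_add add.assoc)
  show "x \<oplus>\<^bsub>L\<^esub> y = y \<oplus>\<^bsub>L\<^esub> x" using f by (simp add: add_cls add.commute)
  show "\<zero>\<^bsub>L\<^esub> \<oplus>\<^bsub>L\<^esub> x = x" using f by (simp add: zero_L add_cls ratl_const)
  show "EX y:carrier L. y \<oplus>\<^bsub>L\<^esub> x = \<zero>\<^bsub>L\<^esub>" using f by (intro bexI[of _ "cls I V (%p. - f p)"]) (simp_all add: zero_L add_cls ratl_uminus cls_carrier)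
 qed (simp add: zero_L cls_carrier ratl_const)
 show "Group.comm_monoid L"
 proof (rule comm_monoidI)
  fix x y z assume "x : carrier L" "y : carrier L" "z : carrier L"
  then obtain f g h where f: "ratl I V f" "ratl I V g" "ratl I V h" "x = cls I V f" "y = cls I V g" "z = cls I V h" using carrierE by metis
  show "x \<otimes>\<^bsub>L\<^esub> y : carrier L" using f by (simp add: mult_cls cls_carrier ratl_mult)
  show "x \<otimes>\<^bsub>L\<^esub> y \<otimes>\<^bsub>L\<^esub> z = x \<otimes>\<^bsub>L\<^esub> (y \<otimes>\<^bsub>L\<^esub> z)" using f by (simp add: mult_cls ratl_mult mult.assoc)
  show "x \<otimes>\<^bsub>L\<^esub> y = y \<otimes>\<^bsub>L\<^esub> x" using f by (simp add: mult_cls mult.commute)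
  show "\<one>\<^bsub>L\<^esub> \<otimes>\<^bsub>L\<^esub> x = x" using f by (simp add: one_L mult_cls ratl_const)
 qed (simp add: one_L cls_carrier ratl_const)
 fix x y z assume "x : carrier L" "y : carrier L" "z : carrier L"
 then obtain f g h where f: "ratl I V f" "ratl I V g" "ratl I V h" "x = cls I V f" "y = cls I V g" "z = cls I V h" using carrierE by metis
 then show "(x \<oplus>\<^bsub>L\<^esub> y) \<otimes>\<^bsub>L\<^esub> z = x \<otimes>\<^bsub>L\<^esub> z \<oplus>\<^bsub>L\<^esub> y \<otimes>\<^bsub>L\<^esub> z"
  by (simp add: mult_cls add_cls ratl_mult ratl_add distrib_right)
qed

lemma cls_nonzero: "ratl I V f ==> cls I V f ~= \<zero>\<^bsub>L\<^esub> \<longleftrightarrow> gen I V (%p. f p ~= 0)" by (simp add: zero_L cls_eq_iff gen_not_zero)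

lemma mult_inverse_cls:
 assumes "ratl I V f" "gen I V (%p. f p ~= 0)"
 shows "cls I V f \<otimes>\<^bsub>L\<^esub> cls I V (%p. inverse (f p)) = \<one>\<^bsub>L\<^esub>" using assms(1) by (simp add: mult_cls ratl_inverse one_L) (rule cls_cong, rule gen_mono[OF assms(2)], simp)

lemma field_L: "field L"
proof -
 interpret cring L by (rule cring_L)
 show ?thesis
 proof (rule cring_fieldI)
  show "Units L = carrier L - {\<zero>\<^bsub>L\<^esub>}"
  proof (intro equalityI subsetI)
   have ne: "\<one>\<^bsub>L\<^esub> ~= \<zero>\<^bsub>L\<^esub>" unfolding one_L by (simp add: cls_nonzero ratl_const)
   fix x assume "x : Units L"
   then show "x : carrier L - {\<zero>\<^bsub>L\<^esub>}" using ne Units_r_inv_ex[of x] by auto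
  next
   fix x assume x: "x : carrier L - {\<zero>\<^bsub>L\<^esub>}"
   then obtain f where f: "ratl I V f" "x = cls I V f" using carrierE by blast
   then have "gen I V (%p. f p ~= 0)" using x cls_nonzero by blast
   then have 1: "x \<otimes>\<^bsub>L\<^esub> cls I V (%p. inverse (f p)) = \<one>\<^bsub>L\<^esub>" using mult_inverse_cls f by blast
   have 2: "cls I V (%p. inverse (f p)) : carrier L" using f by (simp add: cls_carrier ratl_inverse)
   have 3: "cls I V (%p. inverse (f p)) \<otimes>\<^bsub>L\<^esub> x = \<one>\<^bsub>L\<^esub>" using 1 2 x m_comm[of x] by simp
   show "x : Units L" using 1 2 3 x unfolding Units_def by blast
  qed
 qed
qed

sublocale L: field L by (rule field_L)

lemma inv_cls: "ratl I V f ==> gen I V (%p. f p ~= 0) ==> inv\<^bsub>L\<^esub> (cls I V f) = cls I V (%p. inverse (f p))" by (rule L.comm_inv_char) (simp_all add: cls_carrier ratl_inverse mult_inverse_cls)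

lemma divide_cls:
 "ratl I V f ==> ratl I V g ==> gen I V (%p. g p ~= 0) ==> cls I V f \<otimes>\<^bsub>L\<^esub> inv\<^bsub>L\<^esub> (cls I V g) = cls I V (%p. f p / g p)"
 by (simp add: inv_cls mult_cls ratl_inverse divide_inverse)

lemma finsum_cls: "finite A ==> (!!a. a : A ==> ratl I V (f a)) ==>
  finsum L (%a. cls I V (f a)) A = cls I V (%p. SUM a:A. f a p)"
proof (induction A rule: finite_induct)
 case (insert a A)
 have "finsum L (%a. cls I V (f a)) (insert a A) = cls I V (f a) \<oplus>\<^bsub>L\<^esub> finsum L (%a. cls I V (f a)) A" using insert by (intro L.finsum_insert) (auto simp: cls_carrier)
 then show ?case using insert by (simp add: add_cls ratl_sum)
qed (simp add: zero_L)

lemma finprod_cls: "finite A ==> (!!a. a : A ==> ratl I V (f a)) ==>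
  finprod L (%a. cls I V (f a)) A = cls I V (%p. PROD a:A. f a p)"
proof (induction A rule: finite_induct)
 case (insert a A)
 have "finprod L (%a. cls I V (f a)) (insert a A) = cls I V (f a) \<otimes>\<^bsub>L\<^esub> finprod L (%a. cls I V (f a)) A" using insert by (intro L.finprod_insert) (auto simp: cls_carrier)
 then show ?case using insert by (simp add: mult_cls ratl_prod)
qed (simp add: one_L)

lemma pow_cls: "ratl I V f ==> cls I V f [^]\<^bsub>L\<^esub> (n::nat) = cls I V (%p. f p ^ n)" by (induction n) (simp_all add: one_L mult_cls ratl_power mult.commute)

lemma local_ring_cls: "ratl I V f ==> cls I V f : local_ring I V p \<longleftrightarrow> (EX g. rg I V p g & gen I V (%q. f q = g q))"
proof
 assume f: "ratl I V f" and "cls I V f : local_ring I V p"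
 then obtain U g where "(U, g) : cls I V f" "p : U" unfolding local_ring_def by auto
 then show "EX g. rg I V p g & gen I V (%q. f q = g q)" unfolding cls_def reg_pairs_iff by auto
next
 assume f: "ratl I V f" and "EX g. rg I V p g & gen I V (%q. f q = g q)"
 then obtain g where g: "rg I V p g" "gen I V (%q. f q = g q)" by blast
 then have "({q. rg I V q g}, g) : cls I V f" by (simp add: cls_def reg_pairs_rdom rg_ratl)
 then show "cls I V f : local_ring I V p" unfolding local_ring_def using g(1) cls_carrier[OF f] by (auto intro!: bexI[of _ "({q. rg I V q g}, g)"])
qed

lemma rat_value_cls: assumes "rg I V p g" "gen I V (%q. f q = g q)" shows "rat_value (cls I V f) p = g p" unfolding rat_value_def
proof (rule the_equality)
 have "({q. rg I V q g}, g) : cls I V f" using assms by (simp add: cls_def reg_pairs_rdom rg_ratl)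
 then show "EX (U, h):cls I V f. p : U & h p = g p" using assms(1) by (auto intro!: bexI[of _ "({q. rg I V q g}, g)"])
next
 fix c assume "EX (U, h):cls I V f. p : U & h p = c"
 then obtain U h where h: "(U, h) : cls I V f" "p : U" "h p = c" by auto
 then have 1: "rg I V p h" "gen I V (%q. f q = h q)" unfolding cls_def reg_pairs_iff by auto
 moreover have "gen I V (%q. h q = g q)" by (rule gen_mono2[OF 1(2) assms(2)]) simp
 ultimately show "c = g p" using rg_unique assms(1) h(3) by blast
qed

end

section \<open>Rational maps\<close>

text \<open>A morphism at a point, given by regular coordinates of its value near that point. If
  \<open>ta q\<close> is a point of projective space, membership prevents the coordinates from
  vanishing simultaneously. Rational maps are those for which this holds generically.\<close>

definition rmap_at ::
  "'i set => ('i, 'k::field) point set => 'j set => (('i, 'k) point => ('j, 'k) point) => ('i, 'k) point => bool"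
 where "rmap_at I V J ta p \<longleftrightarrow> (EX r. (ALL i:J. rg I V p (r i)) & near I V p (%q. (%i. r i q) : ta q))"

lemma scal_mem: "p : pspace I ==> x : p ==> c ~= 0 ==> scal c x : p" using proj_space_mem(1)[of p I x] unfolding pt_def by blast

lemma pt_in_proj: "x : cspace I ==> x ~= 0 ==> pt x : pspace I" unfolding proj_space_def by blast

lemma point_eq: "p : pspace I ==> q : pspace I ==> x : p ==> x : q ==> p = q" using proj_space_mem(1) by metis

lemma rmap_in: "rmap_at I V J ta p ==> p : V" unfolding rmap_at_def using near_in by blast

lemma rmap_cong: "rmap_at I V J ta p ==> near I V p (%q. ta q = sg q) ==> rmap_at I V J sg p"
proof -
 assume "rmap_at I V J ta p" and e: "near I V p (%q. ta q = sg q)"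
 then obtain r where r: "ALL i:J. rg I V p (r i)" "near I V p (%q. (%i. r i q) : ta q)" unfolding rmap_at_def by blast
 have "near I V p (%q. (%i. r i q) : sg q)" by (rule near_conj3[OF r(2) e]) simp
 then show ?thesis using r(1) unfolding rmap_at_def by blast
qed

lemma rmap_near:
 assumes "rmap_at I V J ta p" "!!q. q : V ==> ta q : Y" "Y <= pspace J" "near J Y (ta p) P"
 shows "near I V p (%q. P (ta q))"
proof -
 obtain r where r: "ALL i:J. rg I V p (r i)" "near I V p (%q. (%i. r i q) : ta q)" using assms(1) unfolding rmap_at_def by blast
 obtain n h where h: "hompf J n h" "h (rep (ta p)) ~= 0" "ALL q:Y. h (rep q) ~= 0 --> P q" using assms(4) unfolding near_def by blast
 have p: "p : V" by (rule rmap_in[OF assms(1)])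
 have rg: "rg I V p (%q. h (%i. r i q))" by (rule rg_hompf[OF p h(1)]) (use r(1) in blast)
 have nz: "h (%i. r i q) = 0 \<longleftrightarrow> h (rep (ta q)) = 0" if "q : V" "(%i. r i q) : ta q" for q using hompf_mem_zero_iff[OF _ that(2) h(1)] assms(2)[OF that(1)] assms(3) by blast
 have "h (%i. r i p) ~= 0" using nz[OF p near_self[OF r(2)]] h(2) by simp
 note N = rg_nonzero_near[OF rg this]
 show ?thesis
 proof (rule near_conj3[OF N r(2)])
  fix q assume "q : V" "h (%i. r i q) ~= 0" "(%i. r i q) : ta q"
  then show "P (ta q)" using nz[of q] h(3) assms(2)[of q] by simp
 qed
qed

lemma rmap_rg:
 assumes "rmap_at I V J ta p" "!!q. q : V ==> ta q : Y" "Y <= pspace J" "rg J Y (ta p) f"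
 shows "rg I V p (%q. f (ta q))"
proof -
 obtain r where r: "ALL i:J. rg I V p (r i)" "near I V p (%q. (%i. r i q) : ta q)" using assms(1) unfolding rmap_at_def by blast
 obtain n F H where f: "hompf J n F" "hompf J n H" "near J Y (ta p) (%q. H (rep q) ~= 0 & f q = F (rep q) / H (rep q))" using assms(4) unfolding rg_def by blast
 have p: "p : V" by (rule rmap_in[OF assms(1)])
 note N = rmap_near[OF assms(1-3) f(3)]
 have q: "F (%i. r i q) / H (%i. r i q) = F (rep (ta q)) / H (rep (ta q))"
  and z: "H (%i. r i q) = 0 \<longleftrightarrow> H (rep (ta q)) = 0" if "q : V" "(%i. r i q) : ta q" for q
  using hompf_quotient_mem[OF _ that(2) f(1,2)] hompf_mem_zero_iff[OF _ that(2) f(2)] assms(2)[OF that(1)] assms(3) by blast+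
 have "H (%i. r i p) ~= 0" using z[OF p near_self[OF r(2)]] near_self[OF N] by simp
 then have "rg I V p (%q. F (%i. r i q) / H (%i. r i q))" by (intro rg_divide rg_hompf[OF p f(1)] rg_hompf[OF p f(2)]) (use r(1) in auto)
 then show ?thesis
 proof (rule rg_cong, rule_tac near_conj3[OF N r(2)])
  fix x assume "x : V" "H (rep (ta x)) ~= 0 & f (ta x) = F (rep (ta x)) / H (rep (ta x))" "(%i. r i x) : ta x"
  then show "F (%i. r i x) / H (%i. r i x) = f (ta x)" using q[of x] by metis
 qed
qed

lemma rmap_compose:
 assumes "rmap_at I V J ta p" "!!q. q : V ==> ta q : Y" "Y <= pspace J" "rmap_at J Y K sg (ta p)"
 shows "rmap_at I V K (%q. sg (ta q)) p"
proof -
 obtain s where s: "ALL i:K. rg J Y (ta p) (s i)" "near J Y (ta p) (%q. (%i. s i q) : sg q)" using assms(4) unfolding rmap_at_def by blast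
 have "ALL i:K. rg I V p (%q. s i (ta q))" using rmap_rg[OF assms(1-3)] s(1) by blast
 with rmap_near[OF assms(1-3) s(2)] show ?thesis unfolding rmap_at_def by (intro exI[of _ "%i q. s i (ta q)"]) simp
qed

text \<open>The chosen vector \<open>rep q\<close> need not depend regularly on \<open>q\<close>;
  dividing by a coordinate that does not vanish at \<open>p\<close> removes the choice.\<close>

lemma rmap_coordinates:
 assumes "p : V" "V <= pspace I" shows "rmap_at I V I (%q. q) p"
proof -
 have "rep p ~= 0" using proj_space_rep(3) assms by blast
 then obtain k where k: "rep p k ~= 0" by (auto simp: fun_eq_iff)
 have kI: "k : I" using k proj_space_rep(4)[of p I] assms by (auto simp: coord_space_def)
 have "near I V p (%q. rep q k ~= 0)" by (rule near_form[OF assms(1) hompf_coord[OF kI] k])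
 then have "near I V p (%q. (%i. rep q i / rep q k) : q)"
 proof (rule near_mono)
  fix q assume q: "q : V" "rep q k ~= 0"
  have "scal (1 / rep q k) (rep q) : q" using q assms(2) by (intro scal_mem[of _ I] proj_space_rep(1)) auto
  then show "(%i. rep q i / rep q k) : q" by (simp add: scal_def)
 qed
 moreover have "ALL i:I. rg I V p (%q. rep q i / rep q k)" using rg_quotient[OF assms(1) hompf_coord hompf_coord[OF kI] k] by blast
 ultimately show ?thesis unfolding rmap_at_def by (intro exI[of _ "%i q. rep q i / rep q k"]) simp
qed

lemma rmap_const:
 assumes "p : V" "x : y" shows "rmap_at I V J (%_. y) p" unfolding rmap_at_def by (rule exI[of _ "%i _. x i"]) (use assms in "auto intro: rg_const near_all")

text \<open>From left to right the chart functions \<open>rep y i / rep y k\<close> are pulled back: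
  they are regular where the coordinate \<open>k\<close> does not vanish, and their pullbacks are
  regular coordinates of \<open>phi\<close>. The converse is substitution of regular coordinates
  into quotients of forms.\<close>

lemma morphism_iff:
 assumes V: "zclosed I V" and Y: "zclosed J Y"
 shows "morphism I V J Y phi \<longleftrightarrow> phi ` V <= Y & (ALL p:V. rmap_at I V J phi p)"
proof safe
 assume m: "morphism I V J Y phi"
 then have sub: "phi ` V <= Y" by (simp add: morphism_def)
 then show "phi p : Y" if "p : V" for p using that by blast
 fix p assume p: "p : V"
 have Yp: "phi q : pspace J" if "q : V" for q using sub that zclosed_subset[OF Y] by blast
 obtain k where k: "rep (phi p) k ~= 0" using proj_space_rep(3)[OF Yp[OF p]] by (auto simp: fun_eq_iff)
 have kJ: "k : J" using k proj_space_rep(4)[OF Yp[OF p]] by (auto simp: coord_space_def)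
 let ?T = "{y : Y. rep y k ~= 0}"
 let ?g = "%i y. rep y i / rep y k"
 have T: "zopen J Y ?T" unfolding zopen_iff_near[OF Y]
 proof (intro conjI subsetI ballI)
  fix y assume "y : ?T"
  then have "near J Y y (%q. rep q k ~= 0)" by (intro near_form[OF _ hompf_coord[OF kJ]]) auto
  then show "near J Y y (%q. q : ?T)" by (rule near_mono) simp
 qed simp
 have "regular_on J Y ?T (?g i)" if "i : J" for i unfolding regular_on_iff[OF Y] using T by (auto intro!: rg_quotient[of _ _ _ 1] hompf_coord that kJ)
 then have "regular_on I V {p : V. phi p : ?T} (%p. ?g i (phi p))" if "i : J" for i using m that unfolding morphism_def by blast
 then have 1: "ALL i:J. rg I V p (%p. ?g i (phi p))" unfolding regular_on_iff[OF V] using p k sub by blast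
 have "zopen I V {p : V. phi p : ?T}" using m T unfolding morphism_def by blast
 then have "near I V p (%q. q : {p : V. phi p : ?T})" unfolding zopen_iff_near[OF V] using p k sub by blast
 then have "near I V p (%q. (%i. ?g i (phi q)) : phi q)"
 proof (rule near_mono)
  fix q assume q: "q : V" "q : {p : V. phi p : ?T}"
  have "scal (1 / rep (phi q) k) (rep (phi q)) : phi q" using q Yp[OF q(1)] by (intro scal_mem[of _ J] proj_space_rep(1)[of _ J]) auto
  then show "(%i. ?g i (phi q)) : phi q" by (simp add: scal_def)
 qed
 then show "rmap_at I V J phi p" using 1 unfolding rmap_at_def by (intro exI[of _ "%i q. ?g i (phi q)"]) simp
next
 assume sub: "phi ` V <= Y" and r: "ALL p:V. rmap_at I V J phi p"
 have Yp: "!!q. q : V ==> phi q : Y" using sub by blast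
 have pre: "zopen I V {p : V. phi p : T}" if "zopen J Y T" for T unfolding zopen_iff_near[OF V]
 proof (intro conjI subsetI ballI)
  fix p assume p: "p : {p : V. phi p : T}"
  then have "near J Y (phi p) (%q. q : T)" using that unfolding zopen_iff_near[OF Y] by blast
  then have "near I V p (%q. phi q : T)" using p r by (intro rmap_near[OF _ Yp zclosed_subset[OF Y]]) auto
  then show "near I V p (%q. q : {p : V. phi p : T})" by (rule near_mono) simp
 qed simp
 have "regular_on I V {p : V. phi p : T} (%p. g (phi p))" if "regular_on J Y T g" for T g using that pre r unfolding regular_on_iff[OF Y] regular_on_iff[OF V]
  by (auto intro!: rmap_rg[OF _ Yp zclosed_subset[OF Y]])
 then show "morphism I V J Y phi" unfolding morphism_def using sub pre by blast
qed

section \<open>The Segre product\<close>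

definition mk :: "'i set => nat => (nat => ('i, 'k::field) point) => (nat => 'i, 'k) point"
 where "mk I d q = {segre I d x | x. ALL j:{1..d}. x j : q j}"

text \<open>Some factorization of some vector of the point as a Segre tensor. Its factors are unique
  up to scalars by \<open>segre_inj\<close>, so the points \<open>co I d p j\<close> do not depend
  on the choice.\<close>

definition crd :: "'i set => nat => (nat => 'i, 'k::field) point => (nat => 'i => 'k)"
 where "crd I d p = (SOME x. (ALL j:{1..d}. x j : cspace I & x j ~= 0) & segre I d x : p)"

definition co :: "'i set => nat => (nat => 'i, 'k::field) point => nat => ('i, 'k) point"
 where "co I d p j = pt (crd I d p j)"

lemma power_index_upd: "a : power_index I d ==> j : {1..d} ==> a(j := i) : power_index I d \<longleftrightarrow> i : I" unfolding power_index_def by (auto simp: PiE_iff extensional_def)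

lemma power_index_mem: "a : power_index I d ==> j : {1..d} ==> a j : I" unfolding power_index_def by auto

lemma finite_power_index: "finite I ==> finite (power_index I d)" unfolding power_index_def by (intro finite_PiE) auto

lemma segre_coord: "segre I d x : cspace (power_index I d)" by (simp add: segre_def coord_space_def)

lemma segre_upd_arg:
 assumes "a : power_index I d" "j : {1..d}" "i : I"
 shows "segre I d x (a(j := i)) = x j i * (PROD l:{1..d}-{j}. x l (a l))"
proof -
 have "segre I d x (a(j := i)) = (PROD l=1..d. x l ((a(j := i)) l))" using power_index_upd[OF assms(1,2)] assms(3) by (simp add: segre_def)
 also have "... = x j ((a(j := i)) j) * (PROD l:{1..d}-{j}. x l ((a(j := i)) l))" using assms(2) by (intro prod.remove) auto
 finally show ?thesis by simp
qed

lemma segre_arg: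
 assumes "a : power_index I d" "j : {1..d}"
 shows "segre I d x a = x j (a j) * (PROD l:{1..d}-{j}. x l (a l))" using segre_upd_arg[OF assms power_index_mem[OF assms]] by simp

lemma segre_cong: "(!!j. j : {1..d} ==> x j = y j) ==> segre I d x = segre I d y" unfolding segre_def by (auto intro!: prod.cong simp: fun_eq_iff)

lemma segre_scal: "segre I d (%j. scal (c j) (x j)) = scal (PROD j=1..d. c j) (segre I d x)" by (auto simp: segre_def scal_def prod.distrib)

lemma segre_nonzero_arg:
 assumes "ALL j:{1..d}. x j : cspace I & x j ~= 0"
 obtains a where "a : power_index I d" "!!j. j : {1..d} ==> x j (a j) ~= 0"
proof -
 have "ALL j:{1..d}. EX i:I. x j i ~= 0" using assms by (auto simp: coord_space_def fun_eq_iff)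
 then obtain a where a: "ALL j:{1..d}. a j : I & x j (a j) ~= 0" by metis
 show thesis by (rule that[of "restrict a {1..d}"]) (use a in "auto simp: power_index_def")
qed

lemma segre_nonzero:
 assumes "ALL j:{1..d}. x j : cspace I & x j ~= 0" shows "segre I d x ~= 0"
proof -
 obtain a where "a : power_index I d" "!!j. j : {1..d} ==> x j (a j) ~= 0" using segre_nonzero_arg[OF assms] by blast
 then have "segre I d x a ~= 0" by (simp add: segre_def)
 then show ?thesis by auto
qed

text \<open>At a multi-index \<open>a\<close> where no factor of \<open>x\<close> vanishes, varying
  the entry \<open>j\<close> alone gives \<open>x j\<close> times a nonzero constant; the same slice
  of the other tensor is a multiple of \<open>y j\<close>.\<close>

lemma segre_inj:
 assumes x: "ALL j:{1..d}. x j : cspace I & x j ~= 0" and y: "ALL j:{1..d}. y j : cspace I & y j ~= 0"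
  and eq: "segre I d x = scal c (segre I d y)" and "j : {1..d}"
 shows "pt (x j) = pt (y j)"
proof -
 obtain a where a: "a : power_index I d" "!!j. j : {1..d} ==> x j (a j) ~= 0" using segre_nonzero_arg[OF x] by blast
 let ?R = "%x. (PROD l:{1..d}-{j}. x l (a l) :: 'b)"
 have R: "?R x ~= 0" using a(2) by simp
 have e: "x j i * ?R x = c * (y j i * ?R y)" for i
 proof (cases "i : I")
  case True
  then show ?thesis using fun_cong[OF eq, of "a(j := i)"]
   segre_upd_arg[OF a(1) assms(4) True, of x] segre_upd_arg[OF a(1) assms(4) True, of y] by (simp add: scal_def)
 next
  case False then show ?thesis using x y assms(4) by (auto simp: coord_space_def)
 qed
 have "x j (a j) * ?R x ~= 0" using R a(2)[OF assms(4)] by (metis mult_eq_0_iff)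
 then have "c * ?R y ~= 0" using e[of "a j"] by (metis mult_eq_0_iff)
 moreover have "x j = scal (c * ?R y / ?R x) (y j)" using e R by (auto simp: scal_def field_simps)
 ultimately show ?thesis using R by (subst pt_eq_iff) (auto intro!: exI[of _ "c * ?R y / ?R x"])
qed

lemma mk_eq_pt:
 assumes "d >= 1" shows "mk I d (%j. pt (x j)) = pt (segre I d x)"
proof (intro equalityI subsetI)
 fix z assume "z : mk I d (%j. pt (x j))"
 then obtain y where y: "z = segre I d y" "ALL j:{1..d}. EX c. c ~= 0 & y j = scal c (x j)" unfolding mk_def pt_def by blast
 then obtain c where c: "ALL j:{1..d}. c j ~= 0 & y j = scal (c j) (x j)" by metis
 have "z = scal (PROD j=1..d. c j) (segre I d x)" unfolding y(1) segre_scal[symmetric] by (rule segre_cong) (use c in simp)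
 moreover have "(PROD j=1..d. c j) ~= 0" using c by simp
 ultimately show "z : pt (segre I d x)" unfolding pt_def by blast
next
 fix z assume "z : pt (segre I d x)"
 then obtain c where c: "c ~= 0" "z = scal c (segre I d x)" unfolding pt_def by blast
 \<comment> \<open>The scalar \<open>c\<close> is absorbed into the first factor, which exists
   because \<open>d >= 1\<close>.\<close>
 have "(PROD j=1..d. if j = 1 then c else 1) = c" using assms by (simp add: prod.delta)
 then have "z = segre I d (%j. scal (if j = 1 then c else 1) (x j))" unfolding segre_scal c(2) by simp
 moreover have "ALL j:{1..d}. scal (if j = 1 then c else 1) (x j) : pt (x j)" unfolding pt_def using c(1) zero_neq_one by auto
 ultimately show "z : mk I d (%j. pt (x j))" unfolding mk_def by blast
qed

locale segre_power =
 fixes I :: "'i set" and C :: "('i, 'k::field) point set" and d :: nat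
 assumes fin_I: "finite I" and C_irreducible: "irreducible_closed I C" and d_pos: "d >= 1"
begin

sublocale C: proj_variety I C by unfold_locales (rule fin_I, rule C_irreducible)

abbreviation A where "A == power_index I d"
abbreviation V where "V == variety_power I C d"

lemma fin_A: "finite A" by (rule finite_power_index[OF fin_I])

lemma mk_cong:
 assumes "!!j. j : {1..d} ==> p j = q j" shows "mk I d p = mk I d q"
proof -
 have "(ALL j:{1..d}. x j : p j) \<longleftrightarrow> (ALL j:{1..d}. x j : q j)" for x by (rule ball_cong[OF refl]) (simp only: assms)
 then show ?thesis unfolding mk_def by (simp only:)
qed

lemma C_rep: "p : C ==> rep p : p & rep p : cspace I & rep p ~= 0 & pt (rep p) = p" using proj_space_rep[of p I] C.in_proj[of p] by simp

lemma C_mem: "p : C ==> x : p ==> x : cspace I & x ~= 0 & pt x = p" using proj_space_mem(1-3)[of p I x] C.in_proj[of p] by simp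

lemma mk_pt: "ALL j:{1..d}. q j : C ==> mk I d q = pt (segre I d (%j. rep (q j)))" by (subst mk_eq_pt[OF d_pos, symmetric], rule mk_cong) (simp add: C_rep)

lemma mk_mem: "ALL j:{1..d}. x j : q j ==> segre I d x : mk I d q" unfolding mk_def by blast

lemma V_eq: "V = {mk I d q | q. ALL j:{1..d}. q j : C}"
proof safe
 fix p assume "p : V"
 then obtain x where x: "p = pt (segre I d x)" "ALL j:{1..d}. x j : \<Union>C" unfolding variety_power_def by blast
 have xC: "pt (x j) : C" if "j : {1..d}" for j
 proof -
  obtain p where "p : C" "x j : p" using x(2) `j : {1..d}` by blast
  then show ?thesis using C_mem[of p "x j"] by simp
 qed
 then show "EX q. p = mk I d q & (ALL j:{1..d}. q j : C)" by (intro exI[of _ "%j. pt (x j)"]) (simp add: x(1) mk_eq_pt[OF d_pos])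
next
 fix q assume q: "ALL j:{1..d}. q j : C"
 then have "ALL j:{1..d}. rep (q j) : \<Union>C" using C_rep by blast
 then show "mk I d q : V" unfolding variety_power_def mk_pt[OF q] by blast
qed

lemma mk_in_V: "ALL j:{1..d}. q j : C ==> mk I d q : V" unfolding V_eq by blast

lemma V_subset_proj: "V <= pspace A"
proof
 fix p assume "p : V"
 then obtain q where q: "p = mk I d q" "ALL j:{1..d}. q j : C" unfolding V_eq by blast
 then have "segre I d (%j. rep (q j)) ~= 0" by (intro segre_nonzero) (simp add: C_rep)
 then show "p : pspace A" unfolding q(1) mk_pt[OF q(2)] by (intro pt_in_proj segre_coord)
qed

lemma co_mk: assumes "ALL j:{1..d}. q j : C" "j : {1..d}" shows "co I d (mk I d q) j = q j"
proof -
 have "EX x. (ALL j:{1..d}. x j : cspace I & x j ~= 0) & segre I d x : mk I d q" by (rule exI[of _ "%j. rep (q j)"]) (simp add: assms(1) C_rep mk_mem)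
 from someI_ex[OF this] have 1: "ALL j:{1..d}. crd I d (mk I d q) j : cspace I & crd I d (mk I d q) j ~= 0"
  "segre I d (crd I d (mk I d q)) : mk I d q" by (simp_all add: crd_def)
 obtain y where y: "segre I d (crd I d (mk I d q)) = segre I d y" "ALL j:{1..d}. y j : q j" using 1(2) unfolding mk_def[of I d q] by blast
 have "pt (crd I d (mk I d q) j) = pt (y j)"
 proof (rule segre_inj[OF 1(1), of y 1 j])
  show "ALL j:{1..d}. y j : cspace I & y j ~= 0" using y(2) assms(1) C_mem by blast
 qed (simp_all only: y(1) scal_1 assms(2))
 also have "... = q j" using C_mem[of "q j" "y j"] y(2) assms by simp
 finally show ?thesis unfolding co_def .
qed

lemma co_in_C: "p : V ==> j : {1..d} ==> co I d p j : C"
proof -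
 assume "p : V" and j: "j : {1..d}"
 then obtain q where q: "p = mk I d q" "ALL j:{1..d}. q j : C" unfolding V_eq by blast
 show ?thesis unfolding q(1) co_mk[OF q(2) j] using q(2) j by simp
qed

lemma mk_co: "p : V ==> mk I d (co I d p) = p"
proof -
 assume "p : V"
 then obtain q where q: "p = mk I d q" "ALL j:{1..d}. q j : C" unfolding V_eq by blast
 show ?thesis unfolding q(1) by (rule mk_cong) (simp add: co_mk q(2))
qed

lemma rep_V:
 assumes "p : V"
 obtains x where "ALL j:{1..d}. x j : co I d p j" "rep p = segre I d x"
proof -
 have "rep p : p" using proj_space_rep(1) V_subset_proj assms by blast
 then have "rep p : mk I d (co I d p)" using mk_co[OF assms] by simp
 then show thesis unfolding mk_def using that by blast
qed

text \<open>The factor \<open>j\<close> is read off along one line of Segre coordinates: the ratio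
  of the coordinates at \<open>a(j := i)\<close> and at \<open>a\<close> is the ratio of the entries
  \<open>i\<close> and \<open>a j\<close> of that factor, all other factors cancelling.\<close>

lemma rmap_co:
 assumes "p : V" "j : {1..d}" shows "rmap_at A V I (%p. co I d p j) p"
proof -
 obtain x where x: "ALL j:{1..d}. x j : co I d p j" "rep p = segre I d x" using rep_V[OF assms(1)] by blast
 have "ALL j:{1..d}. x j : cspace I & x j ~= 0" using x(1) co_in_C[OF assms(1)] C_mem by blast
 then obtain a where a: "a : A" "!!j. j : {1..d} ==> x j (a j) ~= 0" using segre_nonzero_arg by blast
 have nz: "rep p a ~= 0" unfolding x(2) using a by (simp add: segre_def)
 let ?r = "%i q. rep q (a(j := i)) / rep q a"
 have "near A V p (%q. rep q a ~= 0)" by (rule near_form[OF assms(1) hompf_coord[OF a(1)] nz])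
 then have "near A V p (%q. (%i. ?r i q) : co I d q j)"
 proof (rule near_mono)
  fix q assume q: "q : V" "rep q a ~= 0"
  obtain y where y: "ALL j:{1..d}. y j : co I d q j" "rep q = segre I d y" using rep_V[OF q(1)] by blast
  have yj: "y j : cspace I" using y(1) assms(2) co_in_C[OF q(1)] C_mem by blast
  let ?R = "PROD l:{1..d}-{j}. y l (a l)"
  have ra: "rep q a = y j (a j) * ?R" unfolding y(2) by (rule segre_arg[OF a(1) assms(2)])
  have "?r i q = y j i / y j (a j)" for i
  proof (cases "i : I")
   case True
   then show ?thesis using segre_upd_arg[OF a(1) assms(2) True, of y] q(2) unfolding ra y(2)[symmetric] by (simp add: ra)
  next
   case False
   then have "a(j := i) ~: A" using power_index_upd[OF a(1) assms(2)] by simp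
   then show ?thesis using False yj unfolding y(2) by (simp add: segre_def coord_space_def)
  qed
  then have "(%i. ?r i q) = scal (1 / y j (a j)) (y j)" by (simp add: scal_def)
  moreover have "y j (a j) ~= 0" using q(2) unfolding ra by auto
  ultimately show "(%i. ?r i q) : co I d q j" using y(1) assms(2) scal_mem[OF C.in_proj[OF co_in_C[OF q(1) assms(2)]], of "y j" "1 / y j (a j)"] by simp
 qed
 moreover have "rg A V p (?r i)" if "i : I" for i using rg_quotient[OF assms(1) hompf_coord hompf_coord[OF a(1)] nz] power_index_upd[OF a(1) assms(2)] that by blast
 ultimately show ?thesis unfolding rmap_at_def by (intro exI[of _ ?r]) simp
qed

lemma rmap_mk:
 assumes "p : Xs" "!!j. j : {1..d} ==> rmap_at K Xs I (ta j) p"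
 shows "rmap_at K Xs A (%q. mk I d (%j. ta j q)) p"
proof -
 have "ALL j:{1..d}. EX r. (ALL i:I. rg K Xs p (r i)) & near K Xs p (%q. (%i. r i q) : ta j q)" using assms(2) unfolding rmap_at_def by blast
 then obtain r where r: "ALL j:{1..d}. (ALL i:I. rg K Xs p (r j i)) & near K Xs p (%q. (%i. r j i q) : ta j q)" by metis
 have "near K Xs p (%q. ALL j:{1..d}. (%i. r j i q) : ta j q)" using r by (intro near_ball) (auto simp: assms(1))
 then have "near K Xs p (%q. segre I d (%j i. r j i q) : mk I d (%j. ta j q))" by (rule near_mono) (rule mk_mem, blast)
 moreover have "rg K Xs p (%q. segre I d (%j i. r j i q) a)" if "a : A" for a using that r power_index_mem[OF that] by (auto simp: segre_def intro!: rg_prod assms(1))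
 ultimately show ?thesis unfolding rmap_at_def by (intro exI[of _ "%a q. segre I d (%j i. r j i q) a"]) simp
qed

lemma rmap_slice:
 assumes "ALL l:{1..d}. q l : C" "x : C"
 shows "rmap_at I C A (%x. mk I d (q(j := x))) x"
proof -
 have "rmap_at I C A (%x. mk I d (%l. (q(j := x)) l)) x"
 proof (rule rmap_mk[OF assms(2)])
  fix l assume l: "l : {1..d}"
  show "rmap_at I C I (%x. (q(j := x)) l) x"
  proof (cases "l = j")
   case True then show ?thesis using rmap_coordinates[OF assms(2)] C.in_proj by (simp add: subsetI)
  next
   case False then show ?thesis using rmap_const[OF assms(2), of "rep (q l)"] C_rep assms(1) l by simp
  qed
 qed
 then show ?thesis .
qed

lemma slice_in_V: "ALL l:{1..d}. q l : C ==> x : C ==> mk I d (q(j := x)) : V" by (rule mk_in_V) simp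

lemma near_slice:
 assumes "ALL l:{1..d}. q l : C" "x : C" "near A V (mk I d (q(j := x))) P"
 shows "near I C x (%x. P (mk I d (q(j := x))))" by (rule rmap_near[OF rmap_slice[OF assms(1,2)] slice_in_V[OF assms(1)] V_subset_proj assms(3)])

lemma rg_slice:
 assumes "ALL l:{1..d}. q l : C" "x : C" "rg A V (mk I d (q(j := x))) f"
 shows "rg I C x (%x. f (mk I d (q(j := x))))" by (rule rmap_rg[OF rmap_slice[OF assms(1,2)] slice_in_V[OF assms(1)] V_subset_proj assms(3)])

lemma near_co: "p : V ==> j : {1..d} ==> near I C (co I d p j) P ==> near A V p (%p. P (co I d p j))" by (rule rmap_near[where Y = C and J = I, OF rmap_co]) (auto simp: C.in_proj co_in_C)

lemma rg_co: "p : V ==> j : {1..d} ==> rg I C (co I d p j) f ==> rg A V p (%p. f (co I d p j))" by (rule rmap_rg[where Y = C and J = I, OF rmap_co]) (auto simp: C.in_proj co_in_C)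

text \<open>Two families of forms suffice. The quadrics exchanging the entry \<open>j\<close> of two
  multi-indices force the vector to be a multiple of the tensor of its slices through a nonzero
  coordinate \<open>a0\<close>; the equations of \<open>C\<close>, applied to such slices, place
  each slice on the curve.\<close>

lemma V_closed_criterion:
 assumes p: "p : pspace A" and van: "!!n f. hompf A n f ==> (!!q. q : V ==> f (rep q) = 0) ==> f (rep p) = 0"
 shows "p : V"
proof -
 let ?z = "rep p"
 obtain a0 where a0: "?z a0 ~= 0" using proj_space_rep(3)[OF p] by (auto simp: fun_eq_iff)
 have a0A: "a0 : A" using a0 proj_space_rep(4)[OF p] by (auto simp: coord_space_def)
 have quad: "?z a * ?z b = ?z (a(j := b j)) * ?z (b(j := a j))" if "a : A" "b : A" "j : {1..d}" for a b j
 proof -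
  have A': "a(j := b j) : A" "b(j := a j) : A" using that power_index_upd power_index_mem by metis+
  have "hompf A (1 + 1) (%z. z a * z b - z (a(j := b j)) * z (b(j := a j)))" by (intro hompf_diff hompf_mult hompf_coord that A')
  moreover have "rep q a * rep q b - rep q (a(j := b j)) * rep q (b(j := a j)) = 0" if q: "q : V" for q
  proof -
   obtain x where x: "rep q = segre I d x" using rep_V[OF q] by blast
   show ?thesis unfolding x using segre_arg[OF `a : A` `j : {1..d}`, of x] segre_arg[OF `b : A` `j : {1..d}`, of x]
   segre_upd_arg[OF `a : A` `j : {1..d}` power_index_mem[OF `b : A` `j : {1..d}`], of x]
   segre_upd_arg[OF `b : A` `j : {1..d}` power_index_mem[OF `a : A` `j : {1..d}`], of x] by simp
  qed
  ultimately have "?z a * ?z b - ?z (a(j := b j)) * ?z (b(j := a j)) = 0" by (rule van)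
  then show ?thesis by simp
 qed
 define x where "x j i = ?z (a0(j := i))" for j i
 have prod: "?z a * ?z a0 ^ d = ?z a0 * (PROD j=1..d. x j (a j))" if a: "a : A" for a
 proof -
  \<comment> \<open>The index that agrees with \<open>a\<close> in the first \<open>k\<close>
    entries and with \<open>a0\<close> afterwards. One exchange quadric replaces one further entry,
    at the price of one factor \<open>?z a0\<close>.\<close>
  let ?m = "%k l. if l : {1..k} then a l else a0 l"
  have m: "?m k : A" for k using a a0A unfolding power_index_def by (auto simp: PiE_iff extensional_def)
  have "?z (?m k) * ?z a0 ^ k = ?z a0 * (PROD j:{1..k}. x j (a j))" if "k <= d" for k using that
  proof (induction k)
   case 0 then show ?case by simp
  next
   case (Suc k)
   have e: "(?m (Suc k))(Suc k := a0 (Suc k)) = ?m k" "a0(Suc k := ?m (Suc k) (Suc k)) = a0(Suc k := a (Suc k))" by (auto simp: fun_eq_iff)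
   have 1: "?z (?m (Suc k)) * ?z a0 = ?z (?m k) * x (Suc k) (a (Suc k))" using quad[OF m[of "Suc k"] a0A, of "Suc k"] Suc.prems unfolding e x_def by simp
   have "?z (?m (Suc k)) * ?z a0 ^ Suc k = (?z (?m (Suc k)) * ?z a0) * ?z a0 ^ k" by (simp only: power_Suc mult_ac)
   also have "... = (?z (?m k) * ?z a0 ^ k) * x (Suc k) (a (Suc k))" unfolding 1 by (simp only: mult_ac)
   also have "... = ?z a0 * (PROD j:{1..Suc k}. x j (a j))" using Suc.IH Suc.prems by (simp add: mult_ac)
   finally show ?case .
  qed
  from this[of d] have "?z (?m d) * ?z a0 ^ d = ?z a0 * (PROD j=1..d. x j (a j))" by simp
  moreover have "?m d = a" using a a0A unfolding power_index_def by (auto simp: PiE_iff extensional_def fun_eq_iff)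
  ultimately show ?thesis by simp
 qed
 have xC: "pt (x j) : C" if j: "j : {1..d}" for j
 proof (rule zclosed_eq_points[OF C.closed])
  have "x j (a0 j) ~= 0" using a0 by (simp add: x_def)
  then have x0: "x j ~= 0" by auto
  have "x j i = 0" if "i ~: I" for i using power_index_upd[OF a0A j] that proj_space_rep(4)[OF p] by (auto simp: x_def coord_space_def)
  then have xI: "x j : cspace I" by (simp add: coord_space_def)
  show P: "pt (x j) : pspace I" by (rule pt_in_proj[OF xI x0])
  fix n f assume f: "hompf I n f" and fC: "!!q. q : C ==> f (rep q) = 0"
  have "hompf A (n * 1) (%z. f (%i. z (a0(j := i))))" using power_index_upd[OF a0A j] by (intro hompf_compose[OF f] hompf_coord) simp
  moreover have "f (%i. rep q (a0(j := i))) = 0" if q: "q : V" for q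
  proof -
   obtain y where y: "ALL j:{1..d}. y j : co I d q j" "rep q = segre I d y" using rep_V[OF q] by blast
   let ?R = "PROD l:{1..d}-{j}. y l (a0 l)"
   have "f (%i. rep q (a0(j := i))) = f (scal ?R (y j))" by (rule hompf_cong_on[OF f]) (simp add: y(2) segre_upd_arg[OF a0A j] scal_def)
   also have "... = ?R ^ n * f (y j)" by (rule hompf_scale[OF f])
   also have "f (y j) = 0" using fC hompf_mem_zero_iff[OF C.in_proj _ f, of "co I d q j" "y j"] co_in_C[OF q j] y(1) j by blast
   finally show ?thesis by (simp only: mult_zero_right)
  qed
  ultimately have "f (x j) = 0" unfolding x_def by (rule van)
  then show "f (rep (pt (x j))) = 0" using hompf_mem_zero_iff[OF P in_pt_self f] by simp
 qed
 have "segre I d x = scal (?z a0 ^ (d - 1)) ?z"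
 proof
  fix a show "segre I d x a = scal (?z a0 ^ (d - 1)) ?z a"
  proof (cases "a : A")
   case True
   have "?z a0 ^ d = ?z a0 * ?z a0 ^ (d - 1)" using d_pos by (cases d) auto
   then have "?z a0 * (?z a * ?z a0 ^ (d - 1)) = ?z a0 * (PROD j=1..d. x j (a j))" using prod[OF True] by (simp only: mult_ac)
   then have "?z a * ?z a0 ^ (d - 1) = (PROD j=1..d. x j (a j))" using a0 by simp
   then show ?thesis using True by (simp add: segre_def scal_def mult.commute)
  next
   case False
   then show ?thesis using proj_space_rep(4)[OF p] by (simp add: segre_def scal_def coord_space_def)
  qed
 qed
 then have "pt (segre I d x) = pt ?z" using a0 by (simp add: pt_scal)
 then have "p = mk I d (%j. pt (x j))" using proj_space_rep(2)[OF p] mk_eq_pt[OF d_pos, of I x] by simp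
 then show ?thesis unfolding V_eq using xC by blast
qed

lemma V_closed: "zclosed A V"
proof -
 let ?S = "{f. (EX n. hompf A n f) & (ALL q:V. f (rep q) = 0)}"
 have "V = {p : pspace A. ALL f:?S. f (rep p) = 0}"
 proof (intro equalityI subsetI)
  fix p assume "p : {p : pspace A. ALL f:?S. f (rep p) = 0}"
  then show "p : V" by (intro V_closed_criterion) auto
 qed (use V_subset_proj in blast)
 then show ?thesis using zclosed_forms[of ?S A] by simp
qed

text \<open>Two nonempty open sets meet: move a point of the one to a point of the other one coordinate at a time.\<close>

lemma V_irreducible: "irreducible_closed A V"
proof -
 obtain c where c: "c : C" using C.nonempty by blast
 then have ne: "V ~= {}" using mk_in_V[of "%_. c"] by blast
 have meet: "EX q. (ALL j:{1..d}. q j : C) & P (mk I d q) & Q (mk I d q)"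
  if P: "!!p. p : V ==> P p ==> near A V p P" "EX p:V. P p" and Q: "!!p. p : V ==> Q p ==> near A V p Q" "EX p:V. Q p" for P Q
 proof -
  have "EX q q'. (ALL j:{1..d}. q j : C) & (ALL j:{1..d}. q' j : C) & P (mk I d q) & Q (mk I d q') & (ALL j:{1..k}. q j = q' j)" for k
  proof (induction k)
   case 0
   show ?case using P(2) Q(2) unfolding V_eq by fastforce
  next
   case (Suc k)
   then obtain q q' where q: "ALL j:{1..d}. q j : C" "ALL j:{1..d}. q' j : C" "P (mk I d q)" "Q (mk I d q')" "ALL j:{1..k}. q j = q' j" by blast
   show ?case
   proof (cases "Suc k <= d")
   case True
   have "near I C (q (Suc k)) (%x. P (mk I d (q(Suc k := x))))" "near I C (q' (Suc k)) (%x. Q (mk I d (q'(Suc k := x))))" using q True by (auto intro!: near_slice P(1) Q(1) mk_in_V)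
   from C.near_inter[OF this] obtain x where x: "near I C x (%x. P (mk I d (q(Suc k := x))) & Q (mk I d (q'(Suc k := x))))" by blast
   show ?thesis
   proof (intro exI conjI)
   show "ALL j:{1..d}. (q(Suc k := x)) j : C" "ALL j:{1..d}. (q'(Suc k := x)) j : C" using q(1,2) near_in[OF x] by simp_all
   show "P (mk I d (q(Suc k := x)))" "Q (mk I d (q'(Suc k := x)))" using near_self[OF x] by blast+
   show "ALL j:{1..Suc k}. (q(Suc k := x)) j = (q'(Suc k := x)) j" using q(5) by simp
   qed
   next
   case False
   then have e: "mk I d (q'(Suc k := q (Suc k))) = mk I d q'" by (intro mk_cong) auto
   show ?thesis
   proof (intro exI conjI)
   show "ALL j:{1..d}. q j : C" "P (mk I d q)" using q by blast+
   show "ALL j:{1..d}. (q'(Suc k := q (Suc k))) j : C" using q(2) False by simp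
   show "Q (mk I d (q'(Suc k := q (Suc k))))" unfolding e by (rule q(4))
   show "ALL j:{1..Suc k}. q j = (q'(Suc k := q (Suc k))) j" using q(5) by simp
   qed
   qed
  qed
  from this[of d] obtain q q' where q: "ALL j:{1..d}. q j : C" "P (mk I d q)" "Q (mk I d q')" "ALL j:{1..d}. q j = q' j" by blast
  have "mk I d q = mk I d q'" by (rule mk_cong) (use q(4) in blast)
  then have "Q (mk I d q)" using q(3) by (simp only:)
  then show ?thesis using q(1,2) by blast
 qed
 show ?thesis unfolding irreducible_closed_def
 proof (intro conjI V_closed ne allI impI)
  fix Xs Y assume Xs: "zclosed A Xs" and Y: "zclosed A Y" and V: "V = Xs Un Y"
  have nr: "near A V p (%q. q ~: Z)" if "zclosed A Z" "p : V" "p ~: Z" "Z <= V" for p Z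
  proof -
   have "zopen A V (V - Z)" using that by (simp add: zopen_def double_diff)
   then have "near A V p (%q. q : V - Z)" unfolding zopen_iff_near[OF V_closed] using that by blast
   then show ?thesis by (rule near_mono) simp
  qed
  show "V = Xs \<or> V = Y"
  proof (rule ccontr)
   assume "~ ?thesis"
   then obtain q where "ALL j:{1..d}. q j : C" "mk I d q ~: Xs" "mk I d q ~: Y" using meet[of "%p. p ~: Xs" "%p. p ~: Y"] nr Xs Y V by blast
   then show False using mk_in_V V by blast
  qed
 qed
qed

sublocale V: proj_variety A V by unfold_locales (rule fin_A, rule V_irreducible)

text \<open>A nonempty open set of the power is met one coordinate at a time by any dominant maps of the factors.\<close>

lemma gen_power_dominant:
 assumes "gen A V P" "!!j. j : {1..d} ==> gen I C (G j)"
  "!!j Q. j : {1..d} ==> gen I C Q ==> gen I C (%x. Q (gm j x))" "!!j. j : {1..d} ==> gen I C (%x. gm j x : C)"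
 obtains x where "ALL j:{1..d}. x j : C & G j (x j) & gm j (x j) : C" "near A V (mk I d (%j. gm j (x j))) P"
proof -
 let ?U = "%p. near A V p P"
 obtain p where p: "near A V p P" using assms(1) unfolding gen_def by blast
 have "EX x q. (ALL j:{1..d}. q j : C) & ?U (mk I d q) & (ALL j:{1..d}. j <= k --> q j = gm j (x j) & x j : C & G j (x j) & gm j (x j) : C)" for k
 proof (induction k)
  case 0
  show ?case using p near_in[OF p] unfolding V_eq by fastforce
 next
  case (Suc k)
  then obtain x q where q: "ALL j:{1..d}. q j : C" "?U (mk I d q)"
   "ALL j:{1..d}. j <= k --> q j = gm j (x j) & x j : C & G j (x j) & gm j (x j) : C" by blast
  show ?case
  proof (cases "Suc k <= d")
   case True
   have j: "Suc k : {1..d}" using True by simp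
   have "near I C (q (Suc k)) (%x. ?U (mk I d (q(Suc k := x))))" using q j by (intro near_slice near_near) auto
   then have "gen I C (%x. ?U (mk I d (q(Suc k := x))))" by (rule C.near_gen)
   from C.gen_conj[OF C.gen_conj[OF assms(3)[OF j this] assms(2)[OF j]] assms(4)[OF j]]
   obtain y where y: "y : C" "?U (mk I d (q(Suc k := gm (Suc k) y)))" "G (Suc k) y" "gm (Suc k) y : C" using C.gen_ex by blast
   show ?thesis
   proof (intro exI conjI)
   show "ALL j:{1..d}. (q(Suc k := gm (Suc k) y)) j : C" using q(1) y(4) by simp
   show "?U (mk I d (q(Suc k := gm (Suc k) y)))" by (rule y(2))
   show "ALL j:{1..d}. j <= Suc k --> (q(Suc k := gm (Suc k) y)) j = gm j ((x(Suc k := y)) j) & (x(Suc k := y)) j : C &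
   G j ((x(Suc k := y)) j) & gm j ((x(Suc k := y)) j) : C" using q(3) y by (simp add: le_Suc_eq)
   qed
  next
   case False
   then have "j <= Suc k \<longleftrightarrow> j <= k" if "j : {1..d}" for j using that by auto
   then show ?thesis using q by (intro exI[of _ x] exI[of _ q] conjI) (assumption, assumption, simp)
  qed
 qed
 from this[of d] obtain x q where q: "?U (mk I d q)" "ALL j:{1..d}. q j = gm j (x j) & x j : C & G j (x j) & gm j (x j) : C" by auto
 have e: "mk I d q = mk I d (%j. gm j (x j))" by (rule mk_cong) (use q(2) in blast)
 show thesis by (rule that[of x]) (use q(2) in blast, use q(1) in "simp only: e")
qed

lemma gen_co: assumes "gen I C P" "j : {1..d}" shows "gen A V (%p. P (co I d p j))"
proof -
 obtain x where x: "near I C x P" using assms(1) unfolding gen_def by blast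
 have *: "ALL l:{1..d}. x : C" using near_in[OF x] by simp
 show ?thesis by (rule V.near_gen[OF near_co[OF mk_in_V[OF *] assms(2)]]) (use x co_mk[OF * assms(2)] in simp)
qed

lemma ratl_co: assumes "ratl I C f" "j : {1..d}" shows "ratl A V (%p. f (co I d p j))"
proof (rule V.gen_ratl)
 show "gen A V (%p. rg A V p (%p. f (co I d p j)))" by (rule V.gen_mono[OF gen_co[OF C.ratl_gen[OF assms(1)] assms(2)]]) (rule rg_co[OF _ assms(2)])
qed

end

section \<open>Sections of divisors\<close>

text \<open>A representing function may take a wrong value or fail to be regular at \<open>p\<close>
  although its class extends across \<open>p\<close>; the value is therefore taken from a regular
  representative of the same class.\<close>

definition val :: "'i set => ('i, 'k::field) point set => (('i, 'k) point => 'k) => ('i, 'k) point => 'k => bool"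
 where "val I V f p c \<longleftrightarrow> (EX g. rg I V p g & gen I V (%q. f q = g q) & g p = c)"

text \<open>The two local ring conditions of \<open>is_divisor\<close> merge into one: a function
  and its inverse are both regular at \<open>q\<close> exactly when the function has a nonzero value
  there.\<close>

definition isdiv :: "'i set => ('i, 'k::field) point set => (('i, 'k) point => ('i, 'k) point => 'k) => bool"
 where "isdiv I V dl \<longleftrightarrow> (ALL p:V. ratl I V (dl p) & gen I V (%x. dl p x ~= 0)) &
  (ALL p:V. near I V p (%q. EX c. c ~= 0 & val I V (%x. dl p x / dl q x) q c))"

definition sect :: "'i set => ('i, 'k::field) point set => (('i, 'k) point => ('i, 'k) point => 'k) => (('i, 'k) point => 'k) => bool"
 where "sect I V dl s \<longleftrightarrow> ratl I V s & (ALL p:V. EX c. val I V (%x. s x * dl p x) p c)"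

definition sect_basis :: "'i set => ('i, 'k::field) point set => (('i, 'k) point => ('i, 'k) point => 'k) => nat => (nat => ('i, 'k) point => 'k) => bool"
 where "sect_basis I V dl n s \<longleftrightarrow> (ALL i<n. sect I V dl (s i)) &
  (ALL c. gen I V (%x. (SUM i<n. c i * s i x) = 0) --> (ALL i<n. c i = 0)) &
  (ALL f. sect I V dl f --> (EX c. gen I V (%x. f x = (SUM i<n. c i * s i x))))"

section \<open>Values of rational functions, local equations and sections in terms of point
  functions\<close>

context proj_variety
begin

lemma val_rg: "rg I V p f ==> val I V f p (f p)" unfolding val_def by (rule exI[of _ f]) simp

lemma val_cong: "val I V f p c ==> gen I V (%q. f q = g q) ==> val I V g p c"
proof -
 assume "val I V f p c" and e: "gen I V (%q. f q = g q)"
 then obtain h where h: "rg I V p h" "gen I V (%q. f q = h q)" "h p = c" unfolding val_def by blast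
 have "gen I V (%q. g q = h q)" by (rule gen_mono2[OF e h(2)]) simp
 then show ?thesis using h unfolding val_def by blast
qed

lemma val_unique: "val I V f p c ==> val I V f p c' ==> c = c'"
proof -
 assume "val I V f p c" "val I V f p c'"
 then obtain g h where g: "rg I V p g" "gen I V (%q. f q = g q)" "g p = c" "rg I V p h" "gen I V (%q. f q = h q)" "h p = c'" unfolding val_def by blast
 have "gen I V (%q. g q = h q)" by (rule gen_mono2[OF g(2) g(5)]) simp
 then show ?thesis using rg_unique[OF g(1) g(4)] g by simp
qed

lemma val_const: "p : V ==> val I V (%_. c) p c" using val_rg[OF rg_const] by fastforce

lemma val_mult: "val I V f p c ==> val I V g p e ==> val I V (%x. f x * g x) p (c * e)"
proof -
 assume "val I V f p c" "val I V g p e"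
 then obtain f' g' where h: "rg I V p f'" "gen I V (%q. f q = f' q)" "f' p = c" "rg I V p g'" "gen I V (%q. g q = g' q)" "g' p = e" unfolding val_def by blast
 have "gen I V (%x. f x * g x = f' x * g' x)" by (rule gen_mono2[OF h(2,5)]) simp
 then show ?thesis unfolding val_def using rg_mult[OF h(1,4)] h(3,6) by blast
qed

lemma val_add: "val I V f p c ==> val I V g p e ==> val I V (%x. f x + g x) p (c + e)"
proof -
 assume "val I V f p c" "val I V g p e"
 then obtain f' g' where h: "rg I V p f'" "gen I V (%q. f q = f' q)" "f' p = c" "rg I V p g'" "gen I V (%q. g q = g' q)" "g' p = e" unfolding val_def by blast
 have "gen I V (%x. f x + g x = f' x + g' x)" by (rule gen_mono2[OF h(2,5)]) simp
 then show ?thesis unfolding val_def using rg_add[OF h(1,4)] h(3,6) by blast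
qed

lemma val_inverse: "val I V f p c ==> c ~= 0 ==> val I V (%x. inverse (f x)) p (inverse c)"
proof -
 assume "val I V f p c" "c ~= 0"
 then obtain h where h: "rg I V p h" "gen I V (%q. f q = h q)" "h p = c" unfolding val_def by blast
 have "gen I V (%x. inverse (f x) = inverse (h x))" by (rule gen_mono[OF h(2)]) simp
 then show ?thesis unfolding val_def using rg_inverse[OF h(1)] h(3) `c ~= 0` by blast
qed

lemma val_divide: "val I V f p c ==> val I V g p e ==> e ~= 0 ==> val I V (%x. f x / g x) p (c / e)" unfolding divide_inverse by (intro val_mult val_inverse)

lemma val_sum: "p : V ==> (!!a. a : B ==> val I V (f a) p (c a)) ==> val I V (%x. SUM a:B. f a x) p (SUM a:B. c a)"
proof (induction B rule: infinite_finite_induct)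
 case (insert a B)
 then show ?case using val_add[of "f a" p "c a" "%x. SUM a:B. f a x"] by simp
qed (simp_all add: val_const)

lemma val_prod: "p : V ==> (!!a. a : B ==> val I V (f a) p (c a)) ==> val I V (%x. PROD a:B. f a x) p (PROD a:B. c a)"
proof (induction B rule: infinite_finite_induct)
 case (insert a B)
 then show ?case using val_mult[of "f a" p "c a" "%x. PROD a:B. f a x"] by simp
qed (simp_all add: val_const)

lemma val_near: assumes "val I V f p c"
 obtains g where "near I V p (%q. rg I V q g & val I V f q (g q))" "g p = c" "gen I V (%q. f q = g q)"
proof -
 obtain g where g: "rg I V p g" "gen I V (%q. f q = g q)" "g p = c" using assms unfolding val_def by blast
 have "near I V p (%q. rg I V q g & val I V f q (g q))" by (rule near_mono[OF rg_near[OF g(1)]]) (use g(2) in "auto simp: val_def")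
 then show thesis using that g by blast
qed

lemma val_local_ring: "ratl I V f ==> cls I V f : local_ring I V p \<longleftrightarrow> (EX c. val I V f p c)" using local_ring_cls[of f p] unfolding val_def by blast

lemma val_rat_value: "val I V f p c ==> rat_value (cls I V f) p = c" unfolding val_def by (elim exE conjE) (simp add: rat_value_cls)

lemma is_divisor_iff:
 assumes D: "!!p. p : V ==> ratl I V (dl p) & D p = cls I V (dl p)"
 shows "is_divisor I V D \<longleftrightarrow> isdiv I V dl"
proof (cases "ALL p:V. gen I V (%x. dl p x ~= 0)")
 case True
 have unit: "D p \<otimes>\<^bsub>L\<^esub> inv\<^bsub>L\<^esub> (D q) : local_ring I V q & D q \<otimes>\<^bsub>L\<^esub> inv\<^bsub>L\<^esub> (D p) : local_ring I V q
   \<longleftrightarrow> (EX c. c ~= 0 & val I V (%x. dl p x / dl q x) q c)" if "p : V" "q : V" for p q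
 proof -
  have r: "ratl I V (%x. dl p x / dl q x)" "ratl I V (%x. dl q x / dl p x)" using D that by (auto intro: ratl_divide)
  have 1: "D p \<otimes>\<^bsub>L\<^esub> inv\<^bsub>L\<^esub> (D q) = cls I V (%x. dl p x / dl q x)" "D q \<otimes>\<^bsub>L\<^esub> inv\<^bsub>L\<^esub> (D p) = cls I V (%x. dl q x / dl p x)"
   using D that True by (simp_all add: divide_cls)
  have "(EX c. val I V (%x. dl p x / dl q x) q c) & (EX c. val I V (%x. dl q x / dl p x) q c)
   \<longleftrightarrow> (EX c. c ~= 0 & val I V (%x. dl p x / dl q x) q c)"
  proof safe
   fix c e assume v: "val I V (%x. dl p x / dl q x) q c" "val I V (%x. dl q x / dl p x) q e"
   have "gen I V (%x. dl p x / dl q x * (dl q x / dl p x) = 1)" by (rule gen_mono2[of "%x. dl p x ~= 0" "%x. dl q x ~= 0"]) (use True that in auto)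
   from val_cong[OF val_mult[OF v] this] have "c * e = 1" using val_unique val_const[OF that(2)] by blast
   then show "EX c. c ~= 0 & val I V (%x. dl p x / dl q x) q c" using v(1) by (intro exI[of _ c]) auto
  next
   fix c assume c: "c ~= 0" "val I V (%x. dl p x / dl q x) q c"
   from val_inverse[OF c(2,1)] show "EX c. val I V (%x. dl q x / dl p x) q c" by auto
  qed auto
  then show ?thesis unfolding 1 val_local_ring[OF r(1)] val_local_ring[OF r(2)] .
 qed
 have "(EX U. zopen I V U & p : U & (ALL q:U. Q q)) \<longleftrightarrow> near I V p Q" if "p : V" for p Q
 proof
  assume "EX U. zopen I V U & p : U & (ALL q:U. Q q)"
  then obtain U where U: "zopen I V U" "p : U" "ALL q:U. Q q" by blast
  then have "near I V p (%q. q : U)" unfolding zopen_iff by blast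
  then show "near I V p Q" by (rule near_mono) (use U in blast)
 next
  assume n: "near I V p Q"
  have "zopen I V {q. near I V q Q}" unfolding zopen_iff
  proof (intro conjI subsetI ballI)
   fix q assume "q : {q. near I V q Q}"
   then show "q : V" "near I V q (%q. q : {q. near I V q Q})" using near_near[of I V q Q] near_in[of I V q Q] by simp_all
  qed
  then show "EX U. zopen I V U & p : U & (ALL q:U. Q q)" using n near_self by (intro exI[of _ "{q. near I V q Q}"]) auto
 qed
 note op = this
 show ?thesis unfolding is_divisor_def isdiv_def
 proof (rule arg_cong2[where f = "(&)"])
  show "(ALL p:V. D p : carrier L - {\<zero>\<^bsub>L\<^esub>}) = (ALL p:V. ratl I V (dl p) & gen I V (%x. dl p x ~= 0))" using True D by (simp add: cls_nonzero cls_carrier)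
  show "(ALL p:V. EX U. zopen I V U & p : U & (ALL q:U. D p \<otimes>\<^bsub>L\<^esub> inv\<^bsub>L\<^esub> D q : local_ring I V q & D q \<otimes>\<^bsub>L\<^esub> inv\<^bsub>L\<^esub> D p : local_ring I V q)) =
   (ALL p:V. near I V p (%q. EX c. c ~= 0 & val I V (%x. dl p x / dl q x) q c))"
  proof (rule ball_cong[OF refl])
   fix p assume p: "p : V"
   show "(EX U. zopen I V U & p : U & (ALL q:U. D p \<otimes>\<^bsub>L\<^esub> inv\<^bsub>L\<^esub> D q : local_ring I V q & D q \<otimes>\<^bsub>L\<^esub> inv\<^bsub>L\<^esub> D p : local_ring I V q)) =
   near I V p (%q. EX c. c ~= 0 & val I V (%x. dl p x / dl q x) q c)" unfolding op[OF p] using unit[OF p] by (intro iffI) (erule near_mono, simp)+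
  qed
 qed
next
 case False
 then obtain p where "p : V" "~ gen I V (%x. dl p x ~= 0)" by blast
 then have "D p = \<zero>\<^bsub>L\<^esub>" using D cls_nonzero by blast
 then show ?thesis using `p : V` False unfolding is_divisor_def isdiv_def by blast
qed

lemma global_sections_iff:
 assumes D: "!!p. p : V ==> ratl I V (dl p) & D p = cls I V (dl p)" and f: "ratl I V f"
 shows "cls I V f : global_sections I V D \<longleftrightarrow> sect I V dl f" unfolding global_sections_def sect_def using f D by (auto simp: cls_carrier mult_cls val_local_ring ratl_mult)

lemma subfield_constants: "subfield (constants I V) L"
proof (rule L.subfieldI'[OF L.subringI])
 show "constants I V <= carrier L" by (auto simp: constants_eq cls_carrier ratl_const)
 show "\<one>\<^bsub>L\<^esub> : constants I V" by (auto simp: constants_eq one_L)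
 fix h k assume "h : constants I V" "k : constants I V"
 then show "h \<otimes>\<^bsub>L\<^esub> k : constants I V" "h \<oplus>\<^bsub>L\<^esub> k : constants I V" by (auto simp: constants_eq mult_cls add_cls ratl_const)
next
 fix h assume "h : constants I V"
 then obtain c where c: "h = cls I V (%_. c)" by (auto simp: constants_eq)
 have "\<ominus>\<^bsub>L\<^esub> h = cls I V (%_. - c)" unfolding c by (rule L.minus_equality) (simp_all add: cls_carrier ratl_const add_cls zero_L)
 then show "\<ominus>\<^bsub>L\<^esub> h : constants I V" by (auto simp: constants_eq)
next
 fix h assume h: "h : constants I V - {\<zero>\<^bsub>L\<^esub>}"
 then obtain c where c: "h = cls I V (%_. c)" by (auto simp: constants_eq)
 then have "c ~= 0" using h by (auto simp: zero_L)
 then show "inv\<^bsub>L\<^esub> h : constants I V" unfolding c by (auto simp: inv_cls ratl_const constants_eq)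
qed

lemma combine_cls:
 assumes "length cs = length fs" "ALL f:set fs. ratl I V f"
 shows "L.combine (map (%c. cls I V (%_. c)) cs) (map (cls I V) fs) = cls I V (%x. SUM i<length fs. cs ! i * (fs ! i) x)" using assms
proof (induction cs fs rule: list_induct2)
 case Nil then show ?case by (simp add: zero_L)
next
 case (Cons c cs f fs)
 have "ratl I V (%x. SUM i<length fs. cs ! i * (fs ! i) x)" using Cons by (intro ratl_sum ratl_mult ratl_const) auto
 then show ?case using Cons by (simp add: mult_cls ratl_const add_cls ratl_mult sum.lessThan_Suc_shift del: sum.lessThan_Suc)
qed

lemma section_basis_iff:
 assumes D: "!!p. p : V ==> ratl I V (dl p) & D p = cls I V (dl p)" and s: "ALL i<n. ratl I V (s i)"
 shows "section_basis I V D (map (%i. cls I V (s i)) [0..<n]) \<longleftrightarrow> sect_basis I V dl n s"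
proof -
 let ?ss = "map (%i. cls I V (s i)) [0..<n]" and ?K = "constants I V"
 have ss: "?ss = map (cls I V) (map s [0..<n])" by simp
 have car: "set ?ss <= carrier L" using s by (auto simp: cls_carrier)
 have comb: "L.combine (map (%c. cls I V (%_. c)) cs) ?ss = cls I V (%x. SUM i<n. cs ! i * s i x)" if "length cs = n" for cs unfolding ss by (subst combine_cls) (use that s in auto)
 have Ks: "EX cs. Ks = map (%c. cls I V (%_. c)) cs" if "set Ks <= ?K" for Ks using that by (induction Ks) (auto simp: constants_eq, metis list.simps(9))
 have rs: "ratl I V (%x. SUM i<n. c i * s i x)" for c using s by (intro ratl_sum ratl_mult ratl_const) auto
 have Span: "L.Span ?K ?ss = {cls I V (%x. SUM i<n. c i * s i x) | c. True}"
 proof -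
  have "L.Span ?K ?ss = {L.combine Ks ?ss | Ks. length Ks = length ?ss & set Ks <= ?K}" by (rule L.Span_eq_combine_set_length_version[OF subfield_constants car])
  also have "... = {cls I V (%x. SUM i<n. c i * s i x) | c. True}"
  proof (intro equalityI subsetI)
   fix x assume "x : {L.combine Ks ?ss | Ks. length Ks = length ?ss & set Ks <= ?K}"
   then obtain Ks where K: "x = L.combine Ks ?ss" "length Ks = n" "set Ks <= ?K" by auto
   obtain cs where cs: "Ks = map (%c. cls I V (%_. c)) cs" using Ks[OF K(3)] by blast
   then have "x = cls I V (%x. SUM i<n. cs ! i * s i x)" using comb[of cs] K by simp
   then show "x : {cls I V (%x. SUM i<n. c i * s i x) | c. True}" by (auto intro!: exI[of _ "%i. cs ! i"])
  next
   fix x assume "x : {cls I V (%x. SUM i<n. c i * s i x) | c. True}"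
   then obtain c where c: "x = cls I V (%x. SUM i<n. c i * s i x)" by blast
   have "x = L.combine (map (%c. cls I V (%_. c)) (map c [0..<n])) ?ss" using comb[of "map c [0..<n]"] c by simp
   moreover have "set (map (%c. cls I V (%_. c)) (map c [0..<n])) <= ?K" by (auto simp: constants_eq)
   ultimately show "x : {L.combine Ks ?ss | Ks. length Ks = length ?ss & set Ks <= ?K}" by (intro CollectI exI[of _ "map (%c. cls I V (%_. c)) (map c [0..<n])"]) simp
  qed
  finally show ?thesis .
 qed
 have ind: "L.independent ?K ?ss \<longleftrightarrow> (ALL c. gen I V (%x. (SUM i<n. c i * s i x) = 0) --> (ALL i<n. c i = 0))" (is "?l = ?r")
 proof
  assume i: ?l
  show ?r
  proof (intro allI impI)
   fix c i assume c: "gen I V (%x. (SUM i<n. c i * s i x) = 0)" and "i < n"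
   let ?Ks = "map (%c. cls I V (%_. c)) (map c [0..<n])"
   have "cls I V (%x. SUM i<n. c i * s i x) = cls I V (%_. 0)" by (rule cls_cong[OF c])
   then have "L.combine ?Ks ?ss = \<zero>\<^bsub>L\<^esub>" using comb[of "map c [0..<n]"] by (simp add: zero_L)
   moreover have "set ?Ks <= ?K" by (auto simp: constants_eq)
   ultimately have "set (take (length ?ss) ?Ks) <= {\<zero>\<^bsub>L\<^esub>}" using L.independent_imp_trivial_combine[OF subfield_constants i] by blast
   then have "cls I V (%_. c i) = \<zero>\<^bsub>L\<^esub>" using `i < n` by (simp add: image_subset_iff)
   then show "c i = 0" by (simp add: zero_L cls_eq_iff ratl_const)
  qed
 next
  assume r: ?r
  show ?l
  proof (rule L.trivial_combine_imp_independent[OF subfield_constants car])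
   fix Ks assume K: "set Ks <= ?K" "L.combine Ks ?ss = \<zero>\<^bsub>L\<^esub>"
   obtain cs0 where cs0: "Ks = map (%c. cls I V (%_. c)) cs0" using Ks[OF K(1)] by blast
   \<comment> \<open>\<open>combine\<close> ignores surplus coefficients and treats missing ones as
     zero, so the coefficient list is cut or padded to length \<open>n\<close>.\<close>
   define cs where "cs = take n cs0 @ replicate (n - length cs0) 0"
   have len: "length cs = n" by (simp add: cs_def)
   have z: "cls I V (%_. 0) = \<zero>\<^bsub>L\<^esub>" by (simp add: zero_L)
   have "L.combine (map (%c. cls I V (%_. c)) cs) ?ss = L.combine (take n Ks @ replicate (n - length Ks) \<zero>\<^bsub>L\<^esub>) ?ss" unfolding cs_def cs0 by (simp add: take_map map_replicate_const zero_L)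
   also have "... = \<zero>\<^bsub>L\<^esub>" using L.combine_append_replicate[OF car, of "take n Ks"] L.combine_take[of ?ss Ks] K(2) by simp
   finally have "cls I V (%x. SUM i<n. cs ! i * s i x) = cls I V (%_. 0)" using comb[OF len] zero_L by simp
   then have "gen I V (%x. (SUM i<n. cs ! i * s i x) = 0)" using cls_eq_iff[OF rs[of "%i. cs ! i"]] by simp
   then have c0: "ALL i<n. cs ! i = 0" using r[rule_format, of "%i. cs ! i"] by blast
   have "x = 0" if "x : set (take n cs0)" for x
   proof -
   have "x : set cs" using that by (simp add: cs_def)
   then obtain i where "i < n" "x = cs ! i" using len by (auto simp: in_set_conv_nth)
   then show ?thesis using c0 by blast
   qed
   then have "set (take n cs0) <= {0}" by blast
   then have "(%c. cls I V (%_. c)) ` set (take n cs0) <= {cls I V (%_. 0)}" by blast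
   then show "set (take (length ?ss) Ks) <= {\<zero>\<^bsub>L\<^esub>}" unfolding cs0 take_map zero_L by simp
  qed
 qed
 have "L.Span ?K ?ss = global_sections I V D \<longleftrightarrow>
   (ALL i<n. sect I V dl (s i)) & (ALL f. sect I V dl f --> (EX c. gen I V (%x. f x = (SUM i<n. c i * s i x))))"
 proof
  assume e: "L.Span ?K ?ss = global_sections I V D"
  have "sect I V dl (s i)" if "i < n" for i
  proof -
   have "cls I V (s i) = cls I V (%x. SUM l<n. (if l = i then 1 else 0) * s l x)" by (rule arg_cong[where f = "cls I V"], rule ext, subst sum.cong[OF refl, of _ _ "%l. if l = i then s l x else 0" for x])
   (use that in auto)
   then have "cls I V (s i) : L.Span ?K ?ss" unfolding Span by (intro CollectI exI conjI TrueI)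
   then show ?thesis using global_sections_iff[OF D, where f = "s i"] s that unfolding e by simp
  qed
  moreover have "EX c. gen I V (%x. f x = (SUM i<n. c i * s i x))" if f: "sect I V dl f" for f
  proof -
   have "ratl I V f" using f by (simp add: sect_def)
   then have "cls I V f : L.Span ?K ?ss" using global_sections_iff[OF D, where f = f] f unfolding e by simp
   then obtain c where "cls I V f = cls I V (%x. SUM i<n. c i * s i x)" unfolding Span by blast
   then show ?thesis using cls_eq_iff[OF `ratl I V f`, of "%x. SUM i<n. c i * s i x"] by blast
  qed
  ultimately show "(ALL i<n. sect I V dl (s i)) & (ALL f. sect I V dl f --> (EX c. gen I V (%x. f x = (SUM i<n. c i * s i x))))" by blast
 next
  assume a: "(ALL i<n. sect I V dl (s i)) & (ALL f. sect I V dl f --> (EX c. gen I V (%x. f x = (SUM i<n. c i * s i x))))"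
  show "L.Span ?K ?ss = global_sections I V D"
  proof (intro equalityI subsetI)
   fix x assume "x : L.Span ?K ?ss"
   then obtain c where c: "x = cls I V (%x. SUM i<n. c i * s i x)" unfolding Span by blast
   have "sect I V dl (%x. SUM i<n. c i * s i x)" unfolding sect_def
   proof (intro conjI rs ballI)
   fix p assume p: "p : V"
   have "ALL i:{..<n}. EX e. val I V (%x. s i x * dl p x) p e" using a p unfolding sect_def by blast
   then obtain e where e: "ALL i:{..<n}. val I V (%x. s i x * dl p x) p (e i)" by metis
   have "val I V (%x. SUM i<n. c i * (s i x * dl p x)) p (SUM i<n. c i * e i)" using e p by (intro val_sum val_mult val_const) auto
   then show "EX e. val I V (%x. (SUM i<n. c i * s i x) * dl p x) p e" by (auto simp: sum_distrib_right mult.assoc)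
   qed
   then show "x : global_sections I V D" unfolding c using global_sections_iff[OF D rs[of c]] by simp
  next
   fix x assume x: "x : global_sections I V D"
   then have "x : carrier L" by (simp add: global_sections_def)
   then obtain f where f: "ratl I V f" "x = cls I V f" using carrierE by blast
   then have "sect I V dl f" using x global_sections_iff[OF D f(1)] by simp
   then obtain c where "gen I V (%x. f x = (SUM i<n. c i * s i x))" using a by blast
   from cls_cong[OF this] show "x : L.Span ?K ?ss" unfolding Span f(2) by (intro CollectI exI conjI TrueI)
  qed
 qed
 then show ?thesis unfolding section_basis_def sect_basis_def ind by blast
qed

text \<open>At a generic point \<open>q\<close> the local equation \<open>dl q\<close> differs from
  the fixed equation \<open>dl p\<close> by a unit. Value zero in the trivialization at
  \<open>q\<close> is then incompatible with \<open>f q * dl p q ~= 0\<close>.\<close>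

lemma sect_zero:
 assumes dl: "isdiv I V dl" and f: "ratl I V f" and v: "!!p. p : V ==> val I V (%x. f x * dl p x) p 0"
 shows "gen I V (%x. f x = 0)"
proof (rule ccontr)
 assume "~ ?thesis"
 then have nz: "gen I V (%x. f x ~= 0)" using gen_not_zero[OF f] by blast
 obtain p where p: "p : V" using nonempty by blast
 have r: "ratl I V (dl p)" "gen I V (%x. dl p x ~= 0)" "near I V p (%q. EX c. c ~= 0 & val I V (%x. dl p x / dl q x) q c)" using dl p unfolding isdiv_def by auto
 have "gen I V (%q. rg I V q (%x. f x * dl p x) & f q * dl p q ~= 0)" by (rule gen_mono3[OF ratl_gen[OF ratl_mult[OF f r(1)]] nz r(2)]) simp
 from gen_ex[OF gen_conj[OF this near_gen[OF r(3)]]]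
 obtain q c where q: "q : V" "rg I V q (%x. f x * dl p x)" "f q * dl p q ~= 0" "val I V (%x. dl p x / dl q x) q c" by blast
 have "gen I V (%x. f x * dl q x * (dl p x / dl q x) = f x * dl p x)" by (rule gen_mono[of "%x. dl q x ~= 0"]) (use dl q in "auto simp: isdiv_def")
 from val_cong[OF val_mult[OF v[OF q(1)] q(4)] this] have "val I V (%x. f x * dl p x) q 0" by simp
 then show False using val_unique[OF _ val_rg[OF q(2)]] q(3) by fastforce
qed

text \<open>The support of a divisor is a proper closed set: where a fixed equation
  \<open>dl p\<close> is regular, nonzero and a unit multiple of \<open>dl q\<close>, the equation
  \<open>dl q\<close> is a unit as well.\<close>

lemma gen_unit:
 assumes dl: "isdiv I V dl" shows "gen I V (%p. EX c. c ~= 0 & val I V (dl p) p c)"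
proof -
 obtain p where p: "p : V" using nonempty by blast
 have r: "ratl I V (dl p)" "gen I V (%x. dl p x ~= 0)" "near I V p (%q. EX c. c ~= 0 & val I V (%x. dl p x / dl q x) q c)" using dl p unfolding isdiv_def by auto
 show ?thesis
 proof (rule gen_mono3[OF ratl_gen[OF r(1)] r(2) near_gen[OF r(3)]])
  fix q assume q: "q : V" "rg I V q (dl p)" "dl p q ~= 0" "EX c. c ~= 0 & val I V (%x. dl p x / dl q x) q c"
  then obtain c where c: "c ~= 0" "val I V (%x. dl p x / dl q x) q c" by blast
  have "gen I V (%x. dl p x / (dl p x / dl q x) = dl q x)" by (rule gen_mono2[OF r(2), of "%x. dl q x ~= 0"]) (use dl q in "auto simp: isdiv_def")
  from val_cong[OF val_divide[OF val_rg[OF q(2)] c(2,1)] this]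
  show "EX c. c ~= 0 & val I V (dl q) q c" using q(3) c(1) by (intro exI[of _ "dl p q / c"]) simp
 qed
qed

end

section \<open>Functions with separated variables\<close>

text \<open>Linearly independent functions are separated by finitely many points: the weights
  \<open>w i\<close> define combinations of point evaluations that form a dual family. These
  functionals extract coefficients without any topology or integration.\<close>

lemma dual_point_functionals:
 fixes phi :: "nat => 'a => 'k::field"
 assumes "!!c. (ALL x:Xs. (SUM i<n. c i * phi i x) = 0) ==> (ALL i<n. c i = 0)"
 shows "EX Q w. finite Q & Q <= Xs & (ALL i<n. ALL k<n. (SUM y:Q. w i y * phi k y) = (if i = k then 1 else 0))" using assms
proof (induction n)
 case 0 show ?case by (intro exI[of _ "{}"]) auto
next
 case (Suc n)
 have "EX Q w. finite Q & Q <= Xs & (ALL i<n. ALL k<n. (SUM y:Q. w i y * phi k y) = (if i = k then 1 else 0))"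
 proof (rule Suc.IH)
  fix c assume "ALL x:Xs. (SUM i<n. c i * phi i x) = 0"
  then have "ALL x:Xs. (SUM i<Suc n. (c(n := 0)) i * phi i x) = 0" by (simp add: sum.lessThan_Suc)
  from Suc.prems[OF this] show "ALL i<n. c i = 0" by (metis fun_upd_apply less_Suc_eq nat_neq_iff)
 qed
 then obtain Q w where Q: "finite Q" "Q <= Xs" "!!i k. i < n ==> k < n ==> (SUM y:Q. w i y * phi k y) = (if i = k then 1 else 0)" by blast
 define b where "b i = (SUM y:Q. w i y * phi n y)" for i
 \<comment> \<open>The part of \<open>phi n\<close> that its expansion by the old functionals
   misses; independence makes it nonzero at some new point \<open>q\<close>.\<close>
 define psi where "psi x = phi n x - (SUM i<n. b i * phi i x)" for x
 have "EX q:Xs. psi q ~= 0"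
 proof (rule ccontr)
  assume "~ ?thesis"
  then have "ALL x:Xs. (SUM i<Suc n. (if i = n then 1 else - b i) * phi i x) = 0" by (simp add: psi_def sum_negf)
  from Suc.prems[OF this] show False by auto
 qed
 then obtain q where q: "q : Xs" "psi q ~= 0" by blast
 let ?Q = "insert q Q"
 define ev where "ev y = (if y = q then 1 else (0::'k))" for y
 define w0 where "w0 i y = (if y : Q then w i y else 0)" for i y
 have w0: "(SUM y:?Q. w0 i y * f y) = (SUM y:Q. w i y * f y)" for i f
 proof -
  have "(SUM y:?Q. w0 i y * f y) = (SUM y:Q. w0 i y * f y)" by (rule sum.mono_neutral_right) (auto simp: Q(1) w0_def)
  then show ?thesis by (simp add: w0_def)
 qed
 have ev: "(SUM y:?Q. ev y * f y) = f q" for f :: "'a => 'k" using Q(1) by (simp add: ev_def if_distrib[of "%c. c * _"] cong: if_cong)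
 \<comment> \<open>Evaluation at \<open>q\<close> minus its expansion in the old functionals kills
   all earlier \<open>phi k\<close> and takes the value \<open>psi q\<close> on
   \<open>phi n\<close>, whence the division.\<close>
 define wn where "wn y = (ev y - (SUM i<n. phi i q * w0 i y)) / psi q" for y
 have wn: "(SUM y:?Q. wn y * f y) = (f q - (SUM i<n. phi i q * (SUM y:Q. w i y * f y))) / psi q" for f
 proof -
  have "(SUM y:?Q. wn y * f y) = (SUM y:?Q. ev y * f y - (SUM i<n. phi i q * (w0 i y * f y))) / psi q"
   unfolding sum_divide_distrib wn_def by (rule sum.cong) (simp_all add: left_diff_distrib sum_distrib_right mult.assoc)
  also have "(SUM y:?Q. ev y * f y - (SUM i<n. phi i q * (w0 i y * f y))) = f q - (SUM i<n. phi i q * (SUM y:?Q. w0 i y * f y))" by (simp only: sum_subtractf ev sum.swap[of _ _ ?Q] sum_distrib_left)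
  finally show ?thesis by (simp only: w0)
 qed
 have wn1: "(SUM y:?Q. wn y * phi k y) = 0" if "k < n" for k using that by (simp only: wn Q(3) lessThan_iff if_distrib[of "%c. _ * c"] cong: sum.cong) (simp add: Q(3) if_distrib[of "%c. _ * c"] cong: if_cong)
 have wn2: "(SUM y:?Q. wn y * phi n y) = 1" unfolding wn using q(2) unfolding psi_def b_def by (simp add: mult.commute)
 \<comment> \<open>The old functionals are corrected by multiples of \<open>wn\<close> so that they
   vanish on \<open>phi n\<close>; their values on the earlier functions are unchanged.\<close>
 define w' where "w' i y = (if i = n then wn y else w0 i y - b i * wn y)" for i y
 have w': "(SUM y:?Q. w' i y * f y) = (if i = n then (SUM y:?Q. wn y * f y) else (SUM y:Q. w i y * f y) - b i * (SUM y:?Q. wn y * f y))" for i f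
 proof (cases "i = n")
  case False
  have "(SUM y:?Q. w' i y * f y) = (SUM y:?Q. w0 i y * f y) - b i * (SUM y:?Q. wn y * f y)" using False by (simp only: w'_def if_False left_diff_distrib sum_subtractf sum_distrib_left mult.assoc)
  then show ?thesis using False by (simp only: w0 if_False)
 qed (simp only: w'_def simp_thms if_True)
 have dual: "(SUM y:?Q. w' i y * phi k y) = (if i = k then 1 else 0)" if "i < Suc n" "k < Suc n" for i k
 proof (cases "i = n")
  case True
  then show ?thesis using wn1[of k] wn2 that(2) unfolding w' by (cases "k = n") (simp_all only: if_True simp_thms if_False less_Suc_eq, auto)
 next
  case False
  then have i: "i < n" using that(1) by simp
  show ?thesis
  proof (cases "k = n")
   case True
   then show ?thesis unfolding w' using False wn2 by (simp only: if_False b_def[symmetric] True) simp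
  next
   case k: False
   then have "k < n" using that(2) by simp
   then show ?thesis unfolding w' using False wn1[of k] Q(3)[OF i, of k] by (simp only: if_False) simp
  qed
 qed
 show ?case by (rule exI[of _ ?Q], rule exI[of _ w']) (use dual Q(1,2) q(1) in blast)
qed

lemma sum_PiE_insert:
 assumes "finite J" "j ~: J"
 shows "(SUM a:PiE (insert j J) (%_. B). g a) = (SUM i:B. SUM a:PiE J (%_. B). g (a(j := i)))"
proof -
 have inj: "inj_on (%(y, g). g(j := y)) (B \<times> PiE J (%_. B))" by (rule inj_combinator[OF assms(2), of "%_. B"])
 show ?thesis unfolding PiE_insert_eq sum.cartesian_product by (subst sum.reindex[OF inj]) (simp add: case_prod_unfold comp_def)
qed

text \<open>The Kuenneth formula for functions on a product of sets. Expanding in the variable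
  \<open>j\<close> with the dual functionals leaves coefficients that are finite combinations of
  slices of \<open>S\<close>; these are again expandable in each remaining variable, so induction
  applies.\<close>

lemma separated_expansion:
 fixes phi :: "nat => 'a => 'k::field"
 assumes Q: "finite Q" "Q <= Xs" "!!i k. i < n ==> k < n ==> (SUM y:Q. w i y * phi k y) = (if i = k then 1 else 0)"
  and "finite J"
  and "!!j q. j : J ==> range q <= Xs ==> EX c. ALL x:Xs. S (q(j := x)) = (SUM i<n. c i * phi i x)"
  and "!!q q'. range q <= Xs ==> range q' <= Xs ==> (ALL j:J. q j = q' j) ==> S q = S q'"
 shows "EX c. ALL q. range q <= Xs --> S q = (SUM a:PiE J (%_. {..<n}). c a * (PROD j:J. phi (a j) (q j)))" using assms(4-)
proof (induction J arbitrary: S rule: finite_induct)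
 case empty
 show ?case
 proof (cases "EX q::'b => 'a. range q <= Xs")
  case True
  then obtain q0 :: "'b => 'a" where q0: "range q0 <= Xs" by blast
  have "S q = S q0" if "range q <= Xs" for q by (rule empty(2)[OF that q0]) simp
  then show ?thesis by (intro exI[of _ "%_. S q0"]) simp
 qed auto
next
 case (insert j J)
 \<comment> \<open>The coefficient of \<open>phi i\<close> in the variable \<open>j\<close>,
   extracted by the functional \<open>w i\<close> acting on that variable.\<close>
 define T where "T i q = (SUM y:Q. w i y * S (q(j := y)))" for i q
 have upd: "range (q(j := x)) <= Xs" if "range q <= Xs" "x : Xs" for q x using that by auto
 have ST: "S q = (SUM i<n. T i q * phi i (q j))" if q: "range q <= Xs" for q
 proof -
  obtain c where c: "ALL x:Xs. S (q(j := x)) = (SUM i<n. c i * phi i x)" using insert.prems(1)[of j q] q by blast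
  have "T i q = c i" if "i < n" for i
  proof -
   have "T i q = (SUM y:Q. w i y * (SUM k<n. c k * phi k y))" unfolding T_def by (rule sum.cong[OF refl]) (use c Q(2) in "simp add: subsetD")
   also have "... = (SUM k<n. c k * (SUM y:Q. w i y * phi k y))" by (simp only: sum_distrib_left, subst sum.swap) (intro sum.cong refl, simp only: mult_ac)
   also have "... = (SUM k<n. if i = k then c k else 0)" by (rule sum.cong) (use Q(3) that in auto)
   finally show ?thesis using that by simp
  qed
  moreover have "S q = (SUM i<n. c i * phi i (q j))" using c[rule_format, of "q j"] q by (simp only: fun_upd_triv) blast
  ultimately show ?thesis by simp
 qed
 have "EX c. ALL q. range q <= Xs --> T i q = (SUM a:PiE J (%_. {..<n}). c a * (PROD j:J. phi (a j) (q j)))" for i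
 proof (rule insert.IH)
  fix l and q :: "'b => 'a" assume l: "l : J" and q: "range q <= Xs"
  have "EX c. ALL x:Xs. S ((q(j := y))(l := x)) = (SUM k<n. c k * phi k x)" if y: "y : Q" for y by (rule insert.prems(1)[OF insertI2[OF l] upd[OF q subsetD[OF Q(2) y]]])
  then have "ALL y:Q. EX c. ALL x:Xs. S ((q(j := y))(l := x)) = (SUM k<n. c k * phi k x)" by blast
  then obtain c where c: "ALL y:Q. ALL x:Xs. S ((q(j := y))(l := x)) = (SUM k<n. c y k * phi k x)" by metis
  have lj: "(q(l := x))(j := y) = (q(j := y))(l := x)" for x y using l insert.hyps(2) by (auto simp: fun_eq_iff)
  have "T i (q(l := x)) = (SUM k<n. (SUM y:Q. w i y * c y k) * phi k x)" if "x : Xs" for x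
  proof -
   have "T i (q(l := x)) = (SUM y:Q. w i y * (SUM k<n. c y k * phi k x))" unfolding T_def lj by (rule sum.cong[OF refl]) (use c that in simp)
   also have "... = (SUM k<n. (SUM y:Q. w i y * c y k) * phi k x)" by (simp only: sum_distrib_left sum_distrib_right, subst sum.swap) (intro sum.cong refl, simp only: mult_ac)
   finally show ?thesis .
  qed
  then show "EX c. ALL x:Xs. T i (q(l := x)) = (SUM k<n. c k * phi k x)" by (intro exI[of _ "%k. SUM y:Q. w i y * c y k"] ballI)
 next
  fix q q' :: "'b => 'a" assume q: "range q <= Xs" "range q' <= Xs" "ALL j:J. q j = q' j"
  show "T i q = T i q'" unfolding T_def
  proof (rule sum.cong[OF refl])
   fix y assume "y : Q"
   then have y: "y : Xs" using Q(2) by blast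
   have "S (q(j := y)) = S (q'(j := y))" by (rule insert.prems(2)[OF upd[OF q(1) y] upd[OF q(2) y]]) (use q(3) in simp)
   then show "w i y * S (q(j := y)) = w i y * S (q'(j := y))" by simp
  qed
 qed
 then have "ALL i. EX c. ALL q. range q <= Xs --> T i q = (SUM a:PiE J (%_. {..<n}). c a * (PROD j:J. phi (a j) (q j)))" by (rule allI)
 from choice[OF this] obtain c0 where c0: "ALL i. ALL q. range q <= Xs --> T i q = (SUM a:PiE J (%_. {..<n}). c0 i a * (PROD j:J. phi (a j) (q j)))" ..
 obtain c where c: "!!i q. range q <= Xs ==> T i q = (SUM a:PiE J (%_. {..<n}). c i a * (PROD j:J. phi (a j) (q j)))" using c0 that[of c0] by simp
 show ?case
 proof (intro exI[of _ "%a. c (a j) (restrict a J)"] allI impI)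
  fix q :: "'b => 'a" assume q: "range q <= Xs"
  have "S q = (SUM i<n. SUM a:PiE J (%_. {..<n}). c i a * (PROD j:J. phi (a j) (q j)) * phi i (q j))" unfolding ST[OF q] c[OF q] sum_distrib_right ..
  also have "... = (SUM i<n. SUM a:PiE J (%_. {..<n}). c ((a(j := i)) j) (restrict (a(j := i)) J) * (PROD l:insert j J. phi ((a(j := i)) l) (q l)))"
  proof (intro sum.cong refl)
   fix i a assume a: "a : PiE J (%_. {..<n})"
   have "restrict (a(j := i)) J = a" using a insert.hyps(2) by (auto simp: fun_eq_iff restrict_def PiE_iff extensional_def)
   moreover have "(PROD l:J. phi ((a(j := i)) l) (q l)) = (PROD l:J. phi (a l) (q l))" by (rule prod.cong) (use insert.hyps(2) in auto)
   ultimately show "c i a * (PROD j:J. phi (a j) (q j)) * phi i (q j) =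
   c ((a(j := i)) j) (restrict (a(j := i)) J) * (PROD l:insert j J. phi ((a(j := i)) l) (q l))" using insert.hyps by (simp add: mult_ac)
  qed
  finally show "S q = (SUM a:PiE (insert j J) (%_. {..<n}). c (a j) (restrict a J) * (PROD j:insert j J. phi (a j) (q j)))" by (simp only: sum_PiE_insert[OF insert.hyps])
 qed
qed

text \<open>Applying the functional \<open>w (b j)\<close> in each variable \<open>j\<close>
  annihilates every product except the one with index \<open>b\<close>.\<close>

lemma separated_independent:
 fixes phi :: "nat => 'a => 'k::field"
 assumes Q: "finite Q" "Q <= Xs" "!!i k. i < n ==> k < n ==> (SUM y:Q. w i y * phi k y) = (if i = k then 1 else 0)"
  and J: "finite J" and z: "!!q. ALL j:J. q j : Xs ==> (SUM a:PiE J (%_. {..<n}). c a * (PROD j:J. phi (a j) (q j))) = 0"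
  and b: "b : PiE J (%_. {..<n})"
 shows "c b = 0"
proof -
 let ?P = "PiE J (%_. {..<n})"
 have fP: "finite ?P" using J by (intro finite_PiE) auto
 have d: "(PROD j:J. SUM y:Q. w (b j) y * phi (a j) y) = (if a = b then 1 else 0)" if a: "a : ?P" for a
 proof -
  have "(PROD j:J. SUM y:Q. w (b j) y * phi (a j) y) = (PROD j:J. if b j = a j then 1 else 0)" by (rule prod.cong) (use a b Q(3) in "auto simp: PiE_iff")
  also have "... = (if a = b then 1 else 0)"
  proof (cases "a = b")
   case False
   then obtain j where "j : J" "a j ~= b j" using a b PiE_ext by metis
   then have "(PROD j:J. if b j = a j then 1 else (0::'k)) = 0" using J by (intro prod_zero bexI[of _ j]) auto
   then show ?thesis using False by simp
  qed simp
  finally show ?thesis .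
 qed
 have "0 = (SUM y:PiE J (%_. Q). (PROD j:J. w (b j) (y j)) * (SUM a:?P. c a * (PROD j:J. phi (a j) (y j))))" using z Q(2) by (simp add: PiE_iff subset_iff)
 also have "... = (SUM a:?P. c a * (SUM y:PiE J (%_. Q). PROD j:J. w (b j) (y j) * phi (a j) (y j)))" by (simp only: sum_distrib_left prod.distrib, subst sum.swap) (intro sum.cong refl, simp only: mult_ac)
 also have "... = (SUM a:?P. c a * (PROD j:J. SUM y:Q. w (b j) y * phi (a j) y))"
 proof (rule sum.cong[OF refl])
  fix a
  show "c a * (SUM y:PiE J (%_. Q). PROD j:J. w (b j) (y j) * phi (a j) (y j)) = c a * (PROD j:J. SUM y:Q. w (b j) y * phi (a j) y)"
   using prod_sum_PiE[OF J, of "%_. Q" "%j y. w (b j) y * phi (a j) y"] Q(1) by simp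
 qed
 also have "... = (SUM a:?P. if a = b then c a else 0)" by (rule sum.cong) (use d in auto)
 also have "... = c b" using b fP by simp
 finally show ?thesis by simp
qed

section \<open>Closed embeddings\<close>

lemma closed_embeddingI:
 assumes V: "zclosed I V" and im: "zclosed J (phi ` V)" and r: "!!p. p : V ==> rmap_at I V J phi p"
  and inv: "!!p. p : V ==> psi (phi p) = p" and r': "!!y. y : phi ` V ==> rmap_at J (phi ` V) I psi y"
 shows "closed_embedding I V J phi"
proof -
 have inj: "inj_on phi V" by (rule inj_on_inverseI[of V psi phi]) (rule inv)
 have e: "psi y = inv_into V phi y" if y: "y : phi ` V" for y
 proof -
  obtain p where p: "p : V" "y = phi p" using y by blast
  then show ?thesis using inv_into_f_f[OF inj p(1)] inv[OF p(1)] by simp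
 qed
 have 1: "rmap_at J (phi ` V) I (inv_into V phi) y" if "y : phi ` V" for y by (rule rmap_cong[OF r'[OF that] near_all[OF that]]) (rule e)
 have 2: "inv_into V phi ` phi ` V <= V"
 proof
  fix x assume "x : inv_into V phi ` phi ` V"
  then obtain y where "x = inv_into V phi y" "y : phi ` V" by (rule imageE)
  then show "x : V" by (simp only: inv_into_into)
 qed
 show ?thesis unfolding closed_embedding_def morphism_iff[OF V im] morphism_iff[OF im V] by (intro conjI im inj subset_refl ballI r 1 2)
qed

lemma closed_embeddingD:
 assumes V: "zclosed I V" and c: "closed_embedding I V J phi"
 shows "zclosed J (phi ` V)" "!!p. p : V ==> rmap_at I V J phi p"
  "!!p. p : V ==> inv_into V phi (phi p) = p" "!!y. y : phi ` V ==> rmap_at J (phi ` V) I (inv_into V phi) y"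
proof -
 show im: "zclosed J (phi ` V)" using c by (simp add: closed_embedding_def)
 have "inj_on phi V" using c by (simp add: closed_embedding_def)
 then show "!!p. p : V ==> inv_into V phi (phi p) = p" by (rule inv_into_f_f)
 show "!!p. p : V ==> rmap_at I V J phi p" using c unfolding closed_embedding_def morphism_iff[OF V im] by blast
 show "!!y. y : phi ` V ==> rmap_at J (phi ` V) I (inv_into V phi) y" using c unfolding closed_embedding_def morphism_iff[OF im V] by blast
qed

text \<open>Open subsets of the image have open preimages in \<open>V\<close>, and two nonempty open
  subsets of \<open>V\<close> meet.\<close>

lemma (in proj_variety) irreducible_image:
 assumes cl: "zclosed J (phi ` V)" and r: "!!p. p : V ==> rmap_at I V J phi p"
 shows "irreducible_closed J (phi ` V)" unfolding irreducible_closed_def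
proof (intro conjI cl allI impI)
 show "phi ` V ~= {}" using nonempty by simp
 fix M N assume M: "zclosed J M" "zclosed J N" "phi ` V = M Un N"
 have nr: "near I V p (%q. phi q ~: Z)" if Z: "zclosed J Z" "p : V" "phi p ~: Z" "Z <= phi ` V" for p Z
 proof -
  have "zopen J (phi ` V) (phi ` V - Z)" using Z by (simp add: zopen_def double_diff)
  then have "near J (phi ` V) (phi p) (%q. q : phi ` V - Z)" unfolding zopen_iff_near[OF cl] using Z by blast
  then have "near I V p (%q. phi q : phi ` V - Z)" by (intro rmap_near[OF r[OF Z(2)] _ zclosed_subset[OF cl]]) simp_all
  then show ?thesis by (rule near_mono) simp
 qed
 show "phi ` V = M \<or> phi ` V = N"
 proof (rule ccontr)
  assume "~ ?thesis"
  then obtain p q where pq: "p : V" "phi p ~: M" "q : V" "phi q ~: N" using M(3) by blast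
  have "near I V p (%q. phi q ~: M)" "near I V q (%q. phi q ~: N)" using pq M by (auto intro!: nr)
  from near_inter[OF this] obtain x where x: "near I V x (%x. phi x ~: M & phi x ~: N)" by blast
  then show False using near_in[OF x] near_self[OF x] M(3) by blast
 qed
qed

text \<open>Products of sections are naturally indexed by tuples, whereas \<open>linsys_map\<close>
  numbers its coordinates. The two projective spaces are identified along a bijection
  \<open>e\<close>.\<close>

definition reindex :: "(nat => 'a) => nat => ('a => 'k::field) => nat => 'k"
 where "reindex e M z = (%m. if m < M then z (e m) else 0)"

definition unindex :: "(nat => 'a) => nat => 'a set => (nat => 'k::field) => 'a => 'k"
 where "unindex e M B y = (%a. if a : B then y (inv_into {..<M} e a) else 0)"

locale index_change =
 fixes e :: "nat => 'a" and M :: nat and B :: "'a set"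
 assumes bij: "bij_betw e {..<M} B"
begin

lemma e_in: "m < M ==> e m : B" using bij by (auto simp: bij_betw_def)
lemma inv_in: "a : B ==> inv_into {..<M} e a < M" using inv_into_into[of a e "{..<M}"] bij by (simp add: bij_betw_def)
lemma e_inv: "a : B ==> e (inv_into {..<M} e a) = a" using bij by (simp add: bij_betw_inv_into_right)
lemma inv_e: "m < M ==> inv_into {..<M} e (e m) = m" using bij by (simp add: bij_betw_inv_into_left)

lemma unindex_reindex: "z : cspace B ==> unindex e M B (reindex e M z) = z" by (auto simp: unindex_def reindex_def coord_space_def fun_eq_iff inv_in e_inv)

lemma reindex_unindex: "y : cspace {..<M} ==> reindex e M (unindex e M B y) = y" by (auto simp: unindex_def reindex_def coord_space_def fun_eq_iff e_in inv_e)

lemma reindex_scal: "reindex e M (scal c z) = scal c (reindex e M z)" by (auto simp: reindex_def scal_def)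

lemma unindex_scal: "unindex e M B (scal c z) = scal c (unindex e M B z)" by (auto simp: unindex_def scal_def)

lemma reindex_coord: "reindex e M z : cspace {..<M}" by (simp add: reindex_def coord_space_def)
lemma unindex_coord: "unindex e M B y : cspace B" by (simp add: unindex_def coord_space_def)

lemma reindex_pt: "reindex e M ` pt z = pt (reindex e M z)" unfolding pt_def by (simp add: setcompr_eq_image image_image reindex_scal)

lemma unindex_pt: "unindex e M B ` pt z = pt (unindex e M B z)" unfolding pt_def by (simp add: setcompr_eq_image image_image unindex_scal)

lemma unindex_reindex_point: "p : pspace B ==> unindex e M B ` reindex e M ` p = p" using proj_space_rep[of p B] reindex_pt[of "rep p"] unindex_pt[of "reindex e M (rep p)"] unindex_reindex[of "rep p"] by simp

lemma reindex_unindex_point: "p : pspace {..<M} ==> reindex e M ` unindex e M B ` p = p"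
 using proj_space_rep[of p "{..<M}"] unindex_pt[of "rep p"] reindex_pt[of "unindex e M B (rep p)"] reindex_unindex[of "rep p"] by simp

lemma unindex_zero: "y : cspace {..<M} ==> unindex e M B y = 0 ==> y = 0" using reindex_unindex[of y] by (auto simp: reindex_def)

lemma reindex_zero: "z : cspace B ==> reindex e M z = 0 ==> z = 0" using unindex_reindex[of z] by (auto simp: unindex_def)

lemma reindex_proj: "p : pspace B ==> reindex e M ` p : pspace {..<M}" using proj_space_rep[of p B] reindex_pt[of "rep p"] reindex_coord[of "rep p"] reindex_zero[of "rep p"] pt_in_proj by metis

lemma unindex_proj: "p : pspace {..<M} ==> unindex e M B ` p : pspace B" using proj_space_rep[of p "{..<M}"] unindex_pt[of "rep p"] unindex_coord[of "rep p"] unindex_zero[of "rep p"] pt_in_proj by metis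

lemma zclosed_reindex:
 assumes Z: "zclosed B Z" shows "zclosed {..<M} ((`) (reindex e M) ` Z)"
proof -
 obtain S where S: "!!f. f : S ==> EX n. hompf B n f" "Z = {p : pspace B. ALL f:S. f (rep p) = 0}" by (rule zclosed_formsE[OF Z], rule that)
 have Zmem: "p : Z \<longleftrightarrow> p : pspace B & (ALL f:S. f (rep p) = 0)" for p by (subst S(2)) simp
 let ?S = "(%f y. f (unindex e M B y)) ` S"
 have forms: "EX n. hompf {..<M} n f" if f: "f : ?S" for f
 proof -
  obtain g where g: "g : S" "f = (%y. g (unindex e M B y))" using f by (elim imageE)
  obtain n where n: "hompf B n g" using S(1)[OF g(1)] by blast
  have "hompf {..<M} (n * 1) (%y. g (%a. if a : B then y (inv_into {..<M} e a) else 0))"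
  proof (rule hompf_compose[OF n])
   fix a assume a: "a : B"
   show "hompf {..<M} 1 (%y. if a : B then y (inv_into {..<M} e a) else 0)" using hompf_coord[OF iffD2[OF lessThan_iff inv_in[OF a]]] a by (simp only: if_True)
  qed
  then show ?thesis unfolding g(2) unindex_def by blast
 qed
 have zero: "(ALL f:?S. f (rep y) = 0) \<longleftrightarrow> (ALL f:S. f (rep (unindex e M B ` y)) = 0)" if y: "y : pspace {..<M}" for y
 proof -
  have 1: "f (unindex e M B (rep y)) = 0 \<longleftrightarrow> f (rep (unindex e M B ` y)) = 0" if f: "f : S" for f
  proof -
   obtain n where n: "hompf B n f" using S(1)[OF f] by blast
   show ?thesis by (rule hompf_mem_zero_iff[OF unindex_proj[OF y] _ n]) (use proj_space_rep(1)[OF y] in blast)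
  qed
  have "(ALL f:?S. f (rep y) = 0) \<longleftrightarrow> (ALL f:S. f (unindex e M B (rep y)) = 0)" by (rule ball_simps(9))
  also have "... \<longleftrightarrow> (ALL f:S. f (rep (unindex e M B ` y)) = 0)" by (rule ball_cong[OF refl 1])
  finally show ?thesis .
 qed
 have "(`) (reindex e M) ` Z = {y : pspace {..<M}. ALL f:?S. f (rep y) = 0}"
 proof (intro equalityI subsetI)
  fix y assume "y : (`) (reindex e M) ` Z"
  then obtain p where p: "y = reindex e M ` p" "p : Z" by (rule imageE)
  have pB: "p : pspace B" "ALL f:S. f (rep p) = 0" using iffD1[OF Zmem p(2)] by (rule conjunct1, rule conjunct2)
  have y: "y : pspace {..<M}" unfolding p(1) by (rule reindex_proj[OF pB(1)])
  have e: "unindex e M B ` y = p" unfolding p(1) by (rule unindex_reindex_point[OF pB(1)])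
  have "ALL f:S. f (rep (unindex e M B ` y)) = 0" unfolding e by (rule pB(2))
  then show "y : {y : pspace {..<M}. ALL f:?S. f (rep y) = 0}" by (intro CollectI conjI y iffD2[OF zero[OF y]])
 next
  fix y assume "y : {y : pspace {..<M}. ALL f:?S. f (rep y) = 0}"
  then have y: "y : pspace {..<M}" "ALL f:?S. f (rep y) = 0" unfolding mem_Collect_eq by (rule conjunct1, rule conjunct2)
  have "unindex e M B ` y : Z" by (rule iffD2[OF Zmem conjI[OF unindex_proj[OF y(1)] iffD1[OF zero[OF y(1)] y(2)]]])
  from imageI[OF this, of "(`) (reindex e M)"] show "y : (`) (reindex e M) ` Z" unfolding reindex_unindex_point[OF y(1)] .
 qed
 then show ?thesis by (simp only: zclosed_forms[OF forms])
qed

lemma rmap_reindex: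
 assumes "Z <= pspace B" "p : Z" shows "rmap_at B Z {..<M} (%p. reindex e M ` p) p"
proof -
 obtain r where r: "ALL i:B. rg B Z p (r i)" "near B Z p (%q. (%i. r i q) : q)" using rmap_coordinates[OF assms(2,1)] unfolding rmap_at_def by blast
 have "ALL m:{..<M}. rg B Z p (%q. reindex e M (%i. r i q) m)" using r(1) by (simp add: reindex_def e_in)
 moreover have "near B Z p (%q. (%m. reindex e M (%i. r i q) m) : reindex e M ` q)" by (rule near_mono[OF r(2)]) (rule imageI)
 ultimately show ?thesis unfolding rmap_at_def by (intro exI[of _ "%m q. reindex e M (%i. r i q) m"] conjI)
qed

lemma rmap_unindex:
 assumes "Z <= pspace {..<M}" "p : Z" shows "rmap_at {..<M} Z B (%p. unindex e M B ` p) p"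
proof -
 obtain r where r: "ALL i:{..<M}. rg {..<M} Z p (r i)" "near {..<M} Z p (%q. (%i. r i q) : q)" using rmap_coordinates[OF assms(2,1)] unfolding rmap_at_def by blast
 have "ALL a:B. rg {..<M} Z p (%q. unindex e M B (%i. r i q) a)" using r(1) by (simp add: unindex_def inv_in)
 moreover have "near {..<M} Z p (%q. (%a. unindex e M B (%i. r i q) a) : unindex e M B ` q)" by (rule near_mono[OF r(2)]) (rule imageI)
 ultimately show ?thesis unfolding rmap_at_def by (intro exI[of _ "%a q. unindex e M B (%i. r i q) a"] conjI)
qed

end

lemma linsys_map_val:
 assumes "proj_variety K Y" "y : Y" "!!i. i < n ==> ratl K Y (s i)" "ratl K Y (dl y)" "D y = cls K Y (dl y)"
  and "!!i. i < n ==> val K Y (%x. s i x * dl y x) y (c i)"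
 shows "linsys_map K Y D (map (%i. cls K Y (s i)) [0..<n]) y = pt (%i. if i < n then c i else 0)"
proof -
 interpret Y: proj_variety K Y by fact
 have "rat_value (cls K Y (s i) \<otimes>\<^bsub>funfield K Y\<^esub> D y) y = c i" if "i < n" for i unfolding assms(5) Y.mult_cls[OF assms(3)[OF that] assms(4)] by (rule Y.val_rat_value[OF assms(6)[OF that]])
 then show ?thesis unfolding linsys_map_def by (intro arg_cong[where f = pt] ext) simp
qed

section \<open>The divisor on the power\<close>

context segre_power
begin

definition pdiv :: "(('i, 'k) point => ('i, 'k) point => 'k) => (nat => 'i, 'k) point => (nat => 'i, 'k) point => 'k"
 where "pdiv dl p = (%q. PROD j=1..d. dl (co I d p j) (co I d q j))"

definition psec :: "(nat => ('i, 'k) point => 'k) => (nat => nat) => (nat => 'i, 'k) point => 'k"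
 where "psec s a = (%q. PROD j=1..d. s (a j) (co I d q j))"

lemma val_co: assumes "p : V" "j : {1..d}" "val I C f (co I d p j) c" shows "val A V (%q. f (co I d q j)) p c"
proof -
 obtain g where g: "rg I C (co I d p j) g" "gen I C (%q. f q = g q)" "g (co I d p j) = c" using assms(3) unfolding val_def by blast
 show ?thesis unfolding val_def by (rule exI[of _ "%q. g (co I d q j)"]) (use rg_co[OF assms(1,2) g(1)] gen_co[OF g(2) assms(2)] g(3) in simp)
qed

lemma isdiv_pdiv: assumes "isdiv I C dl" shows "isdiv A V (pdiv dl)"
proof -
 have dl: "ratl I C (dl x)" "gen I C (%y. dl x y ~= 0)" "near I C x (%q. EX c. c ~= 0 & val I C (%y. dl x y / dl q y) q c)"
  if "x : C" for x using assms that unfolding isdiv_def by blast+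
 show ?thesis unfolding isdiv_def
 proof (intro conjI ballI)
  fix p assume p: "p : V"
  show "ratl A V (pdiv dl p)" unfolding pdiv_def using co_in_C[OF p] by (intro V.ratl_prod ratl_co dl(1))
  have "gen A V (%x. ALL j:{1..d}. dl (co I d p j) (co I d x j) ~= 0)"
  proof (rule V.gen_ball)
   fix j assume j: "j : {1..d}"
   show "gen A V (%x. dl (co I d p j) (co I d x j) ~= 0)" by (rule gen_co[OF dl(2)[OF co_in_C[OF p j]] j])
  qed simp
  then show "gen A V (%x. pdiv dl p x ~= 0)" by (rule V.gen_mono) (simp add: pdiv_def)
  have "near A V p (%q. ALL j:{1..d}. EX c. c ~= 0 & val I C (%y. dl (co I d p j) y / dl (co I d q j) y) (co I d q j) c)"
  proof (rule near_ball[OF _ p])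
   fix j assume j: "j : {1..d}"
   show "near A V p (%q. EX c. c ~= 0 & val I C (%y. dl (co I d p j) y / dl (co I d q j) y) (co I d q j) c)" by (rule near_co[OF p j dl(3)[OF co_in_C[OF p j]]])
  qed simp
  then show "near A V p (%q. EX c. c ~= 0 & val A V (%x. pdiv dl p x / pdiv dl q x) q c)"
  proof (rule near_mono)
   fix q assume q: "q : V" "ALL j:{1..d}. EX c. c ~= 0 & val I C (%y. dl (co I d p j) y / dl (co I d q j) y) (co I d q j) c"
   from bchoice[OF q(2)] obtain c where c: "ALL j:{1..d}. c j ~= 0 & val I C (%y. dl (co I d p j) y / dl (co I d q j) y) (co I d q j) (c j)" ..
   have "val A V (%x. PROD j=1..d. dl (co I d p j) (co I d x j) / dl (co I d q j) (co I d x j)) q (PROD j=1..d. c j)" by (rule V.val_prod[OF q(1)], rule val_co[OF q(1)]) (use c in simp_all)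
   then show "EX c. c ~= 0 & val A V (%x. pdiv dl p x / pdiv dl q x) q c" using c unfolding pdiv_def prod_dividef by (intro exI[of _ "PROD j=1..d. c j"]) simp
  qed
 qed
qed

text \<open>A section of the divisor on the power, evaluated in its trivializations, is a section on the curve in each variable separately.\<close>

lemma slice_section:
 assumes dl: "isdiv I C dl" and sb: "sect_basis I C dl n s"
  and phi: "!!i x. i < n ==> x : C ==> val I C (%y. s i y * dl x y) x (phi i x)"
  and f: "ratl A V f" and S: "!!q. range q <= C ==> val A V (%p. f p * pdiv dl (mk I d q) p) (mk I d q) (S q)"
  and j: "j : {1..d}" and q: "range q <= C"
 shows "EX c. ALL x:C. S (q(j := x)) = (SUM i<n. c i * phi i x)"
proof -
 have dlr: "ratl I C (dl x)" "gen I C (%y. dl x y ~= 0)" if "x : C" for x using dl that unfolding isdiv_def by blast+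
 have qC: "ALL l:{1..d}. q l : C" using q by blast
 define P where "P x = mk I d (q(j := x))" for x
 have PV: "P x : V" if "x : C" for x unfolding P_def by (rule slice_in_V[OF qC that])
 have coP: "co I d (P x) l = (q(j := x)) l" if "x : C" "l : {1..d}" for x l unfolding P_def by (rule co_mk[OF _ that(2)]) (use qC that(1) in simp)
 have coPj: "co I d (P x) j = x" if "x : C" for x using coP[OF that j] by simp
 have nearP: "near I C x (%x. Q (P x))" if "x : C" "near A V (P x) Q" for x Q using near_slice[OF qC that(1), of j Q] that(2) unfolding P_def by simp
 have rgP: "rg I C x (%x. g (P x))" if "x : C" "rg A V (P x) g" for x g using rg_slice[OF qC that(1), of j g] that(2) unfolding P_def by simp
 define ep where "ep p = (PROD l:{1..d}-{j}. dl (q l) (co I d p l))" for p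
 define g0 where "g0 p = f p * ep p" for p
 have pd: "pdiv dl (P x) p = dl x (co I d p j) * ep p" if x: "x : C" for x p
 proof -
  have "pdiv dl (P x) p = (PROD l=1..d. dl ((q(j := x)) l) (co I d p l))" unfolding pdiv_def by (rule prod.cong[OF refl]) (simp only: coP[OF x])
  also have "... = dl ((q(j := x)) j) (co I d p j) * (PROD l:{1..d}-{j}. dl ((q(j := x)) l) (co I d p l))" by (rule prod.remove) (use j in simp_all)
  also have "(PROD l:{1..d}-{j}. dl ((q(j := x)) l) (co I d p l)) = ep p" unfolding ep_def by (rule prod.cong[OF refl]) simp
  finally show ?thesis by (simp only: fun_upd_same)
 qed
 have G: "val A V (%p. g0 p * dl x (co I d p j)) (P x) (S (q(j := x)))" if x: "x : C" for x
 proof -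
  have "range (q(j := x)) <= C" using q x by auto
  from S[OF this] have "val A V (%p. f p * pdiv dl (P x) p) (P x) (S (q(j := x)))" unfolding P_def .
  then show ?thesis unfolding pd[OF x] g0_def by (simp only: mult_ac)
 qed
 \<comment> \<open>The slice may lie entirely in the polar set of \<open>f\<close>. After
   multiplication by the local equations \<open>ep\<close> of the fixed coordinates, a value at
   \<open>P x\<close> exists for every \<open>x\<close> at which \<open>dl x\<close> is a unit, and
   these values form a rational function on the curve.\<close>
 define u where "u x = (SOME c. val A V g0 (P x) c)" for x
 have ueq: "u x = c" if "val A V g0 (P x) c" for x c unfolding u_def by (rule some_equality[of "%c. val A V g0 (P x) c", OF that]) (rule V.val_unique[OF _ that])
 have uval: "val A V g0 (P x) (u x)" if x: "x : C" "EX c. c ~= 0 & val I C (dl x) x c" for x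
 proof -
  obtain c where c: "c ~= 0" "val I C (dl x) x c" using x(2) by blast
  have "val A V (%p. dl x (co I d p j)) (P x) c" by (rule val_co[OF PV[OF x(1)] j]) (simp only: coPj[OF x(1)] c(2))
  from V.val_divide[OF G[OF x(1)] this c(1)]
  have 1: "val A V (%p. g0 p * dl x (co I d p j) / dl x (co I d p j)) (P x) (S (q(j := x)) / c)" .
  have "gen A V (%p. g0 p * dl x (co I d p j) / dl x (co I d p j) = g0 p)" by (rule V.gen_mono[OF gen_co[OF dlr(2)[OF x(1)] j]]) simp
  from V.val_cong[OF 1 this] show ?thesis using ueq by simp
 qed
 note unit = C.gen_unit[OF dl]
 have ru: "ratl I C u"
 proof -
  obtain x0 where x0: "x0 : C" "EX c. c ~= 0 & val I C (dl x0) x0 c" using C.gen_ex[OF unit] by blast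
  obtain g where g: "near A V (P x0) (%p. rg A V p g & val A V g0 p (g p))" by (rule V.val_near[OF uval[OF x0]])
  have "near I C x0 (%x. g (P x) = u x)"
  proof (rule near_mono[OF nearP[OF x0(1) g]])
   fix y assume "rg A V (P y) g & val A V g0 (P y) (g (P y))"
   then show "g (P y) = u y" using ueq[of y "g (P y)"] by simp
  qed
  moreover have "rg I C x0 (%x. g (P x))" using rgP[OF x0(1)] near_self[OF g] by simp
  ultimately show ?thesis using rg_cong C.rg_ratl by blast
 qed
 have uv: "val I C (%y. u y * dl x y) x (S (q(j := x)))" if x: "x : C" for x
 proof -
  obtain g where g: "near A V (P x) (%p. rg A V p g & val A V (%p. g0 p * dl x (co I d p j)) p (g p))" "g (P x) = S (q(j := x))" by (rule V.val_near[OF G[OF x]])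
  have "gen I C (%y. u y * dl x y = g (P y))"
  proof (rule C.gen_mono3[OF C.near_gen[OF nearP[OF x g(1)]] unit C.ratl_gen[OF dlr(1)[OF x]]])
   fix y assume y: "y : C" "rg A V (P y) g & val A V (%p. g0 p * dl x (co I d p j)) (P y) (g (P y))"
   "EX c. c ~= 0 & val I C (dl y) y c" "rg I C y (dl x)"
   have "val A V (%p. dl x (co I d p j)) (P y) (dl x y)" by (rule val_co[OF PV[OF y(1)] j]) (simp only: coPj[OF y(1)] C.val_rg[OF y(4)])
   from V.val_mult[OF uval[OF y(1,3)] this] show "u y * dl x y = g (P y)" using V.val_unique y(2) by blast
  qed
  moreover have "rg I C x (%y. g (P y))" using rgP[OF x] near_self[OF g(1)] by simp
  ultimately show ?thesis unfolding val_def using g(2) by (intro exI[of _ "%y. g (P y)"]) simp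
 qed
 have "sect I C dl u" unfolding sect_def using ru uv by blast
 then obtain c where c: "gen I C (%x. u x = (SUM i<n. c i * s i x))" using sb unfolding sect_basis_def by blast
 have "S (q(j := x)) = (SUM i<n. c i * phi i x)" if x: "x : C" for x
 proof -
  have 1: "val I C (%y. SUM i<n. c i * (s i y * dl x y)) x (SUM i<n. c i * phi i x)" by (intro C.val_sum C.val_mult C.val_const phi x) simp
  have 2: "gen I C (%y. (SUM i<n. c i * (s i y * dl x y)) = u y * dl x y)" by (rule C.gen_mono[OF c]) (simp add: sum_distrib_right mult.assoc)
  show ?thesis by (rule C.val_unique[OF uv[OF x] C.val_cong[OF 1 2]])
 qed
 then show ?thesis by blast
qed

lemma psec_val:
 assumes phi: "!!i x. i < n ==> x : C ==> val I C (%y. s i y * dl x y) x (phi i x)"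
  and a: "a : PiE {1..d} (%_. {..<n})" and p: "p : V"
 shows "val A V (%q. psec s a q * pdiv dl p q) p (PROD j=1..d. phi (a j) (co I d p j))"
proof -
 have "val A V (%q. PROD j=1..d. s (a j) (co I d q j) * dl (co I d p j) (co I d q j)) p (PROD j=1..d. phi (a j) (co I d p j))"
 proof (rule V.val_prod[OF p])
  fix j assume j: "j : {1..d}"
  have "a j < n" using PiE_mem[OF a j] by simp
  from val_co[OF p j phi[OF this co_in_C[OF p j]]]
  show "val A V (%q. s (a j) (co I d q j) * dl (co I d p j) (co I d q j)) p (phi (a j) (co I d p j))" .
 qed
 then show ?thesis unfolding psec_def pdiv_def prod.distrib .
qed

text \<open>In the trivializations a section becomes an honest function of \<open>d\<close> points,
  to which the separation of variables applies; \<open>sect_zero\<close> leads back from these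
  values to rational functions.\<close>

lemma sect_basis_power:
 assumes dl: "isdiv I C dl" and sb: "sect_basis I C dl n s" and e: "bij_betw e {..<M} (PiE {1..d} (%_. {..<n}))"
  and phi: "!!i x. i < n ==> x : C ==> val I C (%y. s i y * dl x y) x (phi i x)"
 shows "sect_basis A V (pdiv dl) M (%m. psec s (e m))"
proof -
 let ?E = "PiE {1..d} (%_. {..<n})"
 have e_in: "e m : ?E" if "m < M" for m using bij_betwE[OF e] that by blast
 have rs: "ratl I C (s i)" if "i < n" for i using sb that unfolding sect_basis_def sect_def by blast
 have rp: "ratl A V (psec s a)" if "a : ?E" for a unfolding psec_def by (intro V.ratl_prod ratl_co rs) (use PiE_mem[OF that] in simp)
 \<comment> \<open>Independence of the sections passes to their trivialized values: a combination
   all of whose values vanish is the zero section.\<close>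
 have ind: "ALL i<n. c i = 0" if c: "ALL x:C. (SUM i<n. c i * phi i x) = 0" for c
 proof -
  have "gen I C (%y. (SUM i<n. c i * s i y) = 0)"
  proof (rule C.sect_zero[OF dl])
   show "ratl I C (%y. SUM i<n. c i * s i y)" by (intro C.ratl_sum C.ratl_mult C.ratl_const rs) simp
   fix x assume x: "x : C"
   have "val I C (%y. SUM i<n. c i * (s i y * dl x y)) x (SUM i<n. c i * phi i x)" by (intro C.val_sum C.val_mult C.val_const phi x) simp
   moreover have "(%y. SUM i<n. c i * (s i y * dl x y)) = (%y. (SUM i<n. c i * s i y) * dl x y)" by (simp add: sum_distrib_right mult.assoc)
   ultimately show "val I C (%y. (SUM i<n. c i * s i y) * dl x y) x 0" using c x by simp
  qed
  then show ?thesis using sb unfolding sect_basis_def by blast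
 qed
 obtain Q w where "finite Q & Q <= C & (ALL i<n. ALL k<n. (SUM y:Q. w i y * phi k y) = (if i = k then 1 else 0))" using dual_point_functionals[where Xs = C and n = n and phi = phi, OF ind] by blast
 then have Q: "finite Q" "Q <= C" "!!i k. i < n ==> k < n ==> (SUM y:Q. w i y * phi k y) = (if i = k then 1 else 0)" by simp_all
 have reidx: "(SUM m<M. h (e m)) = (SUM a:?E. h a)" for h :: "(nat => nat) => 'k" by (rule sum.reindex_bij_betw[OF e])
 define ei where "ei = inv_into {..<M} e"
 have ei: "ei (e m) = m" if "m < M" for m unfolding ei_def by (rule bij_betw_inv_into_left[OF e]) (simp add: that)
 have sval: "val A V (%q. (SUM m<M. c m * psec s (e m) q) * pdiv dl p q) p (SUM a:?E. c (ei a) * (PROD j=1..d. phi (a j) (co I d p j)))"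
  if p: "p : V" for c p
 proof -
  have "val A V (%q. SUM m<M. c m * (psec s (e m) q * pdiv dl p q)) p (SUM m<M. c m * (PROD j=1..d. phi (e m j) (co I d p j)))"
  proof (intro V.val_sum V.val_mult V.val_const psec_val[where n = n, OF phi] p)
   fix m assume "m : {..<M}"
   then show "e m : ?E" by (intro e_in) simp
  qed
  moreover have "(SUM m<M. c m * (PROD j=1..d. phi (e m j) (co I d p j))) = (SUM m<M. c (ei (e m)) * (PROD j=1..d. phi (e m j) (co I d p j)))" by (rule sum.cong[OF refl]) (simp add: ei)
  moreover note reidx[of "%a. c (ei a) * (PROD j=1..d. phi (a j) (co I d p j))"]
  ultimately show ?thesis by (simp only: sum_distrib_right mult.assoc)
 qed
 show ?thesis unfolding sect_basis_def
 proof (intro conjI allI impI)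
  fix m assume m: "m < M"
  show "sect A V (pdiv dl) (psec s (e m))" unfolding sect_def using rp[OF e_in[OF m]] psec_val[where n = n and s = s and dl = dl and phi = phi, OF phi e_in[OF m]] by blast
 next
  fix c m assume c: "gen A V (%x. (SUM m<M. c m * psec s (e m) x) = 0)" and m: "m < M"
  have "c (ei (e m)) = 0"
  proof (rule separated_independent[OF Q _ _ e_in[OF m]])
   fix q assume q: "ALL j:{1..d}. q j : C"
   have V: "mk I d q : V" by (rule mk_in_V[OF q])
   have "gen A V (%x. (SUM m<M. c m * psec s (e m) x) * pdiv dl (mk I d q) x = 0)" by (rule V.gen_mono[OF c]) simp
   from V.val_cong[OF sval[OF V] this] V.val_const[OF V]
   have "(SUM a:?E. c (ei a) * (PROD j=1..d. phi (a j) (co I d (mk I d q) j))) = 0" by (rule V.val_unique)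
   moreover have "(PROD j=1..d. phi (a j) (co I d (mk I d q) j)) = (PROD j=1..d. phi (a j) (q j))" for a by (rule prod.cong[OF refl]) (simp only: co_mk[OF q])
   ultimately show "(SUM a:?E. c (ei a) * (PROD j=1..d. phi (a j) (q j))) = 0" by (simp only:)
  qed simp_all
  then show "c m = 0" by (simp only: ei[OF m])
 next
  fix f assume f: "sect A V (pdiv dl) f"
  define S where "S q = (SOME c. val A V (%p. f p * pdiv dl (mk I d q) p) (mk I d q) c)" for q
  have mkV: "mk I d q : V" if "range q <= C" for q by (rule mk_in_V) (use that in blast)
  have S: "val A V (%p. f p * pdiv dl (mk I d q) p) (mk I d q) (S q)" if q: "range q <= C" for q unfolding S_def by (rule someI_ex) (use f mkV[OF q] in "simp add: sect_def")
  have rf: "ratl A V f" using f by (simp add: sect_def)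
  have "EX c. ALL q. range q <= C --> S q = (SUM a:?E. c a * (PROD j=1..d. phi (a j) (q j)))"
  proof (rule separated_expansion[OF Q])
   fix j and q :: "nat => ('i, 'k) point" assume "j : {1..d}" "range q <= C"
   then show "EX c. ALL x:C. S (q(j := x)) = (SUM i<n. c i * phi i x)" by (intro slice_section[where S = S and dl = dl and s = s and n = n and f = f] dl sb phi rf S)
  next
   fix q q' :: "nat => ('i, 'k) point" assume "ALL j:{1..d}. q j = q' j"
   then have "mk I d q = mk I d q'" by (intro mk_cong) blast
   then show "S q = S q'" unfolding S_def by (simp only:)
  qed simp_all
  then obtain c where c: "!!q. range q <= C ==> S q = (SUM a:?E. c a * (PROD j=1..d. phi (a j) (q j)))" by blast
  let ?h = "%x. SUM m<M. c (e m) * psec s (e m) x"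
  have rh: "ratl A V ?h" by (intro V.ratl_sum V.ratl_mult V.ratl_const rp e_in) simp
  have "gen A V (%x. f x - ?h x = 0)"
  proof (rule V.sect_zero[OF isdiv_pdiv[OF dl]])
   show "ratl A V (%x. f x - ?h x)" by (rule V.ratl_diff[OF rf rh])
   fix p assume p: "p : V"
   obtain x0 where x0: "x0 : C" using C.nonempty by blast
   \<comment> \<open>\<open>separated_expansion\<close> works with tuples all of whose entries are
     in \<open>C\<close>, so the entries outside \<open>{1..d}\<close> are filled with a fixed
     point; \<open>mk\<close> does not see them.\<close>
   let ?q = "%j. if j : {1..d} then co I d p j else x0"
   have q: "range ?q <= C" using co_in_C[OF p] x0 by auto
   have mkq: "mk I d ?q = p" using mk_cong[of ?q "co I d p"] mk_co[OF p] by simp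
   have e1: "(PROD j=1..d. phi (a j) (?q j)) = (PROD j=1..d. phi (a j) (co I d p j))" for a by (rule prod.cong[OF refl]) simp
   have e2: "c (e (ei a)) = c a" if "a : ?E" for a unfolding ei_def using bij_betw_inv_into_right[OF e that] by simp
   have v: "S ?q = (SUM a:?E. c (e (ei a)) * (PROD j=1..d. phi (a j) (co I d p j)))" unfolding c[OF q] e1 by (rule sum.cong[OF refl]) (simp only: e2)
   have "val A V (%x. f x * pdiv dl p x + (- 1) * (?h x * pdiv dl p x)) p (S ?q + (- 1) * S ?q)"
   proof (intro V.val_add V.val_mult V.val_const p)
   show "val A V (%x. f x * pdiv dl p x) p (S ?q)" using S[OF q] unfolding mkq .
   show "val A V (%x. ?h x * pdiv dl p x) p (S ?q)" unfolding v by (rule sval[OF p])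
   qed
   then show "val A V (%x. (f x - ?h x) * pdiv dl p x) p 0" by (simp add: left_diff_distrib)
  qed
  then show "EX c. gen A V (%x. f x = (SUM m<M. c m * psec s (e m) x))" by (intro exI[of _ "%m. c (e m)"]) simp
 qed
qed

text \<open>The image is the renumbered power of the embedded curve, so it is closed by
  \<open>V_closed\<close> applied to the image of \<open>phi\<close>. The inverse takes the factors,
  applies the inverse of \<open>phi\<close> to each and forms the Segre point again.\<close>

lemma product_embedding:
 assumes phi: "closed_embedding I C J phi" and J: "finite J" and e: "index_change e M (power_index J d)"
 shows "closed_embedding A V {..<M} (%p. reindex e M ` mk J d (%j. phi (co I d p j)))"
proof -
 let ?C' = "phi ` C" and ?psi = "inv_into C phi"
 note E = closed_embeddingD[OF C.closed phi]
 have irr: "irreducible_closed J ?C'" by (rule C.irreducible_image[OF E(1,2)])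
 interpret P: segre_power J ?C' d by (unfold_locales) (rule J, rule irr, rule d_pos)
 interpret R: index_change e M "power_index J d" by (rule e)
 let ?B = "power_index J d" and ?V' = "variety_power J ?C' d"
 let ?Ph = "%p. mk J d (%j. phi (co I d p j))" and ?Ps = "%p. mk I d (%j. ?psi (co J d p j))"
 have PhV: "?Ph p : ?V'" if "p : V" for p by (rule P.mk_in_V) (use co_in_C[OF that] in blast)
 have psiC: "?psi y : C" if "y : ?C'" for y using inv_into_into[OF that] .
 have PsV: "?Ps p : V" if "p : ?V'" for p by (rule mk_in_V) (use P.co_in_C[OF that] psiC in blast)
 have PsPh: "?Ps (?Ph p) = p" if p: "p : V" for p
 proof -
  have 1: "ALL j:{1..d}. phi (co I d p j) : ?C'" using co_in_C[OF p] by blast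
  have "?Ps (?Ph p) = mk I d (co I d p)" by (rule mk_cong) (simp only: P.co_mk[OF 1] E(3)[OF co_in_C[OF p]])
  then show ?thesis using mk_co[OF p] by simp
 qed
 have PhPs: "?Ph (?Ps p) = p" if p: "p : ?V'" for p
 proof -
  have 1: "ALL j:{1..d}. ?psi (co J d p j) : C" using P.co_in_C[OF p] psiC by blast
  have "?Ph (?Ps p) = mk J d (co J d p)" by (rule P.mk_cong) (simp only: co_mk[OF 1] f_inv_into_f[OF P.co_in_C[OF p]])
  then show ?thesis using P.mk_co[OF p] by simp
 qed
 have im: "(%p. reindex e M ` ?Ph p) ` V = (`) (reindex e M) ` ?V'"
 proof (intro equalityI subsetI)
  fix y assume "y : (%p. reindex e M ` ?Ph p) ` V"
  then obtain p where "p : V" "y = reindex e M ` ?Ph p" by blast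
  then show "y : (`) (reindex e M) ` ?V'" using PhV by blast
 next
  fix y assume "y : (`) (reindex e M) ` ?V'"
  then obtain p where p: "p : ?V'" "y = reindex e M ` p" by blast
  then have "y = reindex e M ` ?Ph (?Ps p)" using PhPs[OF p(1)] by simp
  then show "y : (%p. reindex e M ` ?Ph p) ` V" using PsV[OF p(1)] by (rule image_eqI)
 qed
 let ?Y = "(`) (reindex e M) ` ?V'"
 have Ycl: "zclosed {..<M} ?Y" by (rule R.zclosed_reindex[OF P.V_closed])
 have unY: "unindex e M ?B ` y : ?V'" if y: "y : ?Y" for y
 proof -
  obtain p where p: "p : ?V'" "y = reindex e M ` p" using y by blast
  then have pB: "p : pspace ?B" using P.V_subset_proj by blast
  show ?thesis unfolding p(2) R.unindex_reindex_point[OF pB] by (rule p(1))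
 qed
 have rmPh: "rmap_at A V ?B ?Ph p" if p: "p : V" for p
 proof (rule P.rmap_mk[OF p])
  fix j assume j: "j : {1..d}"
  show "rmap_at A V J (%p. phi (co I d p j)) p" by (rule rmap_compose[OF rmap_co[OF p j] co_in_C[OF _ j] _ E(2)[OF co_in_C[OF p j]]]) (use C.in_proj in blast)+
 qed
 have rmPs: "rmap_at ?B ?V' A ?Ps p" if p: "p : ?V'" for p
 proof (rule rmap_mk[OF p])
  fix j assume j: "j : {1..d}"
  show "rmap_at ?B ?V' I (%p. ?psi (co J d p j)) p" by (rule rmap_compose[OF P.rmap_co[OF p j] P.co_in_C[OF _ j] zclosed_subset[OF E(1)] E(4)[OF P.co_in_C[OF p j]]])
 qed
 show ?thesis
 proof (rule closed_embeddingI[OF V_closed, where psi = "%y. ?Ps (unindex e M ?B ` y)"])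
  show "zclosed {..<M} ((%p. reindex e M ` ?Ph p) ` V)" unfolding im by (rule Ycl)
 next
  fix p assume p: "p : V"
  show "rmap_at A V {..<M} (%p. reindex e M ` ?Ph p) p" by (rule rmap_compose[OF rmPh[OF p] PhV P.V_subset_proj R.rmap_reindex[OF P.V_subset_proj PhV[OF p]]])
  have "?Ph p : pspace ?B" using PhV[OF p] P.V_subset_proj by blast
  then show "?Ps (unindex e M ?B ` reindex e M ` ?Ph p) = p" by (simp only: R.unindex_reindex_point PsPh[OF p])
 next
  fix y assume "y : (%p. reindex e M ` ?Ph p) ` V"
  then have y: "y : ?Y" unfolding im .
  show "rmap_at {..<M} ((%p. reindex e M ` ?Ph p) ` V) A (%y. ?Ps (unindex e M ?B ` y)) y" unfolding im
   by (rule rmap_compose[OF R.rmap_unindex[OF zclosed_subset[OF Ycl] y] unY P.V_subset_proj rmPs[OF unY[OF y]]])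
 qed
qed

text \<open>Since the products of sections exhaust the complete linear system, the map it defines is
  the Segre product of \<open>d\<close> copies of the given embedding, up to the numbering of
  coordinates.\<close>

lemma very_ample_power:
 assumes dl: "!!p. p : C ==> ratl I C (dl p) & D p = cls I C (dl p)" and s: "!!i. i < n ==> ratl I C (s i)"
  and va: "very_ample_via I C D (map (%i. cls I C (s i)) [0..<n])"
  and phi: "!!i x. i < n ==> x : C ==> val I C (%y. s i y * dl x y) x (phi i x)"
  and e: "bij_betw e {..<M} (PiE {1..d} (%_. {..<n}))"
 defines "D' == %p. cls A V (pdiv dl p)" and "ss' == map (%m. cls A V (psec s (e m))) [0..<M]"
 shows "very_ample_via A V D' ss'" "isdiv A V (pdiv dl)"
  "!!p. p : V ==> linsys_map A V D' ss' p = pt (%m. if m < M then PROD j=1..d. phi (e m j) (co I d p j) else 0)"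
proof -
 have d: "isdiv I C dl" using va C.is_divisor_iff[OF dl] by (simp add: very_ample_via_def)
 have sb: "sect_basis I C dl n s" using va C.section_basis_iff[where dl = dl and D = D and n = n and s = s] dl s by (simp add: very_ample_via_def)
 have lin: "linsys_map I C D (map (%i. cls I C (s i)) [0..<n]) x = pt (%i. if i < n then phi i x else 0)" if x: "x : C" for x
  by (rule linsys_map_val[where s = s and dl = dl and c = "%i. phi i x", OF C.proj_variety_axioms x s _ _ phi[OF _ x]]) (use dl[OF x] in simp_all)
 show pd: "isdiv A V (pdiv dl)" by (rule isdiv_pdiv[OF d])
 have pr: "ratl A V (pdiv dl p) & D' p = cls A V (pdiv dl p)" if "p : V" for p using pd that unfolding isdiv_def D'_def by blast
 have e_in: "e m : PiE {1..d} (%_. {..<n})" if "m < M" for m using bij_betwE[OF e] that by blast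
 have rp: "ratl A V (psec s (e m))" if "m < M" for m unfolding psec_def by (intro V.ratl_prod ratl_co s) (use PiE_mem[OF e_in[OF that]] in simp)
 show lin': "linsys_map A V D' ss' p = pt (%m. if m < M then PROD j=1..d. phi (e m j) (co I d p j) else 0)" if p: "p : V" for p
  unfolding ss'_def by (rule linsys_map_val[where s = "%m. psec s (e m)" and dl = "pdiv dl" and c = "%m. PROD j=1..d. phi (e m j) (co I d p j)", OF V.proj_variety_axioms p rp _ _ psec_val[where n = n, OF phi e_in p]]) (use pr[OF p] in simp_all)
 have B: "PiE {1..d} (%_. {..<n}) = power_index {..<n} d" by (simp add: power_index_def)
 let ?phi = "linsys_map I C D (map (%i. cls I C (s i)) [0..<n])"
 have "closed_embedding A V {..<M} (%p. reindex e M ` mk {..<n} d (%j. ?phi (co I d p j)))"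
 proof (rule product_embedding)
  show "closed_embedding I C {..<n} ?phi" using va by (simp add: very_ample_via_def)
  show "index_change e M (power_index {..<n} d)" using e unfolding B index_change_def .
 qed simp
 moreover have R: "reindex e M ` mk {..<n} d (%j. ?phi (co I d p j)) = linsys_map A V D' ss' p" if p: "p : V" for p
 proof -
  interpret R: index_change e M "power_index {..<n} d" using e unfolding B index_change_def .
  let ?x = "%j i. if i < n then phi i (co I d p j) else 0"
  have "mk {..<n} d (%j. ?phi (co I d p j)) = mk {..<n} d (%j. pt (?x j))" unfolding mk_def by (intro Collect_cong ex_cong1 conj_cong refl ball_cong) (simp only: lin[OF co_in_C[OF p]])
  then have "reindex e M ` mk {..<n} d (%j. ?phi (co I d p j)) = pt (reindex e M (segre {..<n} d ?x))" by (simp only: mk_eq_pt[OF d_pos] R.reindex_pt)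
  also have "reindex e M (segre {..<n} d ?x) = (%m. if m < M then PROD j=1..d. phi (e m j) (co I d p j) else 0)"
  proof
   fix m
   have "(PROD j=1..d. ?x j (e m j)) = (PROD j=1..d. phi (e m j) (co I d p j))" if "m < M" by (rule prod.cong[OF refl]) (use PiE_mem[OF e_in[OF that]] in simp)
   then show "reindex e M (segre {..<n} d ?x) m = (if m < M then PROD j=1..d. phi (e m j) (co I d p j) else 0)" using R.e_in[of m] unfolding reindex_def segre_def by simp
  qed
  finally show ?thesis unfolding lin'[OF p] .
 qed
 ultimately have ce: "closed_embedding A V {..<M} (linsys_map A V D' ss')"
 proof -
  assume a: "closed_embedding A V {..<M} (%p. reindex e M ` mk {..<n} d (%j. ?phi (co I d p j)))"
  note E = closed_embeddingD[OF V_closed a]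
  have im: "(%p. reindex e M ` mk {..<n} d (%j. ?phi (co I d p j))) ` V = linsys_map A V D' ss' ` V" by (rule image_cong[OF refl R])
  show ?thesis
  proof (rule closed_embeddingI[OF V_closed])
   show "zclosed {..<M} (linsys_map A V D' ss' ` V)" using E(1) unfolding im .
   show "rmap_at A V {..<M} (linsys_map A V D' ss') p" if "p : V" for p by (rule rmap_cong[OF E(2)[OF that] near_all[OF that R]])
   show "inv_into V (%p. reindex e M ` mk {..<n} d (%j. ?phi (co I d p j))) (linsys_map A V D' ss' p) = p" if "p : V" for p using E(3)[OF that] unfolding R[OF that] .
   show "rmap_at {..<M} (linsys_map A V D' ss' ` V) A (inv_into V (%p. reindex e M ` mk {..<n} d (%j. ?phi (co I d p j)))) y"
   if "y : linsys_map A V D' ss' ` V" for y using E(4)[of y] that unfolding im by blast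
  qed
 qed
 have "section_basis A V D' ss'" unfolding ss'_def using V.section_basis_iff[where dl = "pdiv dl" and D = D' and n = M and s = "%m. psec s (e m)"] pr rp sect_basis_power[OF d sb e phi] by simp
 then show "very_ample_via A V D' ss'" unfolding very_ample_via_def using ce V.is_divisor_iff[of "pdiv dl" D'] pr pd by (simp add: ss'_def)
qed

end

section \<open>Linear projections\<close>

definition lf :: "nat set => (nat => 'k::field) => (nat => 'k) => 'k"
 where "lf J l z = (SUM i:J. l i * z i)"

definition comb :: "nat => (nat => nat => 'k::field) => (nat => 'k) => nat => 'k"
 where "comb m b y = (%i. SUM k<=m. y k * b k i)"

definition unit_vec :: "'i => 'i => 'k::field"
 where "unit_vec i = (%j. if j = i then 1 else 0)"

lemma sum_fun_apply: "(SUM a:B. f a) i = (SUM a:B. f a i)" for f :: "'a => 'i => 'k::field" by (induction B rule: infinite_finite_induct) simp_all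

lemma subspace_coord_space: "cvec.subspace (cspace J)" by (rule cvec.subspaceI) (simp_all add: coord_space_def scal_def)

lemma coord_space_units:
 assumes "finite J" "z : cspace J" shows "z = (SUM i:J. scal (z i) (unit_vec i))"
proof
 fix j show "z j = (SUM i:J. scal (z i) (unit_vec i)) j" using assms by (simp add: sum_fun_apply scal_def unit_vec_def coord_space_def if_distrib[of "%c. _ * c"] cong: if_cong)
qed

lemma inj_unit_vec: "inj (unit_vec :: 'i => 'i => 'k::field)" by (rule injI) (metis unit_vec_def zero_neq_one)

lemma units_basis:
 assumes "finite J"
 shows "cvec.independent (unit_vec ` J :: ('i => 'k::field) set)" "cvec.span (unit_vec ` J :: ('i => 'k) set) = cspace J"
  "card (unit_vec ` J :: ('i => 'k) set) = card J"
proof -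
 show "card (unit_vec ` J :: ('i => 'k) set) = card J" by (rule card_image[OF inj_on_subset[OF inj_unit_vec subset_UNIV]])
 show "cvec.independent (unit_vec ` J :: ('i => 'k) set)"
 proof (rule cvec.independent_if_scalars_zero)
  show "finite (unit_vec ` J :: ('i => 'k) set)" using assms by simp
  fix f :: "('i => 'k) => 'k" and x :: "'i => 'k" assume s: "(SUM x:unit_vec ` J. scal (f x) x) = 0" and x: "x : unit_vec ` J"
  obtain i where i: "x = unit_vec i" "i : J" using x by (rule imageE)
  have "(SUM x:unit_vec ` J. scal (f x) x) = (SUM i:J. scal (f (unit_vec i)) (unit_vec i))" by (subst sum.reindex[OF inj_on_subset[OF inj_unit_vec subset_UNIV]]) (simp add: comp_def)
  then have "(SUM i:J. scal (f (unit_vec i)) (unit_vec i)) i = 0" using s by simp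
  then show "f x = 0" using i assms by (simp add: sum_fun_apply scal_def unit_vec_def if_distrib[of "%c. _ * c"] cong: if_cong)
 qed
 show "cvec.span (unit_vec ` J :: ('i => 'k) set) = cspace J"
 proof (intro equalityI subsetI)
  fix z :: "'i => 'k" assume "z : cvec.span (unit_vec ` J)"
  moreover have "cvec.span (unit_vec ` J :: ('i => 'k) set) <= cspace J" by (rule cvec.span_minimal[OF _ subspace_coord_space]) (auto simp: coord_space_def unit_vec_def)
  ultimately show "z : cspace J" by blast
 next
  fix z :: "'i => 'k" assume z: "z : cspace J"
  have "(SUM i:J. scal (z i) (unit_vec i)) : cvec.span (unit_vec ` J)" by (intro cvec.span_sum cvec.span_scale cvec.span_base) simp
  then show "z : cvec.span (unit_vec ` J)" using coord_space_units[OF assms z] by simp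
 qed
qed

lemma independent_union:
 assumes "cvec.independent B" "cvec.independent B0" "finite B0" "cvec.span B Int cvec.span B0 <= {0}"
 shows "cvec.independent (B Un B0)"
proof -
 have "cvec.independent (B Un F)" if "F <= B0" "finite F" for F using that(2,1)
 proof (induction F rule: finite_induct)
  case (insert x F)
  have "x ~: cvec.span (B Un F)"
  proof
   assume "x : cvec.span (B Un F)"
   then obtain u v where uv: "x = u + v" "u : cvec.span B" "v : cvec.span F" unfolding cvec.span_Un by blast
   have vs: "v : cvec.span B0" using uv(3) cvec.span_mono[of F B0] insert.prems by blast
   have "x : cvec.span B0" using insert.prems by (intro cvec.span_base) simp
   then have "x - v : cvec.span B0" using vs by (rule cvec.span_diff)
   then have "u = 0" using uv assms(4) by auto
   then have "x : cvec.span F" using uv by simp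
   moreover have "cvec.span F <= cvec.span (B0 - {x})" using insert.hyps(2) insert.prems by (intro cvec.span_mono) blast
   ultimately show False using assms(2) insert.prems unfolding cvec.dependent_def by blast
  qed
  then show ?case using insert by (simp add: cvec.independent_insertI)
 qed (use assms(1) in simp)
 then show ?thesis using assms(3) by blast
qed

lemma finite_basis_of_subspace:
 fixes E :: "('i => 'k::field) set"
 assumes "finite J" "E <= cspace J" "cvec.subspace E"
 obtains B where "B <= E" "cvec.independent B" "cvec.span B = E" "finite B" "card B = cvec.dim E"
proof -
 obtain B where B: "B <= E" "cvec.independent B" "E <= cvec.span B" "card B = cvec.dim E" using cvec.basis_exists[of E] by blast
 have "B <= cvec.span (unit_vec ` J)" using B(1) assms(2) units_basis(2)[OF assms(1)] by blast
 then have "finite B" using cvec.independent_span_bound[of "unit_vec ` J" B] assms(1) B(2) by simp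
 moreover have "cvec.span B = E" using B(1,3) cvec.span_minimal[OF B(1) assms(3)] by blast
 ultimately show thesis using that B by blast
qed

lemma lf_add: "lf J l (x + y) = lf J l x + lf J l y"
 and lf_scal: "lf J l (scal c x) = c * lf J l x"
 and lf_zero: "lf J l 0 = 0" by (simp_all add: lf_def scal_def algebra_simps sum.distrib sum_distrib_left)

lemma lf_sum: "lf J l (SUM a:B. f a) = (SUM a:B. lf J l (f a))"
proof (induction B rule: infinite_finite_induct)
 case (infinite B)
 show ?case by (simp only: sum.infinite[OF infinite] lf_zero)
next
 case empty
 show ?case by (simp only: sum.empty lf_zero)
next
 case (insert x F)
 show ?case by (simp only: sum.insert[OF insert.hyps] lf_add insert.IH)
qed

lemma comb_alt: "comb m b y = (SUM k<=m. scal (y k) (b k))" by (simp add: comb_def fun_eq_iff sum_fun_apply scal_def)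

lemma lf_comb: "lf J l (comb m b y) = (SUM k<=m. y k * lf J l (b k))" by (simp add: comb_alt lf_sum lf_scal)

lemma hompf_lf: "hompf J 1 (lf J l)"
proof -
 have "hompf J 1 (%z. SUM i:J. l i * z i)" by (intro hompf_sum hompf_cmult hompf_coord)
 then show ?thesis by (simp add: lf_def[abs_def])
qed

text \<open>Bases of the two complementary subspaces form a basis of the whole space. The forms
  \<open>l k\<close> are its coordinate functions belonging to the basis \<open>b\<close> of
  \<open>E0\<close>; their common kernel is \<open>E\<close>.\<close>

lemma linear_decomposition:
 fixes E E0 :: "(nat => 'k::field) set"
 assumes J: "finite J" and E: "cvec.subspace E" "E <= cspace J" and E0: "cvec.subspace E0" "E0 <= cspace J"
  and dim: "cvec.dim E + cvec.dim E0 = card J" "cvec.dim E0 = Suc m" and int: "E Int E0 <= {0}"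
 obtains l b where "!!k. k <= m ==> b k : cspace J"
  "!!i k. i <= m ==> k <= m ==> lf J (l i) (b k) = (if i = k then 1 else 0)"
  "E = {x : cspace J. ALL k<=m. lf J (l k) x = 0}" "E0 = range (comb m b)"
proof -
 obtain B where B: "B <= E" "cvec.independent B" "cvec.span B = E" "finite B" "card B = cvec.dim E" by (rule finite_basis_of_subspace[OF J E(2,1)])
 obtain B0 where B0: "B0 <= E0" "cvec.independent B0" "cvec.span B0 = E0" "finite B0" "card B0 = cvec.dim E0" by (rule finite_basis_of_subspace[OF J E0(2,1)])
 let ?D = "B Un B0"
 have ind: "cvec.independent ?D" by (rule independent_union[OF B(2) B0(2,4)]) (use int B(3) B0(3) in simp)
 have z0: "0 ~: B" "0 ~: B0" using cvec.dependent_zero B(2) B0(2) by blast+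
 have disj: "B Int B0 = {}" using B(1) B0(1) int z0 by blast
 have cD: "card ?D = card J" using card_Un_disjoint[OF B(4) B0(4) disj] B(5) B0(5) dim(1) by simp
 have DJ: "?D <= cspace J" using B(1) B0(1) E(2) E0(2) by blast
 \<comment> \<open>\<open>?D\<close> is independent and has as many elements as \<open>J\<close>, so
   adjoining a vector outside its span would exceed the dimension of
   \<open>coord_space J\<close>.\<close>
 have span: "z : cvec.span ?D" if z: "z : cspace J" for z
 proof (rule ccontr)
  assume n: "z ~: cvec.span ?D"
  then have i: "cvec.independent (insert z ?D)" using ind by (rule cvec.independent_insertI)
  have "insert z ?D <= cvec.span (unit_vec ` J)" using z DJ units_basis(2)[OF J] by blast
  with i have "card (insert z ?D) <= card (unit_vec ` J :: (nat => 'k) set)" using cvec.independent_span_bound[of "unit_vec ` J" "insert z ?D"] J by simp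
  moreover have "z ~: ?D" using n cvec.span_base[of z ?D] by blast
  moreover have "finite ?D" using B(4) B0(4) by simp
  ultimately show False using cD units_basis(3)[OF J, where 'k = 'k] by simp
 qed
 have "card {..m} = card B0" using B0(5) dim(2) by simp
 with finite_same_card_bij[OF finite_atMost B0(4)] obtain b where b: "bij_betw b {..m} B0" by blast
 have bB0: "b k : B0" if "k <= m" for k using bij_betwE[OF b] that by blast
 define rp where "rp z = cvec.representation ?D z" for z
 have rp_lin: "rp z v = (SUM i:J. rp (unit_vec i) v * z i)" if z: "z : cspace J" for z v
 proof -
  have u: "unit_vec i : cvec.span ?D" if "i : J" for i by (rule span) (use that in "simp add: coord_space_def unit_vec_def")
  have "rp (SUM i:J. scal (z i) (unit_vec i)) v = (SUM i:J. rp (scal (z i) (unit_vec i)) v)" unfolding rp_def by (subst cvec.representation_sum[OF ind]) (use u in "simp_all add: cvec.span_scale")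
  also have "... = (SUM i:J. rp (unit_vec i) v * z i)" unfolding rp_def by (rule sum.cong[OF refl], subst cvec.representation_scale[OF ind u]) simp_all
  finally show ?thesis using coord_space_units[OF J z] by simp
 qed
 have rp_E: "rp z v = 0" if "z : E" "v : B0" for z v
 proof -
  have "rp z = cvec.representation B z" unfolding rp_def by (rule cvec.representation_extend[OF ind]) (use that B(3) in simp_all)
  then show ?thesis using cvec.representation_ne_zero[of B z v] that(2) disj by (metis disjoint_iff)
 qed
 have expand: "(SUM v:?D. scal (rp z v) v) = z" if "z : cspace J" for z unfolding rp_def by (rule cvec.sum_representation_eq[OF ind span[OF that]]) (use B(4) B0(4) in simp_all)
 have lfe: "lf J (%i. rp (unit_vec i) (b k)) z = rp z (b k)" if "z : cspace J" for z k unfolding lf_def using rp_lin[OF that, of "b k"] by simp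
 show thesis
 proof (rule that[of b "%k i. rp (unit_vec i) (b k)"])
  show bk: "b k : cspace J" if "k <= m" for k using bB0[OF that] DJ by blast
  show "lf J (%j. rp (unit_vec j) (b i)) (b k) = (if i = k then 1 else 0)" if "i <= m" "k <= m" for i k
  proof -
   have "rp (b k) (b i) = (if b i = b k then 1 else 0)" unfolding rp_def by (subst cvec.representation_basis[OF ind]) (use bB0[OF that(2)] in auto)
   moreover have "b i = b k \<longleftrightarrow> i = k" using b that by (auto simp: bij_betw_def inj_on_def)
   ultimately show ?thesis unfolding lfe[OF bk[OF that(2)]] by simp
  qed
  show "E = {x : cspace J. ALL k<=m. lf J (%i. rp (unit_vec i) (b k)) x = 0}"
  proof (intro equalityI subsetI)
   fix x assume x: "x : E"
   then have "x : cspace J" using E(2) by blast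
   then show "x : {x : cspace J. ALL k<=m. lf J (%i. rp (unit_vec i) (b k)) x = 0}" using rp_E[OF x bB0] lfe by simp
  next
   fix x assume "x : {x : cspace J. ALL k<=m. lf J (%i. rp (unit_vec i) (b k)) x = 0}"
   then have x1: "x : cspace J" "ALL k<=m. lf J (%i. rp (unit_vec i) (b k)) x = 0" by blast+
   have x: "x : cspace J" "ALL k<=m. rp x (b k) = 0" using x1 unfolding lfe[OF x1(1)] by blast+
   have z: "rp x v = 0" if v: "v : B0" for v
   proof -
   have "v : b ` {..m}" using v b unfolding bij_betw_def by simp
   then obtain k where "v = b k" "k : {..m}" by (rule imageE)
   then show ?thesis using x(2) by simp
   qed
   have "x = (SUM v:B. scal (rp x v) v) + (SUM v:B0. scal (rp x v) v)" using expand[OF x(1)] sum.union_disjoint[OF B(4) B0(4) disj, of "%v. scal (rp x v) v"] by simp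
   also have "(SUM v:B0. scal (rp x v) v) = 0" by (rule sum.neutral) (simp add: z scal_eq_0)
   finally have e: "(SUM v:B. scal (rp x v) v) = x" unfolding add_0_right by (rule sym)
   have "(SUM v:B. scal (rp x v) v) : E" using B(1) by (intro cvec.subspace_sum[OF E(1)] cvec.subspace_scale[OF E(1)]) blast
   then show "x : E" unfolding e .
  qed
  show "E0 = range (comb m b)"
  proof (intro equalityI subsetI)
   fix x assume "x : E0"
   then have "x : range (%u. SUM v:B0. scal (u v) v)" using cvec.span_finite[OF B0(4)] B0(3) by (simp only:)
   then obtain c where c: "x = (SUM v:B0. scal (c v) v)" by (rule rangeE)
   have x: "x = comb m b (%k. c (b k))" unfolding c comb_alt by (rule sum.reindex_bij_betw[OF b, symmetric])
   show "x : range (comb m b)" unfolding x by (rule rangeI[of "comb m b"])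
  next
   fix x assume "x : range (comb m b)"
   then obtain y where "x = comb m b y" by (rule rangeE)
   then have x: "x = (SUM k<=m. scal (y k) (b k))" by (simp only: comb_alt)
   show "x : E0" unfolding x by (intro cvec.subspace_sum[OF E0(1)] cvec.subspace_scale[OF E0(1)]) (use B0(1) bB0 in blast)
  qed
 qed
qed

text \<open>Center and target are described by dual data instead of subspaces: \<open>E\<close> is
  the common kernel of the \<open>l k\<close>, \<open>E0\<close> the span of the \<open>b k\<close>,
  and the projection becomes the linear projector \<open>pr\<close>.\<close>

locale projection_data =
 fixes J :: "nat set" and m :: nat and l :: "nat => nat => 'k::field" and b :: "nat => nat => 'k"
 assumes fin_J: "finite J" and b_coord: "!!k. k <= m ==> b k : cspace J"
  and dual: "!!i k. i <= m ==> k <= m ==> lf J (l i) (b k) = (if i = k then 1 else 0)"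
begin

definition E where "E = {x : cspace J. ALL k<=m. lf J (l k) x = 0}"
definition E0 where "E0 = range (comb m b)"
definition W where "W = {pt x | x. x : E & x ~= 0}"
definition W0 where "W0 = {pt x | x. x : E0 & x ~= 0}"

abbreviation "pr == %z. comb m b (%k. lf J (l k) z)"

lemma lf_comb_b: "k <= m ==> lf J (l k) (comb m b y) = y k" by (simp add: lf_comb dual if_distrib[of "%c. _ * c"] cong: if_cong)

lemma comb_coord: "comb m b y : cspace J" unfolding comb_alt by (intro cvec.subspace_sum[OF subspace_coord_space] cvec.subspace_scale[OF subspace_coord_space] b_coord) simp

lemma comb_cong: "(!!k. k <= m ==> y k = y' k) ==> comb m b y = comb m b y'" unfolding comb_def by (intro ext sum.cong) auto

lemma comb_eq_0: "comb m b y = 0 ==> k <= m ==> y k = 0" using lf_comb_b[of k y] by (simp add: lf_zero)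

lemma pr_comb: "pr (comb m b y) = comb m b y" by (rule comb_cong) (rule lf_comb_b)

lemma comb_scal: "comb m b (%k. c * y k) = scal c (comb m b y)" by (simp add: comb_def scal_def sum_distrib_left mult.assoc)

lemma comb_add: "comb m b (%k. y k + y' k) = comb m b y + comb m b y'" by (simp add: comb_def fun_eq_iff sum.distrib distrib_right)

lemma pr_scal: "pr (scal c z) = scal c (pr z)" by (simp add: lf_scal comb_scal)

lemma pr_add: "pr (x + y) = pr x + pr y" by (simp add: lf_add comb_add)

lemma subspace_E: "cvec.subspace E" by (rule cvec.subspaceI) (auto simp: E_def lf_zero lf_add lf_scal cvec.subspace_add[OF subspace_coord_space]
   cvec.subspace_scale[OF subspace_coord_space] cvec.subspace_0[OF subspace_coord_space])

lemma subspace_E0: "cvec.subspace E0"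
proof (rule cvec.subspaceI)
 have "comb m b (%_. 0) = 0" by (simp add: comb_def fun_eq_iff)
 then show "0 : E0" unfolding E0_def by (metis rangeI)
 fix x y assume "x : E0" "y : E0"
 then obtain u v where "x = comb m b u" "y = comb m b v" unfolding E0_def by blast
 then have "x + y = comb m b (%k. u k + v k)" by (simp only: comb_add)
 then show "x + y : E0" unfolding E0_def by (metis rangeI)
next
 fix c x assume "x : E0"
 then obtain u where "x = comb m b u" unfolding E0_def by blast
 then have "scal c x = comb m b (%k. c * u k)" by (simp only: comb_scal)
 then show "scal c x : E0" unfolding E0_def by (metis rangeI)
qed

lemma pr_zero_iff: "z : cspace J ==> pr z = 0 \<longleftrightarrow> z : E"
proof -
 assume z: "z : cspace J"
 have "pr z = 0" if "ALL k<=m. lf J (l k) z = 0"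
 proof
  fix i show "pr z i = 0 i" using that by (simp add: comb_def)
 qed
 then show ?thesis unfolding E_def using comb_eq_0[of "%k. lf J (l k) z"] z by blast
qed

lemma residual_in_E: "z : cspace J ==> z - pr z : E"
proof -
 assume z: "z : cspace J"
 have "lf J (l k) (z - pr z) = 0" if k: "k <= m" for k
 proof -
  have "lf J (l k) z = lf J (l k) (z - pr z) + lf J (l k) (pr z)" using lf_add[of J "l k" "z - pr z" "pr z"] by (simp only: diff_add_cancel)
  then show ?thesis unfolding lf_comb_b[OF k] by (metis add_cancel_left_left)
 qed
 then show ?thesis unfolding E_def using cvec.subspace_diff[OF subspace_coord_space z comb_coord] by blast
qed

lemma E_E0: "E Int E0 <= {0}"
proof
 fix x assume "x : E Int E0"
 then obtain y where y: "x : E" "x = comb m b y" unfolding E0_def by blast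
 then have "pr x = 0" using pr_zero_iff[of x] by (simp add: E_def)
 then show "x : {0}" using y(2) pr_comb by simp
qed

lemma W_disjoint: "W0 Int W = {}"
proof (rule ccontr)
 assume "W0 Int W ~= {}"
 then obtain x y where xy: "x : E" "y : E0" "y ~= 0" "pt x = pt y" unfolding W_def W0_def by blast
 then obtain c where "c ~= 0" "x = scal c y" unfolding pt_eq_iff by blast
 then have "x : E0" "x ~= 0" using xy cvec.subspace_scale[OF subspace_E0] by (simp_all add: scal_eq_0)
 then show False using E_E0 xy(1) by blast
qed

text \<open>Every vector is \<open>pr z\<close> plus an element of \<open>E\<close>, so bases of
  \<open>E\<close> and \<open>E0\<close> together form a basis; the duality relations make the
  \<open>b k\<close> independent.\<close>

lemma dims: "cvec.dim E0 = Suc m" "cvec.dim E + Suc m = card J"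
proof -
 have inj: "inj_on b {..m}"
 proof (rule inj_onI)
  fix i k assume "i : {..m}" "k : {..m}" "b i = b k"
  then show "i = k" using dual[of i i] dual[of i k] by (auto split: if_splits)
 qed
 have E0_coord: "E0 <= cspace J" unfolding E0_def using comb_coord by blast
 have ind: "cvec.independent (b ` {..m})"
 proof (rule cvec.independent_if_scalars_zero)
  fix f x assume s: "(SUM x:b ` {..m}. scal (f x) x) = 0" and x: "x : b ` {..m}"
  have "comb m b (%k. f (b k)) = 0" unfolding comb_alt using s by (simp add: sum.reindex[OF inj])
  moreover obtain k where "x = b k" "k : {..m}" using x by (rule imageE)
  ultimately show "f x = 0" using comb_eq_0[of "%k. f (b k)" k] by simp
 qed simp
 have span: "cvec.span (b ` {..m}) = E0"
 proof (intro equalityI subsetI)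
  fix x assume "x : E0"
  then obtain y where "x = comb m b y" unfolding E0_def by blast
  then have x: "x = (SUM k<=m. scal (y k) (b k))" by (simp only: comb_alt)
  show "x : cvec.span (b ` {..m})" unfolding x by (intro cvec.span_sum cvec.span_scale cvec.span_base imageI)
 next
  fix x assume x: "x : cvec.span (b ` {..m})"
  have "b k : E0" if "k <= m" for k
  proof -
   have e: "b k = comb m b (%i. if i = k then 1 else 0)" using that by (simp add: comb_def fun_eq_iff if_distrib[of "%c. c * _"] cong: if_cong)
   show ?thesis unfolding E0_def by (subst e) (rule rangeI[of "comb m b"])
  qed
  then have "cvec.span (b ` {..m}) <= E0" by (intro cvec.span_minimal subspace_E0) blast
  then show "x : E0" using x by blast
 qed
 show d0: "cvec.dim E0 = Suc m" using cvec.dim_span_eq_card_independent[OF ind] card_image[OF inj] by (simp add: span)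
 have EJ: "E <= cspace J" unfolding E_def by blast
 obtain B where B: "B <= E" "cvec.independent B" "cvec.span B = E" "finite B" "card B = cvec.dim E" by (rule finite_basis_of_subspace[OF fin_J EJ subspace_E])
 have iu: "cvec.independent (B Un b ` {..m})" by (rule independent_union[OF B(2) ind]) (use E_E0 B(3) span in simp_all)
 have n0: "0 ~: B" using cvec.dependent_zero B(2) by blast
 have bE0: "b ` {..m} <= E0" using cvec.span_superset[of "b ` {..m}"] unfolding span .
 have "B Int b ` {..m} <= {0}" by (rule subset_trans[OF Int_mono[OF B(1) bE0] E_E0])
 then have "x ~: B Int b ` {..m}" for x using n0 by (metis IntD1 singletonD subsetD)
 then have disj: "B Int b ` {..m} = {}" by (metis equals0I)
 have "cvec.span (B Un b ` {..m}) = cspace J"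
 proof (intro equalityI subsetI)
  fix z assume "z : cvec.span (B Un b ` {..m})"
  moreover have "cvec.span (B Un b ` {..m}) <= cspace J" by (rule cvec.span_minimal[OF _ subspace_coord_space]) (use B(1) EJ b_coord in blast)
  ultimately show "z : cspace J" by blast
 next
  fix z :: "nat => 'k" assume z: "z : cspace J"
  have "pr z : cvec.span (b ` {..m})" unfolding span E0_def by (rule rangeI[of "comb m b"])
  moreover have "z - pr z : cvec.span B" unfolding B(3) by (rule residual_in_E[OF z])
  ultimately have "(z - pr z) + pr z : cvec.span (B Un b ` {..m})" unfolding cvec.span_Un by blast
  then show "z : cvec.span (B Un b ` {..m})" by simp
 qed
 then have "card (B Un b ` {..m}) = cvec.dim (cspace J :: (nat => 'k) set)" using cvec.dim_span_eq_card_independent[OF iu] by simp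
 also have "... = card J" using cvec.dim_span_eq_card_independent[OF units_basis(1)[OF fin_J, where 'k = 'k]] units_basis(2,3)[OF fin_J, where 'k = 'k] by simp
 finally show "cvec.dim E + Suc m = card J" using card_Un_disjoint[OF B(4) _ disj] B(5) card_image[OF inj] by simp
qed

lemma linear_subvariety_W: "linear_subvariety J (int (card J) - int m - 2) W" unfolding linear_subvariety_def by (rule exI[of _ E]) (use subspace_E dims(2) in "auto simp: W_def E_def")

lemma linear_subvariety_W0: "linear_subvariety J (int m) W0" unfolding linear_subvariety_def by (rule exI[of _ E0]) (use subspace_E0 dims(1) comb_coord in "auto simp: W0_def E0_def")

text \<open>The span of the center and \<open>z\<close> consists of the vectors
  \<open>u + scal c z\<close> with \<open>u\<close> in \<open>E\<close>. The projector kills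
  \<open>u\<close> and fixes \<open>E0\<close>, so a vector of \<open>E0\<close> in this span is a
  multiple of \<open>pr z\<close>.\<close>

lemma linear_projection_pt:
 assumes z: "z : cspace J" "z ~: E"
 shows "linear_projection W W0 (pt z) = pt (pr z)"
proof -
 have pz: "pr z ~= 0" using pr_zero_iff z by blast
 let ?S = "{u + scal c z | u c. u : E}"
 have sub: "cvec.span (\<Union>W Un pt z) <= ?S"
 proof (rule cvec.span_minimal)
  show "\<Union>W Un pt z <= ?S"
  proof
   fix x assume "x : \<Union>W Un pt z"
   then consider y where "y : E" "x : pt y" | "x : pt z" unfolding W_def by blast
   then show "x : ?S"
   proof cases
   case 1
   then obtain c where "x = scal c y" unfolding pt_def by blast
   then have "x : E" using 1(1) cvec.subspace_scale[OF subspace_E] by simp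
   then show ?thesis by (intro CollectI exI[of _ x] exI[of _ 0]) (simp add: scal_def fun_eq_iff)
   next
   case 2
   then obtain c where "x = scal c z" unfolding pt_def by blast
   then show ?thesis using cvec.subspace_0[OF subspace_E] by (intro CollectI exI[of _ 0] exI[of _ c]) simp
   qed
  qed
  show "cvec.subspace ?S"
  proof (rule cvec.subspaceI)
   show "0 : ?S" using cvec.subspace_0[OF subspace_E] by (intro CollectI exI[of _ 0]) (simp add: scal_def fun_eq_iff)
   fix x y assume "x : ?S" "y : ?S"
   then obtain u c v e where "x = u + scal c z" "u : E" "y = v + scal e z" "v : E" by blast
   moreover from this have "x + y = (u + v) + scal (c + e) z" by (simp add: scal_def fun_eq_iff algebra_simps)
   ultimately show "x + y : ?S" using cvec.subspace_add[OF subspace_E] by blast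
  next
   fix a x assume "x : ?S"
   then obtain u c where "x = u + scal c z" "u : E" by blast
   moreover from this have "scal a x = scal a u + scal (a * c) z" by (simp add: scal_def fun_eq_iff algebra_simps)
   ultimately show "scal a x : ?S" using cvec.subspace_scale[OF subspace_E] by blast
  qed
 qed
 have Esub: "E <= cvec.span (\<Union>W Un pt z)"
 proof
  fix x assume x: "x : E"
  show "x : cvec.span (\<Union>W Un pt z)"
  proof (cases "x = 0")
   case False
   then have "pt x : W" using x unfolding W_def by blast
   then have "x : \<Union>W Un pt z" using in_pt_self[of x] by blast
   then show ?thesis by (rule cvec.span_base)
  qed (simp add: cvec.span_zero)
 qed
 show ?thesis unfolding linear_projection_def
 proof (rule the_equality)
  have "z : cvec.span (\<Union>W Un pt z)" using in_pt_self[of z] by (intro cvec.span_base) blast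
  moreover have "z - pr z : cvec.span (\<Union>W Un pt z)" using Esub residual_in_E[OF z(1)] by blast
  ultimately have "z - (z - pr z) : cvec.span (\<Union>W Un pt z)" by (rule cvec.span_diff)
  then have "pr z : cvec.span (\<Union>W Un pt z)" by simp
  then have "pt (pr z) <= cvec.span (\<Union>W Un pt z)" unfolding pt_def[of "pr z"] using cvec.span_scale by blast
  moreover have "pt (pr z) : W0" unfolding W0_def E0_def using pz by blast
  ultimately show "pt (pr z) : W0 & pt (pr z) <= cvec.span (\<Union>W Un pt z)" by blast
 next
  fix q assume q: "q : W0 & q <= cvec.span (\<Union>W Un pt z)"
  then obtain y where y: "q = pt (comb m b y)" "comb m b y ~= 0" unfolding W0_def E0_def by blast
  have "comb m b y : ?S" using q y(1) in_pt_self[of "comb m b y"] sub by blast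
  then obtain u c where u: "comb m b y = u + scal c z" "u : E" by blast
  have "comb m b y = pr (u + scal c z)" using pr_comb[of y] u(1) by simp
  also have "... = pr u + scal c (pr z)" by (simp only: pr_add pr_scal)
  also have "pr u = 0" using pr_zero_iff[of u] u(2) unfolding E_def by blast
  finally have e: "comb m b y = scal c (pr z)" by simp
  then have "c ~= 0" using y(2) by (auto simp: scal_eq_0)
  then show "q = pt (pr z)" unfolding y(1) e by (rule pt_scal)
 qed
qed

lemma W0_closed: "zclosed J W0"
proof -
 \<comment> \<open>The target is the fixed locus of the projector, hence given by linear
   equations.\<close>
 let ?S = "(%i z. z i - pr z i) ` J"
 have forms: "EX n. hompf J n f" if f: "f : ?S" for f
 proof -
  obtain i where i: "f = (%z. z i - pr z i)" "i : J" using f by (rule imageE)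
  have "hompf J 1 (%z. z i - (SUM k<=m. b k i * lf J (l k) z))" by (intro hompf_diff hompf_coord hompf_sum hompf_cmult hompf_lf i(2))
  then show ?thesis unfolding i(1) comb_def by (simp only: mult.commute[of "b _ i"]) blast
 qed
 have "W0 = {p : pspace J. ALL f:?S. f (rep p) = 0}"
 proof (intro equalityI subsetI)
  fix p assume "p : W0"
  then obtain y where y: "p = pt (comb m b y)" "comb m b y ~= 0" unfolding W0_def E0_def by blast
  have p: "p : pspace J" unfolding y(1) by (rule pt_in_proj[OF comb_coord y(2)])
  obtain c where c: "rep p = scal c (comb m b y)" using proj_space_rep(1)[OF p] unfolding y(1) pt_def by blast
  have "pr (rep p) = rep p" unfolding c pr_scal pr_comb ..
  then show "p : {p : pspace J. ALL f:?S. f (rep p) = 0}" using p by (simp add: fun_eq_iff)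
 next
  fix p assume "p : {p : pspace J. ALL f:?S. f (rep p) = 0}"
  then have p: "p : pspace J" "!!i. i : J ==> rep p i = pr (rep p) i" by auto
  have e: "rep p = pr (rep p)"
  proof
   fix i show "rep p i = pr (rep p) i" using p(2)[of i] proj_space_rep(4)[OF p(1)] comb_coord[of "%k. lf J (l k) (rep p)"] unfolding coord_space_def by (cases "i : J") auto
  qed
  have "rep p : E0" unfolding E0_def by (subst e) (rule rangeI[of "comb m b"])
  then show "p : W0" unfolding W0_def using proj_space_rep(2,3)[OF p(1)] by (intro CollectI exI[of _ "rep p"]) simp
 qed
 then show ?thesis by (simp only: zclosed_forms[OF forms])
qed

end

section \<open>The field of functions pulled back along a projection\<close>

text \<open>\<open>sg\<close> lists rational functions that are homogeneous coordinates of
  \<open>phi\<close> at generic points. They replace the local trivializations wherever only the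
  function field matters; in the application they are the sections themselves.\<close>

locale projected_variety = proj_variety I V + projection_data J m l b
 for I :: "'i set" and V :: "('i, 'k::field) point set" and J m l and b :: "nat => nat => 'k" +
 fixes phi :: "('i, 'k) point => (nat, 'k) point" and sg :: "nat => ('i, 'k) point => 'k"
 assumes phi_rmap: "!!p. p : V ==> rmap_at I V J phi p" and phi_proj: "!!p. p : V ==> phi p : pspace J"
  and phi_center: "!!p. p : V ==> phi p ~: W"
  and sigma_ratl: "!!i. i : J ==> ratl I V (sg i)"
  and sigma_gen: "gen I V (%p. (%i. if i : J then sg i p else 0) : phi p)"
begin

definition t where "t k p = (SUM i:J. l k i * sg i p)"
definition pi where "pi p = linear_projection W W0 (phi p)"

abbreviation "quot f F H p == H (%k. t k p) ~= 0 & f p = F (%k. t k p) / H (%k. t k p)"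

text \<open>The classes of these functions form the pulled back function field of \<open>W0\<close>.\<close>

definition symf where "symf f \<longleftrightarrow> (EX n F H. hompf {..m} n F & hompf {..m} n H &
  gen I V (%p. quot f F H p))"

lemma pi_pt: assumes "p : V" "z : phi p" shows "pi p = pt (pr z)" "pr z ~= 0"
proof -
 have z: "pt z = phi p" "z : cspace J" "z ~= 0" using proj_space_mem(1-3)[OF phi_proj[OF assms(1)] assms(2)] by blast+
 have "z ~: E" using phi_center[OF assms(1)] z unfolding W_def by blast
 then show "pi p = pt (pr z)" "pr z ~= 0" using linear_projection_pt[OF z(2)] pr_zero_iff[OF z(2)] z(1) unfolding pi_def by simp_all
qed

lemma pi_W0: assumes "p : V" shows "pi p : W0"
proof -
 have "rep (phi p) : phi p" using proj_space_rep(1)[OF phi_proj[OF assms]] .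
 from pi_pt[OF assms this] show ?thesis unfolding W0_def E0_def by blast
qed

lemma pi_rmap: assumes "p : V" shows "rmap_at I V J pi p"
proof -
 obtain r where r: "ALL i:J. rg I V p (r i)" "near I V p (%q. (%i. r i q) : phi q)" using phi_rmap[OF assms] unfolding rmap_at_def by blast
 have "near I V p (%q. (%i. pr (%i. r i q) i) : pi q)" by (rule near_mono[OF r(2)]) (simp add: pi_pt(1) in_pt_self)
 moreover have "ALL i:J. rg I V p (%q. pr (%i. r i q) i)" using r(1) unfolding comb_def lf_def by (auto intro!: rg_sum rg_mult rg_const assms)
 ultimately show ?thesis unfolding rmap_at_def by (intro exI[of _ "%i q. pr (%i. r i q) i"] conjI)
qed

lemma t_lf: "lf J (l k) (%i. if i : J then sg i p else 0) = t k p" by (simp add: lf_def t_def)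

lemma t_ratl: "ratl I V (t k)" unfolding t_def[abs_def] by (intro ratl_sum ratl_mult ratl_const sigma_ratl)

lemma pi_gen: "gen I V (%p. pi p = pt (comb m b (%k. t k p)) & comb m b (%k. t k p) ~= 0)"
proof (rule gen_mono[OF sigma_gen])
 fix p assume "p : V" "(%i. if i : J then sg i p else 0) : phi p"
 from pi_pt[OF this] show "pi p = pt (comb m b (%k. t k p)) & comb m b (%k. t k p) ~= 0" unfolding t_lf by (rule conjI)
qed

lemma form_t_ratl: "hompf {..m} n F ==> ratl I V (%p. F (%k. t k p))" by (rule ratl_hompf[where r = t and J = "{..m}"]) (simp_all add: t_ratl)

lemma symf_ratl: assumes "symf f" shows "ratl I V f"
proof -
 obtain n F H where f: "hompf {..m} n F" "hompf {..m} n H" "gen I V (%p. quot f F H p)" using assms unfolding symf_def by blast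
 show ?thesis by (rule ratl_cong[OF ratl_divide[OF form_t_ratl[OF f(1)] form_t_ratl[OF f(2)]]]) (rule gen_mono[OF f(3)], simp)
qed

lemma symf_cong: assumes "symf f" "gen I V (%p. f p = g p)" shows "symf g"
proof -
 obtain n F H where f: "hompf {..m} n F" "hompf {..m} n H" "gen I V (%p. quot f F H p)" using assms unfolding symf_def by blast
 have "gen I V (%p. H (%k. t k p) ~= 0 & g p = F (%k. t k p) / H (%k. t k p))" by (rule gen_mono2[OF f(3) assms(2)]) simp
 then show ?thesis unfolding symf_def using f by blast
qed

lemma symf_const: "symf (%_. c)" unfolding symf_def by (intro exI[of _ 0] exI[of _ "%_. c"] exI[of _ "%_. 1"] conjI hompf_const) simp

lemma symf_add: assumes "symf f" "symf g" shows "symf (%p. f p + g p)"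
proof -
 obtain n F H where f: "hompf {..m} n F" "hompf {..m} n H" "gen I V (%p. quot f F H p)" using assms unfolding symf_def by blast
 obtain n' F' H' where g: "hompf {..m} n' F'" "hompf {..m} n' H'" "gen I V (%p. H' (%k. t k p) ~= 0 & g p = F' (%k. t k p) / H' (%k. t k p))" using assms unfolding symf_def by blast
 show ?thesis unfolding symf_def by (rule exI[of _ "n + n'"], rule exI[of _ "%x. F x * H' x + H x * F' x"], rule exI[of _ "%x. H x * H' x"],
   intro conjI hompf_add hompf_mult f g gen_mono2[OF f(3) g(3)]) (simp_all add: field_simps)
qed

lemma symf_mult: assumes "symf f" "symf g" shows "symf (%p. f p * g p)"
proof -
 obtain n F H where f: "hompf {..m} n F" "hompf {..m} n H" "gen I V (%p. quot f F H p)" using assms unfolding symf_def by blast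
 obtain n' F' H' where g: "hompf {..m} n' F'" "hompf {..m} n' H'" "gen I V (%p. H' (%k. t k p) ~= 0 & g p = F' (%k. t k p) / H' (%k. t k p))" using assms unfolding symf_def by blast
 show ?thesis unfolding symf_def by (rule exI[of _ "n + n'"], rule exI[of _ "%x. F x * F' x"], rule exI[of _ "%x. H x * H' x"],
   intro conjI hompf_add hompf_mult f g gen_mono2[OF f(3) g(3)]) simp_all
qed

lemma symf_inverse: assumes "symf f" "gen I V (%p. f p ~= 0)" shows "symf (%p. inverse (f p))"
proof -
 obtain n F H where f: "hompf {..m} n F" "hompf {..m} n H" "gen I V (%p. quot f F H p)" using assms unfolding symf_def by blast
 show ?thesis unfolding symf_def by (rule exI[of _ n], rule exI[of _ H], rule exI[of _ F], intro conjI f gen_mono2[OF f(3) assms(2)]) auto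
qed

lemma symf_cmult: "symf f ==> symf (%p. c * f p)" by (rule symf_mult[OF symf_const])

lemma symf_uminus: "symf f ==> symf (%p. - f p)" using symf_cmult[of f "-1"] by simp

lemma symf_sum: "(!!a. a : B ==> symf (f a)) ==> symf (%p. SUM a:B. f a p)"
proof (induction B rule: infinite_finite_induct)
 case (insert a B)
 then show ?case using symf_add[of "f a" "%p. SUM a:B. f a p"] by simp
qed (simp_all add: symf_const)

lemma subfield_symf: "subfield (cls I V ` {f. symf f}) L"
proof (rule L.subfieldI'[OF L.subringI])
 show "cls I V ` {f. symf f} <= carrier L" using cls_carrier symf_ratl by blast
 show "\<one>\<^bsub>L\<^esub> : cls I V ` {f. symf f}" unfolding one_L using symf_const by blast
 fix h k assume "h : cls I V ` {f. symf f}" "k : cls I V ` {f. symf f}"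
 then obtain f g where f: "h = cls I V f" "symf f" "k = cls I V g" "symf g" by blast
 show "h \<otimes>\<^bsub>L\<^esub> k : cls I V ` {f. symf f}" "h \<oplus>\<^bsub>L\<^esub> k : cls I V ` {f. symf f}"
  unfolding f(1,3) mult_cls[OF symf_ratl[OF f(2)] symf_ratl[OF f(4)]] add_cls[OF symf_ratl[OF f(2)] symf_ratl[OF f(4)]] using symf_mult[OF f(2,4)] symf_add[OF f(2,4)] by blast+
next
 fix h assume "h : cls I V ` {f. symf f}"
 then obtain f where f: "h = cls I V f" "symf f" by blast
 have "\<ominus>\<^bsub>L\<^esub> h = cls I V (%p. - f p)" unfolding f(1) by (rule L.minus_equality) (use symf_ratl[OF f(2)] in "simp_all add: cls_carrier ratl_uminus add_cls zero_L")
 then show "\<ominus>\<^bsub>L\<^esub> h : cls I V ` {f. symf f}" using symf_uminus[OF f(2)] by blast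
next
 fix h assume h: "h : cls I V ` {f. symf f} - {\<zero>\<^bsub>L\<^esub>}"
 then obtain f where f: "h = cls I V f" "symf f" by blast
 have nz: "gen I V (%p. f p ~= 0)" using h cls_nonzero[OF symf_ratl[OF f(2)]] unfolding f(1) by blast
 show "inv\<^bsub>L\<^esub> h : cls I V ` {f. symf f}" unfolding f(1) inv_cls[OF symf_ratl[OF f(2)] nz] using symf_inverse[OF f(2) nz] by blast
qed

lemma W0_proj: "W0 <= pspace J" by (rule zclosed_subset[OF W0_closed])

lemma pi_zopen: assumes "zopen J W0 T" shows "zopen I V {p : V. pi p : T}" unfolding zopen_iff
proof (intro conjI subsetI ballI)
 fix p assume p: "p : {p : V. pi p : T}"
 then have "near J W0 (pi p) (%q. q : T)" using assms unfolding zopen_iff_near[OF W0_closed] by blast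
 then have "near I V p (%q. pi q : T)" using p by (intro rmap_near[OF pi_rmap pi_W0 W0_proj]) auto
 then show "near I V p (%q. q : {p : V. pi p : T})" by (rule near_mono) simp
qed simp

lemma pi_reg_pairs:
 assumes "(T, g) : reg_pairs J W0" "{p : V. pi p : T} ~= {}"
 shows "({p : V. pi p : T}, %p. g (pi p)) : reg_pairs I V"
proof -
 have T: "zopen J W0 T" "ALL q:T. rg J W0 q g" using assms(1) unfolding reg_pairs_def by (simp_all add: regular_on_iff[OF W0_closed])
 have "rg I V p (%p. g (pi p))" if "p : V" "pi p : T" for p using T(2) that by (intro rmap_rg[OF pi_rmap pi_W0 W0_proj]) auto
 then show ?thesis unfolding reg_pairs_iff using assms(2) pi_zopen[OF T(1)] by simp
qed

lemma form_comb: "hompf J n F ==> hompf {..m} n (%y. F (comb m b y))"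
proof -
 assume F: "hompf J n F"
 have "hompf {..m} (n * 1) (%y. F (%i. comb m b y i))"
 proof (rule hompf_compose[OF F])
  fix i
  have "hompf {..m} 1 (%y. SUM k<=m. b k i * y k)" by (intro hompf_sum hompf_cmult hompf_coord) simp
  then show "hompf {..m} 1 (%y. comb m b y i)" unfolding comb_def by (simp only: mult.commute)
 qed
 then show ?thesis by simp
qed

lemma rep_pi_gen:
 assumes "hompf J n F" "hompf J n H"
 shows "gen I V (%p. F (rep (pi p)) / H (rep (pi p)) = F (comb m b (%k. t k p)) / H (comb m b (%k. t k p)) &
  (H (rep (pi p)) = 0 \<longleftrightarrow> H (comb m b (%k. t k p)) = 0))"
proof (rule gen_mono[OF pi_gen])
 fix p assume p: "p : V" "pi p = pt (comb m b (%k. t k p)) & comb m b (%k. t k p) ~= 0"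
 have 1: "pi p : pspace J" using pi_W0[OF p(1)] W0_proj by blast
 have 2: "comb m b (%k. t k p) : pi p" using p(2) in_pt_self[of "comb m b (%k. t k p)"] by simp
 show "F (rep (pi p)) / H (rep (pi p)) = F (comb m b (%k. t k p)) / H (comb m b (%k. t k p)) &
  (H (rep (pi p)) = 0 \<longleftrightarrow> H (comb m b (%k. t k p)) = 0)" using hompf_quotient_mem[OF 1 2 assms] hompf_mem_zero_iff[OF 1 2 assms(2)] by simp
qed

lemma pullback_symf:
 assumes "(T, g) : reg_pairs J W0" "{p : V. pi p : T} ~= {}"
 shows "symf (%p. g (pi p))"
proof -
 obtain p where p: "p : V" "pi p : T" using assms(2) by blast
 have "ALL q:T. rg J W0 q g" using assms(1) unfolding reg_pairs_def by (simp add: regular_on_iff[OF W0_closed])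
 then have "rg J W0 (pi p) g" using p(2) by blast
 then obtain n F H where F: "hompf J n F" "hompf J n H" "near J W0 (pi p) (%q. H (rep q) ~= 0 & g q = F (rep q) / H (rep q))" unfolding rg_def by blast
 have N: "near I V p (%p. H (rep (pi p)) ~= 0 & g (pi p) = F (rep (pi p)) / H (rep (pi p)))" by (rule rmap_near[OF pi_rmap[OF p(1)] pi_W0 W0_proj F(3)])
 have "gen I V (%p. H (comb m b (%k. t k p)) ~= 0 & g (pi p) = F (comb m b (%k. t k p)) / H (comb m b (%k. t k p)))" by (rule gen_mono2[OF near_gen[OF N] rep_pi_gen[OF F(1,2)]]) simp
 then show ?thesis unfolding symf_def using form_comb[OF F(1)] form_comb[OF F(2)] by blast
qed

lemma symf_pullback:
 assumes "symf f" shows "cls I V f : pullback_field I V J W0 pi"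
proof -
 obtain n F H where f: "hompf {..m} n F" "hompf {..m} n H" "gen I V (%p. quot f F H p)" using assms unfolding symf_def by blast
 have lin: "hompf J (n * 1) (%z. G (%k. lf J (l k) z))" if "hompf {..m} n G" for G by (rule hompf_compose[OF that hompf_lf])
 let ?F = "%z. F (%k. lf J (l k) z)" and ?H = "%z. H (%k. lf J (l k) z)"
 have FH: "hompf J n ?F" "hompf J n ?H" using lin f(1,2) by simp_all
 let ?T = "{q : W0. ?H (rep q) ~= 0}" and ?g = "%q. ?F (rep q) / ?H (rep q)"
 have c: "G (%k. lf J (l k) (comb m b y)) = G y" if "hompf {..m} n G" for G y by (rule hompf_cong_on[OF that]) (simp add: lf_comb_b)
 have g: "gen I V (%p. pi p : ?T & ?g (pi p) = f p)"
 proof (rule gen_mono2[OF f(3) rep_pi_gen[OF FH]])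
  fix p assume p: "p : V" "quot f F H p"
   "?F (rep (pi p)) / ?H (rep (pi p)) = ?F (comb m b (%k. t k p)) / ?H (comb m b (%k. t k p)) &
   (?H (rep (pi p)) = 0 \<longleftrightarrow> ?H (comb m b (%k. t k p)) = 0)"
  show "pi p : ?T & ?g (pi p) = f p" using p(2,3) pi_W0[OF p(1)] unfolding c[OF f(1)] c[OF f(2)] by (intro conjI CollectI) simp_all
 qed
 then obtain p where p: "p : V" "pi p : ?T" using gen_ex by blast
 have o: "zopen J W0 ?T" unfolding zopen_iff_near[OF W0_closed]
 proof (intro conjI subsetI ballI)
  fix q assume "q : ?T"
  then have "near J W0 q (%q. ?H (rep q) ~= 0)" by (intro near_form[OF _ FH(2)]) auto
  then show "near J W0 q (%q. q : ?T)" by (rule near_mono) simp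
 qed simp
 have "(?T, ?g) : reg_pairs J W0" unfolding reg_pairs_def
 proof (simp only: mem_Collect_eq prod.case regular_on_iff[OF W0_closed], intro conjI o ballI)
  show "?T ~= {}" using p(2) by blast
  fix q assume "q : ?T"
  then have "q : W0" "?H (rep q) ~= 0" by blast+
  then show "rg J W0 q ?g" by (rule rg_quotient[OF _ FH])
 qed
 moreover have "{p : V. pi p : ?T} ~= {}" using p by blast
 ultimately have "rat_class I V {p : V. pi p : ?T} (%p. ?g (pi p)) = cls I V (%p. ?g (pi p))" by (intro rat_class_eq_cls pi_reg_pairs)
 moreover have "cls I V (%p. ?g (pi p)) = cls I V f" by (rule cls_cong[OF gen_mono[OF g]]) simp
 moreover have "rat_class I V {p : V. pi p : ?T} (%p. ?g (pi p)) : pullback_field I V J W0 pi" unfolding pullback_field_def by (intro CollectI exI[of _ ?T] exI[of _ ?g] conjI refl) fact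
 ultimately show ?thesis by simp
qed

text \<open>If the preimage of \<open>T\<close> is empty, then the class consists of all pairs, which is not an element of the function field.\<close>

lemma pullback_in_carrier:
 assumes "x : pullback_field I V J W0 pi" "x : carrier L" shows "x : cls I V ` {f. symf f}"
proof -
 obtain T g where g: "x = rat_class I V {p : V. pi p : T} (%p. g (pi p))" "(T, g) : reg_pairs J W0" using assms(1) unfolding pullback_field_def by blast
 have "{p : V. pi p : T} ~= {}"
 proof
  assume e: "{p : V. pi p : T} = {}"
  obtain f where f: "ratl I V f" "x = cls I V f" using carrierE[OF assms(2)] by blast
  have all: "x = reg_pairs I V" unfolding g(1) e rat_class_def by auto
  have "gen I V (%p. f p = c)" for c
  proof -
   have "({q. rg I V q (%_. c)}, %_. c) : x" unfolding all by (rule reg_pairs_rdom[OF ratl_const])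
   then show ?thesis unfolding f(2) cls_def by simp
  qed
  from gen_mono2[OF this[of 0] this[of 1], of "%_. False"] show False by simp
 qed
 then have "x = cls I V (%p. g (pi p))" "symf (%p. g (pi p))" unfolding g(1) using rat_class_eq_cls[OF pi_reg_pairs[OF g(2)]] pullback_symf[OF g(2)] by blast+
 then show ?thesis by blast
qed

text \<open>\<open>dom\<close> expresses dominance: a form that is not identically zero on the
  target does not vanish identically after pulling back. Hence every nonempty open subset of
  \<open>W0\<close> has a nonempty preimage and no degenerate class arises.\<close>

lemma pullback_eq_symf:
 assumes dom: "!!n H y. hompf {..m} n H ==> H y ~= 0 ==> gen I V (%p. H (%k. t k p) ~= 0)"
 shows "pullback_field I V J W0 pi = cls I V ` {f. symf f}"
proof (intro equalityI subsetI)
 fix x assume x: "x : pullback_field I V J W0 pi"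
 obtain T g where g: "x = rat_class I V {p : V. pi p : T} (%p. g (pi p))" "(T, g) : reg_pairs J W0" using x unfolding pullback_field_def by blast
 have T: "T ~= {}" "zopen J W0 T" using g(2) unfolding reg_pairs_def by (simp_all add: regular_on_iff[OF W0_closed])
 then obtain q where q: "q : T" by blast
 then have "near J W0 q (%q. q : T)" using T(2) unfolding zopen_iff_near[OF W0_closed] by blast
 then obtain n h where h: "q : W0" "hompf J n h" "h (rep q) ~= 0" "ALL q:W0. h (rep q) ~= 0 --> q : T" unfolding near_def by blast
 obtain y where y: "q = pt (comb m b y)" using h(1) unfolding W0_def E0_def by blast
 have "h (comb m b y) ~= 0" using hompf_mem_zero_iff[OF _ in_pt_self h(2), of "comb m b y"] h(1,3) W0_proj unfolding y by blast
 from dom[OF form_comb[OF h(2)] this] have "gen I V (%p. h (comb m b (%k. t k p)) ~= 0)" .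
 then have "gen I V (%p. h (rep (pi p)) ~= 0)" by (rule gen_mono2[OF _ rep_pi_gen[OF h(2,2)]]) simp
 then obtain p where "p : V" "h (rep (pi p)) ~= 0" using gen_ex by blast
 then have "{p : V. pi p : T} ~= {}" using h(4) pi_W0 by blast
 then have "x = cls I V (%p. g (pi p))" "symf (%p. g (pi p))" unfolding g(1) using rat_class_eq_cls[OF pi_reg_pairs[OF g(2)]] pullback_symf[OF g(2)] by blast+
 then show "x : cls I V ` {f. symf f}" by blast
qed (use symf_pullback in blast)

end

section \<open>Automorphisms of the function field as point maps\<close>

context proj_variety
begin

text \<open>A class has no canonical representative, so the action of \<open>sg\<close> on functions
  is a relation; \<open>liftrel_unique\<close> makes it single-valued up to generic
  equality.\<close>

definition liftrel :: "(('i, 'k) ratfun => ('i, 'k) ratfun) => (('i, 'k) point => 'k) => (('i, 'k) point => 'k) => bool"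
 where "liftrel sg f g \<longleftrightarrow> ratl I V f & ratl I V g & sg (cls I V f) = cls I V g"

lemma liftrel_ex:
 assumes "sg : ring_hom L L" "ratl I V f" shows "EX g. liftrel sg f g" using carrierE[OF ring_hom_closed[OF assms(1) cls_carrier[OF assms(2)]]] assms(2) unfolding liftrel_def by blast

lemma liftrel_unique: "liftrel sg f g ==> liftrel sg f g' ==> gen I V (%p. g p = g' p)" unfolding liftrel_def using cls_eq_iff by metis

lemma liftrel_cong: "liftrel sg f g ==> gen I V (%p. f p = f' p) ==> gen I V (%p. g p = g' p) ==> liftrel sg f' g'" unfolding liftrel_def using ratl_cong cls_cong by metis

lemma liftrel_add: "sg : ring_hom L L ==> liftrel sg f g ==> liftrel sg f' g' ==> liftrel sg (%p. f p + f' p) (%p. g p + g' p)" unfolding liftrel_def using ring_hom_add[of sg L L "cls I V f" "cls I V f'"]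
 by (simp add: add_cls ratl_add cls_carrier)

lemma liftrel_mult: "sg : ring_hom L L ==> liftrel sg f g ==> liftrel sg f' g' ==> liftrel sg (%p. f p * f' p) (%p. g p * g' p)" unfolding liftrel_def using ring_hom_mult[of sg L L "cls I V f" "cls I V f'"]
 by (simp add: mult_cls ratl_mult cls_carrier)

lemma liftrel_sum:
 assumes "sg : ring_hom L L" "!!c. liftrel sg (%_. c) (%_. c)" "!!a. a : B ==> liftrel sg (f a) (g a)"
 shows "liftrel sg (%p. SUM a:B. f a p) (%p. SUM a:B. g a p)" using assms(3)
proof (induction B rule: infinite_finite_induct)
 case (insert a B)
 then show ?case using liftrel_add[OF assms(1), of "f a" "g a" "%p. SUM a:B. f a p" "%p. SUM a:B. g a p"] by simp
qed (simp_all add: assms(2))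

lemma liftrel_prod:
 assumes "sg : ring_hom L L" "!!c. liftrel sg (%_. c) (%_. c)" "!!a. a : B ==> liftrel sg (f a) (g a)"
 shows "liftrel sg (%p. PROD a:B. f a p) (%p. PROD a:B. g a p)" using assms(3)
proof (induction B rule: infinite_finite_induct)
 case (insert a B)
 then show ?case using liftrel_mult[OF assms(1), of "f a" "g a" "%p. PROD a:B. f a p" "%p. PROD a:B. g a p"] by simp
qed (simp_all add: assms(2))

lemma liftrel_power:
 assumes "sg : ring_hom L L" "!!c. liftrel sg (%_. c) (%_. c)" "liftrel sg f g"
 shows "liftrel sg (%p. f p ^ n) (%p. g p ^ n)"
proof (induction n)
 case (Suc n)
 then show ?case using liftrel_mult[OF assms(1,3)] by simp
qed (simp add: assms(2))

lemma liftrel_hompf: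
 assumes s: "sg : ring_hom L L" and c: "!!c. liftrel sg (%_. c) (%_. c)"
  and F: "hompf J n F" and r: "!!i. i : J ==> liftrel sg (r i) (r' i)"
 shows "liftrel sg (%p. F (%i. r i p)) (%p. F (%i. r' i p))"
proof -
 obtain S e where S: "finite S" "!!m. m : S ==> mkeys m <= J" "!!m. m : S ==> mdeg m = n"
  "F = (%x. SUM m:S. e m * mval m x)" using hompf_repr[OF F] by blast
 have "liftrel sg (%p. mval m (%i. r i p)) (%p. mval m (%i. r' i p))" if "m : S" for m unfolding mval_def by (intro liftrel_prod[OF s c] liftrel_power[OF s c] r) (use S(2)[OF that] in blast)
 then show ?thesis unfolding S(4) by (intro liftrel_sum[OF s c] liftrel_mult[OF s] c)
qed

lemma liftrel_nonzero:
 assumes s: "sg : ring_hom L L" and fg: "liftrel sg f g" and nz: "gen I V (%p. f p ~= 0)"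
 shows "gen I V (%p. g p ~= 0)" "liftrel sg (%p. inverse (f p)) (%p. inverse (g p))"
proof -
 have r: "ratl I V f" "ratl I V g" "sg (cls I V f) = cls I V g" using fg unfolding liftrel_def by blast+
 obtain g' where g': "liftrel sg (%p. inverse (f p)) g'" using liftrel_ex[OF s ratl_inverse[OF r(1)]] by blast
 have m: "liftrel sg (%p. f p * inverse (f p)) (%p. g p * g' p)" by (rule liftrel_mult[OF s fg g'])
 have "cls I V (%p. f p * inverse (f p)) = \<one>\<^bsub>L\<^esub>" unfolding one_L by (rule cls_cong, rule gen_mono[OF nz]) simp
 then have "cls I V (%p. g p * g' p) = cls I V (%_. 1)" using m ring_hom_one[OF s] unfolding liftrel_def one_L by simp
 moreover have "ratl I V (%p. g p * g' p)" using m unfolding liftrel_def by blast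
 ultimately have 1: "gen I V (%p. g p * g' p = 1)" using cls_eq_iff[of "%p. g p * g' p" "%_. 1"] by simp
 show "gen I V (%p. g p ~= 0)" by (rule gen_mono[OF 1]) auto
 have "gen I V (%p. g' p = inverse (g p))" by (rule gen_mono[OF 1]) (metis inverse_unique)
 with g' show "liftrel sg (%p. inverse (f p)) (%p. inverse (g p))" using liftrel_cong[of sg "%p. inverse (f p)" g' "%p. inverse (f p)" "%p. inverse (g p)"] by simp
qed

lemma liftrel_zero: "sg : ring_hom L L ==> liftrel sg f g ==> gen I V (%p. f p = 0) ==> (!!c. liftrel sg (%_. c) (%_. c)) ==> gen I V (%p. g p = 0)"
 using liftrel_unique[of sg "%_. 0" g "%_. 0"] liftrel_cong[of sg f g "%_. 0" g] by simp

text \<open>An automorphism over the ground field is composition with a rational self-map, whose coordinates are the images of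
 the affine coordinate functions `x i / x i0`.\<close>

definition affc where "affc i0 i q = rep q i / rep q i0"

lemma affc_index: "EX i0:I. gen I V (%q. rep q i0 ~= 0)"
proof -
 obtain p where p: "p : V" using nonempty by blast
 obtain i0 where i0: "rep p i0 ~= 0" using proj_space_rep(3)[OF in_proj[OF p]] by (auto simp: fun_eq_iff)
 have iI: "i0 : I" using i0 proj_space_rep(4)[OF in_proj[OF p]] by (auto simp: coord_space_def)
 show ?thesis using near_gen[OF near_form[OF p hompf_coord[OF iI] i0]] iI by blast
qed

lemma affc_ratl: assumes "i0 : I" "gen I V (%q. rep q i0 ~= 0)" "i : I" shows "ratl I V (affc i0 i)"
proof -
 obtain p where p: "p : V" "rep p i0 ~= 0" using gen_ex[OF assms(2)] by blast
 have "rg I V p (affc i0 i)" unfolding affc_def[abs_def] by (rule rg_quotient[OF p(1) hompf_coord[OF assms(3)] hompf_coord[OF assms(1)] p(2)])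
 then show ?thesis by (rule rg_ratl)
qed

lemma affc_mem: assumes "q : V" "rep q i0 ~= 0" shows "(%i. affc i0 i q) : q"
proof -
 have "scal (1 / rep q i0) (rep q) : q" using assms by (intro scal_mem[OF in_proj] proj_space_rep(1)[OF in_proj]) simp_all
 then show ?thesis by (simp add: scal_def affc_def)
qed

lemma affc_point_eq:
 assumes "p : V" "q : V" "rep p i0 ~= 0" "rep q i0 ~= 0" "ALL i:I. affc i0 i p = affc i0 i q" shows "p = q"
proof (rule point_eq[OF in_proj[OF assms(1)] in_proj[OF assms(2)] affc_mem[OF assms(1,3)]])
 have "(%i. affc i0 i p) = (%i. affc i0 i q)"
 proof
  fix i show "affc i0 i p = affc i0 i q"
  proof (cases "i : I")
   case True
   then show ?thesis by (rule bspec[OF assms(5)])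
  next
   case False
   then have "rep p i = 0" "rep q i = 0" using proj_space_rep(4)[OF in_proj[OF assms(1)]] proj_space_rep(4)[OF in_proj[OF assms(2)]] unfolding coord_space_def by blast+
   then show ?thesis unfolding affc_def by simp
  qed
 qed
 then show "(%i. affc i0 i p) : q" by (rule ssubst) (rule affc_mem[OF assms(2,4)])
qed

text \<open>The finitely many affine coordinate functions determine a point of the chart, so
  agreement on each of them is enough. The hypotheses that generic statements pull back keep both
  images inside the chart.\<close>

lemma maps_eq_gen:
 assumes al: "!!p. p : V ==> al p : V" "!!P. gen I V P ==> gen I V (%p. P (al p))"
  and be: "!!p. p : V ==> be p : V" "!!P. gen I V P ==> gen I V (%p. P (be p))"
  and eq: "!!f. ratl I V f ==> gen I V (%p. f (al p) = f (be p))"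
 shows "gen I V (%p. al p = be p)"
proof -
 obtain i0 where i0: "i0 : I" "gen I V (%q. rep q i0 ~= 0)" using affc_index by blast
 have "gen I V (%p. ALL i:I. affc i0 i (al p) = affc i0 i (be p))" by (rule gen_ball[OF finite_I eq[OF affc_ratl[OF i0]]])
 then show ?thesis
 proof (rule gen_mono3[OF _ al(2)[OF i0(2)] be(2)[OF i0(2)]])
  fix p assume "p : V" "ALL i:I. affc i0 i (al p) = affc i0 i (be p)" "rep (al p) i0 ~= 0" "rep (be p) i0 ~= 0"
  then show "al p = be p" by (intro affc_point_eq al(1) be(1))
 qed
qed

lemma automorphism_point_map:
 assumes s: "sg : ring_hom L L" and c: "!!c. liftrel sg (%_. c) (%_. c)"
 shows "EX gm. (ALL p:V. gm p : V) & gen I V (%p. rmap_at I V I gm p) & (ALL P. gen I V P --> gen I V (%p. P (gm p))) &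
  (ALL f. ratl I V f --> liftrel sg f (%p. f (gm p)))"
proof -
 obtain i0 where i0: "i0 : I" "gen I V (%q. rep q i0 ~= 0)" using affc_index by blast
 let ?x = "affc i0"
 have "ALL i:I. EX r. liftrel sg (?x i) r" using liftrel_ex[OF s affc_ratl[OF i0]] by blast
 from bchoice[OF this] obtain r where r: "!!i. i : I ==> liftrel sg (?x i) (r i)" by blast
 define z where "z p = (%i. if i : I then r i p else 0)" for p
 have zc: "z p : cspace I" for p by (simp add: z_def coord_space_def)
 have form: "liftrel sg (%p. F (%i. ?x i p)) (%p. F (z p))" if F: "hompf I n F" for n F
 proof -
  have "liftrel sg (%p. F (%i. ?x i p)) (%p. F (%i. r i p))" by (rule liftrel_hompf[OF s c F r])
  moreover have "F (%i. r i p) = F (z p)" for p by (rule hompf_cong_on[OF F]) (simp add: z_def)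
  ultimately show ?thesis by simp
 qed
 have xF: "F (%i. ?x i q) = 0 \<longleftrightarrow> F (rep q) = 0" if "hompf I n F" "q : V" "rep q i0 ~= 0" for n F q by (rule hompf_mem_zero_iff[OF in_proj[OF that(2)] affc_mem[OF that(2,3)] that(1)])
 have rr: "gen I V (%p. ALL i:I. rg I V p (r i))" using r by (intro gen_ball[OF finite_I] ratl_gen) (auto simp: liftrel_def)
 have "gen I V (%p. ?x i0 p = 1)" by (rule gen_mono[OF i0(2)]) (simp add: affc_def)
 from liftrel_cong[OF r[OF i0(1)] this, of "r i0"] have "liftrel sg (%_. 1) (r i0)" by simp
 from liftrel_unique[OF this c] have r1: "gen I V (%p. r i0 p = 1)" .
 \<comment> \<open>A form vanishing on \<open>V\<close> vanishes at the affine coordinates, and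
   \<open>sg\<close> carries this relation with constant coefficients to the images
   \<open>r i\<close>. The new vector therefore satisfies all equations of \<open>V\<close>, at each
   point where the \<open>r i\<close> are regular by \<open>rg_zero\<close>.\<close>
 have good: "pt (z p) : V" if p: "p : V" "ALL i:I. rg I V p (r i)" "r i0 p = 1" for p
 proof (rule zclosed_eq_points[OF closed])
  have z0: "z p ~= 0"
  proof
   assume "z p = 0"
   then have "z p i0 = 0" by simp
   then show False using p(3) i0(1) by (simp add: z_def)
  qed
  show P: "pt (z p) : pspace I" by (rule pt_in_proj[OF zc z0])
  fix n F assume F: "hompf I n F" and v: "!!q. q : V ==> F (rep q) = 0"
  have "gen I V (%q. F (%i. ?x i q) = 0)" by (rule gen_mono[OF i0(2)]) (use xF[OF F] v in blast)
  from liftrel_zero[OF s form[OF F] this c] have g: "gen I V (%q. F (z q) = 0)" .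
  have "rg I V p (%q. F (%i. z q i))" by (rule rg_hompf[OF p(1) F]) (use p(2) in "simp add: z_def")
  from rg_zero[OF this g] have "F (z p) = 0" by simp
  then show "F (rep (pt (z p))) = 0" using hompf_mem_zero_iff[OF P in_pt_self F] by simp
 qed
 obtain v0 where v0: "v0 : V" using nonempty by blast
 \<comment> \<open>Outside the generic domain the map takes the arbitrary value \<open>v0\<close>,
   so that it is total with values in \<open>V\<close>.\<close>
 define gm where "gm p = (if pt (z p) : V then pt (z p) else v0)" for p
 have gmV: "ALL p:V. gm p : V" by (simp add: gm_def v0)
 have gmz: "gen I V (%p. gm p = pt (z p))" by (rule gen_mono2[OF rr r1]) (simp add: gm_def good)
 have rm: "gen I V (%p. rmap_at I V I gm p)"
 proof (rule gen_mono2[OF rr gen_near[OF gmz]])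
  fix p assume p: "ALL i:I. rg I V p (r i)" "near I V p (%p. gm p = pt (z p))"
  have "near I V p (%q. (%i. z q i) : gm q)" by (rule near_mono[OF p(2)]) (simp add: in_pt_self)
  moreover have "ALL i:I. rg I V p (%q. z q i)" using p(1) by (simp add: z_def)
  ultimately show "rmap_at I V I gm p" unfolding rmap_at_def by (intro exI[of _ "%i q. z q i"] conjI)
 qed
 \<comment> \<open>Dominance: a homomorphism between fields preserves invertibility, so a form that
   does not vanish on \<open>V\<close> does not vanish generically at \<open>z\<close>.\<close>
 have Hz: "gen I V (%p. H (z p) ~= 0)" if H: "hompf I n H" and q: "q : V" "H (rep q) ~= 0" for n H q
 proof -
  have "gen I V (%p. H (%i. ?x i p) ~= 0)" by (rule gen_mono2[OF i0(2) near_gen[OF near_form[OF q(1) H q(2)]]]) (use xF[OF H] in blast)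
  then show ?thesis by (rule liftrel_nonzero(1)[OF s form[OF H]])
 qed
 have zm: "z p : gm p" if "gm p = pt (z p)" for p unfolding that by (rule in_pt_self)
 have gp: "gen I V (%p. P (gm p))" if P: "gen I V P" for P
 proof -
  obtain q n h where h: "q : V" "hompf I n h" "h (rep q) ~= 0" "ALL q:V. h (rep q) ~= 0 --> P q" using P unfolding gen_def near_def by blast
  show ?thesis
  proof (rule gen_mono2[OF Hz[OF h(2,1,3)] gmz])
   fix p assume p: "p : V" "h (z p) ~= 0" "gm p = pt (z p)"
   have "h (rep (gm p)) ~= 0" using hompf_mem_zero_iff[OF in_proj[OF gmV[rule_format, OF p(1)]] zm[OF p(3)] h(2)] p(2) by simp
   then show "P (gm p)" using h(4) gmV p(1) by blast
  qed
 qed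
 have lift: "liftrel sg f (%p. f (gm p))" if f: "ratl I V f" for f
 proof -
  obtain q n F H where FH: "q : V" "hompf I n F" "hompf I n H" "H (rep q) ~= 0"
  "!!q. q : V ==> H (rep q) ~= 0 ==> f q = F (rep q) / H (rep q)" by (rule ratl_repr[OF f]) blast
  have Hx: "gen I V (%p. H (%i. ?x i p) ~= 0)" by (rule gen_mono2[OF i0(2) near_gen[OF near_form[OF FH(1,3,4)]]]) (use xF[OF FH(3)] in blast)
  have 1: "liftrel sg (%p. F (%i. ?x i p) * inverse (H (%i. ?x i p))) (%p. F (z p) * inverse (H (z p)))" by (rule liftrel_mult[OF s form[OF FH(2)] liftrel_nonzero(2)[OF s form[OF FH(3)] Hx]])
  show ?thesis
  proof (rule liftrel_cong[OF 1])
   show "gen I V (%p. F (%i. ?x i p) * inverse (H (%i. ?x i p)) = f p)"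
   proof (rule gen_mono2[OF i0(2) near_gen[OF near_form[OF FH(1,3,4)]]])
   fix p assume p: "p : V" "rep p i0 ~= 0" "H (rep p) ~= 0"
   show "F (%i. ?x i p) * inverse (H (%i. ?x i p)) = f p" using hompf_quotient_mem[OF in_proj[OF p(1)] affc_mem[OF p(1,2)] FH(2,3)] FH(5)[OF p(1,3)] by (simp add: divide_inverse)
   qed
   show "gen I V (%p. F (z p) * inverse (H (z p)) = f (gm p))"
   proof (rule gen_mono2[OF Hz[OF FH(3,1,4)] gmz])
   fix p assume p: "p : V" "H (z p) ~= 0" "gm p = pt (z p)"
   have gV: "gm p : V" using gmV p(1) by blast
   have "H (rep (gm p)) ~= 0" using hompf_mem_zero_iff[OF in_proj[OF gV] zm[OF p(3)] FH(3)] p(2) by simp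
   then show "F (z p) * inverse (H (z p)) = f (gm p)" using hompf_quotient_mem[OF in_proj[OF gV] zm[OF p(3)] FH(2,3)] FH(5)[OF gV] by (simp add: divide_inverse)
   qed
  qed
 qed
 show ?thesis by (intro exI[of _ gm] conjI allI impI gmV rm gp lift)
qed

lemma eval_fixed:
 assumes s: "sg : ring_hom L L" and K: "K <= carrier L" "!!k. k : K ==> sg k = k" and p: "set p <= K" and x: "x : carrier L"
 shows "sg (L.eval p x) = L.eval p (sg x)" using p
proof (induction p)
 case Nil
 have "sg \<zero>\<^bsub>L\<^esub> = \<zero>\<^bsub>L\<^esub>" using ring_hom_zero[OF s] L.ring_axioms by blast
 then show ?case by simp
next
 case (Cons a p)
 have sx: "sg x : carrier L" by (rule ring_hom_closed[OF s x])
 have pw: "sg (x [^]\<^bsub>L\<^esub> n) = sg x [^]\<^bsub>L\<^esub> n" for n :: nat by (induction n) (use ring_hom_one[OF s] ring_hom_mult[OF s] x in "simp_all")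
 have ev: "L.eval p x : carrier L" using Cons.prems K(1) x by (intro L.eval_in_carrier) auto
 have a: "a : carrier L" "sg a = a" using Cons.prems K by auto
 show ?case using Cons a ev x sx ring_hom_add[OF s, of "a \<otimes>\<^bsub>L\<^esub> x [^]\<^bsub>L\<^esub> length p" "L.eval p x"]
   ring_hom_mult[OF s, of a "x [^]\<^bsub>L\<^esub> length p"] pw by simp
qed

text \<open>The images of an algebraic element under automorphisms over \<open>K\<close> are roots of one polynomial.\<close>

lemma finite_images:
 assumes K: "subfield K L" and x: "x : carrier L" "L.algebraic K x"
 shows "finite {sg x | sg. sg : ring_hom L L & (ALL k:K. sg k = k)}"
proof -
 obtain p where p: "p : carrier (K[X]\<^bsub>L\<^esub>)" "p ~= []" "L.eval p x = \<zero>\<^bsub>L\<^esub>" using L.algebraicE[OF subfieldE(1)[OF K] x(1), of thesis] x(2) unfolding over_def by blast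
 have KL: "K <= carrier L" by (rule subfieldE(3)[OF K])
 have pK: "set p <= K" using p(1,2) unfolding univ_poly_carrier[symmetric] polynomial_def by blast
 have pL: "p : carrier (poly_ring L)" by (rule L.carrier_polynomial_shell[OF subfieldE(1)[OF K] p(1)])
 have "{sg x | sg. sg : ring_hom L L & (ALL k:K. sg k = k)} <= {a. L.is_root p a}"
 proof
  fix y assume "y : {sg x | sg. sg : ring_hom L L & (ALL k:K. sg k = k)}"
  then obtain sg where s: "y = sg x" "sg : ring_hom L L" "ALL k:K. sg k = k" by blast
  have "L.eval p y = sg (L.eval p x)" unfolding s(1) using eval_fixed[OF s(2) KL _ pK x(1)] s(3) by simp
  also have "... = \<zero>\<^bsub>L\<^esub>" unfolding p(3) using ring_hom_zero[OF s(2)] L.ring_axioms by blast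
  finally have "L.eval p y = \<zero>\<^bsub>L\<^esub>" .
  moreover have "y : carrier L" unfolding s(1) by (rule ring_hom_closed[OF s(2) x(1)])
  ultimately show "y : {a. L.is_root p a}" using p(2) unfolding L.is_root_def by simp
 qed
 then show ?thesis using L.finite_number_of_roots[OF pL] finite_subset by blast
qed

end

lemma galois_group_carrier:
 "sg : carrier (galois_group R K) \<longleftrightarrow> sg : extensional (carrier R) & bij_betw sg (carrier R) (carrier R) & sg : ring_hom R R & (ALL x:K. sg x = x)" by (auto simp: galois_group_def Bij_def)

lemma galois_group_mult:
 "sg : carrier (galois_group R K) ==> ta : carrier (galois_group R K) ==> sg \<otimes>\<^bsub>galois_group R K\<^esub> ta = compose (carrier R) sg ta" by (auto simp: galois_group_def BijGroup_def Bij_def)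

text \<open>\<open>psi\<close> is the given isomorphism with the Galois group, inverted and read as
  an action of \<open>G\<close>. The base field is stated through \<open>symf\<close>; its equality
  with the pulled back field is established at the instantiation.\<close>

locale galois_projection = projected_variety I C J m l b phi sg + G: group G
 for I :: "'i set" and C :: "('i, 'k::field) point set" and J m l and b :: "nat => nat => 'k" and phi sg
  and G :: "'g monoid" (structure) +
 fixes psi :: "'g => ('i, 'k) ratfun => ('i, 'k) ratfun"
 assumes galois: "galois_extension (funfield I C) (cls I C ` {f. symf f})"
  and psi_bij: "bij_betw psi (carrier G) (carrier (galois_group (funfield I C) (cls I C ` {f. symf f})))"
  and psi_mult: "!!g h x. g : carrier G ==> h : carrier G ==> x : carrier (funfield I C) ==> psi (g \<otimes>\<^bsub>G\<^esub> h) x = psi g (psi h x)"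
begin

lemma psi_gal: assumes "g : carrier G"
 shows "psi g : ring_hom L L" "psi g : extensional (carrier L)" "!!f. symf f ==> psi g (cls I C f) = cls I C f" using bij_betwE[OF psi_bij] assms unfolding galois_group_carrier by blast+

lemma psi_const: "g : carrier G ==> liftrel (psi g) (%_. c) (%_. c)" unfolding liftrel_def using psi_gal(3)[of g "%_. c"] by (simp add: ratl_const symf_const)

definition gam :: "'g => ('i, 'k) point => ('i, 'k) point" where
 "gam g = (SOME gm. (ALL p:C. gm p : C) & gen I C (%p. rmap_at I C I gm p) & (ALL P. gen I C P --> gen I C (%p. P (gm p))) &
  (ALL f. ratl I C f --> liftrel (psi g) f (%p. f (gm p))))"

lemma gam:
 assumes "g : carrier G"
 shows "!!p. p : C ==> gam g p : C" "gen I C (%p. rmap_at I C I (gam g) p)" "!!P. gen I C P ==> gen I C (%p. P (gam g p))"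
  "!!f. ratl I C f ==> liftrel (psi g) f (%p. f (gam g p))" using someI_ex[OF automorphism_point_map[OF psi_gal(1)[OF assms] psi_const[OF assms]]] unfolding gam_def[symmetric] by blast+

lemma gam_ratl: "g : carrier G ==> ratl I C f ==> ratl I C (%p. f (gam g p))" using gam(4) unfolding liftrel_def by blast

lemma gam_symf: assumes "g : carrier G" "symf f" shows "gen I C (%p. f (gam g p) = f p)"
proof -
 have "liftrel (psi g) f f" unfolding liftrel_def using psi_gal(3)[OF assms] symf_ratl[OF assms(2)] by simp
 then show ?thesis using liftrel_unique[OF gam(4)[OF assms(1) symf_ratl[OF assms(2)]]] by blast
qed

text \<open>The order is reversed because automorphisms act by precomposition: applying
  \<open>psi h\<close> and then \<open>psi g\<close> to \<open>f\<close> gives \<open>f\<close>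
  composed with \<open>gam h\<close> after \<open>gam g\<close>.\<close>

lemma gam_mult: assumes "g : carrier G" "h : carrier G" shows "gen I C (%p. gam (g \<otimes> h) p = gam h (gam g p))"
proof (rule maps_eq_gen)
 have gh: "g \<otimes> h : carrier G" using assms by simp
 show "gam (g \<otimes> h) p : C" if "p : C" for p by (rule gam(1)[OF gh that])
 show "gen I C (%p. P (gam (g \<otimes> h) p))" if "gen I C P" for P by (rule gam(3)[OF gh that])
 show "gam h (gam g p) : C" if "p : C" for p by (rule gam(1)[OF assms(2) gam(1)[OF assms(1) that]])
 show "gen I C (%p. P (gam h (gam g p)))" if "gen I C P" for P by (rule gam(3)[OF assms(1) gam(3)[OF assms(2) that]])
 fix f assume f: "ratl I C f"
 have "liftrel (psi (g \<otimes> h)) f (%p. f (gam (g \<otimes> h) p))" by (rule gam(4)[OF gh f])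
 moreover have "liftrel (psi (g \<otimes> h)) f (%p. f (gam h (gam g p)))" using gam(4)[OF assms(2) f] gam(4)[OF assms(1) gam_ratl[OF assms(2) f]] psi_mult[OF assms cls_carrier[OF f]]
  unfolding liftrel_def by simp
 ultimately show "gen I C (%p. f (gam (g \<otimes> h) p) = f (gam h (gam g p)))" by (rule liftrel_unique)
qed

text \<open>By multiplicativity \<open>psi \<one>\<close> is idempotent; being injective it is the
  identity on the function field.\<close>

lemma gam_one: "gen I C (%p. gam \<one> p = p)"
proof (rule maps_eq_gen)
 have o: "\<one> : carrier G" by simp
 show "gam \<one> p : C" if "p : C" for p by (rule gam(1)[OF o that])
 show "gen I C (%p. P (gam \<one> p))" if "gen I C P" for P by (rule gam(3)[OF o that])
 fix f assume f: "ratl I C f"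
 have inj: "inj_on (psi \<one>) (carrier L)" using bij_betwE[OF psi_bij] o unfolding galois_group_carrier bij_betw_def by blast
 have "psi \<one> (psi \<one> (cls I C f)) = psi \<one> (cls I C f)" using psi_mult[OF o o cls_carrier[OF f]] by simp
 then have "psi \<one> (cls I C f) = cls I C f" using inj_onD[OF inj] ring_hom_closed[OF psi_gal(1)[OF o] cls_carrier[OF f]] cls_carrier[OF f] by blast
 then have "liftrel (psi \<one>) f f" using f unfolding liftrel_def by simp
 then show "gen I C (%p. f (gam \<one> p) = f p)" using liftrel_unique[OF gam(4)[OF o f]] by blast
qed simp_all

lemma gam_inj:
 assumes "g : carrier G" "h : carrier G" "!!f. ratl I C f ==> gen I C (%p. f (gam g p) = f (gam h p))" shows "g = h"
proof -
 have "psi g = psi h"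
 proof (rule extensionalityI[OF psi_gal(2)[OF assms(1)] psi_gal(2)[OF assms(2)]])
  fix x assume "x : carrier L"
  then obtain f where f: "ratl I C f" "x = cls I C f" using carrierE by blast
  show "psi g x = psi h x" unfolding f(2) using gam(4)[OF assms(1) f(1)] gam(4)[OF assms(2) f(1)] cls_cong[OF assms(3)[OF f(1)]] unfolding liftrel_def by simp
 qed
 then show ?thesis using psi_bij assms(1,2) unfolding bij_betw_def inj_on_def by blast
qed

text \<open>An automorphism over the base field is determined by its effect on the finitely many
  affine coordinate functions, and each of these, being algebraic, has finitely many possible
  images.\<close>

lemma finite_G: "finite (carrier G)"
proof -
 let ?K = "cls I C ` {f. symf f}"
 obtain i0 where i0: "i0 : I" "gen I C (%q. rep q i0 ~= 0)" using affc_index by blast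
 let ?R = "%i. {sg (cls I C (affc i0 i)) | sg. sg : ring_hom L L & (ALL k:?K. sg k = k)}"
 let ?h = "%g. \<lambda>i\<in>I. psi g (cls I C (affc i0 i))"
 have alg: "ALL x:carrier L. L.algebraic ?K x" using galois unfolding galois_extension_def by blast
 have "finite (PiE I ?R)"
 proof (rule finite_PiE[OF finite_I])
  fix i assume "i : I"
  then have "cls I C (affc i0 i) : carrier L" by (intro cls_carrier affc_ratl[OF i0])
  then show "finite (?R i)" using alg by (intro finite_images[OF subfield_symf]) blast+
 qed
 moreover have "?h ` carrier G <= PiE I ?R"
 proof
  fix x assume "x : ?h ` carrier G"
  then obtain g where g: "x = ?h g" "g : carrier G" by (rule imageE)
  show "x : PiE I ?R" unfolding g(1) using psi_gal(1,3)[OF g(2)] by auto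
 qed
 ultimately have fin: "finite (?h ` carrier G)" by (rule rev_finite_subset)
 have "inj_on ?h (carrier G)"
 proof (rule inj_onI)
  fix g h assume gh: "g : carrier G" "h : carrier G" "?h g = ?h h"
  have e: "gen I C (%p. ALL i:I. affc i0 i (gam g p) = affc i0 i (gam h p))"
  proof (rule gen_ball[OF finite_I])
   fix i assume i: "i : I"
   have "psi g (cls I C (affc i0 i)) = psi h (cls I C (affc i0 i))" using fun_cong[OF gh(3), of i] i by simp
   then show "gen I C (%p. affc i0 i (gam g p) = affc i0 i (gam h p))" using gam(4)[OF gh(1) affc_ratl[OF i0 i]] gam(4)[OF gh(2) affc_ratl[OF i0 i]] cls_eq_iff unfolding liftrel_def by metis
  qed
  have eq: "gen I C (%p. gam g p = gam h p)" by (rule gen_mono3[OF e gam(3)[OF gh(1) i0(2)] gam(3)[OF gh(2) i0(2)]]) (use affc_point_eq gam(1) gh(1,2) in metis)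
  show "g = h" by (rule gam_inj[OF gh(1,2)]) (rule gen_mono[OF eq], simp)
 qed
 from finite_imageD[OF fin this] show ?thesis .
qed

lemma invariant_symf:
 assumes "ratl I C f" "!!g. g : carrier G ==> gen I C (%p. f (gam g p) = f p)" shows "symf f"
proof -
 let ?K = "cls I C ` {f. symf f}"
 have "sg (cls I C f) = cls I C f" if s: "sg : carrier (galois_group L ?K)" for sg
 proof -
  have "sg : psi ` carrier G" using psi_bij s unfolding bij_betw_def by simp
  then obtain g where g: "sg = psi g" "g : carrier G" by (rule imageE)
  have "psi g (cls I C f) = cls I C (%p. f (gam g p))" using gam(4)[OF g(2) assms(1)] unfolding liftrel_def by blast
  also have "... = cls I C f" by (rule cls_cong[OF assms(2)[OF g(2)]])
  finally show ?thesis unfolding g(1) .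
 qed
 then have "cls I C f : {x : carrier L. ALL sg:carrier (galois_group L ?K). sg x = x}" using cls_carrier[OF assms(1)] by blast
 then have "cls I C f : ?K" using galois unfolding galois_extension_def by simp
 then obtain h where h: "cls I C f = cls I C h" "symf h" by blast
 have "gen I C (%p. h p = f p)" using h(1) cls_eq_iff[OF symf_ratl[OF h(2)], of f] by simp
 then show ?thesis by (rule symf_cong[OF h(2)])
qed

end

section \<open>Symmetric functions\<close>

text \<open>Ryser's formula for the permanent.\<close>

lemma permanent_subsets:
 fixes M :: "nat => nat => 'k::comm_ring_1"
 assumes D: "finite D"
 shows "(\<Sum>s | s permutes D. PROD l:D. M (s l) l) = (SUM S:Pow D. (- 1) ^ card (D - S) * (PROD l:D. SUM i:S. M i l))"
proof -
 let ?F = "PiE D (%_. D)" and ?P = "%f. PROD l:D. M (f l) l"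
 have fF: "finite ?F" using D by (intro finite_PiE) auto
 \<comment> \<open>Inclusion and exclusion: applied with \<open>A\<close> the image of a map
   \<open>f\<close>, the alternating sum over the sets between \<open>A\<close> and \<open>D\<close>
   discards every map that is not onto.\<close>
 have alt: "(SUM S:{S. A <= S & S <= D}. (- 1 :: 'k) ^ card (D - S)) = (if A = D then 1 else 0)" if A: "A <= D" for A
 proof -
  have fA: "finite (D - A)" using D by simp
  have "(SUM S:{S. A <= S & S <= D}. (- 1 :: 'k) ^ card (D - S)) = (SUM R:Pow (D - A). (- 1) ^ card R)" by (rule sum.reindex_bij_witness[of _ "%R. D - R" "%S. D - S"]) (use A in auto)
  also have "... = (PROD x:D - A. (- 1) + 1)" unfolding prod_add[OF fA] by simp
  also have "... = (if D - A = {} then 1 else 0)" using fA by (simp add: power_0_left)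
  also have "... = (if A = D then 1 else 0)" using A by auto
  finally show ?thesis .
 qed
 have "(SUM S:Pow D. (- 1) ^ card (D - S) * (PROD l:D. SUM i:S. M i l))
   = (SUM S:Pow D. SUM f:?F. if f ` D <= S then (- 1) ^ card (D - S) * ?P f else 0)"
 proof (rule sum.cong[OF refl])
  fix S assume S: "S : Pow D"
  have "(PROD l:D. SUM i:S. M i l) = (SUM f:PiE D (%_. S). ?P f)" by (rule prod_sum_PiE[OF D]) (use S D finite_subset in auto)
  also have "PiE D (%_. S) = {f:?F. f ` D <= S}" using S by (auto simp: PiE_iff extensional_def)
  also have "(SUM f:{f:?F. f ` D <= S}. ?P f) = (SUM f:?F. if f ` D <= S then ?P f else 0)" by (rule sum.inter_filter[OF fF])
  finally show "(- 1) ^ card (D - S) * (PROD l:D. SUM i:S. M i l) = (SUM f:?F. if f ` D <= S then (- 1) ^ card (D - S) * ?P f else 0)" by (simp add: sum_distrib_left if_distrib[of "%x. _ * x"] cong: if_cong)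
 qed
 also have "... = (SUM f:?F. SUM S:Pow D. if f ` D <= S then (- 1) ^ card (D - S) * ?P f else 0)" by (rule sum.swap)
 also have "... = (SUM f:?F. if f ` D = D then ?P f else 0)"
 proof (rule sum.cong[OF refl])
  fix f assume f: "f : ?F"
  have fP: "finite (Pow D)" using D by simp
  have "(SUM S:Pow D. if f ` D <= S then (- 1) ^ card (D - S) * ?P f else 0)
   = (SUM S:{S:Pow D. f ` D <= S}. (- 1) ^ card (D - S) * ?P f)" by (rule sum.inter_filter[OF fP, symmetric])
  also have "{S:Pow D. f ` D <= S} = {S. f ` D <= S & S <= D}" by blast
  also have "(SUM S:{S. f ` D <= S & S <= D}. (- 1) ^ card (D - S) * ?P f) = (if f ` D = D then 1 else 0) * ?P f" unfolding sum_distrib_right[symmetric] using f by (subst alt) auto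
  finally show "(SUM S:Pow D. if f ` D <= S then (- 1) ^ card (D - S) * ?P f else 0) = (if f ` D = D then ?P f else 0)" by simp
 qed
 also have "... = (SUM f:{f:?F. f ` D = D}. ?P f)" by (rule sum.inter_filter[OF fF, symmetric])
 also have "... = (\<Sum>s | s permutes D. ?P s)"
 proof (rule sum.reindex_bij_witness[of _ "%s. restrict s D" "%f x. if x : D then f x else x"])
  fix f assume f: "f : {f:?F. f ` D = D}"
  then show "restrict (%x. if x : D then f x else x) D = f" by (auto simp: fun_eq_iff PiE_iff extensional_def)
  have im: "f ` D = D" using f by blast
  then have "inj_on f D" using D by (simp add: eq_card_imp_inj_on)
  then have "bij_betw f D D" using im by (simp add: bij_betw_def)
  then have "bij_betw (%x. if x : D then f x else x) D D" by (rule bij_betw_cong[THEN iffD1, rotated]) simp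
  then show "(%x. if x : D then f x else x) : {s. s permutes D}" by (simp add: bij_imp_permutes)
  show "?P (%x. if x : D then f x else x) = ?P f" by (rule prod.cong) auto
 next
  fix s assume s: "s : {s. s permutes D}"
  then show "(%x. if x : D then restrict s D x else x) = s" by (auto simp: fun_eq_iff permutes_not_in)
  show "restrict s D : {f:?F. f ` D = D}" using s permutes_image[of s D] permutes_in_image[of s D] by auto
 qed
 finally show ?thesis by simp
qed

text \<open>In the variable \<open>y 1 / y 0\<close> the form becomes a polynomial of degree at most
  \<open>n\<close>, which splits; homogenizing its factors gives the form where
  \<open>y 0 ~= 0\<close>. On \<open>y 0 = 0\<close> only the coefficient of \<open>y 1 ^ n\<close>
  survives on both sides.\<close>

lemma binary_form_factor:
 fixes F :: "(nat => 'k::alg_closed_field) => 'k"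
 assumes "hompf {..1} n F"
 shows "EX c al be. ALL y. F y = c * (PROD i<n. al i * y 0 + be i * y 1)"
proof -
 obtain S c where S: "finite S" "!!m. m : S ==> mkeys m <= {..1}" "!!m. m : S ==> mdeg m = n"
  "F = (%x. SUM m:S. c m * mval m x)" using hompf_repr[OF assms] by blast
 let ?e = "%m i. mlookup m (i::nat)"
 have set01: "{..1} = {0, 1::nat}" by auto
 have dg: "?e m 0 + ?e m 1 = n" if "m : S" for m using S(3)[OF that] mdeg_superset[of "{..1}" m] S(2)[OF that] unfolding set01 by simp
 have mv: "mval m y = y 0 ^ (n - ?e m 1) * y 1 ^ ?e m 1" if "m : S" for m and y :: "nat => 'k"
 proof -
  have "?e m 0 = n - ?e m 1" using dg[OF that] by simp
  moreover have "mval m y = y 0 ^ ?e m 0 * y 1 ^ ?e m 1" using mval_superset[of "{..1}" m y] S(2)[OF that] unfolding set01 by simp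
  ultimately show ?thesis by simp
 qed
 define q where "q = (SUM m:S. Polynomial.monom (c m) (?e m 1))"
 have Fq: "F y = y 0 ^ n * poly q (y 1 / y 0)" if "y 0 ~= 0" for y
 proof -
  have "F y = (SUM m:S. c m * (y 0 ^ (n - ?e m 1) * y 1 ^ ?e m 1))" unfolding S(4) by (rule sum.cong[OF refl]) (simp add: mv)
  also have "... = (SUM m:S. y 0 ^ n * (c m * (y 1 / y 0) ^ ?e m 1))"
  proof (rule sum.cong[OF refl])
   fix m assume m: "m : S"
   have "y 0 ^ n = y 0 ^ (n - ?e m 1) * y 0 ^ ?e m 1" using dg[OF m] by (metis add_diff_cancel_right' power_add)
   then show "c m * (y 0 ^ (n - ?e m 1) * y 1 ^ ?e m 1) = y 0 ^ n * (c m * (y 1 / y 0) ^ ?e m 1)" using that by (simp add: power_divide)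
  qed
  also have "... = y 0 ^ n * poly q (y 1 / y 0)" unfolding q_def by (simp add: poly_sum poly_monom sum_distrib_left)
  finally show ?thesis .
 qed
 have F0: "F y = pcoeff q n * y 1 ^ n" if "y 0 = 0" for y
 proof -
  have "F y = (SUM m:S. (if ?e m 1 = n then c m else 0) * y 1 ^ n)" unfolding S(4)
  proof (rule sum.cong[OF refl])
   fix m assume m: "m : S"
   show "c m * mval m y = (if ?e m 1 = n then c m else 0) * y 1 ^ n" using dg[OF m] unfolding mv[OF m] that by auto
  qed
  also have "... = pcoeff q n * y 1 ^ n" unfolding q_def by (simp add: coeff_sum sum_distrib_right)
  finally show ?thesis .
 qed
 have dq: "Polynomial.degree q <= n" unfolding q_def by (rule degree_sum_le[OF S(1)], rule order.trans[OF degree_monom_le]) (metis dg le_add2)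
 show ?thesis
 proof (cases "q = 0")
  case True
  have "F y = 0" for y using Fq[of y] F0[of y] True by (cases "y 0 = 0") simp_all
  then show ?thesis by (intro exI[of _ 0]) simp
 next
  case False
  obtain A where A: "size A = Polynomial.degree q" "q = psmult (Polynomial.lead_coeff q) (\<Prod>x\<in>#A. [:- x, 1:])" using alg_closed_imp_factorization[OF False] by blast
  obtain xs where xs: "mset xs = A" using ex_mset by blast
  let ?D = "Polynomial.degree q"
  have len: "length xs = ?D" using xs A(1) by (metis size_mset)
  have q2: "poly q x = Polynomial.lead_coeff q * (PROD i<?D. x - xs ! i)" for x
  proof -
   have "poly q x = Polynomial.lead_coeff q * poly (\<Prod>x\<in>#A. [:- x, 1:]) x" by (subst A(2)) simp
   also have "(\<Prod>x\<in>#A. [:- x, 1:]) = (\<Prod>x\<leftarrow>xs. [:- x, 1:])" unfolding xs[symmetric] by (simp flip: prod_mset_prod_list mset_map)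
   also have "poly (\<Prod>x\<leftarrow>xs. [:- x, 1:]) x = (PROD i<?D. x - xs ! i)" unfolding poly_prod_list by (simp add: prod.list_conv_set_nth len comp_def atLeast0LessThan poly_prod)
   finally show ?thesis .
  qed
  \<comment> \<open>Indices below the degree carry the finite roots; each of the remaining
    \<open>n - ?D\<close> indices carries a factor \<open>y 0\<close>, a root at infinity.\<close>
  let ?al = "%i. if i < ?D then - xs ! i else 1" and ?be = "%i. if i < ?D then 1 else 0"
  have split: "(PROD i<n. ?al i * y 0 + ?be i * y 1) = (PROD i<?D. y 1 - xs ! i * y 0) * y 0 ^ (n - ?D)" for y :: "nat => 'k"
  proof -
   have "(PROD i<n. ?al i * y 0 + ?be i * y 1) = (PROD i<?D. ?al i * y 0 + ?be i * y 1) * (PROD i=?D..<n. ?al i * y 0 + ?be i * y 1)"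
   using prod.atLeastLessThan_concat[OF le0 dq, of "%i. ?al i * y 0 + ?be i * y 1", symmetric] unfolding atLeast0LessThan .
   also have "(PROD i<?D. ?al i * y 0 + ?be i * y 1) = (PROD i<?D. y 1 - xs ! i * y 0)" by (rule prod.cong) auto
   also have "(PROD i=?D..<n. ?al i * y 0 + ?be i * y 1) = (PROD i=?D..<n. y 0)" by (rule prod.cong) auto
   finally show ?thesis by simp
  qed
  have "F y = Polynomial.lead_coeff q * (PROD i<n. ?al i * y 0 + ?be i * y 1)" for y
  proof (cases "y 0 = 0")
   case True
   show ?thesis
   proof (cases "?D = n")
   case D: True
   show ?thesis unfolding split F0[of y, OF True] D True by (simp add: D)
   next
   case D: False
   then have "?D < n" using dq by simp
   then show ?thesis unfolding split F0[of y, OF True] True by (auto simp: coeff_eq_0 intro!: bexI[of _ ?D])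
   qed
  next
   case y: False
   have "(PROD i<?D. y 1 / y 0 - xs ! i) = (PROD i<?D. (y 1 - xs ! i * y 0) / y 0)" by (rule prod.cong) (use y in "simp_all add: field_simps")
   also have "... = (PROD i<?D. y 1 - xs ! i * y 0) / y 0 ^ ?D" by (simp add: prod_dividef)
   finally have "(PROD i<?D. y 1 / y 0 - xs ! i) = (PROD i<?D. y 1 - xs ! i * y 0) / y 0 ^ ?D" .
   moreover have "y 0 ^ n = y 0 ^ (n - ?D) * y 0 ^ ?D" using dq by (metis le_add_diff_inverse2 power_add)
   ultimately show ?thesis unfolding split Fq[of y, OF y] q2 using y by simp
  qed
  then show ?thesis by (intro exI[of _ "Polynomial.lead_coeff q"] exI[of _ ?al] exI[of _ ?be] allI)
 qed
qed

lemma coeff_linear_mult: "pcoeff ([:a, b:] * q) k = a * pcoeff q k + (if k = 0 then 0 else b * pcoeff q (k - 1))"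
 for a :: "'k::comm_ring_1" by (cases k) (simp_all add: mult_pCons_left)

lemma degree_prod_linear: "finite B ==> Polynomial.degree (PROD h:B. [:f h, g h:] :: 'k::field poly) <= card B"
proof (induction B rule: finite_induct)
 case (insert h B)
 have "Polynomial.degree ([:f h, g h:] * (PROD h:B. [:f h, g h:])) <= Polynomial.degree [:f h, g h:] + Polynomial.degree (PROD h:B. [:f h, g h:])" by (rule degree_mult_le)
 also have "... <= 1 + card B" by (intro add_mono insert.IH) simp
 finally show ?case using insert.hyps by simp
qed simp

lemma poly_eq_sum: "Polynomial.degree q <= n ==> poly q x = (SUM k<=n. pcoeff q k * x ^ k)" for q :: "'k::comm_ring_1 poly" unfolding poly_altdef by (rule sum.mono_neutral_left) (auto simp: coeff_eq_0)

text \<open>The product over all points of a binary form is a form in the coefficients of the product of the linear polynomials,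
 since a binary form splits into linear factors.\<close>

lemma product_of_binary_form:
 fixes F :: "(nat => 'k::alg_closed_field) => 'k"
 assumes F: "hompf {..1} n F"
 shows "EX F'. hompf {..d} n F' & (ALL u0 u1. (PROD j=1..d. F (%k. if k = 0 then u0 j else u1 j)) = F' (pcoeff (PROD j=1..d. [:u0 j, u1 j:])))"
proof -
 obtain c al be where f: "!!y. F y = c * (PROD i<n. al i * y 0 + be i * y 1)" using binary_form_factor[OF F] by blast
 let ?E = "%i e. SUM k<=d. (al i ^ (d - k) * be i ^ k) * e k"
 let ?F' = "%e. c ^ d * (PROD i<n. ?E i e)"
 \<comment> \<open>Both sides are the homogenization of \<open>\<Prod>j. (u0 j + u1 j T)\<close> at
   \<open>(a, b)\<close>, so a product of linear forms over all points is linear in the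
   coefficients.\<close>
 have lin: "(PROD j=1..d. a * u0 j + b * u1 j) = (SUM k<=d. (a ^ (d - k) * b ^ k) * pcoeff (PROD j=1..d. [:u0 j, u1 j:]) k)"
  for a b :: 'k and u0 u1
 proof -
  have "(PROD j:B. a * u0 j + b * u1 j) = (SUM k<=card B. (a ^ (card B - k) * b ^ k) * pcoeff (PROD j:B. [:u0 j, u1 j:]) k)"
   if "finite B" for B :: "nat set" using that
  proof (induction B rule: finite_induct)
   case (insert j B)
   let ?q = "PROD j:B. [:u0 j, u1 j:]" and ?m = "card B"
   have z: "pcoeff ?q (Suc ?m) = 0" using degree_prod_linear[OF insert.hyps(1), of u0 u1] by (intro coeff_eq_0) simp
   have "(SUM k<=Suc ?m. (a ^ (Suc ?m - k) * b ^ k) * pcoeff ([:u0 j, u1 j:] * ?q) k)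
   = (SUM k<=Suc ?m. (a ^ (Suc ?m - k) * b ^ k) * (u0 j * pcoeff ?q k))
   + (SUM k<=Suc ?m. (a ^ (Suc ?m - k) * b ^ k) * (if k = 0 then 0 else u1 j * pcoeff ?q (k - 1)))" unfolding coeff_linear_mult by (simp only: distrib_left sum.distrib)
   also have "(SUM k<=Suc ?m. (a ^ (Suc ?m - k) * b ^ k) * (u0 j * pcoeff ?q k)) = (SUM k<=?m. (a ^ (Suc ?m - k) * b ^ k) * (u0 j * pcoeff ?q k))" by (simp add: z)
   also have "... = a * u0 j * (SUM k<=?m. (a ^ (?m - k) * b ^ k) * pcoeff ?q k)" unfolding sum_distrib_left by (rule sum.cong[OF refl]) (simp add: Suc_diff_le)
   also have "(SUM k<=Suc ?m. (a ^ (Suc ?m - k) * b ^ k) * (if k = 0 then 0 else u1 j * pcoeff ?q (k - 1)))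
   = (SUM k<=?m. (a ^ (?m - k) * b ^ Suc k) * (u1 j * pcoeff ?q k))" by (subst sum.atMost_Suc_shift) simp
   also have "... = b * u1 j * (SUM k<=?m. (a ^ (?m - k) * b ^ k) * pcoeff ?q k)" unfolding sum_distrib_left by (rule sum.cong[OF refl]) simp
   finally show ?case using insert.hyps insert.IH by (simp add: distrib_right)
  qed simp
  from this[of "{1..d}"] show ?thesis by simp
 qed
 have "hompf {..d} (SUM i<n. 1) (%e. PROD i<n. ?E i e)" by (intro hompf_prod hompf_sum hompf_cmult hompf_coord) simp
 then have "hompf {..d} n ?F'" by (intro hompf_cmult) simp
 moreover have "(PROD j=1..d. F (%k. if k = 0 then u0 j else u1 j)) = ?F' (pcoeff (PROD j=1..d. [:u0 j, u1 j:]))" for u0 u1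
 proof -
  have "(PROD j=1..d. F (%k. if k = 0 then u0 j else u1 j)) = c ^ d * (PROD j=1..d. PROD i<n. al i * u0 j + be i * u1 j)" unfolding f by (simp add: prod.distrib)
  also have "(PROD j=1..d. PROD i<n. al i * u0 j + be i * u1 j) = (PROD i<n. PROD j=1..d. al i * u0 j + be i * u1 j)" by (rule prod.swap)
  finally show ?thesis unfolding lin .
 qed
 ultimately show ?thesis by blast
qed

section \<open>The wreath product\<close>

lemma wreath_carrier: "(a, s) : carrier (wreath_sym G d) \<longleftrightarrow> a : PiE {1..d} (%_. carrier G) & s permutes {1..d}" by (simp add: wreath_sym_def semidirect_product_def sym_group_def)

lemma wreath_mult: "(a, s) \<otimes>\<^bsub>wreath_sym G d\<^esub> (b, t) = ((\<lambda>j\<in>{1..d}. a j \<otimes>\<^bsub>G\<^esub> b (inv' s j)), s \<circ> t)"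
 by (auto simp: wreath_sym_def semidirect_product_def sym_group_def permute_factors_def fun_eq_iff)

lemma wreath_one: "\<one>\<^bsub>wreath_sym G d\<^esub> = ((\<lambda>j\<in>{1..d}. \<one>\<^bsub>G\<^esub>), id)" by (simp add: wreath_sym_def semidirect_product_def sym_group_def)

lemma group_wreath:
 assumes "group G" shows "group (wreath_sym G d)"
proof -
 interpret G: group G by fact
 let ?D = "{1..d}"
 have pin: "inv' s j : ?D" if "s permutes ?D" "j : ?D" for s j using permutes_inv[OF that(1)] that(2) by (simp only: permutes_in_image)
 show ?thesis
 proof (rule groupI)
  show "\<one>\<^bsub>wreath_sym G d\<^esub> : carrier (wreath_sym G d)" unfolding wreath_one wreath_carrier using permutes_id by auto
  fix x y assume "x : carrier (wreath_sym G d)" "y : carrier (wreath_sym G d)"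
  then obtain a s b t where x: "x = (a, s)" "a : PiE ?D (%_. carrier G)" "s permutes ?D"
   and y: "y = (b, t)" "b : PiE ?D (%_. carrier G)" "t permutes ?D" by (metis surj_pair wreath_carrier)
  have "a j \<otimes>\<^bsub>G\<^esub> b (inv' s j) : carrier G" if "j : ?D" for j by (intro G.m_closed PiE_mem[OF x(2) that] PiE_mem[OF y(2) pin[OF x(3) that]])
  then show "x \<otimes>\<^bsub>wreath_sym G d\<^esub> y : carrier (wreath_sym G d)" unfolding x(1) y(1) wreath_mult wreath_carrier using permutes_compose[OF y(3) x(3)] by auto
  fix z assume "z : carrier (wreath_sym G d)"
  then obtain c r where z: "z = (c, r)" "c : PiE ?D (%_. carrier G)" "r permutes ?D" by (metis surj_pair wreath_carrier)
  have io: "inv' (s \<circ> t) j = inv' t (inv' s j)" for j using o_inv_distrib[OF permutes_bij[OF x(3)] permutes_bij[OF y(3)]] by simp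
  have "(\<lambda>j\<in>?D. (\<lambda>j\<in>?D. a j \<otimes>\<^bsub>G\<^esub> b (inv' s j)) j \<otimes>\<^bsub>G\<^esub> c (inv' (s \<circ> t) j))
   = (\<lambda>j\<in>?D. a j \<otimes>\<^bsub>G\<^esub> (\<lambda>j\<in>?D. b j \<otimes>\<^bsub>G\<^esub> c (inv' t j)) (inv' s j))"
  proof (rule restrict_ext)
   fix j assume j: "j : ?D"
   have "a j : carrier G" "b (inv' s j) : carrier G" "c (inv' t (inv' s j)) : carrier G" by (intro PiE_mem[OF x(2) j] PiE_mem[OF y(2) pin[OF x(3) j]] PiE_mem[OF z(2) pin[OF y(3) pin[OF x(3) j]]])+
   then show "(\<lambda>j\<in>?D. a j \<otimes>\<^bsub>G\<^esub> b (inv' s j)) j \<otimes>\<^bsub>G\<^esub> c (inv' (s \<circ> t) j) = a j \<otimes>\<^bsub>G\<^esub> (\<lambda>j\<in>?D. b j \<otimes>\<^bsub>G\<^esub> c (inv' t j)) (inv' s j)"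
   unfolding io restrict_apply'[OF j] restrict_apply'[OF pin[OF x(3) j]] by (rule G.m_assoc)
  qed
  then show "x \<otimes>\<^bsub>wreath_sym G d\<^esub> y \<otimes>\<^bsub>wreath_sym G d\<^esub> z = x \<otimes>\<^bsub>wreath_sym G d\<^esub> (y \<otimes>\<^bsub>wreath_sym G d\<^esub> z)"
   unfolding x(1) y(1) z(1) wreath_mult by (simp only: o_assoc)
 next
  fix x assume "x : carrier (wreath_sym G d)"
  then obtain a s where x: "x = (a, s)" "a : PiE ?D (%_. carrier G)" "s permutes ?D" by (metis surj_pair wreath_carrier)
  have "(\<lambda>j\<in>?D. (\<lambda>j\<in>?D. \<one>\<^bsub>G\<^esub>) j \<otimes>\<^bsub>G\<^esub> a (inv' id j)) = a"
  proof (rule extensionalityI[of _ ?D])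
   fix j assume "j : ?D"
   then show "(\<lambda>j\<in>?D. (\<lambda>j\<in>?D. \<one>\<^bsub>G\<^esub>) j \<otimes>\<^bsub>G\<^esub> a (inv' id j)) j = a j" using PiE_mem[OF x(2)] by simp
  qed (use x(2) in "auto simp: PiE_def")
  then show "\<one>\<^bsub>wreath_sym G d\<^esub> \<otimes>\<^bsub>wreath_sym G d\<^esub> x = x" unfolding x(1) wreath_one wreath_mult by simp
  \<comment> \<open>In the product of \<open>(?b, inv' s)\<close> and \<open>(a, s)\<close> the
    entry of \<open>a\<close> is read at \<open>inv' (inv' s) j\<close>, that is at
    \<open>s j\<close>.\<close>
  let ?b = "\<lambda>j\<in>?D. inv\<^bsub>G\<^esub> (a (s j))"
  have sin: "s j : ?D" if "j : ?D" for j using that x(3) by (simp only: permutes_in_image)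
  have b: "?b : PiE ?D (%_. carrier G)"
  proof (rule restrict_PiE_iff[THEN iffD2], rule ballI)
   fix j assume "j : ?D"
   then show "inv\<^bsub>G\<^esub> (a (s j)) : carrier G" by (intro G.inv_closed PiE_mem[OF x(2)] sin)
  qed
  have "(\<lambda>j\<in>?D. ?b j \<otimes>\<^bsub>G\<^esub> a (inv' (inv' s) j)) = (\<lambda>j\<in>?D. \<one>\<^bsub>G\<^esub>)"
  proof (rule restrict_ext)
   fix j assume j: "j : ?D"
   show "?b j \<otimes>\<^bsub>G\<^esub> a (inv' (inv' s) j) = \<one>\<^bsub>G\<^esub>" unfolding permutes_inv_inv[OF x(3)] restrict_apply'[OF j] by (rule G.l_inv[OF PiE_mem[OF x(2) sin[OF j]]])
  qed
  then have "(?b, inv' s) \<otimes>\<^bsub>wreath_sym G d\<^esub> x = \<one>\<^bsub>wreath_sym G d\<^esub>" unfolding x(1) wreath_one wreath_mult using permutes_inv_o(2)[OF x(3)] by simp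
  moreover have "(?b, inv' s) : carrier (wreath_sym G d)" unfolding wreath_carrier using b permutes_inv[OF x(3)] by blast
  ultimately show "EX y:carrier (wreath_sym G d). y \<otimes>\<^bsub>wreath_sym G d\<^esub> x = \<one>\<^bsub>wreath_sym G d\<^esub>" by blast
 qed
qed

lemma finite_wreath: "finite (carrier G) ==> finite (carrier (wreath_sym G d))"
proof -
 assume "finite (carrier G)"
 then have "finite (PiE {1..d} (%_. carrier G) \<times> {s. s permutes {1..d}})" by (intro finite_cartesian_product finite_PiE finite_permutations) simp_all
 moreover have "carrier (wreath_sym G d) <= PiE {1..d} (%_. carrier G) \<times> {s. s permutes {1..d}}" by (auto simp: wreath_sym_def semidirect_product_def sym_group_def)
 ultimately show ?thesis by (rule rev_finite_subset)
qed

section \<open>Products of generic functions and a uniform choice from a finite family\<close>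

context proj_variety
begin

lemma ratl_coeff_prod:
 "finite B ==> (!!h. h : B ==> ratl I V (f h)) ==> (!!h. h : B ==> ratl I V (g h)) ==>
  ratl I V (%p. pcoeff (PROD h:B. [:f h p, g h p:]) k)"
proof (induction B arbitrary: k rule: finite_induct)
 case empty
 then show ?case by (cases k) (simp_all add: ratl_const)
next
 case (insert h B)
 show ?case
 proof (cases "k = 0")
  case True
  then show ?thesis using insert by (simp add: coeff_linear_mult ratl_mult)
 next
  case False
  have "ratl I V (%p. f h p * pcoeff (PROD h:B. [:f h p, g h p:]) k + g h p * pcoeff (PROD h:B. [:f h p, g h p:]) (k - 1))" using insert by (intro ratl_add ratl_mult) auto
  then show ?thesis using False insert.hyps by (simp add: coeff_linear_mult del: mult_pCons_left)
 qed
qed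

lemma gen_prod_zero:
 "finite B ==> (!!h. h : B ==> ratl I V (f h)) ==> gen I V (%p. (PROD h:B. f h p) = 0) ==> EX h:B. gen I V (%p. f h p = 0)"
proof -
 assume B: "finite B" "!!h. h : B ==> ratl I V (f h)" "gen I V (%p. (PROD h:B. f h p) = 0)"
 show ?thesis
 proof (rule ccontr)
  assume n: "~ ?thesis"
  have "gen I V (%p. ALL h:B. f h p ~= 0)"
  proof (rule gen_ball[OF B(1)])
   fix h assume "h : B"
   then show "gen I V (%p. f h p ~= 0)" using n B(2) ratl_zero_or_nonzero by blast
  qed
  from gen_mono2[OF this B(3), of "%_. False"] show False using B(1) by auto
 qed
qed

text \<open>A vector space over an infinite field is not a finite union of proper subspaces: evaluate along the curve
 `(1, x, x ^ 2, ...)` and use that Vandermonde determinants do not vanish.\<close>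

lemma uniform_choice:
 assumes H: "finite H" and lin: "!!f g h. ratl I V f ==> h : H ==> ratl I V (T h f)"
  and inf: "infinite (UNIV :: 'k set)"
  and sum: "!!h M (c :: nat => 'k) F. h : H ==> (!!i. ratl I V (F i)) ==>
   gen I V (%p. T h (%p. SUM i<M. c i * F i p) p = (SUM i<M. c i * T h (F i) p))"
  and each: "!!f. ratl I V f ==> EX h:H. gen I V (%p. T h f p = 0)"
 shows "EX h:H. ALL f. ratl I V f --> gen I V (%p. T h f p = 0)"
proof (rule ccontr)
 assume "~ ?thesis"
 then have "ALL h:H. EX f. ratl I V f & ~ gen I V (%p. T h f p = 0)" by blast
 from bchoice[OF this] obtain F where F: "ALL h:H. ratl I V (F h) & ~ gen I V (%p. T h (F h) p = 0)" ..
 define M where "M = card H"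
 obtain e where e: "bij_betw e {..<M} H" using ex_bij_betw_nat_finite[OF H] unfolding M_def atLeast0LessThan by blast
 define E where "E i = (if i < M then F (e i) else (%_. 0))" for i
 have eH: "e i : H" if "i < M" for i using bij_betwE[OF e] that by blast
 have rE: "ratl I V (E i)" for i using F eH[of i] by (simp add: E_def ratl_const)
 have "ALL s::'k. EX h. h : H & gen I V (%p. T h (%p. SUM i<M. s ^ i * E i p) p = 0)"
 proof
  fix s :: 'k
  have "ratl I V (%p. SUM i<M. s ^ i * E i p)" by (intro ratl_sum ratl_mult ratl_const rE)
  from each[OF this] show "EX h. h : H & gen I V (%p. T h (%p. SUM i<M. s ^ i * E i p) p = 0)" by blast
 qed
 from choice[OF this] obtain h where h0: "ALL s. h s : H & gen I V (%p. T (h s) (%p. SUM i<M. s ^ i * E i p) p = 0)" ..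
 have h: "h s : H" "gen I V (%p. T (h s) (%p. SUM i<M. s ^ i * E i p) p = 0)" for s using spec[OF h0, of s] by (rule conjunct1, rule conjunct2)
 have "finite (h ` UNIV)" by (rule finite_subset[OF _ H]) (use h(1) in blast)
 \<comment> \<open>Each parameter \<open>s\<close> is served by some element of the finite set
   \<open>H\<close>, so one element serves infinitely many parameters. \<open>M\<close> of them
   suffice, because the polynomial with coefficients \<open>?D i p\<close> has degree below
   \<open>M\<close>.\<close>
 from pigeonhole_infinite[OF inf this] obtain s0 where s0: "infinite {s. h s = h s0}" by auto
 obtain S where S: "finite S" "card S = M" "S <= {s. h s = h s0}" using infinite_arbitrarily_large[OF s0] by blast
 let ?D = "%i. T (h s0) (E i)"
 have "gen I V (%p. ALL s:S. (SUM i<M. s ^ i * ?D i p) = 0)"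
 proof (rule gen_ball[OF S(1)])
  fix s assume "s : S"
  then have hs: "h s = h s0" using S(3) by blast
  have 1: "gen I V (%p. T (h s0) (%p. SUM i<M. s ^ i * E i p) p = 0)" using h(2)[of s] unfolding hs .
  show "gen I V (%p. (SUM i<M. s ^ i * ?D i p) = 0)"
  proof (rule gen_mono2[OF 1 sum[OF h(1)[of s0], of E "%i. s ^ i" M, OF rE]])
   fix q assume a: "T (h s0) (%p. SUM i<M. s ^ i * E i p) q = 0" and b: "T (h s0) (%p. SUM i<M. s ^ i * E i p) q = (SUM i<M. s ^ i * ?D i q)"
   show "(SUM i<M. s ^ i * ?D i q) = 0" by (rule trans[OF sym[OF b] a])
  qed
 qed
 then have "gen I V (%p. ALL i<M. ?D i p = 0)"
 proof (rule gen_mono)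
  fix p assume p: "ALL s:S. (SUM i<M. s ^ i * ?D i p) = 0"
  let ?q = "SUM i<M. Polynomial.monom (?D i p) i"
  have ev: "poly ?q s = (SUM i<M. s ^ i * ?D i p)" for s by (simp add: poly_sum poly_monom mult.commute)
  have "?q = 0"
  proof (rule ccontr)
   assume q: "?q ~= 0"
   then have M0: "M > 0" by (cases M) auto
   have "card S <= card {x. poly ?q x = 0}" by (rule card_mono[OF poly_roots_finite[OF q]]) (use p ev in auto)
   also have "... <= Polynomial.degree ?q" by (rule card_poly_roots_bound[OF q])
   also have "... <= M - 1" by (rule degree_sum_le) (auto intro: order.trans[OF degree_monom_le])
   finally have "M <= M - 1" unfolding S(2) .
   then show False using M0 by linarith
  qed
  note q0 = this
  show "ALL i<M. ?D i p = 0"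
  proof (intro allI impI)
   fix i assume i: "i < M"
   have "?D i p = (SUM l<M. if l = i then ?D l p else 0)" using i by (subst sum.delta) simp_all
   also have "... = pcoeff ?q i" unfolding coeff_sum coeff_monom ..
   also have "... = 0" unfolding q0 by (rule coeff_0)
   finally show "?D i p = 0" .
  qed
 qed
 note G = this
 obtain i where i: "i < M" "e i = h s0" using e h(1)[of s0] unfolding bij_betw_def by (metis imageE lessThan_iff)
 have "gen I V (%p. T (h s0) (E i) p = 0)" by (rule gen_mono[OF G], drule spec[of _ i], erule mp) (rule i(1))
 moreover have "E i = F (h s0)" using i by (simp add: E_def)
 ultimately show False using F h(1)[of s0] by simp
qed

end

section \<open>The Galois group of the power\<close>

lemma (in group) bij_betw_left_mult: "h : carrier G ==> bij_betw (%g. h \<otimes> g) (carrier G) (carrier G)" by (rule bij_betw_byWitness[where f' = "%g. inv h \<otimes> g"]) (auto simp: m_assoc[symmetric])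

lemma monic_prod_linear:
 "finite B ==> pcoeff (PROD h:B. [:f h, 1:] :: 'k::field poly) (card B) = 1"
proof (induction B rule: finite_induct)
 case (insert x B)
 have "pcoeff (PROD h:B. [:f h, 1:]) (Suc (card B)) = 0" by (rule coeff_eq_0) (use degree_prod_linear[OF insert.hyps(1), of f "%_. 1"] in linarith)
 then show ?case using insert by (simp add: coeff_linear_mult del: mult_pCons_left)
qed simp

lemma (in proj_variety) eval_cls:
 assumes "!!k. ratl I V (e k)" "ratl I V f"
 shows "L.eval (map (%k. cls I V (e k)) (rev [0..<n])) (cls I V f) = cls I V (%p. SUM k<n. e k p * f p ^ k)"
proof (induction n)
 case 0
 then show ?case by (simp add: zero_L)
next
 case (Suc n)
 have r: "ratl I V (%p. SUM k<n. e k p * f p ^ k)" by (intro ratl_sum ratl_mult ratl_power assms)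
 have "L.eval (map (%k. cls I V (e k)) (rev [0..<Suc n])) (cls I V f) =
   cls I V (e n) \<otimes>\<^bsub>L\<^esub> cls I V f [^]\<^bsub>L\<^esub> n \<oplus>\<^bsub>L\<^esub> cls I V (%p. SUM k<n. e k p * f p ^ k)" using Suc.IH by simp
 also have "... = cls I V (%p. e n p * f p ^ n + (SUM k<n. e k p * f p ^ k))"
  by (simp only: pow_cls[OF assms(2)] mult_cls[OF assms(1) ratl_power[OF assms(2)]] add_cls[OF ratl_mult[OF assms(1) ratl_power[OF assms(2)]] r])
 also have "... = cls I V (%p. SUM k<Suc n. e k p * f p ^ k)" by (simp only: sum.lessThan_Suc add.commute)
 finally show ?case .
qed

text \<open>\<open>PV_t\<close> says that the projection of the power is the \<open>d\<close>-fold
  product of the projection of the curve followed by the symmetric quotient, whose coordinates are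
  polynomial coefficients. \<open>nonconst\<close> says that \<open>t 0\<close> and
  \<open>t 1\<close> are linearly independent over the ground field.\<close>

locale power_galois = segre_power I C d +
  PC: galois_projection I C Jc 1 lc bc phic sgc G psi +
  PV: projected_variety "power_index I d" "variety_power I C d" Jv d lv bv phiv sgv
 for I :: "'i set" and C :: "('i, 'k::{alg_closed_field, field_char_0}) point set" and d
  and Jc lc bc phic sgc and G :: "'g monoid" (structure) and psi Jv lv bv phiv sgv +
 assumes PV_t: "gen (power_index I d) (variety_power I C d) (%p. ALL k<=d. PV.t k p =
   pcoeff (PROD j=1..d. [:PC.t 0 (co I d p j), PC.t 1 (co I d p j):]) k)"
  and nonconst: "!!al be. (al, be) ~= (0, 0) ==> gen I C (%x. al * PC.t 0 x + be * PC.t 1 x ~= 0)"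
begin

abbreviation "Wr == carrier (wreath_sym G d)"
abbreviation "LV == funfield A V"
abbreviation "KV == cls A V ` {f. PV.symf f}"

abbreviation "WG == wreath_sym G d"
abbreviation "tlin p j == [:PC.t 0 (co I d p j), PC.t 1 (co I d p j):]"

text \<open>Coordinate \<open>j\<close> of the image is read at \<open>snd x j\<close>, without an
  inverse. Then \<open>tau\<close> of a product of \<open>x\<close> and \<open>y\<close> is
  \<open>tau y\<close> after \<open>tau x\<close>, and precomposition with \<open>tau\<close>
  becomes a homomorphism for the multiplication of \<open>wreath_sym\<close>.\<close>

definition tau :: "(nat => 'g) \<times> (nat => nat) => (nat => 'i, 'k) point => (nat => 'i, 'k) point" where
 "tau x p = mk I d (%j. PC.gam (fst x (snd x j)) (co I d p (snd x j)))"

interpretation W: group "WG" by (rule group_wreath) (rule PC.G.is_group)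

lemma fin_Wr: "finite Wr" by (rule finite_wreath[OF PC.finite_G])

lemma wr:
 assumes "x : Wr"
 shows "snd x permutes {1..d}" "!!j. j : {1..d} ==> snd x j : {1..d}" "!!j. j : {1..d} ==> fst x j : carrier G"
proof -
 have "(fst x, snd x) : Wr" using assms by simp
 then have a: "fst x : PiE {1..d} (%_. carrier G)" "snd x permutes {1..d}" unfolding wreath_carrier by (rule conjunct1, rule conjunct2)
 show "snd x permutes {1..d}" by (rule a(2))
 show "snd x j : {1..d}" if "j : {1..d}" for j using permutes_in_image[OF a(2), of j] that by blast
 show "fst x j : carrier G" if "j : {1..d}" for j using PiE_mem[OF a(1) that] .
qed

lemma gam_co_in: "x : Wr ==> p : V ==> ALL j:{1..d}. PC.gam (fst x (snd x j)) (co I d p (snd x j)) : C"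
proof
 fix j assume a: "x : Wr" "p : V" "j : {1..d}"
 show "PC.gam (fst x (snd x j)) (co I d p (snd x j)) : C" by (rule PC.gam(1)[OF wr(3)[OF a(1) wr(2)[OF a(1,3)]] co_in_C[OF a(2) wr(2)[OF a(1,3)]]])
qed

lemma tau_in: "x : Wr ==> p : V ==> tau x p : V" unfolding tau_def by (rule mk_in_V[OF gam_co_in])

lemma co_tau: "x : Wr ==> p : V ==> j : {1..d} ==> co I d (tau x p) j = PC.gam (fst x (snd x j)) (co I d p (snd x j))" unfolding tau_def by (rule co_mk[OF gam_co_in])

lemma tau_rmap_at:
 assumes x: "x : Wr" and p: "p : V" and r: "ALL j:{1..d}. rmap_at I C I (PC.gam (fst x (snd x j))) (co I d p (snd x j))"
 shows "rmap_at A V A (tau x) p"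
proof -
 have e: "tau x = (%q. mk I d (%j. PC.gam (fst x (snd x j)) (co I d q (snd x j))))" by (rule ext) (simp only: tau_def)
 show ?thesis unfolding e
 proof (rule rmap_mk[OF p])
  fix j assume j: "j : {1..d}"
  have Cp: "C <= pspace I" using C.in_proj by blast
  show "rmap_at A V I (%q. PC.gam (fst x (snd x j)) (co I d q (snd x j))) p" by (rule rmap_compose[OF rmap_co[OF p wr(2)[OF x j]] co_in_C[OF _ wr(2)[OF x j]] Cp bspec[OF r j]])
 qed
qed

text \<open>Each factor of the map is a dominant self-map of the curve. This yields coordinates at
  which all factors are regular and whose images lie in the given open set; rearranged by the
  inverse permutation they form a point near which the statement pulls back.\<close>

lemma tau_gen:
 assumes x: "x : Wr" and P: "gen A V P" shows "gen A V (%p. P (tau x p))"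
proof -
 let ?g = "%j. PC.gam (fst x (snd x j))"
 have g: "fst x (snd x j) : carrier G" if "j : {1..d}" for j by (rule wr(3)[OF x wr(2)[OF x that]])
 obtain y where y: "ALL j:{1..d}. y j : C & rmap_at I C I (?g j) (y j) & ?g j (y j) : C" "near A V (mk I d (%j. ?g j (y j))) P"
 proof (rule gen_power_dominant[OF P, of "%j. rmap_at I C I (?g j)" ?g])
  show "gen I C (rmap_at I C I (?g j))" if "j : {1..d}" for j using PC.gam(2)[OF g[OF that]] .
  show "gen I C (%z. Q (?g j z))" if "j : {1..d}" "gen I C Q" for j Q using PC.gam(3)[OF g[OF that(1)] that(2)] .
  show "gen I C (%z. ?g j z : C)" if "j : {1..d}" for j by (rule C.gen_all) (rule PC.gam(1)[OF g[OF that]])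
 qed
 define q where "q = mk I d (%l. y (inv' (snd x) l))"
 have yi: "ALL l:{1..d}. y (inv' (snd x) l) : C"
 proof
  fix l assume l: "l : {1..d}"
  have "inv' (snd x) l : {1..d}" using permutes_in_image[OF permutes_inv[OF wr(1)[OF x]], of l] l by blast
  then show "y (inv' (snd x) l) : C" using y(1) by blast
 qed
 have qV: "q : V" unfolding q_def by (rule mk_in_V[OF yi])
 have coq: "co I d q (snd x j) = y j" if "j : {1..d}" for j unfolding q_def co_mk[OF yi wr(2)[OF x that]] permutes_inverses(2)[OF wr(1)[OF x]] ..
 have r: "rmap_at A V A (tau x) q"
 proof (rule tau_rmap_at[OF x qV])
  show "ALL j:{1..d}. rmap_at I C I (?g j) (co I d q (snd x j))"
  proof
   fix j assume j: "j : {1..d}"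
   show "rmap_at I C I (?g j) (co I d q (snd x j))" unfolding coq[OF j] using y(1) j by blast
  qed
 qed
 have tq: "tau x q = mk I d (%j. ?g j (y j))" unfolding tau_def by (rule mk_cong) (simp only: coq)
 have "near A V q (%p. P (tau x p))" by (rule rmap_near[OF r tau_in[OF x] V_subset_proj]) (assumption, unfold tq, rule y(2))
 then show ?thesis by (rule V.near_gen)
qed

lemma tau_rmap: assumes x: "x : Wr" shows "gen A V (rmap_at A V A (tau x))"
proof -
 have "gen A V (%p. ALL j:{1..d}. rmap_at I C I (PC.gam (fst x (snd x j))) (co I d p (snd x j)))"
 proof (rule V.gen_ball[OF finite_atLeastAtMost])
  fix j assume j: "j : {1..d}"
  show "gen A V (%p. rmap_at I C I (PC.gam (fst x (snd x j))) (co I d p (snd x j)))" by (rule gen_co[OF PC.gam(2)[OF wr(3)[OF x wr(2)[OF x j]]] wr(2)[OF x j]])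
 qed
 then show ?thesis by (rule V.gen_mono) (rule tau_rmap_at[OF x])
qed

lemma tau_ratl: assumes x: "x : Wr" and f: "ratl A V f" shows "ratl A V (%p. f (tau x p))"
proof (rule V.gen_ratl, rule V.gen_mono2[OF tau_rmap[OF x] tau_gen[OF x V.ratl_gen[OF f]]])
 fix p assume r: "rmap_at A V A (tau x) p" "rg A V (tau x p) f"
 show "rg A V p (%p. f (tau x p))" by (rule rmap_rg[OF r(1) tau_in[OF x] V_subset_proj r(2)])
qed

lemma tau_mult:
 assumes x: "x : Wr" and y: "y : Wr"
 shows "gen A V (%p. tau (x \<otimes>\<^bsub>WG\<^esub> y) p = tau y (tau x p))"
proof -
 let ?l = "%j. snd x (snd y j)"
 have z: "x \<otimes>\<^bsub>WG\<^esub> y = ((\<lambda>j\<in>{1..d}. fst x j \<otimes> fst y (inv' (snd x) j)), snd x \<circ> snd y)"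
  using wreath_mult[where a = "fst x" and s = "snd x" and b = "fst y" and t = "snd y" and G = G and d = d] by simp
 have l: "?l j : {1..d}" if "j : {1..d}" for j by (rule wr(2)[OF x wr(2)[OF y that]])
 have "gen A V (%p. ALL j:{1..d}. PC.gam (fst x (?l j) \<otimes> fst y (snd y j)) (co I d p (?l j)) =
   PC.gam (fst y (snd y j)) (PC.gam (fst x (?l j)) (co I d p (?l j))))"
 proof (rule V.gen_ball[OF finite_atLeastAtMost])
  fix j assume j: "j : {1..d}"
  show "gen A V (%p. PC.gam (fst x (?l j) \<otimes> fst y (snd y j)) (co I d p (?l j)) =
   PC.gam (fst y (snd y j)) (PC.gam (fst x (?l j)) (co I d p (?l j))))" by (rule gen_co[OF PC.gam_mult[OF wr(3)[OF x l[OF j]] wr(3)[OF y wr(2)[OF y j]]] l[OF j]])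
 qed
 then show ?thesis
 proof (rule V.gen_mono)
  fix p assume p: "p : V" and g: "ALL j:{1..d}. PC.gam (fst x (?l j) \<otimes> fst y (snd y j)) (co I d p (?l j)) =
   PC.gam (fst y (snd y j)) (PC.gam (fst x (?l j)) (co I d p (?l j)))"
  show "tau (x \<otimes>\<^bsub>WG\<^esub> y) p = tau y (tau x p)" unfolding tau_def[of y] tau_def[of "x \<otimes>\<^bsub>WG\<^esub> y"] unfolding z fst_conv snd_conv
  proof (rule mk_cong)
   fix j assume j: "j : {1..d}"
   have 1: "(\<lambda>j\<in>{1..d}. fst x j \<otimes> fst y (inv' (snd x) j)) ((snd x \<circ> snd y) j) = fst x (?l j) \<otimes> fst y (snd y j)"
   using l[OF j] by (simp add: permutes_inverses(2)[OF wr(1)[OF x]])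
   show "PC.gam ((\<lambda>j\<in>{1..d}. fst x j \<otimes> fst y (inv' (snd x) j)) ((snd x \<circ> snd y) j)) (co I d p ((snd x \<circ> snd y) j)) =
   PC.gam (fst y (snd y j)) (co I d (tau x p) (snd y j))" unfolding o_apply 1[unfolded o_apply] co_tau[OF x p wr(2)[OF y j]] by (rule bspec[OF g j])
  qed
 qed
qed

lemma tau_one: "gen A V (%p. tau \<one>\<^bsub>WG\<^esub> p = p)"
proof -
 have "gen A V (%p. ALL j:{1..d}. PC.gam \<one> (co I d p j) = co I d p j)" by (rule V.gen_ball[OF finite_atLeastAtMost]) (rule gen_co[OF PC.gam_one])
 then show ?thesis
 proof (rule V.gen_mono)
  fix p assume p: "p : V" and g: "ALL j:{1..d}. PC.gam \<one> (co I d p j) = co I d p j"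
  have "tau \<one>\<^bsub>WG\<^esub> p = mk I d (co I d p)" unfolding tau_def wreath_one fst_conv snd_conv
  proof (rule mk_cong)
   fix j assume j: "j : {1..d}"
   show "PC.gam ((\<lambda>j\<in>{1..d}. \<one>) (id j)) (co I d p (id j)) = co I d p j" using g j by simp
  qed
  then show "tau \<one>\<^bsub>WG\<^esub> p = p" using mk_co[OF p] by simp
 qed
qed

lemma t0_nonzero: "gen I C (%q. PC.t 0 q ~= 0)" using nonconst[of 1 0] by simp

lemma symf_ratio: "PC.symf (%q. PC.t 1 q / PC.t 0 q)" unfolding PC.symf_def
proof (intro exI conjI)
 show "hompf {..1} 1 (%y::nat => 'k. y 1)" "hompf {..1} 1 (%y::nat => 'k. y 0)" by (rule hompf_coord, simp)+
 show "gen I C (%p. PC.t 0 p ~= 0 & PC.t 1 p / PC.t 0 p = PC.t 1 p / PC.t 0 p)" by (rule C.gen_mono[OF t0_nonzero]) simp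
qed

lemma ratio_nonconstant: "~ gen I C (%x. PC.t 1 x / PC.t 0 x = a)"
proof
 assume a: "gen I C (%x. PC.t 1 x / PC.t 0 x = a)"
 have "gen I C (%z. - a * PC.t 0 z + 1 * PC.t 1 z ~= 0)" by (rule nonconst) simp
 from C.gen_mono3[OF this a t0_nonzero, of "%_. False"] show False by (simp add: field_simps)
qed

lemma gam_t:
 assumes g: "g : carrier G"
 shows "gen I C (%q. EX c. c ~= 0 & PC.t 0 (PC.gam g q) = c * PC.t 0 q & PC.t 1 (PC.gam g q) = c * PC.t 1 q)"
proof (rule C.gen_mono3[OF t0_nonzero PC.gam(3)[OF g t0_nonzero] PC.gam_symf[OF g symf_ratio]])
 fix q assume a: "PC.t 0 q ~= 0" "PC.t 0 (PC.gam g q) ~= 0" "PC.t 1 (PC.gam g q) / PC.t 0 (PC.gam g q) = PC.t 1 q / PC.t 0 q"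
 show "EX c. c ~= 0 & PC.t 0 (PC.gam g q) = c * PC.t 0 q & PC.t 1 (PC.gam g q) = c * PC.t 1 q" by (rule exI[of _ "PC.t 0 (PC.gam g q) / PC.t 0 q"]) (use a in "simp add: field_simps")
qed

text \<open>Each \<open>gam g\<close> fixes the ratio of \<open>t 0\<close> and \<open>t 1\<close>,
  so it scales a linear factor, and the permutation merely reorders the factors. The coefficient
  vector of the product is thus scaled as a whole.\<close>

lemma tau_t:
 assumes x: "x : Wr"
 shows "gen A V (%p. EX c. c ~= 0 & (ALL k<=d. PV.t k (tau x p) = c * PV.t k p))"
proof -
 let ?s = "snd x" and ?a = "fst x"
 have cg: "gen A V (%p. ALL l:{1..d}. EX c. c ~= 0 & PC.t 0 (PC.gam (?a l) (co I d p l)) = c * PC.t 0 (co I d p l) & PC.t 1 (PC.gam (?a l) (co I d p l)) = c * PC.t 1 (co I d p l))"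
  by (rule V.gen_ball[OF finite_atLeastAtMost]) (rule gen_co[OF gam_t[OF wr(3)[OF x]]])
 show ?thesis
 proof (rule V.gen_mono3[OF PV_t tau_gen[OF x PV_t] cg])
  fix p assume p: "p : V" and t: "ALL k<=d. PV.t k p = pcoeff (PROD j=1..d. tlin p j) k"
   and t': "ALL k<=d. PV.t k (tau x p) = pcoeff (PROD j=1..d. [:PC.t 0 (co I d (tau x p) j), PC.t 1 (co I d (tau x p) j):]) k"
   and c0: "ALL l:{1..d}. EX c. c ~= 0 & PC.t 0 (PC.gam (?a l) (co I d p l)) = c * PC.t 0 (co I d p l) & PC.t 1 (PC.gam (?a l) (co I d p l)) = c * PC.t 1 (co I d p l)"
  from bchoice[OF c0] obtain c where c: "ALL l:{1..d}. c l ~= 0 & PC.t 0 (PC.gam (?a l) (co I d p l)) = c l * PC.t 0 (co I d p l) & PC.t 1 (PC.gam (?a l) (co I d p l)) = c l * PC.t 1 (co I d p l)" ..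
  let ?q = "%l. psmult (c l) [:PC.t 0 (co I d p l), PC.t 1 (co I d p l):]"
  have "(PROD j=1..d. [:PC.t 0 (co I d (tau x p) j), PC.t 1 (co I d (tau x p) j):]) = (PROD j=1..d. (?q \<circ> ?s) j)"
  proof (rule prod.cong[OF refl])
   fix j assume j: "j : {1..d}"
   show "[:PC.t 0 (co I d (tau x p) j), PC.t 1 (co I d (tau x p) j):] = (?q \<circ> ?s) j" unfolding co_tau[OF x p j] using c wr(2)[OF x j] by simp
  qed
  also have "... = (PROD l=1..d. ?q l)" by (rule prod.permute[OF wr(1)[OF x], symmetric])
  also have "... = psmult (PROD l=1..d. c l) (PROD l=1..d. [:PC.t 0 (co I d p l), PC.t 1 (co I d p l):])" by (rule prod_smult)
  finally have e: "(PROD j=1..d. [:PC.t 0 (co I d (tau x p) j), PC.t 1 (co I d (tau x p) j):]) = psmult (PROD l=1..d. c l) (PROD l=1..d. [:PC.t 0 (co I d p l), PC.t 1 (co I d p l):])" .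
  show "EX c. c ~= 0 & (ALL k<=d. PV.t k (tau x p) = c * PV.t k p)"
  proof (intro exI conjI allI impI)
   show "(PROD l=1..d. c l) ~= 0" using c by simp
   fix k assume k: "k <= d"
   show "PV.t k (tau x p) = (PROD l=1..d. c l) * PV.t k p" using t'[rule_format, OF k] t[rule_format, OF k] unfolding e coeff_smult by simp
  qed
 qed
qed

lemma symf_tau:
 assumes x: "x : Wr" and f: "PV.symf f" shows "gen A V (%p. f (tau x p) = f p)"
proof -
 obtain n F H where F: "hompf {..d} n F" "hompf {..d} n H"
  and g: "gen A V (%p. H (%k. PV.t k p) ~= 0 & f p = F (%k. PV.t k p) / H (%k. PV.t k p))" using f unfolding PV.symf_def by blast
 show ?thesis
 proof (rule V.gen_mono3[OF g tau_gen[OF x g] tau_t[OF x]])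
  fix p assume a: "H (%k. PV.t k p) ~= 0 & f p = F (%k. PV.t k p) / H (%k. PV.t k p)"
   and b: "H (%k. PV.t k (tau x p)) ~= 0 & f (tau x p) = F (%k. PV.t k (tau x p)) / H (%k. PV.t k (tau x p))"
   and "EX c. c ~= 0 & (ALL k<=d. PV.t k (tau x p) = c * PV.t k p)"
  then obtain c where c: "c ~= 0" "ALL k<=d. PV.t k (tau x p) = c * PV.t k p" by blast
  have e: "Q (%k. PV.t k (tau x p)) = c ^ n * Q (%k. PV.t k p)" if Q: "hompf {..d} n Q" for Q
  proof -
   have "Q (%k. PV.t k (tau x p)) = Q (scal c (%k. PV.t k p))" by (rule hompf_cong_on[OF Q]) (use c(2) in "simp add: scal_def")
   then show ?thesis using hompf_scale[OF Q] by simp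
  qed
  show "f (tau x p) = f p" using a b c(1) unfolding e[OF F(1)] e[OF F(2)] by simp
 qed
qed

text \<open>Sums of products of rational functions of one coordinate each, that is, the image of the
  tensor product of \<open>d\<close> copies of the function field of the curve. The generic
  equalities in both rules make the class independent of representatives.\<close>

inductive sepf :: "((nat => 'i, 'k) point => 'k) => bool" where
 sepf_base: "(!!j. j : {1..d} ==> ratl I C (u j)) ==> gen A V (%p. f p = (PROD j=1..d. u j (co I d p j))) ==> sepf f"
| sepf_add: "sepf f ==> sepf g ==> gen A V (%p. h p = f p + g p) ==> sepf h"

lemma sepf_cong: assumes "sepf f" "gen A V (%p. g p = f p)" shows "sepf g" using assms(1)
proof cases
 case (sepf_base u)
 show ?thesis by (rule sepf.sepf_base[OF sepf_base(1)], assumption) (rule V.gen_mono2[OF assms(2) sepf_base(2)], simp only:)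
next
 case (sepf_add f' g')
 show ?thesis by (rule sepf.sepf_add[OF sepf_add(1,2)]) (rule V.gen_mono2[OF assms(2) sepf_add(3)], simp only:)
qed

lemma sepf_sep: "(!!j. j : {1..d} ==> ratl I C (u j)) ==> sepf (%p. PROD j=1..d. u j (co I d p j))" by (rule sepf_base) (assumption, rule V.gen_all, rule refl)

lemma sepf_plus: "sepf f ==> sepf g ==> sepf (%p. f p + g p)" by (rule sepf_add) (assumption, assumption, rule V.gen_all, rule refl)

lemma sepf_const: "sepf (%_. c)"
proof -
 have "sepf (%p. PROD j=1..d. (%_. if j = 1 then c else 1) (co I d p j))" by (rule sepf_sep) (rule C.ratl_const)
 moreover have "(PROD j=1..d. if j = 1 then c else 1) = c" using d_pos by (subst prod.delta) simp_all
 ultimately show ?thesis by (simp only:)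
qed

lemma sepf_mult_sep: "sepf g ==> (!!j. j : {1..d} ==> ratl I C (u j)) ==> sepf (%p. (PROD j=1..d. u j (co I d p j)) * g p)"
proof (induction rule: sepf.induct)
 case (sepf_base v f)
 show ?case
 proof (rule sepf.sepf_base[of "%j q. u j q * v j q"])
  show "ratl I C (%q. u j q * v j q)" if "j : {1..d}" for j by (rule C.ratl_mult[OF sepf_base(3)[OF that] sepf_base(1)[OF that]])
  show "gen A V (%p. (PROD j=1..d. u j (co I d p j)) * f p = (PROD j=1..d. u j (co I d p j) * v j (co I d p j)))" by (rule V.gen_mono[OF sepf_base(2)]) (simp only: prod.distrib)
 qed
next
 case (sepf_add f g h)
 show ?case by (rule sepf.sepf_add[OF sepf_add.IH(1)[OF sepf_add.prems] sepf_add.IH(2)[OF sepf_add.prems]])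
   (assumption, assumption, rule V.gen_mono[OF sepf_add.hyps(3)], simp only: distrib_left)
qed

lemma sepf_mult: "sepf f ==> sepf g ==> sepf (%p. f p * g p)"
proof (induction rule: sepf.induct)
 case (sepf_base u f)
 show ?case by (rule sepf_cong[OF sepf_mult_sep[OF sepf_base(3) sepf_base(1)]])
   (assumption, rule V.gen_mono[OF sepf_base(2)], simp only:)
next
 case (sepf_add f f' h)
 show ?case by (rule sepf.sepf_add[OF sepf_add.IH(1)[OF sepf_add.prems] sepf_add.IH(2)[OF sepf_add.prems]])
   (rule V.gen_mono[OF sepf_add.hyps(3)], simp only: distrib_right)
qed

lemma sepf_sum: "(!!a. a : B ==> sepf (f a)) ==> sepf (%p. SUM a:B. f a p)" by (induction B rule: infinite_finite_induct) (simp_all add: sepf_const sepf_plus)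

lemma sepf_prod: "(!!a. a : B ==> sepf (f a)) ==> sepf (%p. PROD a:B. f a p)" by (induction B rule: infinite_finite_induct) (simp_all add: sepf_const sepf_mult)

lemma sepf_power: "sepf f ==> sepf (%p. f p ^ n)" by (induction n) (simp_all add: sepf_const sepf_mult)

lemma sepf_hompf:
 assumes "hompf A n F" "!!a. a : A ==> sepf (r a)" shows "sepf (%p. F (%a. r a p))"
proof -
 obtain S c where S: "finite S" "!!m. m : S ==> mkeys m <= A" "!!m. m : S ==> mdeg m = n"
   and F: "F = (%x. SUM m:S. c m * mval m x)" by (rule hompf_repr[OF assms(1)]) (rule that)
 have r: "sepf (r a)" if "m : S" "a : mkeys m" for m a by (rule assms(2)) (use S(2) that in blast)
 show ?thesis unfolding F mval_def
 proof (rule sepf_sum)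
  fix m assume m: "m : S"
  show "sepf (%p. c m * (PROD i:mkeys m. r i p ^ mlookup m i))" by (rule sepf_mult[OF sepf_const], rule sepf_prod, rule sepf_power, rule r[OF m])
 qed
qed

lemma sepf_tau: "sepf f ==> x : Wr ==> sepf (%p. f (tau x p))"
proof (induction rule: sepf.induct)
 case (sepf_base u f)
 let ?v = "%l q. u (inv' (snd x) l) (PC.gam (fst x l) q)"
 note x = sepf_base(3)
 show ?case
 proof (rule sepf.sepf_base[of ?v])
  fix l assume l: "l : {1..d}"
  have "inv' (snd x) l : {1..d}" using permutes_in_image[OF permutes_inv[OF wr(1)[OF x]], of l] l by blast
  then show "ratl I C (?v l)" by (rule PC.gam_ratl[OF wr(3)[OF x l] sepf_base(1)])
 next
  show "gen A V (%p. f (tau x p) = (PROD l=1..d. ?v l (co I d p l)))"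
  proof (rule V.gen_mono[OF tau_gen[OF x sepf_base(2)]])
   fix p assume p: "p : V" and e: "f (tau x p) = (PROD j=1..d. u j (co I d (tau x p) j))"
   have "(PROD l=1..d. ?v l (co I d p l)) = (PROD j=1..d. ((%l. ?v l (co I d p l)) \<circ> snd x) j)" by (rule prod.permute[OF wr(1)[OF x]])
   also have "... = (PROD j=1..d. u j (co I d (tau x p) j))" by (rule prod.cong[OF refl]) (simp only: o_apply co_tau[OF x p] permutes_inverses(2)[OF wr(1)[OF x]])
   finally show "f (tau x p) = (PROD l=1..d. ?v l (co I d p l))" using e by simp
  qed
 qed
next
 case (sepf_add f g h)
 show ?case by (rule sepf.sepf_add[OF sepf_add.IH(1)[OF sepf_add.prems] sepf_add.IH(2)[OF sepf_add.prems]])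
   (rule tau_gen[OF sepf_add.prems sepf_add.hyps(3)])
qed

text \<open>Affine Segre coordinates are products of affine coordinates of the factors. Substituting
  them into numerator and denominator of a quotient of forms gives sums of separated
  products.\<close>

lemma ratl_sepf_quotient:
 assumes f: "ratl A V f"
 obtains b c where "sepf b" "sepf c" "gen A V (%p. c p ~= 0 & f p = b p / c p)"
proof -
 obtain p0 n F H where F: "p0 : V" "hompf A n F" "hompf A n H" "H (rep p0) ~= 0"
  and fq: "!!q. q : V ==> H (rep q) ~= 0 ==> f q = F (rep q) / H (rep q)" using ratl_repr[OF f] by metis
 obtain i0 where i0: "i0 : I" "gen I C (%q. rep q i0 ~= 0)" using C.affc_index by blast
 let ?z = "%q. segre I d (%j i. C.affc i0 i (co I d q j))"
 have z: "sepf (%q. ?z q a)" if a: "a : A" for a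
 proof -
  have "sepf (%q. PROD j=1..d. C.affc i0 (a j) (co I d q j))" by (rule sepf_sep) (rule C.affc_ratl[OF i0 power_index_mem[OF a]])
  then show ?thesis using a by (simp only: segre_def if_True)
 qed
 have s: "sepf (%q. Q (?z q))" if Q: "hompf A n Q" for Q using sepf_hompf[OF Q z] by simp
 have g1: "gen A V (%q. H (rep q) ~= 0)" by (rule V.near_gen[OF near_form[OF F(1,3,4)]])
 have g2: "gen A V (%q. ALL j:{1..d}. rep (co I d q j) i0 ~= 0)" by (rule V.gen_ball[OF finite_atLeastAtMost]) (rule gen_co[OF i0(2)])
 have "gen A V (%q. H (?z q) ~= 0 & f q = F (?z q) / H (?z q))"
 proof (rule V.gen_mono2[OF g1 g2])
  fix q assume q: "q : V" "H (rep q) ~= 0" "ALL j:{1..d}. rep (co I d q j) i0 ~= 0"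
  have "ALL j:{1..d}. (%i. C.affc i0 i (co I d q j)) : co I d q j" using C.affc_mem[OF co_in_C[OF q(1)]] q(3) by blast
  from mk_mem[OF this] have zq: "?z q : q" unfolding mk_co[OF q(1)] .
  have qp: "q : pspace A" by (rule V.in_proj[OF q(1)])
  show "H (?z q) ~= 0 & f q = F (?z q) / H (?z q)" unfolding hompf_quotient_mem[OF qp zq F(2,3)] hompf_mem_zero_iff[OF qp zq F(3)] using q(2) fq[OF q(1,2)] by blast
 qed
 then show ?thesis using that[OF s[OF F(2)] s[OF F(3)]] by blast
qed

lemma power_symf:
 assumes w: "PC.symf w" shows "PV.symf (%p. PROD l=1..d. w (co I d p l))"
proof -
 obtain n F H where F: "hompf {..1} n F" "hompf {..1} n H"
  and g: "gen I C (%p. H (%k. PC.t k p) ~= 0 & w p = F (%k. PC.t k p) / H (%k. PC.t k p))" using w unfolding PC.symf_def by blast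
 obtain F' where F': "hompf {..d} n F'" "ALL u0 u1. (PROD j=1..d. F (%k. if k = 0 then u0 j else u1 j)) = F' (pcoeff (PROD j=1..d. [:u0 j, u1 j:]))" using product_of_binary_form[OF F(1), of d] by blast
 obtain H' where H': "hompf {..d} n H'" "ALL u0 u1. (PROD j=1..d. H (%k. if k = 0 then u0 j else u1 j)) = H' (pcoeff (PROD j=1..d. [:u0 j, u1 j:]))" using product_of_binary_form[OF F(2), of d] by blast
 have e: "(PROD l=1..d. Q (%k. PC.t k (co I d p l))) = Q' (%k. PV.t k p)"
  if Q: "hompf {..1} n Q" and Q': "hompf {..d} n Q'" "ALL u0 u1. (PROD j=1..d. Q (%k. if k = 0 then u0 j else u1 j)) = Q' (pcoeff (PROD j=1..d. [:u0 j, u1 j:]))"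
  and t: "ALL k<=d. PV.t k p = pcoeff (PROD j=1..d. tlin p j) k" for p Q Q'
 proof -
  have "(PROD l=1..d. Q (%k. PC.t k (co I d p l))) = (PROD l=1..d. Q (%k. if k = 0 then PC.t 0 (co I d p l) else PC.t 1 (co I d p l)))"
  proof (rule prod.cong[OF refl], rule hompf_cong_on[OF Q])
   fix l k :: nat assume "k : {..1}"
   then have "k = 0 \<or> k = 1" by auto
   then show "PC.t k (co I d p l) = (if k = 0 then PC.t 0 (co I d p l) else PC.t 1 (co I d p l))" by auto
  qed
  also have "... = Q' (pcoeff (PROD j=1..d. tlin p j))" using Q'(2)[rule_format, of "%l. PC.t 0 (co I d p l)" "%l. PC.t 1 (co I d p l)"] .
  also have "... = Q' (%k. PV.t k p)" by (rule hompf_cong_on[OF Q'(1)]) (use t in simp)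
  finally show ?thesis .
 qed
 have g': "gen A V (%p. ALL l:{1..d}. H (%k. PC.t k (co I d p l)) ~= 0 & w (co I d p l) = F (%k. PC.t k (co I d p l)) / H (%k. PC.t k (co I d p l)))"
  by (rule V.gen_ball[OF finite_atLeastAtMost]) (rule gen_co[OF g])
 show ?thesis unfolding PV.symf_def
 proof (intro exI conjI)
  show "hompf {..d} n F'" "hompf {..d} n H'" by (rule F'(1), rule H'(1))
  show "gen A V (%p. H' (%k. PV.t k p) ~= 0 & (PROD l=1..d. w (co I d p l)) = F' (%k. PV.t k p) / H' (%k. PV.t k p))"
  proof (rule V.gen_mono2[OF g' PV_t])
   fix p assume a: "ALL l:{1..d}. H (%k. PC.t k (co I d p l)) ~= 0 & w (co I d p l) = F (%k. PC.t k (co I d p l)) / H (%k. PC.t k (co I d p l))"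
   and t: "ALL k<=d. PV.t k p = pcoeff (PROD j=1..d. tlin p j) k"
   have "(PROD l=1..d. w (co I d p l)) = (PROD l=1..d. F (%k. PC.t k (co I d p l)) / H (%k. PC.t k (co I d p l)))" by (rule prod.cong[OF refl]) (use a in blast)
   also have "... = F' (%k. PV.t k p) / H' (%k. PV.t k p)" unfolding prod_dividef e[OF F(1) F' t] e[OF F(2) H' t] ..
   finally show "H' (%k. PV.t k p) ~= 0 & (PROD l=1..d. w (co I d p l)) = F' (%k. PV.t k p) / H' (%k. PV.t k p)" using a unfolding e[OF F(2) H' t, symmetric] by simp
  qed
 qed
qed

lemma trace_symf:
 assumes u: "ratl I C u" shows "PC.symf (%q. SUM g:carrier G. u (PC.gam g q))"
proof (rule PC.invariant_symf)
 show "ratl I C (%q. SUM g:carrier G. u (PC.gam g q))" by (rule C.ratl_sum) (rule PC.gam_ratl[OF _ u])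
 fix h assume h: "h : carrier G"
 have "gen I C (%q. ALL g:carrier G. PC.gam (h \<otimes> g) q = PC.gam g (PC.gam h q))" by (rule C.gen_ball[OF PC.finite_G]) (rule PC.gam_mult[OF h])
 then show "gen I C (%q. (SUM g:carrier G. u (PC.gam g (PC.gam h q))) = (SUM g:carrier G. u (PC.gam g q)))"
 proof (rule C.gen_mono)
  fix q assume a: "ALL g:carrier G. PC.gam (h \<otimes> g) q = PC.gam g (PC.gam h q)"
  have "(SUM g:carrier G. u (PC.gam g (PC.gam h q))) = (SUM g:carrier G. u (PC.gam (h \<otimes> g) q))" by (rule sum.cong[OF refl]) (use a in simp)
  also have "... = (SUM g:carrier G. u (PC.gam g q))" by (rule sum.reindex_bij_betw[OF PC.G.bij_betw_left_mult[OF h]])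
  finally show "(SUM g:carrier G. u (PC.gam g (PC.gam h q))) = (SUM g:carrier G. u (PC.gam g q))" .
 qed
qed

lemma Wr_eq: "Wr = PiE {1..d} (%_. carrier G) \<times> {s. s permutes {1..d}}"
proof (rule Set.set_eqI)
 fix x show "x : Wr \<longleftrightarrow> x : PiE {1..d} (%_. carrier G) \<times> {s. s permutes {1..d}}" by (cases x) (simp only: wreath_carrier mem_Sigma_iff mem_Collect_eq)
qed

text \<open>Summing over the tuples in \<open>G\<close> turns each factor into its trace
  \<open>v i\<close>; the remaining sum over permutations is a permanent. Ryser's formula writes it
  through products over all coordinates of one and the same invariant function, the sum of the
  \<open>v i\<close> over a subset.\<close>

lemma sepf_average: "sepf f ==> PV.symf (%p. SUM x:Wr. f (tau x p))"
proof (induction rule: sepf.induct)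
 case (sepf_base u f)
 let ?D = "{1..d}"
 define v where "v i q = (SUM g:carrier G. u i (PC.gam g q))" for i q
 have vs: "PC.symf (v i)" if "i : ?D" for i unfolding v_def[abs_def] by (rule trace_symf[OF sepf_base(1)[OF that]])
 have symf: "PV.symf (%p. SUM S:Pow ?D. (- 1) ^ card (?D - S) * (PROD l:?D. SUM i:S. v i (co I d p l)))"
 proof (rule PV.symf_sum, rule PV.symf_cmult)
  fix S assume S: "S : Pow ?D"
  have "PC.symf (%q. SUM i:S. v i q)" by (rule PC.symf_sum) (use S vs in blast)
  then show "PV.symf (%p. PROD l:?D. SUM i:S. v i (co I d p l))" by (rule power_symf)
 qed
 have "gen A V (%p. ALL x:Wr. f (tau x p) = (PROD j:?D. u j (co I d (tau x p) j)))" by (rule V.gen_ball[OF fin_Wr]) (rule tau_gen[OF _ sepf_base(2)])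
 then have "gen A V (%p. (SUM S:Pow ?D. (- 1) ^ card (?D - S) * (PROD l:?D. SUM i:S. v i (co I d p l))) = (SUM x:Wr. f (tau x p)))"
 proof (rule V.gen_mono)
  fix p assume p: "p : V" and a: "ALL x:Wr. f (tau x p) = (PROD j:?D. u j (co I d (tau x p) j))"
  let ?M = "%i l. v i (co I d p l)"
  have e: "f (tau x p) = (PROD l:?D. u (inv' (snd x) l) (PC.gam (fst x l) (co I d p l)))" if x: "x : Wr" for x
  proof -
   have "(PROD l:?D. u (inv' (snd x) l) (PC.gam (fst x l) (co I d p l))) = (PROD j:?D. ((%l. u (inv' (snd x) l) (PC.gam (fst x l) (co I d p l))) \<circ> snd x) j)" by (rule prod.permute[OF wr(1)[OF x]])
   also have "... = (PROD j:?D. u j (co I d (tau x p) j))" by (rule prod.cong[OF refl]) (simp only: o_apply co_tau[OF x p] permutes_inverses(2)[OF wr(1)[OF x]])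
   finally show ?thesis using a x by simp
  qed
  have "(SUM x:Wr. f (tau x p)) = (SUM x:Wr. PROD l:?D. u (inv' (snd x) l) (PC.gam (fst x l) (co I d p l)))" by (rule sum.cong[OF refl]) (rule e)
  also have "... = (SUM a:PiE ?D (%_. carrier G). \<Sum>s | s permutes ?D. PROD l:?D. u (inv' s l) (PC.gam (a l) (co I d p l)))"
   unfolding Wr_eq sum.cartesian_product by (rule sum.cong[OF refl]) (simp only: case_prod_beta)
  also have "... = (\<Sum>s | s permutes ?D. SUM a:PiE ?D (%_. carrier G). PROD l:?D. u (inv' s l) (PC.gam (a l) (co I d p l)))" by (rule sum.swap)
  also have "... = (\<Sum>s | s permutes ?D. PROD l:?D. ?M (inv' s l) l)" unfolding v_def by (rule sum.cong[OF refl]) (rule prod_sum_PiE[symmetric, OF finite_atLeastAtMost PC.finite_G])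
  also have "... = (\<Sum>s | s permutes ?D. PROD l:?D. ?M (s l) l)" by (rule sum_permutations_inverse[symmetric])
  also have "... = (SUM S:Pow ?D. (- 1) ^ card (?D - S) * (PROD l:?D. SUM i:S. ?M i l))" by (rule permanent_subsets[OF finite_atLeastAtMost])
  finally show "(SUM S:Pow ?D. (- 1) ^ card (?D - S) * (PROD l:?D. SUM i:S. ?M i l)) = (SUM x:Wr. f (tau x p))" by (rule sym)
 qed
 then show ?case by (rule PV.symf_cong[OF symf])
next
 case (sepf_add f g h)
 have "gen A V (%p. ALL x:Wr. h (tau x p) = f (tau x p) + g (tau x p))" by (rule V.gen_ball[OF fin_Wr]) (rule tau_gen[OF _ sepf_add.hyps(3)])
 then have "gen A V (%p. (SUM x:Wr. f (tau x p)) + (SUM x:Wr. g (tau x p)) = (SUM x:Wr. h (tau x p)))" by (rule V.gen_mono) (simp add: sum.distrib)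
 then show ?case by (rule PV.symf_cong[OF PV.symf_add[OF sepf_add.IH]])
qed

text \<open>An invariant function is its own average, and dividing by the order of the group is
  possible in characteristic zero.\<close>

lemma sepf_invariant_symf:
 assumes f: "sepf f" and inv: "!!x. x : Wr ==> gen A V (%p. f (tau x p) = f p)" shows "PV.symf f"
proof -
 let ?n = "of_nat (card Wr) :: 'k"
 have n: "?n ~= 0" using fin_Wr W.one_closed by (simp add: card_eq_0_iff) blast
 have "gen A V (%p. ALL x:Wr. f (tau x p) = f p)" by (rule V.gen_ball[OF fin_Wr inv])
 then have "gen A V (%p. inverse ?n * (SUM x:Wr. f (tau x p)) = f p)" by (rule V.gen_mono) (use n in simp)
 then show ?thesis by (rule PV.symf_cong[OF PV.symf_cmult[OF sepf_average[OF f]]])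
qed

lemma prod_tau_invariant:
 fixes F :: "_ => 'b::comm_monoid_mult"
 assumes y: "y : Wr" shows "gen A V (%p. (PROD x:Wr. F (tau x (tau y p))) = (PROD x:Wr. F (tau x p)))"
proof -
 have "gen A V (%p. ALL x:Wr. tau (y \<otimes>\<^bsub>WG\<^esub> x) p = tau x (tau y p))" by (rule V.gen_ball[OF fin_Wr]) (rule tau_mult[OF y])
 then show ?thesis
 proof (rule V.gen_mono)
  fix p assume a: "ALL x:Wr. tau (y \<otimes>\<^bsub>WG\<^esub> x) p = tau x (tau y p)"
  have "(PROD x:Wr. F (tau x (tau y p))) = (PROD x:Wr. F (tau (y \<otimes>\<^bsub>WG\<^esub> x) p))" by (rule prod.cong[OF refl]) (use a in simp)
  also have "... = (PROD x:Wr. F (tau x p))" by (rule prod.reindex_bij_betw[OF W.bij_betw_left_mult[OF y]])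
  finally show "(PROD x:Wr. F (tau x (tau y p))) = (PROD x:Wr. F (tau x p))" .
 qed
qed

text \<open>The quotient is expanded by the other conjugates of its denominator. The new denominator
  \<open>N\<close> is a norm, hence invariant, and so is the new numerator as the product of two
  invariant functions; both are separated sums.\<close>

lemma invariant_symf_power:
 assumes f: "ratl A V f" and inv: "!!x. x : Wr ==> gen A V (%p. f (tau x p) = f p)" shows "PV.symf f"
proof -
 let ?e = "\<one>\<^bsub>WG\<^esub>"
 obtain b c where bc: "sepf b" "sepf c" "gen A V (%p. c p ~= 0 & f p = b p / c p)" by (rule ratl_sepf_quotient[OF f])
 have c0: "gen A V (%p. c p ~= 0)" by (rule V.gen_mono[OF bc(3)]) (rule conjunct1)
 define N where "N p = (PROD x:Wr. c (tau x p))" for p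
 define g where "g p = b p * (PROD x:Wr - {?e}. c (tau x p))" for p
 have Ns: "sepf N" unfolding N_def[abs_def] by (rule sepf_prod) (rule sepf_tau[OF bc(2)])
 have gs: "sepf g" unfolding g_def[abs_def] by (rule sepf_mult[OF bc(1)], rule sepf_prod, rule sepf_tau[OF bc(2)]) blast
 have N0: "gen A V (%p. N p ~= 0)"
 proof -
  have "gen A V (%p. ALL x:Wr. c (tau x p) ~= 0)" by (rule V.gen_ball[OF fin_Wr]) (rule tau_gen[OF _ c0])
  then show ?thesis by (rule V.gen_mono) (use fin_Wr in "simp add: N_def")
 qed
 have gN: "gen A V (%p. g p = f p * N p)"
 proof (rule V.gen_mono2[OF bc(3) tau_one])
  fix p assume a: "c p ~= 0 & f p = b p / c p" and e: "tau ?e p = p"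
  have "N p = c (tau ?e p) * (PROD x:Wr - {?e}. c (tau x p))" unfolding N_def by (rule prod.remove[OF fin_Wr W.one_closed])
  then show "g p = f p * N p" using a e by (simp add: g_def)
 qed
 have Ni: "gen A V (%p. N (tau y p) = N p)" if "y : Wr" for y unfolding N_def by (rule prod_tau_invariant[OF that])
 have gi: "gen A V (%p. g (tau y p) = g p)" if y: "y : Wr" for y
 proof -
  have "gen A V (%p. g p = f p * N p & f (tau y p) = f p)" by (rule V.gen_conj[OF gN inv[OF y]])
  from V.gen_mono3[OF this tau_gen[OF y gN] Ni[OF y], of "%p. g (tau y p) = g p"] show ?thesis by simp
 qed
 have "PV.symf (%p. g p * inverse (N p))" by (rule PV.symf_mult[OF sepf_invariant_symf[OF gs gi] PV.symf_inverse[OF sepf_invariant_symf[OF Ns Ni] N0]])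
 then show ?thesis by (rule PV.symf_cong) (rule V.gen_mono2[OF gN N0], simp)
qed

text \<open>Precomposition with \<open>tau x\<close> on classes. The representative is chosen, and
  \<open>Phi_cls\<close> shows that the choice is immaterial; the restriction to the carrier matches
  the extensional functions in \<open>BijGroup\<close>.\<close>

definition Phi where "Phi x = (\<lambda>y\<in>carrier LV. cls A V (%p. (SOME f. ratl A V f & y = cls A V f) (tau x p)))"

lemma Phi_cls:
 assumes x: "x : Wr" and f: "ratl A V f" shows "Phi x (cls A V f) = cls A V (%p. f (tau x p))"
proof -
 define g where "g = (SOME g. ratl A V g & cls A V f = cls A V g)"
 have "ratl A V g & cls A V f = cls A V g" unfolding g_def by (rule someI[of _ f]) (use f in simp)
 then have g: "gen A V (%p. g p = f p)" using V.cls_eq_iff[of g f] by simp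
 have "Phi x (cls A V f) = cls A V (%p. g (tau x p))" unfolding Phi_def g_def using V.cls_carrier[OF f] by simp
 also have "... = cls A V (%p. f (tau x p))" by (rule V.cls_cong) (rule tau_gen[OF x g])
 finally show ?thesis .
qed

lemma Phi_closed: assumes "x : Wr" "z : carrier LV" shows "Phi x z : carrier LV"
proof -
 obtain f where f: "ratl A V f" "z = cls A V f" using V.carrierE[OF assms(2)] by blast
 show ?thesis unfolding f(2) Phi_cls[OF assms(1) f(1)] by (rule V.cls_carrier[OF tau_ratl[OF assms(1) f(1)]])
qed

lemma Phi_hom: assumes x: "x : Wr" shows "Phi x : ring_hom LV LV"
proof (rule ring_hom_memI)
 show "Phi x z : carrier LV" if "z : carrier LV" for z by (rule Phi_closed[OF x that])
 fix y z assume a: "y : carrier LV" "z : carrier LV"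
 obtain f where f: "ratl A V f" "y = cls A V f" using V.carrierE[OF a(1)] by blast
 obtain g where g: "ratl A V g" "z = cls A V g" using V.carrierE[OF a(2)] by blast
 note t = tau_ratl[OF x f(1)] tau_ratl[OF x g(1)]
 show "Phi x (y \<otimes>\<^bsub>LV\<^esub> z) = Phi x y \<otimes>\<^bsub>LV\<^esub> Phi x z"
  unfolding f(2) g(2) V.mult_cls[OF f(1) g(1)] Phi_cls[OF x f(1)] Phi_cls[OF x g(1)] Phi_cls[OF x V.ratl_mult[OF f(1) g(1)]] V.mult_cls[OF t] ..
 show "Phi x (y \<oplus>\<^bsub>LV\<^esub> z) = Phi x y \<oplus>\<^bsub>LV\<^esub> Phi x z"
  unfolding f(2) g(2) V.add_cls[OF f(1) g(1)] Phi_cls[OF x f(1)] Phi_cls[OF x g(1)] Phi_cls[OF x V.ratl_add[OF f(1) g(1)]] V.add_cls[OF t] ..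
next
 show "Phi x \<one>\<^bsub>LV\<^esub> = \<one>\<^bsub>LV\<^esub>" unfolding V.one_L Phi_cls[OF x V.ratl_const] ..
qed

lemma Phi_mult:
 assumes x: "x : Wr" and y: "y : Wr" and z: "z : carrier LV"
 shows "Phi (x \<otimes>\<^bsub>WG\<^esub> y) z = Phi x (Phi y z)"
proof -
 obtain f where f: "ratl A V f" "z = cls A V f" using V.carrierE[OF z] by blast
 show ?thesis unfolding f(2) Phi_cls[OF W.m_closed[OF x y] f(1)] Phi_cls[OF y f(1)] Phi_cls[OF x tau_ratl[OF y f(1)]] by (rule V.cls_cong, rule V.gen_mono[OF tau_mult[OF x y]]) (simp only:)
qed

lemma Phi_one: assumes z: "z : carrier LV" shows "Phi \<one>\<^bsub>WG\<^esub> z = z"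
proof -
 obtain f where f: "ratl A V f" "z = cls A V f" using V.carrierE[OF z] by blast
 show ?thesis unfolding f(2) Phi_cls[OF W.one_closed f(1)] by (rule V.cls_cong, rule V.gen_mono[OF tau_one]) (simp only:)
qed

lemma Phi_galois: assumes x: "x : Wr" shows "Phi x : carrier (galois_group LV KV)"
proof -
 let ?i = "inv\<^bsub>WG\<^esub> x"
 have i: "?i : Wr" by (rule W.inv_closed[OF x])
 have "bij_betw (Phi x) (carrier LV) (carrier LV)"
 proof (rule bij_betw_byWitness[where f' = "Phi ?i"])
  show "ALL z:carrier LV. Phi ?i (Phi x z) = z" using Phi_mult[OF i x, symmetric] Phi_one W.l_inv[OF x] by simp
  show "ALL z:carrier LV. Phi x (Phi ?i z) = z" using Phi_mult[OF x i, symmetric] Phi_one W.r_inv[OF x] by simp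
  show "Phi x ` carrier LV <= carrier LV" "Phi ?i ` carrier LV <= carrier LV" using Phi_closed[OF x] Phi_closed[OF i] by blast+
 qed
 moreover have "ALL z:KV. Phi x z = z"
 proof
  fix z assume "z : KV"
  then obtain f where f: "PV.symf f" "z = cls A V f" by blast
  show "Phi x z = z" unfolding f(2) Phi_cls[OF x PV.symf_ratl[OF f(1)]] by (rule V.cls_cong[OF symf_tau[OF x f(1)]])
 qed
 moreover have "Phi x : extensional (carrier LV)" unfolding Phi_def by (rule restrict_extensional)
 ultimately show ?thesis unfolding galois_group_carrier using Phi_hom[OF x] by blast
qed

text \<open>The coefficients of the polynomial whose roots are all conjugates
  \<open>f (tau x p)\<close>; they are invariant, so this is a monic equation for \<open>f\<close>
  over the pulled back field.\<close>

definition ecoef :: "((nat => 'i, 'k) point => 'k) => nat => (nat => 'i, 'k) point => 'k" where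
 "ecoef f k p = pcoeff (PROD x:Wr. [:- f (tau x p), 1:]) k"

lemma ecoef_ratl: assumes f: "ratl A V f" shows "ratl A V (ecoef f k)" unfolding ecoef_def[abs_def] by (rule V.ratl_coeff_prod[OF fin_Wr V.ratl_uminus[OF tau_ratl[OF _ f]] V.ratl_const])

lemma ecoef_symf: assumes f: "ratl A V f" shows "PV.symf (ecoef f k)"
proof (rule invariant_symf_power[OF ecoef_ratl[OF f]])
 fix y assume y: "y : Wr"
 from prod_tau_invariant[OF y, of "%p. [:- f p, 1:]"] show "gen A V (%p. ecoef f k (tau y p) = ecoef f k p)" by (rule V.gen_mono) (simp only: ecoef_def)
qed

lemma ecoef_eval: "(SUM k<Suc (card Wr). ecoef f k p * z ^ k) = (PROD x:Wr. z - f (tau x p))"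
proof -
 have "(SUM k<Suc (card Wr). ecoef f k p * z ^ k) = poly (PROD x:Wr. [:- f (tau x p), 1:]) z" unfolding ecoef_def lessThan_Suc_atMost by (rule poly_eq_sum[OF degree_prod_linear[OF fin_Wr], symmetric])
 then show ?thesis by (simp add: poly_prod)
qed

lemma ecoef_top: "ecoef f (card Wr) p = 1" unfolding ecoef_def by (rule monic_prod_linear[OF fin_Wr])

lemma ecoef_root: "gen A V (%p. (SUM k<Suc (card Wr). ecoef f k p * f p ^ k) = 0)"
proof (rule V.gen_mono[OF tau_one])
 fix p assume e: "tau \<one>\<^bsub>WG\<^esub> p = p"
 have "(PROD x:Wr. f p - f (tau x p)) = 0" by (rule prod_zero[OF fin_Wr], rule bexI[OF _ W.one_closed]) (simp only: e diff_self)
 then show "(SUM k<Suc (card Wr). ecoef f k p * f p ^ k) = 0" unfolding ecoef_eval .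
qed

lemma algebraic_KV: assumes "z : carrier LV" shows "ring.algebraic LV KV z"
proof -
 obtain f where f: "ratl A V f" "z = cls A V f" using V.carrierE[OF assms] by blast
 let ?n = "card Wr"
 let ?q = "map (%k. cls A V (ecoef f k)) (rev [0..<Suc ?n])"
 have "set ?q <= KV" using ecoef_symf[OF f(1)] by auto
 moreover have "Polynomials.lead_coeff ?q ~= \<zero>\<^bsub>LV\<^esub>"
 proof -
  have "cls A V (ecoef f ?n) ~= \<zero>\<^bsub>LV\<^esub>" unfolding V.cls_nonzero[OF ecoef_ratl[OF f(1)]] ecoef_top by simp
  then show ?thesis by simp
 qed
 ultimately have q: "?q : carrier (KV [X]\<^bsub>LV\<^esub>)" unfolding univ_poly_def polynomial_def by simp
 have "V.L.eval ?q z = \<zero>\<^bsub>LV\<^esub>" unfolding f(2) V.eval_cls[of "ecoef f", OF ecoef_ratl[OF f(1)] f(1)] V.zero_L by (rule V.cls_cong) (rule ecoef_root)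
 from V.L.algebraicI[OF q _ this] show ?thesis by (simp add: over_def)
qed

text \<open>An automorphism over \<open>KV\<close> maps \<open>f\<close> to a root of the polynomial
  with coefficients \<open>ecoef f\<close>, hence to some conjugate of \<open>f\<close>. The
  conjugating element might depend on \<open>f\<close>; \<open>uniform_choice\<close> makes it the
  same for all functions.\<close>

lemma galois_image:
 assumes s: "sg : carrier (galois_group LV KV)" shows "EX x:Wr. sg = Phi x"
proof -
 have s1: "sg : extensional (carrier LV)" "sg : ring_hom LV LV" "!!z. z : KV ==> sg z = z" using s unfolding galois_group_carrier by blast+
 have symf: "V.liftrel sg f f" if "PV.symf f" for f unfolding V.liftrel_def using PV.symf_ratl[OF that] s1(3)[of "cls A V f"] that by blast
 have const: "V.liftrel sg (%_. c) (%_. c)" for c by (rule symf[OF PV.symf_const])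
 define lft where "lft f = (SOME g. V.liftrel sg f g)" for f
 have lft: "V.liftrel sg f (lft f)" if "ratl A V f" for f unfolding lft_def using V.liftrel_ex[OF s1(2) that] by (rule someI_ex)
 have rl: "ratl A V (lft f)" if "ratl A V f" for f using lft[OF that] unfolding V.liftrel_def by blast
 have "EX x:Wr. ALL f. ratl A V f --> gen A V (%p. (%x f p. lft f p - f (tau x p)) x f p = 0)"
 proof (rule V.uniform_choice[OF fin_Wr _ infinite_UNIV_char_0])
  show "ratl A V (%p. lft f p - f (tau x p))" if "ratl A V f" "x : Wr" for f x by (rule V.ratl_diff[OF rl[OF that(1)] tau_ratl[OF that(2,1)]])
 next
  fix x M and c :: "nat => 'k" and F :: "nat => (nat => 'i, 'k) point => 'k"
  assume x: "x : Wr" and F: "!!i. ratl A V (F i)"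
  have 1: "V.liftrel sg (%p. SUM i<M. c i * F i p) (%p. SUM i<M. c i * lft (F i) p)" by (rule V.liftrel_sum[OF s1(2) const], rule V.liftrel_mult[OF s1(2) const lft[OF F]])
  have 2: "V.liftrel sg (%p. SUM i<M. c i * F i p) (lft (%p. SUM i<M. c i * F i p))" by (rule lft, rule V.ratl_sum, rule V.ratl_mult[OF V.ratl_const F])
  \<comment> \<open>The chosen lift of a linear combination agrees generically with the combination
    of the lifts, since \<open>sg\<close> fixes constants.\<close>
  show "gen A V (%p. lft (%p. SUM i<M. c i * F i p) p - (SUM i<M. c i * F i (tau x p)) = (SUM i<M. c i * (lft (F i) p - F i (tau x p))))"
   by (rule V.gen_mono[OF V.liftrel_unique[OF 2 1]]) (simp only: sum_subtractf right_diff_distrib)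
 next
  fix f assume f: "ratl A V f"
  let ?N = "Suc (card Wr)"
  have l: "V.liftrel sg (%p. SUM k<?N. ecoef f k p * f p ^ k) (%p. SUM k<?N. ecoef f k p * lft f p ^ k)"
   by (rule V.liftrel_sum[OF s1(2) const], rule V.liftrel_mult[OF s1(2) symf[OF ecoef_symf[OF f]] V.liftrel_power[OF s1(2) const lft[OF f]]])
  have "gen A V (%p. (SUM k<?N. ecoef f k p * lft f p ^ k) = 0)" by (rule V.liftrel_zero[OF s1(2) l ecoef_root const])
  then have "gen A V (%p. (PROD x:Wr. lft f p - f (tau x p)) = 0)" unfolding ecoef_eval .
  from V.gen_prod_zero[OF fin_Wr _ this] show "EX x:Wr. gen A V (%p. lft f p - f (tau x p) = 0)" using V.ratl_diff[OF rl[OF f] tau_ratl[OF _ f]] by blast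
 qed
 then obtain x where x: "x : Wr" "ALL f. ratl A V f --> gen A V (%p. lft f p - f (tau x p) = 0)" by blast
 have "sg = Phi x"
 proof (rule extensionalityI[OF s1(1)])
  show "Phi x : extensional (carrier LV)" unfolding Phi_def by (rule restrict_extensional)
  fix z assume "z : carrier LV"
  then obtain f where f: "ratl A V f" "z = cls A V f" using V.carrierE by blast
  have "sg z = cls A V (lft f)" using lft[OF f(1)] unfolding V.liftrel_def f(2) by blast
  also have "... = cls A V (%p. f (tau x p))" by (rule V.cls_cong, rule V.gen_mono[OF mp[OF spec[OF x(2)] f(1)]]) simp
  also have "... = Phi x z" unfolding f(2) Phi_cls[OF x(1) f(1)] ..
  finally show "sg z = Phi x z" .
 qed
 then show ?thesis using x(1) by blast
qed

lemma gen_slice: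
 assumes "gen A V P" and l: "l : {1..d}"
 shows "EX q. (ALL j:{1..d}. q j : C) & gen I C (%z. P (mk I d (q(l := z))))"
proof -
 obtain p where p: "near A V p P" using assms unfolding gen_def by blast
 have pV: "p : V" by (rule near_in[OF p])
 have q: "ALL j:{1..d}. co I d p j : C" using co_in_C[OF pV] by blast
 have "near A V (mk I d ((co I d p)(l := co I d p l))) P" unfolding fun_upd_triv mk_co[OF pV] by (rule p)
 from C.near_gen[OF near_slice[OF q co_in_C[OF pV l] this]] show ?thesis using q by (intro exI conjI)
qed

text \<open>The ratio \<open>t 1 / t 0\<close> is invariant under every \<open>gam g\<close> but not
  constant. If the two permutations differed at \<open>j\<close>, its values at two different
  coordinates would agree generically, and fixing all coordinates but one would make it constant.
  Then the components in \<open>G\<close> are compared on slices.\<close>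

lemma Phi_inj: assumes x: "x : Wr" and y: "y : Wr" and e: "Phi x = Phi y" shows "x = y"
proof -
 have fe: "gen A V (%p. f (tau x p) = f (tau y p))" if f: "ratl A V f" for f
 proof -
  have "cls A V (%p. f (tau x p)) = cls A V (%p. f (tau y p))" using e Phi_cls[OF x f] Phi_cls[OF y f] by simp
  then show ?thesis unfolding V.cls_eq_iff[OF tau_ratl[OF x f]] .
 qed
 have g: "gen A V (%p. tau x p = tau y p)"
 proof (rule V.maps_eq_gen)
  show "tau x p : V" "tau y p : V" if "p : V" for p by (rule tau_in[OF x that], rule tau_in[OF y that])
  show "gen A V (%p. P (tau x p))" "gen A V (%p. P (tau y p))" if "gen A V P" for P by (rule tau_gen[OF x that], rule tau_gen[OF y that])
 qed (rule fe)
 have gc: "gen A V (%p. PC.gam (fst x (snd x j)) (co I d p (snd x j)) = PC.gam (fst y (snd y j)) (co I d p (snd y j)))" if j: "j : {1..d}" for j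
 proof (rule V.gen_mono[OF g])
  fix p assume p: "p : V" "tau x p = tau y p"
  show "PC.gam (fst x (snd x j)) (co I d p (snd x j)) = PC.gam (fst y (snd y j)) (co I d p (snd y j))" unfolding co_tau[OF x p(1) j, symmetric] co_tau[OF y p(1) j, symmetric] p(2) ..
 qed
 let ?u = "%q. PC.t 1 q / PC.t 0 q"
 have sj: "snd x j = snd y j" if j: "j : {1..d}" for j
 proof (rule ccontr)
  assume n: "snd x j ~= snd y j"
  note l = wr(2)[OF x j] and l' = wr(2)[OF y j]
  have 1: "gen A V (%p. ?u (PC.gam (fst x (snd x j)) (co I d p (snd x j))) = ?u (co I d p (snd x j)))" by (rule gen_co[OF PC.gam_symf[OF wr(3)[OF x l] symf_ratio] l])
  have 2: "gen A V (%p. ?u (PC.gam (fst y (snd y j)) (co I d p (snd y j))) = ?u (co I d p (snd y j)))" by (rule gen_co[OF PC.gam_symf[OF wr(3)[OF y l'] symf_ratio] l'])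
  have "gen A V (%p. ?u (co I d p (snd x j)) = ?u (co I d p (snd y j)))" by (rule V.gen_mono3[OF 1 2 gc[OF j]]) (simp only:)
  from gen_slice[OF this l] obtain q where q: "ALL j:{1..d}. q j : C"
   and s: "gen I C (%z. ?u (co I d (mk I d (q(snd x j := z))) (snd x j)) = ?u (co I d (mk I d (q(snd x j := z))) (snd y j)))" by (elim exE conjE)
  let ?c = "?u (q (snd y j))"
  have 3: "gen I C (%z. ?u z = ?c)"
  proof (rule C.gen_mono[OF s])
   fix z assume z: "z : C" and eq: "?u (co I d (mk I d (q(snd x j := z))) (snd x j)) = ?u (co I d (mk I d (q(snd x j := z))) (snd y j))"
   have qz: "ALL l:{1..d}. (q(snd x j := z)) l : C" using q z by simp
   show "?u z = ?c" using eq n unfolding co_mk[OF qz l] co_mk[OF qz l'] by simp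
  qed
  show False by (rule notE[OF ratio_nonconstant 3])
 qed
 have "snd x = snd y"
 proof
  fix j show "snd x j = snd y j" using sj permutes_not_in[OF wr(1)[OF x]] permutes_not_in[OF wr(1)[OF y]] by (cases "j : {1..d}") simp_all
 qed
 have fl: "fst x l = fst y l" if l: "l : {1..d}" for l
 proof -
  let ?j = "inv' (snd x) l"
  have j: "?j : {1..d}" using permutes_in_image[OF permutes_inv[OF wr(1)[OF x]], of l] l by blast
  have xj: "snd x ?j = l" using permutes_inverses(1)[OF wr(1)[OF x]] .
  have yj: "snd y ?j = l" using xj sj[OF j] by simp
  from gc[OF j] have 1: "gen A V (%p. PC.gam (fst x l) (co I d p l) = PC.gam (fst y l) (co I d p l))" unfolding xj yj .
  from gen_slice[OF 1 l] obtain q where q: "ALL j:{1..d}. q j : C"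
   and s: "gen I C (%z. PC.gam (fst x l) (co I d (mk I d (q(l := z))) l) = PC.gam (fst y l) (co I d (mk I d (q(l := z))) l))" by (elim exE conjE)
  have s': "gen I C (%z. PC.gam (fst x l) z = PC.gam (fst y l) z)"
  proof (rule C.gen_mono[OF s])
   fix z assume z: "z : C" and eq: "PC.gam (fst x l) (co I d (mk I d (q(l := z))) l) = PC.gam (fst y l) (co I d (mk I d (q(l := z))) l)"
   have qz: "ALL i:{1..d}. (q(l := z)) i : C" using q z by simp
   show "PC.gam (fst x l) z = PC.gam (fst y l) z" using eq unfolding co_mk[OF qz l] by simp
  qed
  show ?thesis by (rule PC.gam_inj[OF wr(3)[OF x l] wr(3)[OF y l]]) (rule C.gen_mono[OF s'], simp only:)
 qed
 have "fst x : PiE {1..d} (%_. carrier G)" "fst y : PiE {1..d} (%_. carrier G)" using x y unfolding Wr_eq by auto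
 then have "fst x = fst y" by (rule PiE_ext) (rule fl)
 with `snd x = snd y` show ?thesis by (rule prod_eqI[rotated])
qed

theorem power_galois_extension: "galois_extension LV KV" "galois_group LV KV \<cong> WG"
proof -
 have "{z : carrier LV. ALL sg:carrier (galois_group LV KV). sg z = z} = KV"
 proof (rule Set.set_eqI, rule iffI)
  fix z assume "z : {z : carrier LV. ALL sg:carrier (galois_group LV KV). sg z = z}"
  then have z: "z : carrier LV" "!!x. x : Wr ==> Phi x z = z" using Phi_galois by blast+
  obtain f where f: "ratl A V f" "z = cls A V f" using V.carrierE[OF z(1)] by blast
  have "PV.symf f"
  proof (rule invariant_symf_power[OF f(1)])
   fix x assume x: "x : Wr"
   show "gen A V (%p. f (tau x p) = f p)" using z(2)[OF x] unfolding f(2) Phi_cls[OF x f(1)] V.cls_eq_iff[OF tau_ratl[OF x f(1)]] .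
  qed
  then show "z : KV" unfolding f(2) by blast
 next
  fix z assume z: "z : KV"
  then have "z : carrier LV" using V.cls_carrier PV.symf_ratl by blast
  moreover have "sg z = z" if "sg : carrier (galois_group LV KV)" for sg using that z unfolding galois_group_carrier by blast
  ultimately show "z : {z : carrier LV. ALL sg:carrier (galois_group LV KV). sg z = z}" by (intro CollectI conjI ballI)
 qed
 then show "galois_extension LV KV" unfolding galois_extension_def using V.field_L PV.subfield_symf algebraic_KV by blast
 have "Phi : iso (WG) (galois_group LV KV)" unfolding iso_def
 proof (rule CollectI, rule conjI)
  show "Phi : hom (WG) (galois_group LV KV)"
  proof (rule homI)
   show "Phi x : carrier (galois_group LV KV)" if "x : Wr" for x by (rule Phi_galois[OF that])
   fix x y assume x: "x : Wr" and y: "y : Wr"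
   show "Phi (x \<otimes>\<^bsub>WG\<^esub> y) = Phi x \<otimes>\<^bsub>galois_group LV KV\<^esub> Phi y" unfolding galois_group_mult[OF Phi_galois[OF x] Phi_galois[OF y]]
   proof (rule extensionalityI)
   show "Phi (x \<otimes>\<^bsub>WG\<^esub> y) : extensional (carrier LV)" unfolding Phi_def by (rule restrict_extensional)
   show "compose (carrier LV) (Phi x) (Phi y) : extensional (carrier LV)" by (rule compose_extensional)
   fix z assume z: "z : carrier LV"
   show "Phi (x \<otimes>\<^bsub>WG\<^esub> y) z = compose (carrier LV) (Phi x) (Phi y) z" unfolding Phi_mult[OF x y z] compose_eq[OF z] ..
   qed
  qed
  show "bij_betw Phi Wr (carrier (galois_group LV KV))" unfolding bij_betw_def
  proof
   show "inj_on Phi Wr" by (rule inj_onI) (rule Phi_inj)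
   show "Phi ` Wr = carrier (galois_group LV KV)" using Phi_galois galois_image by blast
  qed
 qed
 then have "WG \<cong> galois_group LV KV" unfolding is_iso_def by blast
 then show "galois_group LV KV \<cong> WG" by (rule W.iso_sym)
qed

end

section \<open>Dimension\<close>

text \<open>Gaussian elimination: an equation with a nonzero coefficient at \<open>j0\<close>
  determines that unknown and leaves one equation and one unknown fewer.\<close>

lemma underdetermined_system:
 fixes a :: "'e => 'u => 'k::field"
 assumes "finite E" "finite U" "card E < card U"
 shows "EX c. (EX j:U. c j ~= 0) & (ALL i:E. (SUM j:U. a i j * c j) = 0)" using assms
proof (induction E arbitrary: U a rule: finite_induct)
 case empty
 then have "U ~= {}" by auto
 then show ?case by (intro exI[of _ "%_. 1"]) auto
next
 case (insert e E)
 show ?case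
 proof (cases "ALL j:U. a e j = 0")
  case True
  have "card E < card U" using insert.prems(2) insert.hyps by simp
  from insert.IH[OF insert.prems(1) this, of a] obtain c where c: "EX j:U. c j ~= 0" "ALL i:E. (SUM j:U. a i j * c j) = 0" by blast
  have "(SUM j:U. a e j * c j) = 0" by (rule sum.neutral) (use True in simp)
  then show ?thesis using c by blast
 next
  case False
  then obtain j0 where j0: "j0 : U" "a e j0 ~= 0" by blast
  let ?U = "U - {j0}"
  have "card E < card ?U" using insert.prems insert.hyps j0 by simp
  from insert.IH[OF _ this, of "%i j. a i j - a i j0 * a e j / a e j0"] insert.prems(1)
  obtain c where c: "EX j:?U. c j ~= 0" "ALL i:E. (SUM j:?U. (a i j - a i j0 * a e j / a e j0) * c j) = 0" by auto
  define c' where "c' j = (if j = j0 then - (SUM j:?U. a e j * c j) / a e j0 else c j)" for j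
  have s: "(SUM j:U. a i j * c' j) = (SUM j:?U. a i j * c j) - a i j0 * (SUM j:?U. a e j * c j) / a e j0" for i
  proof -
   have "(SUM j:U. a i j * c' j) = a i j0 * c' j0 + (SUM j:?U. a i j * c' j)" by (rule sum.remove[OF insert.prems(1) j0(1)])
   also have "(SUM j:?U. a i j * c' j) = (SUM j:?U. a i j * c j)" by (rule sum.cong) (auto simp: c'_def)
   finally show ?thesis by (simp add: c'_def)
  qed
  have "(SUM j:U. a i j * c' j) = 0" if "i : E" for i
  proof -
   have "(SUM j:?U. (a i j - a i j0 * a e j / a e j0) * c j) = (SUM j:?U. a i j * c j) - a i j0 * (SUM j:?U. a e j * c j) / a e j0"
   by (simp add: left_diff_distrib sum_subtractf sum_distrib_left sum_divide_distrib mult.assoc)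
   then show ?thesis using c(2) that unfolding s by simp
  qed
  moreover have "(SUM j:U. a e j * c' j) = 0" unfolding s using j0(2) by simp
  moreover have "EX j:U. c' j ~= 0" using c(1) by (auto simp: c'_def)
  ultimately show ?thesis by blast
 qed
qed

section \<open>Counting monomials and building polynomial relations\<close>

definition mons :: "nat => nat => (nat \<Rightarrow>\<^sub>0 nat) set"
 where "mons m D = {mu. mkeys mu <= {..m} & mdeg mu = D}"

text \<open>The exponent of the variable \<open>0\<close> is determined by the degree and the other
  \<open>m\<close> exponents; this gives the power \<open>m\<close> and not \<open>m + 1\<close>, on
  which the dimension bound depends.\<close>

lemma card_mons: "finite (mons m D)" "card (mons m D) <= (D + 1) ^ m"
proof -
 let ?f = "%mu :: nat \<Rightarrow>\<^sub>0 nat. \<lambda>i\<in>{1..m}. mlookup mu i"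
 let ?P = "PiE {1..m} (%_. {..D})"
 have deg: "D = mlookup mu 0 + (SUM i:{1..m}. mlookup mu i)" if "mu : mons m D" for mu
 proof -
  have "D = (SUM i:{..m}. mlookup mu i)" using that mdeg_superset[of "{..m}" mu] by (simp add: mons_def)
  also have "{..m} = insert 0 {1..m}" by auto
  finally show ?thesis by simp
 qed
 have inj: "inj_on ?f (mons m D)"
 proof (rule inj_onI)
  fix mu nu assume a: "mu : mons m D" "nu : mons m D" and e: "?f mu = ?f nu"
  have 1: "mlookup mu i = mlookup nu i" if "i : {1..m}" for i using fun_cong[OF e, of i] that by simp
  have "(SUM i:{1..m}. mlookup mu i) = (SUM i:{1..m}. mlookup nu i)" by (rule sum.cong[OF refl 1])
  then have 0: "mlookup mu 0 = mlookup nu 0" using deg[OF a(1)] deg[OF a(2)] by linarith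
  show "mu = nu"
  proof (rule poly_mapping_eqI)
   fix i
   consider "i = 0" | "i : {1..m}" | "i ~: {..m}" by force
   then show "mlookup mu i = mlookup nu i"
   proof cases
   case 3
   then have "i ~: mkeys mu" "i ~: mkeys nu" using a unfolding mons_def by blast+
   then show ?thesis by (simp add: in_keys_iff)
   qed (use 0 1 in auto)
  qed
 qed
 have im: "?f ` mons m D <= ?P"
 proof (rule image_subsetI, rule PiE_I)
  fix mu i assume a: "mu : mons m D" "i : {1..m}"
  have "mlookup mu i <= (SUM i:{1..m}. mlookup mu i)" by (rule member_le_sum) (use a in auto)
  then show "?f mu i : {..D}" using a(2) deg[OF a(1)] by simp
 qed auto
 have fin: "finite ?P" by (intro finite_PiE) auto
 show "finite (mons m D)" by (rule inj_on_finite[OF inj im fin])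
 have "card (mons m D) <= card ?P" by (rule card_inj_on_le[OF inj im fin])
 then show "card (mons m D) <= (D + 1) ^ m" by (simp add: card_PiE)
qed

lemma hompf_mons:
 assumes "hompf {..m} D f" shows "EX a. ALL x. f x = (SUM mu:mons m D. a mu * mval mu x)"
proof -
 obtain F where F: "hom_poly {..m} D F" "f = mv_eval F" using assms unfolding hompf_def by blast
 have "mkeys F <= mons m D" using F(1) unfolding hom_poly_def mons_def mdeg_def by blast
 then show ?thesis using mv_eval_superset[OF card_mons(1)] F(2) by metis
qed

definition mon :: "nat => (nat => nat) => nat \<Rightarrow>\<^sub>0 nat"
 where "mon m al = (SUM i<=m. msingle i (al i))"

lemma lookup_mon: "mlookup (mon m al) i = (if i <= m then al i else 0)"
proof -
 have "mlookup (mon m al) i = (SUM j<=m. if j = i then al j else 0)" unfolding mon_def lookup_sum by (rule sum.cong[OF refl]) (simp add: lookup_single when_def)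
 then show ?thesis by simp
qed

lemma keys_mon: "mkeys (mon m al) <= {..m}"
proof
 fix i assume "i : mkeys (mon m al)"
 then show "i : {..m}" unfolding in_keys_iff lookup_mon by (simp split: if_splits)
qed

lemma mval_mon: "mval (mon m al) x = (PROD i<=m. x i ^ al i)" unfolding mval_superset[OF finite_atMost keys_mon] by (rule prod.cong[OF refl]) (simp add: lookup_mon)

lemma nontrivial_relation:
 fixes c :: "(nat => nat) => 'k::field"
 assumes U: "finite U" "U <= extensional {..m}" and al: "al : U" "c al ~= 0"
 defines "F == SUM al:U. msingle (mon m al) (c al)"
 shows "F ~= 0" "!!mu. mu : mkeys F ==> mkeys mu <= {..m}"
  "mv_eval F x = (SUM al:U. c al * (PROD i<=m. x i ^ al i))"
proof -
 \<comment> \<open>The exponent functions are extensional, so different ones give different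
   monomials and the coefficient at \<open>mon m al\<close> cannot cancel.\<close>
 have inj: "be = al" if "be : U" "mon m be = mon m al" for be
 proof (rule extensionalityI[of _ "{..m}"])
  show "be : extensional {..m}" "al : extensional {..m}" using that U al by blast+
  show "be i = al i" if "i : {..m}" for i using arg_cong[OF `mon m be = mon m al`, of "%mu. mlookup mu i"] that by (simp add: lookup_mon)
 qed
 have "mlookup F (mon m al) = (SUM be:U. if be = al then c be else 0)" unfolding F_def lookup_sum
 proof (rule sum.cong[OF refl])
  fix be assume "be : U"
  then show "mlookup (msingle (mon m be) (c be)) (mon m al) = (if be = al then c be else 0)" using inj[of be] by (auto simp: lookup_single when_def)
 qed
 also have "... = c al" using U(1) al(1) by simp
 finally show "F ~= 0" using al(2) by auto
 show "mkeys mu <= {..m}" if "mu : mkeys F" for mu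
 proof -
  have "mu : (UN al:U. mkeys (msingle (mon m al) (c al)))" using that keys_sum[of "%al. msingle (mon m al) (c al)" U] unfolding F_def by blast
  then show ?thesis using keys_mon by (auto split: if_splits)
 qed
 show "mv_eval F x = (SUM al:U. c al * (PROD i<=m. x i ^ al i))" unfolding F_def mv_eval_sum mv_eval_single mval_mon ..
qed

context proj_variety
begin

text \<open>Generically \<open>f\<close> takes values in the finite root set of \<open>q\<close>, so
  the product of all \<open>f - a\<close> over the roots vanishes; the function field has no zero
  divisors.\<close>

lemma root_const:
 assumes f: "ratl I V f" and q: "q ~= 0" and g: "gen I V (%p. poly q (f p) = 0)" shows "EX a. gen I V (%p. f p = a)"
proof -
 have fin: "finite {a. poly q a = 0}" by (rule poly_roots_finite[OF q])
 have "gen I V (%p. (PROD a:{a. poly q a = 0}. f p - a) = 0)"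
 proof (rule gen_mono[OF g])
  fix p assume "poly q (f p) = 0"
  then show "(PROD a:{a. poly q a = 0}. f p - a) = 0" by (intro prod_zero[OF fin] bexI[of _ "f p"]) simp_all
 qed
 from gen_prod_zero[OF fin _ this] ratl_diff[OF f ratl_const] obtain a where "gen I V (%p. f p - a = 0)" by blast
 then have "gen I V (%p. f p = a)" by (rule gen_mono) simp
 then show ?thesis by blast
qed

lemma alg_independent_cls:
 assumes f: "!!i. i < n ==> ratl I V (f i)" "!!i. i < n ==> t i = cls I V (f i)"
 shows "alg_independent I V n t \<longleftrightarrow> (ALL F :: (nat, 'k) mvpoly. (ALL m:mkeys F. mkeys m <= {..<n}) -->
  gen I V (%p. mv_eval F (%i. f i p) = 0) --> F = 0)"
proof -
 have key: "finsum L (%m. const_rat I V (mlookup F m) \<otimes>\<^bsub>L\<^esub>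
   finprod L (%i. t i [^]\<^bsub>L\<^esub> mlookup m i) (mkeys m)) (mkeys F) = cls I V (%p. mv_eval F (%i. f i p))
   & ratl I V (%p. mv_eval F (%i. f i p))"
  if F: "ALL m:mkeys F. mkeys m <= {..<n}" for F :: "(nat, 'k) mvpoly"
 proof -
  let ?h = "%m p. mlookup F m * (PROD i:mkeys m. f i p ^ mlookup m i)"
  have rm: "ratl I V (%p. f i p ^ k)" if "m : mkeys F" "i : mkeys m" for m i k by (rule ratl_power[OF f(1)]) (use F that in blast)
  have rp: "ratl I V (%p. PROD i:mkeys m. f i p ^ mlookup m i)" if "m : mkeys F" for m by (rule ratl_prod[OF rm[OF that]])
  have rh: "ratl I V (?h m)" if "m : mkeys F" for m by (rule ratl_mult[OF ratl_const rp[OF that]])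
  have tm: "const_rat I V (mlookup F m) \<otimes>\<^bsub>L\<^esub>
   finprod L (%i. t i [^]\<^bsub>L\<^esub> mlookup m i) (mkeys m) = cls I V (?h m)" if m: "m : mkeys F" for m
  proof -
   have "finprod L (%i. t i [^]\<^bsub>L\<^esub> mlookup m i) (mkeys m) =
   finprod L (%i. cls I V (%p. f i p ^ mlookup m i)) (mkeys m)"
   proof (rule L.finprod_cong'[OF refl])
   show "(%i. cls I V (%p. f i p ^ mlookup m i)) : mkeys m \<rightarrow> carrier L" using cls_carrier[OF rm[OF m]] by blast
   fix i assume "i : mkeys m"
   then have i: "i < n" using F m by blast
   show "t i [^]\<^bsub>L\<^esub> mlookup m i = cls I V (%p. f i p ^ mlookup m i)" unfolding f(2)[OF i] by (rule pow_cls[OF f(1)[OF i]])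
   qed
   also have "... = cls I V (%p. PROD i:mkeys m. f i p ^ mlookup m i)" by (rule finprod_cls[OF finite_keys rm[OF m]])
   finally show ?thesis unfolding const_rat_eq by (simp only: mult_cls[OF ratl_const rp[OF m]])
  qed
  have "finsum L (%m. const_rat I V (mlookup F m) \<otimes>\<^bsub>L\<^esub>
   finprod L (%i. t i [^]\<^bsub>L\<^esub> mlookup m i) (mkeys m)) (mkeys F) = finsum L (%m. cls I V (?h m)) (mkeys F)" by (rule L.finsum_cong'[OF refl _ tm]) (use cls_carrier[OF rh] in blast)
  also have "... = cls I V (%p. SUM m:mkeys F. ?h m p)" by (rule finsum_cls[OF finite_keys rh])
  finally show ?thesis unfolding mv_eval_def using ratl_sum[of "mkeys F" ?h, OF rh] by blast
 qed
 have car: "ALL i<n. t i : carrier L" using f cls_carrier by simp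
 show ?thesis
 proof
  assume a: "alg_independent I V n t"
  show "ALL F :: (nat, 'k) mvpoly. (ALL m:mkeys F. mkeys m <= {..<n}) -->
   gen I V (%p. mv_eval F (%i. f i p) = 0) --> F = 0"
  proof (intro allI impI)
   fix F :: "(nat, 'k) mvpoly"
   assume F: "ALL m:mkeys F. mkeys m <= {..<n}" and g: "gen I V (%p. mv_eval F (%i. f i p) = 0)"
   have "cls I V (%p. mv_eval F (%i. f i p)) = \<zero>\<^bsub>L\<^esub>" unfolding zero_L by (rule cls_cong[OF g])
   then show "F = 0" using a F key[OF F] unfolding alg_independent_def by simp
  qed
 next
  assume a: "ALL F :: (nat, 'k) mvpoly. (ALL m:mkeys F. mkeys m <= {..<n}) -->
   gen I V (%p. mv_eval F (%i. f i p) = 0) --> F = 0"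
  show "alg_independent I V n t" unfolding alg_independent_def
  proof (rule conjI[OF car], intro allI impI)
   fix F :: "(nat, 'k) mvpoly"
   assume F: "ALL m:mkeys F. mkeys m <= {..<n}"
   and z: "finsum L (%m. const_rat I V (mlookup F m) \<otimes>\<^bsub>L\<^esub>
   finprod L (%i. t i [^]\<^bsub>L\<^esub> mlookup m i) (mkeys m)) (mkeys F) = \<zero>\<^bsub>L\<^esub>"
   have "cls I V (%p. mv_eval F (%i. f i p)) = cls I V (%_. 0)" using z key[OF F] unfolding zero_L by simp
   then have "gen I V (%p. mv_eval F (%i. f i p) = 0)" using cls_eq_iff[OF conjunct2[OF key[OF F]]] by simp
   then show "F = 0" using a F by blast
  qed
 qed
qed

lemma alg_independent_repr:
 assumes "alg_independent I V n t"
 obtains f where "!!i. i < n ==> ratl I V (f i)" "!!F :: (nat, 'k) mvpoly. (ALL m:mkeys F. mkeys m <= {..<n}) ==>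
  gen I V (%p. mv_eval F (%i. f i p) = 0) ==> F = 0"
proof -
 have "ALL i. EX f. i < n --> ratl I V f & t i = cls I V f" using assms carrierE unfolding alg_independent_def by blast
 from choice[OF this] obtain f where f: "ALL i. i < n --> ratl I V (f i) & t i = cls I V (f i)" ..
 have f1: "!!i. i < n ==> ratl I V (f i)" and f2: "!!i. i < n ==> t i = cls I V (f i)" using f by blast+
 note iff = iffD1[OF alg_independent_cls[OF f1 f2] assms]
 show ?thesis
 proof (rule that)
  show "!!i. i < n ==> ratl I V (f i)" by (rule f1)
  fix F :: "(nat, 'k) mvpoly"
  assume "ALL m:mkeys F. mkeys m <= {..<n}" "gen I V (%p. mv_eval F (%i. f i p) = 0)"
  then show "F = 0" using iff by blast
 qed
qed

end

context galois_projection
begin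

text \<open>A linear relation would make the projected point constant, so every quotient of forms in
  it is constant. An arbitrary rational function is a root of the polynomial of its conjugates,
  whose coefficients are then constants, so it is constant too and the transcendence degree is
  0.\<close>

lemma nonconstant_of_dim:
 assumes m: "m = 1" and dim: "variety_dim I C = 1" and ab: "(al, be) ~= (0, 0)"
 shows "gen I C (%x. al * t 0 x + be * t 1 x ~= 0)"
proof (rule ccontr)
 assume n: "~ ?thesis"
 have "ratl I C (%x. al * t 0 x + be * t 1 x)" by (intro ratl_add ratl_mult ratl_const t_ratl)
 then have z: "gen I C (%x. al * t 0 x + be * t 1 x = 0)" using n ratl_zero_or_nonzero by blast
 have symf_const: "EX a. gen I C (%p. f p = a)" if f: "symf f" for f
 proof -
  obtain n F H where F0: "hompf {..m} n F" "hompf {..m} n H"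
   and g: "gen I C (%p. H (%k. t k p) ~= 0 & f p = F (%k. t k p) / H (%k. t k p))" using f unfolding symf_def by blast
  note F = F0[unfolded m]
  \<comment> \<open>The solutions of the linear relation are the multiples of the vector
    \<open>(be, - al)\<close>.\<close>
  let ?w = "%k::nat. if k = 0 then be else - al"
  have "gen I C (%p. f p = F ?w / H ?w)"
  proof (rule gen_mono2[OF z g])
   fix p assume a: "al * t 0 p + be * t 1 p = 0" and b: "H (%k. t k p) ~= 0 & f p = F (%k. t k p) / H (%k. t k p)"
   obtain c where c: "t 0 p = c * be" "t 1 p = c * - al"
   proof (cases "be = 0")
   case True
   then have "al ~= 0" "t 0 p = 0" using ab a by auto
   then show ?thesis using that[of "- t 1 p / al"] True by simp
   next
   case False
   then have "t 1 p = - (al * t 0 p) / be" using a by (simp add: field_simps eq_neg_iff_add_eq_0)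
   then show ?thesis using that[of "t 0 p / be"] False by simp
   qed
   have e: "Q (%k. t k p) = c ^ n * Q ?w" if Q: "hompf {..1} n Q" for Q
   proof -
   have "Q (%k. t k p) = Q (scal c ?w)"
   proof (rule hompf_cong_on[OF Q])
   fix k :: nat assume "k : {..1}"
   then have "k = 0 \<or> k = 1" by auto
   then show "t k p = scal c ?w k" using c by (auto simp: scal_def)
   qed
   then show ?thesis using hompf_scale[OF Q] by simp
   qed
   show "f p = F ?w / H ?w" using b unfolding e[OF F(1)] e[OF F(2)] by auto
  qed
  then show ?thesis by blast
 qed
 have const: "EX a. gen I C (%p. f p = a)" if f: "ratl I C f" for f
 proof -
  define e where "e k p = pcoeff (PROD g:carrier G. [:- f (gam g p), 1:]) k" for k p
  let ?n = "card (carrier G)"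
  have er: "ratl I C (e k)" for k unfolding e_def[abs_def] by (rule ratl_coeff_prod[OF finite_G ratl_uminus[OF gam_ratl[OF _ f]] ratl_const])
  have es: "symf (e k)" for k
  proof (rule invariant_symf[OF er])
   fix h assume h: "h : carrier G"
   have "gen I C (%p. ALL g:carrier G. gam (h \<otimes> g) p = gam g (gam h p))" by (rule gen_ball[OF finite_G]) (rule gam_mult[OF h])
   then show "gen I C (%p. e k (gam h p) = e k p)"
   proof (rule gen_mono)
   fix p assume a: "ALL g:carrier G. gam (h \<otimes> g) p = gam g (gam h p)"
   have "(PROD g:carrier G. [:- f (gam g (gam h p)), 1:]) = (PROD g:carrier G. [:- f (gam (h \<otimes> g) p), 1:])" by (rule prod.cong[OF refl]) (use a in simp)
   also have "... = (PROD g:carrier G. [:- f (gam g p), 1:])" by (rule prod.reindex_bij_betw[OF G.bij_betw_left_mult[OF h]])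
   finally show "e k (gam h p) = e k p" unfolding e_def by simp
   qed
  qed
  have "ALL k. EX a. gen I C (%p. e k p = a)" using symf_const[OF es] by blast
  from choice[OF this] obtain a where a: "ALL k. gen I C (%p. e k p = a k)" ..
  let ?q = "SUM k<=?n. Polynomial.monom (a k) k"
  have "gen I C (%p. ALL k:{..?n}. e k p = a k)" by (rule gen_ball[OF finite_atMost]) (rule spec[OF a])
  then have "gen I C (%p. poly ?q (f p) = 0)"
  proof (rule gen_mono2[OF _ gam_one])
   fix p assume b: "ALL k:{..?n}. e k p = a k" and o: "gam \<one> p = p"
   have "poly ?q (f p) = (SUM k<=?n. e k p * f p ^ k)" unfolding poly_sum poly_monom by (rule sum.cong[OF refl]) (use b in simp)
   also have "... = poly (PROD g:carrier G. [:- f (gam g p), 1:]) (f p)" unfolding e_def by (rule poly_eq_sum[OF degree_prod_linear[OF finite_G], symmetric])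
   also have "... = (PROD g:carrier G. f p - f (gam g p))" by (simp add: poly_prod)
   also have "... = 0" by (rule prod_zero[OF finite_G], rule bexI[OF _ G.one_closed]) (simp only: o diff_self)
   finally show "poly ?q (f p) = 0" .
  qed
  moreover have "?q ~= 0"
  proof -
   have "gen I C (%p. a ?n = 1)" by (rule gen_mono[OF spec[OF a, of ?n]]) (simp only: e_def monic_prod_linear[OF finite_G])
   then have an: "a ?n = 1" by simp
   have "pcoeff ?q ?n = (SUM k<=?n. if k = ?n then a k else 0)" unfolding coeff_sum coeff_monom ..
   then have "pcoeff ?q ?n = 1" using an by simp
   then show ?thesis by (metis coeff_0 zero_neq_one)
  qed
  ultimately show ?thesis using root_const[OF f] by blast
 qed
 have "variety_dim I C = 0" unfolding variety_dim_def
 proof (rule Greatest_equality)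
  have "alg_independent I C 0 (%_. cls I C (%_. 0))"
  proof (rule iffD2[OF alg_independent_cls[of 0 "%_ _. 0"]])
   show "ALL F :: (nat, 'k) mvpoly. (ALL m:mkeys F. mkeys m <= {..<0}) --> gen I C (%p. mv_eval F (%i. 0) = 0) --> F = 0"
   proof (intro allI impI, rule ccontr)
   fix F :: "(nat, 'k) mvpoly"
   assume F: "ALL m:mkeys F. mkeys m <= {..<0}" "gen I C (%p. mv_eval F (%i. 0) = 0)" "F ~= 0"
   have "mkeys F ~= {}" using F(3) by simp
   moreover have "m = 0" if "m : mkeys F" for m using F(1) that by auto
   ultimately have k: "mkeys F = {0}" by blast
   then have "mlookup F 0 ~= 0" by (metis in_keys_iff singletonI)
   then show False using F(2) unfolding mv_eval_mval k by simp
   qed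
  qed simp_all
  then show "EX t. alg_independent I C 0 t" by blast
 next
  fix n assume "EX t. alg_independent I C n t"
  then obtain t' where "alg_independent I C n t'" ..
  then obtain f where f: "!!i. i < n ==> ratl I C (f i)" and ind: "!!F :: (nat, 'k) mvpoly. (ALL m:mkeys F. mkeys m <= {..<n}) ==>
   gen I C (%p. mv_eval F (%i. f i p) = 0) ==> F = 0" by (rule alg_independent_repr) (rule that)
  show "n <= 0"
  proof (rule ccontr)
   assume "~ n <= 0"
   then have n0: "0 < n" by simp
   obtain a where a: "gen I C (%p. f 0 p = a)" using const[OF f[OF n0]] by blast
   let ?F = "msingle (msingle 0 1) 1 + msingle 0 (- a) :: (nat, 'k) mvpoly"
   have ev: "mv_eval ?F x = x 0 - a" for x unfolding mv_eval_add mv_eval_single mval_single by simp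
   have "?F = 0"
   proof (rule ind)
   show "gen I C (%p. mv_eval ?F (%i. f i p) = 0)" unfolding ev by (rule gen_mono[OF a]) simp
   show "ALL m:mkeys ?F. mkeys m <= {..<n}"
   proof
   fix m assume "m : mkeys ?F"
   then have "m : mkeys (msingle (msingle 0 1) 1 :: (nat, 'k) mvpoly) Un mkeys (msingle 0 (- a) :: (nat, 'k) mvpoly)" by (rule subsetD[OF Poly_Mapping.keys_add])
   then have "m = msingle 0 1 \<or> m = 0" by (auto split: if_splits)
   then show "mkeys m <= {..<n}" using n0 by auto
   qed
   qed
   then have "mv_eval ?F (%_. a + 1) = 0" by (simp only: mv_eval_0)
   then show False unfolding ev by simp
  qed
 qed
 with dim show False by simp
qed

end

section \<open>Algebraic dependence of functions algebraic over the pulled back field\<close>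

context projected_variety
begin

lemma symf_common_denominator:
 assumes "finite B" "!!b. b : B ==> symf (e b)"
 shows "EX r Q N. hompf {..m} r Q & (ALL b:B. hompf {..m} r (N b)) & gen I V (%p. Q (%k. t k p) ~= 0 & (ALL b:B. e b p = N b (%k. t k p) / Q (%k. t k p)))" using assms
proof (induction B rule: finite_induct)
 case empty
 show ?case by (rule exI[of _ 0], rule exI[of _ "%_. 1"]) (simp add: hompf_const)
next
 case (insert b0 B)
 from insert.IH insert.prems obtain r Q N where Q: "hompf {..m} r Q" "ALL b:B. hompf {..m} r (N b)"
  and g: "gen I V (%p. Q (%k. t k p) ~= 0 & (ALL b:B. e b p = N b (%k. t k p) / Q (%k. t k p)))" by blast
 obtain n F H where F: "hompf {..m} n F" "hompf {..m} n H"
  and g': "gen I V (%p. H (%k. t k p) ~= 0 & e b0 p = F (%k. t k p) / H (%k. t k p))" using insert.prems[of b0] unfolding symf_def by blast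
 let ?N = "%b y. if b = b0 then Q y * F y else N b y * H y"
 show ?case
 proof (intro exI conjI)
  show "hompf {..m} (r + n) (%y. Q y * H y)" by (rule hompf_mult[OF Q(1) F(2)])
  show "ALL b:insert b0 B. hompf {..m} (r + n) (?N b)"
  proof
   fix b assume "b : insert b0 B"
   then consider "b = b0" | "b ~= b0" "b : B" by blast
   then show "hompf {..m} (r + n) (?N b)"
   proof cases
   case 1
   then show ?thesis using hompf_mult[OF Q(1) F(1)] by simp
   next
   case 2
   show ?thesis using hompf_mult[OF bspec[OF Q(2) 2(2)] F(2)] 2(1) by simp
   qed
  qed
  show "gen I V (%p. Q (%k. t k p) * H (%k. t k p) ~= 0 & (ALL b:insert b0 B. e b p = ?N b (%k. t k p) / (Q (%k. t k p) * H (%k. t k p))))" by (rule gen_mono2[OF g g']) (use insert.hyps(2) in auto)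
 qed
qed

text \<open>With \<open>Q\<close> a common denominator of the coefficients of the monic equation,
  multiplication by \<open>Q * y\<close> preserves the combinations of the powers
  \<open>y ^ k\<close> with \<open>k <= h\<close>. The degrees of the coefficient forms grow only
  linearly in the exponent \<open>a\<close>, which the counting of monomials relies on.\<close>

lemma integral_powers:
 assumes e: "!!k. k < Suc h ==> symf (e k)" and y: "gen I V (%p. y p ^ Suc h = (SUM k<Suc h. e k p * y p ^ k))"
 shows "EX r Q R. hompf {..m} r Q & (ALL a k. hompf {..m} (r * a) (R a k)) &
  gen I V (%p. Q (%k. t k p) ~= 0 & (ALL a. Q (%k. t k p) ^ a * y p ^ a = (SUM k<Suc h. R a k (%k. t k p) * y p ^ k)))"
proof -
 obtain r Q N where Q: "hompf {..m} r Q" "ALL k:{..<Suc h}. hompf {..m} r (N k)"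
  and g: "gen I V (%p. Q (%k. t k p) ~= 0 & (ALL k:{..<Suc h}. e k p = N k (%k. t k p) / Q (%k. t k p)))" using symf_common_denominator[of "{..<Suc h}" e] e by auto
 define N' where "N' k = (if k < Suc h then N k else (%_. 0))" for k
 have N': "hompf {..m} r (N' k)" for k using Q(2) by (auto simp: N'_def hompf_zero)
 \<comment> \<open>Multiplication by \<open>Q * y\<close> on coefficient vectors: entries move up by
   one place, and the overflowing entry \<open>R a h\<close> is reduced by the equation of
   \<open>y\<close>.\<close>
 define R where "R = rec_nat (%k::nat. %z. if k = 0 then 1 else 0 :: 'k) (%a R k z. Q z * (case k of 0 => 0 | Suc k => R k z) + R h z * N' k z)"
 have R0: "R 0 k z = (if k = 0 then 1 else 0)" for k z unfolding R_def by simp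
 have RS: "R (Suc a) k z = Q z * (case k of 0 => 0 | Suc k => R a k z) + R a h z * N' k z" for a k z unfolding R_def by simp
 have hR: "hompf {..m} (r * a) (R a k)" for a k
 proof (induction a arbitrary: k)
  case 0
  have "R 0 k = (%z. if k = 0 then 1 else 0)" by (rule ext) (rule R0)
  then show ?case using hompf_const[of "{..m}" "if k = 0 then 1 else 0"] by simp
 next
  case (Suc a)
  have 1: "hompf {..m} (r + r * a) (%z. Q z * (case k of 0 => 0 | Suc k => R a k z))"
  proof (cases k)
   case 0 then show ?thesis by (simp add: hompf_zero)
  next
   case (Suc k') then show ?thesis using hompf_mult[OF Q(1) Suc.IH[of k']] by simp
  qed
  have 2: "hompf {..m} (r + r * a) (%z. R a h z * N' k z)" using hompf_mult[OF Suc.IH[of h] N'[of k]] by (simp only: add.commute)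
  have "R (Suc a) k = (%z. Q z * (case k of 0 => 0 | Suc k => R a k z) + R a h z * N' k z)" by (rule ext) (rule RS)
  then show ?case using hompf_add[OF 1 2] by (simp only: mult_Suc_right)
 qed
 have "gen I V (%p. Q (%k. t k p) ~= 0 & (ALL a. Q (%k. t k p) ^ a * y p ^ a = (SUM k<Suc h. R a k (%k. t k p) * y p ^ k)))"
 proof (rule gen_mono2[OF g y])
  fix p assume b: "Q (%k. t k p) ~= 0 & (ALL k:{..<Suc h}. e k p = N k (%k. t k p) / Q (%k. t k p))"
   and yp: "y p ^ Suc h = (SUM k<Suc h. e k p * y p ^ k)"
  let ?t = "%k. t k p"
  have q: "Q ?t * y p ^ Suc h = (SUM k<Suc h. N' k ?t * y p ^ k)" unfolding yp sum_distrib_left by (rule sum.cong[OF refl]) (use b in "simp add: N'_def")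
  have "Q ?t ^ a * y p ^ a = (SUM k<Suc h. R a k ?t * y p ^ k)" for a
  proof (induction a)
   case 0
   show ?case unfolding sum.lessThan_Suc_shift by (simp add: R0)
  next
   case (Suc a)
   have "Q ?t ^ Suc a * y p ^ Suc a = Q ?t * y p * (Q ?t ^ a * y p ^ a)" by simp
   also have "... = Q ?t * y p * (SUM k<h. R a k ?t * y p ^ k) + R a h ?t * (Q ?t * y p ^ Suc h)" unfolding Suc.IH sum.lessThan_Suc by (simp add: algebra_simps)
   also have "... = (SUM k<h. Q ?t * R a k ?t * y p ^ Suc k) + (SUM k<Suc h. R a h ?t * N' k ?t * y p ^ k)" unfolding q sum_distrib_left by (simp add: mult_ac)
   also have "(SUM k<h. Q ?t * R a k ?t * y p ^ Suc k) = (SUM k<Suc h. Q ?t * (case k of 0 => 0 | Suc k => R a k ?t) * y p ^ k)" unfolding sum.lessThan_Suc_shift by simp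
   finally show ?case unfolding RS distrib_right sum.distrib .
  qed
  then show "Q ?t ~= 0 & (ALL a. Q ?t ^ a * y p ^ a = (SUM k<Suc h. R a k ?t * y p ^ k))" using b by blast
 qed
 then show ?thesis using Q(1) hR by blast
qed

text \<open>Clearing denominators, the monomials of degree at most \<open>s\<close> in each of the \<open>m + 1\<close> functions \<open>y i\<close> lie in a
 space of dimension `O(s ^ m)`, whereas there are `(s + 1) ^ (m + 1)` of them.\<close>

lemma algebraic_dependence:
 assumes alg: "!!i. i <= m ==> EX h e. (ALL k<Suc h. symf (e k)) & gen I V (%p. y i p ^ Suc h = (SUM k<Suc h. e k p * y i p ^ k))"
 shows "EX F :: (nat, 'k) mvpoly. F ~= 0 & (ALL mu:mkeys F. mkeys mu <= {..m}) & gen I V (%p. mv_eval F (%i. y i p) = 0)"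
proof -
 define P where "P i h r Q R \<longleftrightarrow> hompf {..m} r Q & (ALL a k. hompf {..m} (r * a) (R a k)) &
  gen I V (%p. Q (%k. t k p) ~= 0 & (ALL a. Q (%k. t k p) ^ a * y i p ^ a = (SUM k<Suc h. R a k (%k. t k p) * y i p ^ k)))"
  for i h r Q and R :: "nat => nat => (nat => 'k) => 'k"
 have "ALL i:{..m}. EX h r Q R. P i h r Q R"
 proof
  fix i assume "i : {..m}"
  then obtain h e where e: "!!k. k < Suc h ==> symf (e k)" "gen I V (%p. y i p ^ Suc h = (SUM k<Suc h. e k p * y i p ^ k))" using alg[of i] by auto
  from integral_powers[OF e] show "EX h r Q R. P i h r Q R" unfolding P_def by blast
 qed
 from bchoice[OF this] obtain h where "ALL i:{..m}. EX r Q R. P i (h i) r Q R" ..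
 from bchoice[OF this] obtain r where "ALL i:{..m}. EX Q R. P i (h i) (r i) Q R" ..
 from bchoice[OF this] obtain Q where "ALL i:{..m}. EX R. P i (h i) (r i) (Q i) R" ..
 from bchoice[OF this] obtain R where "ALL i:{..m}. P i (h i) (r i) (Q i) (R i)" ..
 then have Q: "!!i. i : {..m} ==> hompf {..m} (r i) (Q i)" and R: "!!i a k. i : {..m} ==> hompf {..m} (r i * a) (R i a k)"
  and g: "!!i. i : {..m} ==> gen I V (%p. Q i (%k. t k p) ~= 0 & (ALL a. Q i (%k. t k p) ^ a * y i p ^ a = (SUM k<Suc (h i). R i a k (%k. t k p) * y i p ^ k)))" unfolding P_def by blast+
 define rho where "rho = (SUM i:{..m}. r i)"
 define K where "K = (PROD i:{..m}. Suc (h i))"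
 \<comment> \<open>Chosen so that unknowns outnumber equations: the count
   \<open>K * (rho * s + 1) ^ m\<close> is at most \<open>K * ((rho + 1) * (s + 1)) ^ m\<close>,
   which equals \<open>s * (s + 1) ^ m\<close> and is less than
   \<open>(s + 1) ^ Suc m\<close>.\<close>
 define s where "s = K * (rho + 1) ^ m"
 define U where "U = PiE {..m} (%_. {..s})"
 define B where "B = PiE {..m} (%i. {..<Suc (h i)})"
 let ?D = "rho * s"
 have finU: "finite U" and finB: "finite B" unfolding U_def B_def by (intro finite_PiE; simp)+
 have cU: "card U = (s + 1) ^ Suc m" unfolding U_def by (simp add: card_PiE)
 have cB: "card B = K" unfolding B_def K_def by (simp add: card_PiE)
 have "card (B \<times> mons m ?D) <= K * (?D + 1) ^ m" unfolding card_cartesian_product cB by (rule mult_left_mono[OF card_mons(2)]) simp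
 also have "... <= K * ((rho + 1) * (s + 1)) ^ m" by (intro mult_left_mono power_mono) (simp_all add: algebra_simps)
 also have "... = s * (s + 1) ^ m" unfolding power_mult_distrib s_def by (simp only: mult.assoc)
 also have "... < (s + 1) ^ Suc m" by simp
 finally have card: "card (B \<times> mons m ?D) < card U" unfolding cU .
 \<comment> \<open>The complementary powers of \<open>Q i\<close> bring all coefficient forms to the
   common degree \<open>rho * s\<close>, whatever the exponents \<open>al\<close>.\<close>
 define T where "T al be z = (PROD i:{..m}. Q i z ^ (s - al i) * R i (al i) (be i) z)" for al be :: "nat => nat" and z
 have hT: "hompf {..m} ?D (T al be)" if al: "al : U" for al be
 proof -
  have "hompf {..m} (SUM i:{..m}. r i * s) (%z. PROD i:{..m}. Q i z ^ (s - al i) * R i (al i) (be i) z)"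
  proof (rule hompf_prod)
   fix i assume i: "i : {..m}"
   have "al i <= s" using al i unfolding U_def by (auto dest: PiE_mem)
   then have "(s - al i) * r i + r i * al i = r i * s" by (metis add_mult_distrib2 le_add_diff_inverse2 mult.commute)
   then show "hompf {..m} (r i * s) (%z. Q i z ^ (s - al i) * R i (al i) (be i) z)" using hompf_mult[OF hompf_power[OF Q[OF i], of "s - al i"] R[OF i, of "al i" "be i"]] by simp
  qed
  then show ?thesis unfolding T_def[abs_def] rho_def sum_distrib_right .
 qed
 have "ALL albe. EX a. fst albe : U --> (ALL z. T (fst albe) (snd albe) z = (SUM mu:mons m ?D. a mu * mval mu z))" using hompf_mons[OF hT] by blast
 from choice[OF this] obtain a where a0: "ALL albe. fst albe : U --> (ALL z. T (fst albe) (snd albe) z = (SUM mu:mons m ?D. a albe mu * mval mu z))" ..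
 have a: "T al be z = (SUM mu:mons m ?D. a (al, be) mu * mval mu z)" if "al : U" for al be z using a0[rule_format, of "(al, be)" z] that by simp
 have fE: "finite (B \<times> mons m ?D)" using finB card_mons(1) by blast
 from underdetermined_system[OF fE finU card, of "%i al. a (al, fst i) (snd i)"]
 obtain c where c: "EX al:U. c al ~= 0" "ALL i:B \<times> mons m ?D. (SUM al:U. a (al, fst i) (snd i) * c al) = 0" by blast
 have gb: "gen I V (%p. ALL i:{..m}. Q i (%k. t k p) ~= 0 & (ALL a. Q i (%k. t k p) ^ a * y i p ^ a = (SUM k<Suc (h i). R i a k (%k. t k p) * y i p ^ k)))" by (rule gen_ball[OF finite_atMost g])
 have rel: "gen I V (%p. (SUM al:U. c al * (PROD i<=m. y i p ^ al i)) = 0)"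
 proof (rule gen_mono[OF gb])
  fix p assume b: "ALL i:{..m}. Q i (%k. t k p) ~= 0 & (ALL a. Q i (%k. t k p) ^ a * y i p ^ a = (SUM k<Suc (h i). R i a k (%k. t k p) * y i p ^ k))"
  let ?t = "%k. t k p" and ?q = "PROD i:{..m}. Q i (%k. t k p) ^ s" and ?y = "%be. PROD i:{..m}. y i p ^ be i"
  have e: "?q * (PROD i<=m. y i p ^ al i) = (SUM be:B. T al be ?t * ?y be)" if al: "al : U" for al
  proof -
   have "?q * (PROD i<=m. y i p ^ al i) = (PROD i:{..m}. Q i ?t ^ s * y i p ^ al i)" by (rule prod.distrib[symmetric])
   also have "... = (PROD i:{..m}. SUM k<Suc (h i). Q i ?t ^ (s - al i) * R i (al i) k ?t * y i p ^ k)"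
   proof (rule prod.cong[OF refl])
   fix i assume i: "i : {..m}"
   have "al i <= s" using al i unfolding U_def by (auto dest: PiE_mem)
   then have "Q i ?t ^ s * y i p ^ al i = Q i ?t ^ (s - al i) * (Q i ?t ^ al i * y i p ^ al i)" by (metis le_add_diff_inverse2 mult.assoc power_add)
   also have "... = Q i ?t ^ (s - al i) * (SUM k<Suc (h i). R i (al i) k ?t * y i p ^ k)" using b i by simp
   finally show "Q i ?t ^ s * y i p ^ al i = (SUM k<Suc (h i). Q i ?t ^ (s - al i) * R i (al i) k ?t * y i p ^ k)" unfolding sum_distrib_left mult.assoc .
   qed
   also have "... = (SUM be:B. PROD i:{..m}. Q i ?t ^ (s - al i) * R i (al i) (be i) ?t * y i p ^ be i)" unfolding B_def by (rule prod_sum_PiE) simp_all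
   also have "... = (SUM be:B. T al be ?t * ?y be)" unfolding T_def prod.distrib[symmetric] ..
   finally show ?thesis .
  qed
  have "?q * (SUM al:U. c al * (PROD i<=m. y i p ^ al i)) = (SUM al:U. c al * (SUM be:B. T al be ?t * ?y be))"
   unfolding sum_distrib_left[of ?q] by (rule sum.cong[OF refl]) (simp only: e[symmetric] mult.left_commute)
  also have "... = (SUM al:U. SUM be:B. SUM mu:mons m ?D. (a (al, be) mu * c al) * (mval mu ?t * ?y be))"
   unfolding sum_distrib_left by (intro sum.cong refl) (simp only: a sum_distrib_left sum_distrib_right mult_ac)
  also have "... = (SUM be:B. SUM al:U. SUM mu:mons m ?D. (a (al, be) mu * c al) * (mval mu ?t * ?y be))" by (rule sum.swap)
  also have "... = (SUM be:B. SUM mu:mons m ?D. SUM al:U. (a (al, be) mu * c al) * (mval mu ?t * ?y be))" by (rule sum.cong[OF refl]) (rule sum.swap)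
  also have "... = 0"
  proof (rule sum.neutral, rule ballI, rule sum.neutral, rule ballI)
   fix be mu assume "be : B" "mu : mons m ?D"
   then have "(SUM al:U. a (al, be) mu * c al) = 0" using c(2)[rule_format, of "(be, mu)"] by simp
   then show "(SUM al:U. (a (al, be) mu * c al) * (mval mu ?t * ?y be)) = 0" unfolding sum_distrib_right[symmetric] by simp
  qed
  finally show "(SUM al:U. c al * (PROD i<=m. y i p ^ al i)) = 0" using b by simp
 qed
 obtain al where al: "al : U" "c al ~= 0" using c(1) by blast
 have Ue: "U <= extensional {..m}" unfolding U_def by (auto simp: PiE_def)
 note F = nontrivial_relation[where U = U and m = m and al = al and c = c, OF finU Ue al]
 have "gen I V (%p. mv_eval (SUM al:U. msingle (mon m al) (c al)) (%i. y i p) = 0)" unfolding F(3) by (rule rel)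
 then show ?thesis using F(1,2) by blast
qed

end

section \<open>Algebraic independence of one function evaluated at different coordinates\<close>

context segre_power
begin

text \<open>For a nonconstant \<open>u\<close> the powers of \<open>u\<close> are linearly
  independent as functions on the points where \<open>u\<close> is regular, by
  \<open>root_const\<close>. Monomials in the values of \<open>u\<close> at different coordinates
  are separated products of these powers, hence independent.\<close>

lemma power_independent:
 fixes F :: "(nat, 'k) mvpoly"
 assumes u: "ratl I C u" and nc: "!!a. ~ gen I C (%x. u x = a)"
  and F: "ALL m:mkeys F. mkeys m <= {..<d}" and g: "gen A V (%p. mv_eval F (%i. u (co I d p (Suc i))) = 0)"
 shows "F = 0"
proof (rule ccontr)
 assume F0: "F ~= 0"
 let ?Xs = "{x : C. rg I C x u}" and ?D = "{1..d}"
 \<comment> \<open>By the identity principle the generic relation holds at every tuple of regular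
   points of \<open>u\<close>, so it may be evaluated pointwise.\<close>
 have pw: "mv_eval F (%i. u (q (Suc i))) = 0" if q: "ALL j:?D. q j : ?Xs" for q
 proof -
  have qC: "ALL j:?D. q j : C" using q by blast
  have pV: "mk I d q : V" by (rule mk_in_V[OF qC])
  have "rg A V (mk I d q) (%p. mv_eval F (%i. u (co I d p (Suc i))))"
  proof (rule rg_mv_eval[OF pV])
   fix i m assume "m : mkeys F" "i : mkeys m"
   then have "i < d" using F by blast
   then have i: "Suc i : ?D" by simp
   show "rg A V (mk I d q) (%p. u (co I d p (Suc i)))" by (rule rg_co[OF pV i]) (use q i co_mk[OF qC i] in simp)
  qed
  from V.rg_zero[OF this g] have z: "mv_eval F (%i. u (co I d (mk I d q) (Suc i))) = 0" .
  have "mv_eval F (%i. u (q (Suc i))) = mv_eval F (%i. u (co I d (mk I d q) (Suc i)))" unfolding mv_eval_def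
  proof (intro sum.cong refl arg_cong2[of _ _ _ _ "(*)"] prod.cong)
   fix m i assume "m : mkeys F" "i : mkeys m"
   then have "i < d" using F by blast
   then have i: "Suc i : ?D" by simp
   show "u (q (Suc i)) ^ mlookup m i = u (co I d (mk I d q) (Suc i)) ^ mlookup m i" unfolding co_mk[OF qC i] ..
  qed
  then show ?thesis using z by simp
 qed
 \<comment> \<open>Any number exceeding all exponents that occur in \<open>F\<close>.\<close>
 define n where "n = Suc (SUM m:mkeys F. mdeg m)"
 have bound: "mlookup m i < n" if m: "m : mkeys F" for m i
 proof -
  have "mlookup m i <= mdeg m"
  proof (cases "i : mkeys m")
   case True
   then show ?thesis unfolding mdeg_def by (intro member_le_sum) simp_all
  qed (simp add: in_keys_iff)
  also have "mdeg m <= (SUM m:mkeys F. mdeg m)" by (rule member_le_sum[OF m]) simp_all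
  finally show ?thesis unfolding n_def by simp
 qed
 have ind: "ALL i<n. c i = 0" if c: "ALL x:?Xs. (SUM i<n. c i * u x ^ i) = 0" for c
 proof -
  let ?q = "SUM i<n. Polynomial.monom (c i) i"
  have "gen I C (%x. poly ?q (u x) = 0)" by (rule C.gen_mono[OF C.ratl_gen[OF u]]) (use c in "simp add: poly_sum poly_monom")
  then have q0: "?q = 0" using C.root_const[OF u] nc by blast
  show ?thesis
  proof (intro allI impI)
   fix i assume i: "i < n"
   have "c i = (SUM l<n. if l = i then c l else 0)" using i by simp
   also have "... = pcoeff ?q i" unfolding coeff_sum coeff_monom ..
   finally show "c i = 0" unfolding q0 by simp
  qed
 qed
 from dual_point_functionals[of ?Xs "%i x. u x ^ i" n, OF ind]
 obtain Qs w where Qs: "finite Qs" "Qs <= ?Xs" "ALL i<n. ALL k<n. (SUM y:Qs. w i y * u y ^ k) = (if i = k then 1 else 0)" by blast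
 \<comment> \<open>The variables of \<open>F\<close> are numbered from 0, the coordinates of the
   power from 1.\<close>
 define enc where "enc m = (\<lambda>j\<in>?D. mlookup m (j - 1))" for m :: "nat \<Rightarrow>\<^sub>0 nat"
 have inj: "inj_on enc (mkeys F)"
 proof (rule inj_onI)
  fix m m' assume m: "m : mkeys F" "m' : mkeys F" and e: "enc m = enc m'"
  show "m = m'"
  proof (rule poly_mapping_eqI)
   fix i show "mlookup m i = mlookup m' i"
   proof (cases "i < d")
   case True
   then show ?thesis using fun_cong[OF e, of "Suc i"] by (simp add: enc_def)
   next
   case False
   then have "i ~: mkeys m" "i ~: mkeys m'" using F m by auto
   then show ?thesis by (simp add: in_keys_iff)
   qed
  qed
 qed
 have encP: "enc ` mkeys F <= PiE ?D (%_. {..<n})" using bound by (auto simp: enc_def)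
 define c where "c a = (if a : enc ` mkeys F then mlookup F (inv_into (mkeys F) enc a) else 0)" for a
 have fP: "finite (PiE ?D (%_. {..<n}))" by (intro finite_PiE) auto
 have sum_eq: "(SUM a:PiE ?D (%_. {..<n}). c a * (PROD j:?D. u (q j) ^ a j)) = mv_eval F (%i. u (q (Suc i)))" for q
 proof -
  have "(SUM a:PiE ?D (%_. {..<n}). c a * (PROD j:?D. u (q j) ^ a j)) = (SUM a:enc ` mkeys F. c a * (PROD j:?D. u (q j) ^ a j))" by (rule sum.mono_neutral_right[OF fP encP]) (simp add: c_def)
  also have "... = (SUM m:mkeys F. c (enc m) * (PROD j:?D. u (q j) ^ enc m j))" by (rule sum.reindex[OF inj, unfolded o_def])
  also have "... = (SUM m:mkeys F. mlookup F m * mval m (%i. u (q (Suc i))))"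
  proof (rule sum.cong[OF refl])
   fix m assume m: "m : mkeys F"
   have "c (enc m) = mlookup F m" using m inv_into_f_f[OF inj m] by (simp add: c_def)
   moreover have "(PROD j:?D. u (q j) ^ enc m j) = mval m (%i. u (q (Suc i)))"
   proof -
   have "mval m (%i. u (q (Suc i))) = (PROD i:{..<d}. u (q (Suc i)) ^ mlookup m i)" by (rule mval_superset) (use F m in auto)
   also have "... = (PROD j:?D. u (q j) ^ enc m j)" by (rule prod.reindex_bij_witness[of _ "%j. j - 1" Suc]) (auto simp: enc_def)
   finally show ?thesis by (rule sym)
   qed
   ultimately show "c (enc m) * (PROD j:?D. u (q j) ^ enc m j) = mlookup F m * mval m (%i. u (q (Suc i)))" by simp
  qed
  finally show ?thesis unfolding mv_eval_mval .
 qed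
 obtain m where m: "m : mkeys F" using F0 by (metis all_not_in_conv keys_eq_empty)
 have "c (enc m) = 0"
 proof (rule separated_independent[of Qs ?Xs n w "%i x. u x ^ i" ?D c "enc m"])
  show "(SUM y:Qs. w i y * u y ^ k) = (if i = k then 1 else 0)" if "i < n" "k < n" for i k using Qs(3) that by blast
  show "(SUM a:PiE ?D (%_. {..<n}). c a * (PROD j:?D. u (q j) ^ a j)) = 0" if "ALL j:?D. q j : ?Xs" for q unfolding sum_eq by (rule pw[OF that])
  show "enc m : PiE ?D (%_. {..<n})" using encP m by blast
 qed (use Qs in simp_all)
 then show False using m inv_into_f_f[OF inj m] by (simp add: c_def in_keys_iff)
qed

end

context power_galois
begin

text \<open>The ratio \<open>t 1 / t 0\<close> at the \<open>d\<close> coordinates gives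
  \<open>d\<close> independent functions. Conversely all functions are integral over the pulled back
  field by the equations with coefficients \<open>ecoef\<close>, so any \<open>d + 1\<close> of them
  are dependent by \<open>algebraic_dependence\<close>.\<close>

lemma variety_dim_power: "variety_dim A V = d" unfolding variety_dim_def
proof (rule Greatest_equality)
 let ?u = "%q. PC.t 1 q / PC.t 0 q"
 have u: "ratl I C ?u" by (rule PC.symf_ratl[OF symf_ratio])
 note nc = ratio_nonconstant
 have "alg_independent A V d (%i. cls A V (%p. ?u (co I d p (Suc i))))"
 proof (rule iffD2[OF V.alg_independent_cls[of d "%i p. ?u (co I d p (Suc i))"]])
  show "ratl A V (%p. ?u (co I d p (Suc i)))" if "i < d" for i by (rule ratl_co[OF u]) (use that in simp)
  show "ALL F :: (nat, 'k) mvpoly. (ALL m:mkeys F. mkeys m <= {..<d}) -->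
   gen A V (%p. mv_eval F (%i. ?u (co I d p (Suc i))) = 0) --> F = 0" by (intro allI impI) (rule power_independent[OF u nc])
 qed simp
 then show "EX t. alg_independent A V d t" by blast
next
 fix n assume "EX t. alg_independent A V n t"
 then obtain t where "alg_independent A V n t" ..
 then obtain f where f: "!!i. i < n ==> ratl A V (f i)" and ind: "!!F :: (nat, 'k) mvpoly. (ALL m:mkeys F. mkeys m <= {..<n}) ==>
  gen A V (%p. mv_eval F (%i. f i p) = 0) ==> F = 0" by (rule V.alg_independent_repr) (rule that)
 show "n <= d"
 proof (rule ccontr)
  assume "~ n <= d"
  then have dn: "{..d} <= {..<n}" by auto
  have alg: "EX h e. (ALL k<Suc h. PV.symf (e k)) & gen A V (%p. f i p ^ Suc h = (SUM k<Suc h. e k p * f i p ^ k))" if i: "i <= d" for i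
  proof -
   have fi: "ratl A V (f i)" by (rule f) (use dn i in blast)
   have "Wr ~= {}" using monoid.one_closed[OF group.is_monoid[OF group_wreath[OF PC.G.is_group]]] by blast
   then have "card Wr ~= 0" using fin_Wr by (simp only: card_eq_0_iff simp_thms)
   then obtain h where h: "card Wr = Suc h" by (rule not0_implies_Suc[THEN exE])
   have "gen A V (%p. f i p ^ Suc h = (SUM k<Suc h. - ecoef (f i) k p * f i p ^ k))"
   proof (rule V.gen_mono[OF ecoef_root[of "f i", unfolded h]])
   fix p assume a: "(SUM k<Suc (Suc h). ecoef (f i) k p * f i p ^ k) = 0"
   have top: "ecoef (f i) (Suc h) p = 1" using ecoef_top[of "f i" p] unfolding h .
   have "(SUM k<Suc h. ecoef (f i) k p * f i p ^ k) + f i p ^ Suc h = 0" using a unfolding sum.lessThan_Suc[of _ "Suc h"] top by simp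
   then show "f i p ^ Suc h = (SUM k<Suc h. - ecoef (f i) k p * f i p ^ k)" unfolding mult_minus_left sum_negf by (simp only: add.commute eq_neg_iff_add_eq_0)
   qed
   then show ?thesis by (intro exI[of _ h] exI[of _ "%k p. - ecoef (f i) k p"] conjI allI impI) (rule PV.symf_uminus[OF ecoef_symf[OF fi]])
  qed
  have "EX F :: (nat, 'k) mvpoly. F ~= 0 & (ALL mu:mkeys F. mkeys mu <= {..d}) & gen A V (%p. mv_eval F (%i. f i p) = 0)" by (rule PV.algebraic_dependence) (rule alg)
  then obtain F :: "(nat, 'k) mvpoly" where F: "F ~= 0" "ALL mu:mkeys F. mkeys mu <= {..d}"
   "gen A V (%p. mv_eval F (%i. f i p) = 0)" by (elim exE conjE)
  have "ALL mu:mkeys F. mkeys mu <= {..<n}" using F(2) dn by (meson subset_trans)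
  from ind[OF this F(3)] have "F = 0" .
  with F(1) show False ..
 qed
qed

end

section \<open>Tangent spaces\<close>

text \<open>The derivative along a line, defined through the polynomial that the function becomes on
  it. It depends on the function alone, so forms can be pulled back along linear maps without
  computing formal partial derivatives.\<close>

definition dird :: "(('i => 'k::field) => 'k) => ('i => 'k) => ('i => 'k) => 'k => bool"
 where "dird f x v c \<longleftrightarrow> (EX q. (ALL ep. f (%i. x i + ep * v i) = poly q ep) & poly (pderiv q) 0 = c)"

lemma dird_unique:
 fixes f :: "('i => 'k::field_char_0) => 'k"
 assumes "dird f x v c" "dird f x v c'" shows "c = c'"
proof -
 obtain q where q: "ALL ep. f (%i. x i + ep * v i) = poly q ep" "poly (pderiv q) 0 = c" using assms(1) unfolding dird_def by blast
 obtain q' where q': "ALL ep. f (%i. x i + ep * v i) = poly q' ep" "poly (pderiv q') 0 = c'" using assms(2) unfolding dird_def by blast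
 have "poly q = poly q'" by (rule ext) (use q(1) q'(1) in simp)
 then have "q = q'" by (simp only: poly_eq_poly_eq_iff)
 then show ?thesis using q(2) q'(2) by simp
qed

lemma poly_pderiv_prod_0:
 fixes g :: "'a => 'k::field poly"
 shows "poly (pderiv (PROD i:B. g i)) 0 = (SUM i:B. poly (pderiv (g i)) 0 * (PROD j:B - {i}. poly (g j) 0))" by (simp add: pderiv_prod poly_sum poly_prod mult.commute)

lemma poly_pderiv_linear_power_0:
 "poly (pderiv ([:a, b:] ^ n)) 0 = of_nat n * a ^ (n - 1) * (b :: 'k::field)" by (cases n) (simp_all add: pderiv_power_Suc pderiv_pCons mult_ac del: power_Suc)

lemma pderiv_sum_poly: "pderiv (SUM a:B. g a) = (SUM a:B. pderiv (g a))" for g :: "'a => 'k::field poly" by (induction B rule: infinite_finite_induct) (simp_all add: pderiv_add)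

lemma dird_mv_eval:
 assumes I: "finite I" and F: "hom_poly I n F"
 shows "dird (mv_eval F) x v (SUM i:I. mv_partial F i x * v i)" unfolding dird_def
proof (intro exI conjI allI)
 let ?K = "mkeys F"
 let ?l = "mlookup F"
 let ?g = "%m i. [:x i, v i:] ^ mlookup m i"
 let ?q = "SUM m:?K. psmult (?l m) (PROD i:mkeys m. ?g m i)"
 show "mv_eval F (%i. x i + ep * v i) = poly ?q ep" for ep unfolding mv_eval_def poly_sum poly_smult poly_prod poly_power by simp
 have "poly (pderiv ?q) 0 = (SUM m:?K. ?l m * poly (pderiv (PROD i:mkeys m. ?g m i)) 0)" unfolding pderiv_sum_poly poly_sum pderiv_smult poly_smult ..
 also have "... = (SUM m:?K. SUM i:I. ?l m * of_nat (mlookup m i) *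
   (PROD j:mkeys m. x j ^ (mlookup m j - (if j = i then 1 else 0))) * v i)"
 proof (rule sum.cong[OF refl])
  fix m assume m: "m : ?K"
  have k: "mkeys m <= I" using F m unfolding hom_poly_def by blast
  let ?t = "%i. ?l m * of_nat (mlookup m i) *
   (PROD j:mkeys m. x j ^ (mlookup m j - (if j = i then 1 else 0))) * v i"
  have "(SUM i:I. ?t i) = (SUM i:mkeys m. ?t i)" by (rule sum.mono_neutral_right[OF I k]) (simp add: in_keys_iff)
  also have "... = (SUM i:mkeys m. ?l m * (poly (pderiv (?g m i)) 0 * (PROD j:mkeys m - {i}. poly (?g m j) 0)))"
  proof (rule sum.cong[OF refl])
   fix i assume i: "i : mkeys m"
   have "(PROD j:mkeys m. x j ^ (mlookup m j - (if j = i then 1 else 0)))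
   = x i ^ (mlookup m i - 1) * (PROD j:mkeys m - {i}. x j ^ (mlookup m j - (if j = i then 1 else 0)))" using prod.remove[OF finite_keys i, of "%j. x j ^ (mlookup m j - (if j = i then 1 else 0))"] by simp
   also have "(PROD j:mkeys m - {i}. x j ^ (mlookup m j - (if j = i then 1 else 0))) = (PROD j:mkeys m - {i}. poly (?g m j) 0)" by (rule prod.cong) auto
   finally show "?t i = ?l m * (poly (pderiv (?g m i)) 0 * (PROD j:mkeys m - {i}. poly (?g m j) 0))" unfolding poly_pderiv_linear_power_0 by (simp only: mult_ac)
  qed
  finally show "?l m * poly (pderiv (PROD i:mkeys m. ?g m i)) 0 = (SUM i:I. ?t i)" unfolding poly_pderiv_prod_0 sum_distrib_left by (rule sym)
 qed
 also have "... = (SUM i:I. mv_partial F i x * v i)" unfolding mv_partial_def sum_distrib_right by (rule sum.swap)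
 finally show "poly (pderiv ?q) 0 = (SUM i:I. mv_partial F i x * v i)" .
qed

lemma tangent_iff:
 fixes V :: "('i, 'k::field_char_0) point set"
 assumes I: "finite I"
 shows "v : tangent I V x \<longleftrightarrow> v : cspace I & (ALL n f. hompf I n f --> (ALL y:\<Union>V. f y = 0) --> dird f x v 0)"
proof
 assume v: "v : tangent I V x"
 show "v : cspace I & (ALL n f. hompf I n f --> (ALL y:\<Union>V. f y = 0) --> dird f x v 0)"
 proof (intro conjI allI impI)
  show "v : cspace I" using v unfolding cone_tangent_space_def by blast
  fix n f assume f: "hompf I n f" "ALL y:\<Union>V. f y = 0"
  then obtain F where F: "hom_poly I n F" "f = mv_eval F" unfolding hompf_def by blast
  have "(SUM i:I. mv_partial F i x * v i) = 0" using v F f(2) unfolding cone_tangent_space_def by blast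
  then show "dird f x v 0" using dird_mv_eval[OF I F(1), of x v] F(2) by simp
 qed
next
 assume v: "v : cspace I & (ALL n f. hompf I n f --> (ALL y:\<Union>V. f y = 0) --> dird f x v 0)"
 have "(SUM i:I. mv_partial F i x * v i) = 0" if F: "hom_poly I n F" "ALL y:\<Union>V. mv_eval F y = 0" for n F
 proof (rule dird_unique[OF dird_mv_eval[OF I F(1)]])
  show "dird (mv_eval F) x v 0" using v hom_poly_hompf[OF F(1)] F(2) by blast
 qed
 then show "v : tangent I V x" using v unfolding cone_tangent_space_def by blast
qed

lemma subspace_tangent: "cvec.subspace (tangent I V x)"
proof (rule cvec.subspaceI)
 show "0 : tangent I V x" by (simp add: cone_tangent_space_def coord_space_def)
 show "u + w : tangent I V x" if u: "u : tangent I V x" and w: "w : tangent I V x" for u w unfolding cone_tangent_space_def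
 proof (intro CollectI conjI allI impI)
  show "u + w : cspace I" using u w unfolding cone_tangent_space_def coord_space_def by simp
  fix n F assume F: "hom_poly I n F & (ALL y:\<Union>V. mv_eval F y = 0)"
  have "(SUM i:I. mv_partial F i x * u i) = 0" "(SUM i:I. mv_partial F i x * w i) = 0" using u w F unfolding cone_tangent_space_def by blast+
  then show "(SUM i:I. mv_partial F i x * (u + w) i) = 0" by (simp add: distrib_left sum.distrib)
 qed
 show "scal c u : tangent I V x" if u: "u : tangent I V x" for c u unfolding cone_tangent_space_def
 proof (intro CollectI conjI allI impI)
  show "scal c u : cspace I" using u unfolding cone_tangent_space_def coord_space_def by (simp add: scal_def)
  fix n F assume F: "hom_poly I n F & (ALL y:\<Union>V. mv_eval F y = 0)"
  have "(SUM i:I. mv_partial F i x * scal c u i) = c * (SUM i:I. mv_partial F i x * u i)" unfolding sum_distrib_left by (rule sum.cong) (simp_all add: scal_def)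
  moreover have "(SUM i:I. mv_partial F i x * u i) = 0" using u F unfolding cone_tangent_space_def by blast
  ultimately show "(SUM i:I. mv_partial F i x * scal c u i) = 0" by simp
 qed
qed

lemma tangent_scal_subset:
 fixes V :: "('i, 'k::field_char_0) point set"
 assumes I: "finite I" and c: "c ~= 0"
 shows "tangent I V x <= tangent I V (scal c x)"
proof
 fix v assume v: "v : tangent I V x"
 show "v : tangent I V (scal c x)" unfolding tangent_iff[OF I]
 proof (intro conjI allI impI)
  show "v : cspace I" using v unfolding tangent_iff[OF I] by blast
  fix n f assume f: "hompf I n f" "ALL y:\<Union>V. f y = 0"
  then have "dird f x v 0" using v unfolding tangent_iff[OF I] by blast
  then obtain q where q: "ALL ep. f (%i. x i + ep * v i) = poly q ep" "poly (pderiv q) 0 = 0" unfolding dird_def by blast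
  show "dird f (scal c x) v 0" unfolding dird_def
  proof (intro exI conjI allI)
   let ?q = "psmult (c ^ n) (pcompose q [:0, 1 / c:])"
   fix ep
   have "(%i. scal c x i + ep * v i) = scal c (%i. x i + ep / c * v i)" using c by (simp add: scal_def fun_eq_iff field_simps)
   then have "f (%i. scal c x i + ep * v i) = c ^ n * f (%i. x i + ep / c * v i)" using hompf_scale[OF f(1)] by simp
   also have "... = c ^ n * poly q (ep / c)" by (simp only: spec[OF q(1), of "ep / c"])
   finally show "f (%i. scal c x i + ep * v i) = poly ?q ep" by (simp add: poly_pcompose)
   show "poly (pderiv ?q) 0 = 0" using q(2) by (simp add: pderiv_smult pderiv_pcompose poly_pcompose)
  qed
 qed
qed

lemma tangent_scal:
 fixes V :: "('i, 'k::field_char_0) point set"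
 assumes I: "finite I" and c: "c ~= 0"
 shows "tangent I V (scal c x) = tangent I V x"
proof
 show "tangent I V x <= tangent I V (scal c x)" by (rule tangent_scal_subset[OF I c])
 have "scal (1 / c) (scal c x) = x" using c by (simp add: scal_scal)
 then show "tangent I V (scal c x) <= tangent I V x" using tangent_scal_subset[OF I, of "1 / c" V "scal c x"] c by simp
qed

text \<open>The cone contains the line through \<open>x\<close>, on which every form vanishing on it
  is zero.\<close>

lemma tangent_self:
 fixes V :: "('i, 'k::field_char_0) point set"
 assumes I: "finite I" and x: "x : \<Union>V" "x : cspace I"
 shows "x : tangent I V x" unfolding tangent_iff[OF I]
proof (intro conjI allI impI x(2))
 fix n f assume f: "hompf I n f" "ALL y:\<Union>V. f y = 0"
 have "f (%i. x i + ep * x i) = 0" for ep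
 proof -
  have "(%i. x i + ep * x i) = scal (1 + ep) x" by (simp add: scal_def fun_eq_iff distrib_right)
  moreover have "f x = 0" using f(2) x(1) by blast
  ultimately show ?thesis using hompf_scale[OF f(1)] by simp
 qed
 then show "dird f x x 0" unfolding dird_def by (intro exI[of _ 0]) simp
qed

text \<open>The second basis vector is corrected by a multiple of \<open>x\<close> so that its entry
  at \<open>a\<close> vanishes; the coefficient of \<open>x\<close> in a vector \<open>y\<close> of
  the plane is then \<open>y a\<close>. Applied to the tangent planes of the cone over the
  curve.\<close>

lemma plane_decomposition:
 fixes T :: "('i => 'k::field) set"
 assumes "finite I" "T <= cspace I" and T: "cvec.subspace T" and dim: "cvec.dim T = 2" and x: "x : T" "x a = 1"
 shows "EX w:T. w ~= 0 & w a = 0 & (ALL y:T. EX mu. ALL i. y i = y a * x i + mu * w i)"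
proof -
 obtain B where B: "cvec.span B = T" "finite B" "card B = 2" by (rule finite_basis_of_subspace[OF assms(1-3)]) (use dim in auto)
 have x0: "x ~= 0" using x(2) by auto
 have ind1: "cvec.independent {x}" using x0 by (simp add: cvec.dependent_single)
 have "~ T <= cvec.span {x}"
 proof
  assume s: "T <= cvec.span {x}"
  have "{x} <= T" using x(1) by simp
  from cvec.basis_card_eq_dim[OF this s ind1] show False using dim by simp
 qed
 then obtain w where w: "w : T" "w ~: cvec.span {x}" by blast
 have wx: "w ~= x" using w(2) cvec.span_base by blast
 have ind2: "cvec.independent {w, x}" using w(2) ind1 wx by (simp add: cvec.independent_insert)
 have span2: "y : cvec.span {w, x}" if y: "y : T" for y
 proof (rule ccontr)
  assume n: "y ~: cvec.span {w, x}"
  then have "y ~: {w, x}" using cvec.span_base by blast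
  then have i3: "cvec.independent {y, w, x}" using n ind2 by (simp add: cvec.independent_insert)
  have "{y, w, x} <= cvec.span B" using y w(1) x(1) B(1) by simp
  from cvec.independent_span_bound[OF B(2) i3 this] have "card {y, w, x} <= 2" using B(3) by simp
  then show False using `y ~: {w, x}` wx by simp
 qed
 define w' where "w' = w - scal (w a) x"
 have w'i: "w' i = w i - w a * x i" for i by (simp add: w'_def scal_def)
 show ?thesis
 proof (intro bexI conjI ballI)
  show "w' : T" unfolding w'_def by (rule cvec.subspace_diff[OF T w(1) cvec.subspace_scale[OF T x(1)]])
  show "w' ~= 0"
  proof
   assume "w' = 0"
   then have "w = scal (w a) x" unfolding w'_def by simp
   then show False using w(2) cvec.span_scale[OF cvec.span_base[of x "{x}"], of "w a"] by simp
  qed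
  show "w' a = 0" unfolding w'i using x(2) by simp
  fix y assume "y : T"
  then have "y : cvec.span (insert w {x})" by (rule span2)
  then obtain k where "y - scal k w : cvec.span {x}" unfolding cvec.span_breakdown_eq by blast
  then obtain l where "y - scal k w = scal l x" unfolding cvec.span_singleton by blast
  then have "y = scal k w + scal l x" by (simp add: diff_eq_eq add.commute)
  then have yi: "y i = k * w i + l * x i" for i by (simp add: scal_def)
  have l: "l = y a - k * w a" unfolding yi[of a] using x(2) by simp
  show "EX mu. ALL i. y i = y a * x i + mu * w' i"
  proof (intro exI allI)
   fix i show "y i = y a * x i + k * w' i" unfolding yi[of i] l w'i by (simp add: algebra_simps)
  qed
 qed
qed

lemma family_independent:
 fixes f :: "'a => 'i => 'k::field"
 assumes N: "finite N" and ind: "!!c j. (!!i. (SUM l:N. c l * f l i) = 0) ==> j : N ==> c j = 0"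
 shows "inj_on f N" "cvec.independent (f ` N)"
proof -
 show inj: "inj_on f N"
 proof (rule inj_onI, rule ccontr)
  fix j j' assume j: "j : N" "j' : N" "f j = f j'" "j ~= j'"
  let ?c = "%l. (if l = j then 1 else 0) - (if l = j' then 1 else 0) :: 'k"
  have "(SUM l:N. ?c l * f l i) = 0" for i
  proof -
   have "(SUM l:N. ?c l * f l i) = (SUM l:N. (if l = j then f l i else 0) - (if l = j' then f l i else 0))" by (rule sum.cong) auto
   also have "... = f j i - f j' i" unfolding sum_subtractf using j N by simp
   finally show ?thesis using j(3) by simp
  qed
  from ind[of ?c, OF this j(1)] show False using j(4) by simp
 qed
 show "cvec.independent (f ` N)"
 proof (rule cvec.independent_if_scalars_zero)
  show "finite (f ` N)" using N by simp
  fix u x assume s: "(SUM x:f ` N. scal (u x) x) = 0" and x: "x : f ` N"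
  have "(SUM l:N. u (f l) * f l i) = 0" for i
  proof -
   have "(SUM l:N. u (f l) * f l i) = (SUM l:N. scal (u (f l)) (f l)) i" unfolding sum_fun_apply by (simp add: scal_def)
   also have "(SUM l:N. scal (u (f l)) (f l)) = 0" using s unfolding sum.reindex[OF inj] by (simp add: o_def)
   finally show ?thesis by simp
  qed
  then show "u x = 0" using ind[of "%l. u (f l)"] x by blast
 qed
qed

lemma prod_prod_remove:
 fixes y :: "'a => 'k::comm_semiring_1"
 assumes D: "finite D"
 shows "(PROD j:D. PROD l:D - {j}. y l) = (PROD l:D. y l) ^ (card D - 1)"
proof -
 have r: "(PROD l:D - {j}. g l) = (PROD l:D. if l = j then 1 else g l)" for j and g :: "'a => 'k" by (rule prod.mono_neutral_cong_left[OF D]) auto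
 have "(PROD j:D. PROD l:D - {j}. y l) = (PROD j:D. PROD l:D. if l = j then 1 else y l)" unfolding r ..
 also have "... = (PROD l:D. PROD j:D. if l = j then 1 else y l)" by (rule prod.swap)
 also have "... = (PROD l:D. PROD j:D - {l}. y l)" unfolding r by (intro prod.cong refl) auto
 also have "... = (PROD l:D. y l ^ (card D - 1))" by (rule prod.cong[OF refl]) (use D in simp)
 finally show ?thesis unfolding prod_power_distrib .
qed

locale segre_power_char_0 = segre_power I C d
 for I :: "'i set" and C :: "('i, 'k::field_char_0) point set" and d
begin

lemma segre_in_cone: "ALL j:{1..d}. x j : \<Union>C ==> segre I d x : \<Union>V" unfolding variety_power_def using in_pt_self[of "segre I d x"] by blast

lemma cone_coord: "x : \<Union>C ==> x : cspace I & x ~= 0" using C_mem by blast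

lemma cone_segre:
 assumes "z : \<Union>V" obtains c y where "c ~= 0" "ALL j:{1..d}. y j : \<Union>C" "z = scal c (segre I d y)" using assms unfolding variety_power_def pt_def by blast

text \<open>Replacing the factor \<open>j\<close> by a variable vector is a linear map from the cone
  over \<open>C\<close> to the cone over the power, and forms vanishing on the target pull back to
  forms vanishing on the source.\<close>

lemma segre_tangent:
 assumes x: "ALL j:{1..d}. x j : \<Union>C" and j: "j : {1..d}" and w: "w : tangent I C (x j)"
 shows "segre I d (x(j := w)) : tangent A V (segre I d x)" unfolding tangent_iff[OF fin_A]
proof (intro conjI allI impI segre_coord)
 fix n f assume f: "hompf A n f" "ALL y:\<Union>V. f y = 0"
 let ?g = "%y. f (segre I d (x(j := y)))"
 have upd: "segre I d (x(j := y)) a = (if a : A then y (a j) * (PROD l:{1..d} - {j}. x l (a l)) else 0)" for y a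
 proof (cases "a : A")
  case True
  have "segre I d (x(j := y)) a = (x(j := y)) j (a j) * (PROD l:{1..d} - {j}. (x(j := y)) l (a l))" by (rule segre_arg[OF True j])
  also have "(PROD l:{1..d} - {j}. (x(j := y)) l (a l)) = (PROD l:{1..d} - {j}. x l (a l))" by (rule prod.cong) auto
  finally show ?thesis using True by (simp only: fun_upd_same if_True)
 qed (simp add: segre_def)
 have "hompf I (n * 1) (%y. f (%a. segre I d (x(j := y)) a))"
 proof (rule hompf_compose[OF f(1)])
  fix a assume a: "a : A"
  have "hompf I 1 (%y. (PROD l:{1..d} - {j}. x l (a l)) * y (a j))" by (rule hompf_cmult[OF hompf_coord[OF power_index_mem[OF a j]]])
  then show "hompf I 1 (%y. segre I d (x(j := y)) a)" unfolding upd using a by (simp add: mult.commute)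
 qed
 then have g: "hompf I n ?g" by simp
 have "ALL y:\<Union>C. ?g y = 0"
 proof
  fix y assume "y : \<Union>C"
  then have "ALL l:{1..d}. (x(j := y)) l : \<Union>C" using x by simp
  from segre_in_cone[OF this] show "?g y = 0" using f(2) by blast
 qed
 then have "dird ?g (x j) w 0" using w g unfolding tangent_iff[OF fin_I] by blast
 then obtain q where q: "ALL ep. ?g (%i. x j i + ep * w i) = poly q ep" "poly (pderiv q) 0 = 0" unfolding dird_def by blast
 show "dird f (segre I d x) (segre I d (x(j := w))) 0" unfolding dird_def
 proof (intro exI[of _ q] conjI allI q(2))
  fix ep
  have "(%a. segre I d x a + ep * segre I d (x(j := w)) a) = segre I d (x(j := (%i. x j i + ep * w i)))"
  proof
   fix a
   have "segre I d x a = segre I d (x(j := x j)) a" by simp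
   then show "segre I d x a + ep * segre I d (x(j := w)) a = segre I d (x(j := (%i. x j i + ep * w i))) a" unfolding upd by (simp only: upd) (simp add: algebra_simps)
  qed
  then show "f (%a. segre I d x a + ep * segre I d (x(j := w)) a) = poly q ep" using q(1) by simp
 qed
qed

section \<open>The tangent space at a Segre tensor normalized to 1 at the index
  \<open>a0\<close>\<close>

context
 fixes x :: "nat => 'i => 'k" and a0 :: "nat => 'i"
 assumes x: "ALL j:{1..d}. x j : \<Union>C" and a0: "a0 : A" and norm: "ALL j:{1..d}. x j (a0 j) = 1"
begin

lemma segre_base: "segre I d x a0 = 1" using a0 norm by (simp add: segre_def)

lemma segre_slice: assumes j: "j : {1..d}" shows "segre I d x (a0(j := i)) = x j i"
proof (cases "i : I")
 case True
 have "(PROD l:{1..d} - {j}. x l (a0 l)) = 1" by (rule prod.neutral) (use norm in blast)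
 then show ?thesis unfolding segre_upd_arg[OF a0 j True] by simp
next
 case False
 then have "a0(j := i) ~: A" using power_index_upd[OF a0 j] by blast
 moreover have "x j i = 0" using cone_coord[of "x j"] x j False unfolding coord_space_def by blast
 ultimately show ?thesis by (simp add: segre_def)
qed

text \<open>Restriction to the coordinates \<open>a0(j := i)\<close> is linear and maps the cone
  over the power to multiples of vectors of the cone over \<open>C\<close>, so forms vanishing on
  \<open>C\<close> pull back.\<close>

lemma slice_tangent:
 assumes j: "j : {1..d}" and v: "v : tangent A V (segre I d x)"
 shows "(%i. v (a0(j := i))) : tangent I C (x j)" unfolding tangent_iff[OF fin_I]
proof (intro conjI allI impI)
 have vA: "v : cspace A" using v unfolding tangent_iff[OF fin_A] by blast
 show "(%i. v (a0(j := i))) : cspace I" using vA power_index_upd[OF a0 j] unfolding coord_space_def by blast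
 fix n f assume f: "hompf I n f" "ALL y:\<Union>C. f y = 0"
 let ?g = "%z. f (%i. z (a0(j := i)))"
 have "hompf A (n * 1) ?g" by (rule hompf_compose[OF f(1)], rule hompf_coord) (use power_index_upd[OF a0 j] in blast)
 then have g: "hompf A n ?g" by simp
 have "?g z = 0" if z: "z : \<Union>V" for z
 proof -
  obtain c y where y: "ALL j:{1..d}. y j : \<Union>C" "z = scal c (segre I d y)" by (rule cone_segre[OF z]) blast
  let ?c = "c * (PROD l:{1..d} - {j}. y l (a0 l))"
  have "?g z = f (scal ?c (y j))"
  proof (rule hompf_cong_on[OF f(1)])
   fix i assume i: "i : I"
   show "z (a0(j := i)) = scal ?c (y j) i" unfolding y(2) scal_def segre_upd_arg[OF a0 j i] by (simp only: mult_ac)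
  qed
  also have "... = ?c ^ n * f (y j)" by (rule hompf_scale[OF f(1)])
  also have "f (y j) = 0" using f(2) y(1) j by blast
  finally show ?thesis by (simp only: mult_zero_right)
 qed
 then have "dird ?g (segre I d x) v 0" using v g unfolding tangent_iff[OF fin_A] by blast
 then show "dird f (x j) (%i. v (a0(j := i))) 0" unfolding dird_def segre_slice[OF j] .
qed

text \<open>The derivative of the relation \<open>z a * z a0 ^ (d - 1) = (\<Prod>j. z (a0(j := a j)))\<close> between the Segre coordinates
 recovers a tangent vector from its slices through `a0`.\<close>

lemma tangent_coordinate:
 assumes v: "v : tangent A V (segre I d x)" and a: "a : A"
 shows "v a + of_nat (d - 1) * v a0 * segre I d x a = (SUM j=1..d. v (a0(j := a j)) * (PROD l:{1..d} - {j}. x l (a l)))"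
proof -
 let ?D = "{1..d}"
 let ?f = "%z. z a * z a0 ^ (d - 1) - (PROD j:?D. z (a0(j := a j)))"
 have aj: "a0(j := a j) : A" if "j : ?D" for j using power_index_upd[OF a0 that] power_index_mem[OF a that] by blast
 have h1: "hompf A (1 + (d - 1) * 1) (%z. z a * z a0 ^ (d - 1))" by (rule hompf_mult[OF hompf_coord[OF a] hompf_power[OF hompf_coord[OF a0]]])
 have h2: "hompf A (SUM j:?D. 1) (%z. PROD j:?D. z (a0(j := a j)))" by (rule hompf_prod) (rule hompf_coord[OF aj])
 have "hompf A d ?f" using hompf_diff[of A d, OF _ h2[simplified]] h1 d_pos by simp
 moreover have "?f z = 0" if z: "z : \<Union>V" for z
 proof -
  obtain c y where y: "z = scal c (segre I d y)" by (rule cone_segre[OF z]) blast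
  have "(PROD j:?D. z (a0(j := a j))) = (PROD j:?D. c * y j (a j) * (PROD l:?D - {j}. y l (a0 l)))" by (rule prod.cong[OF refl]) (simp only: y scal_def segre_upd_arg[OF a0 _ power_index_mem[OF a]] mult.assoc)
  also have "... = c ^ d * (PROD j:?D. y j (a j)) * (PROD l:?D. y l (a0 l)) ^ (d - 1)" unfolding prod.distrib prod_prod_remove[OF finite_atLeastAtMost] by simp
  also have "... = (c * (PROD j:?D. y j (a j))) * (c * (PROD l:?D. y l (a0 l))) ^ (d - 1)" using d_pos by (cases d) (simp_all add: power_mult_distrib mult_ac)
  also have "... = z a * z a0 ^ (d - 1)" unfolding y scal_def segre_def using a a0 by simp
  finally show ?thesis by simp
 qed
 ultimately have "dird ?f (segre I d x) v 0" using v unfolding tangent_iff[OF fin_A] by blast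
 moreover have "dird ?f (segre I d x) v (v a + of_nat (d - 1) * v a0 * segre I d x a - (SUM j:?D. v (a0(j := a j)) * (PROD l:?D - {j}. x l (a l))))" unfolding dird_def
 proof (intro exI conjI allI)
  let ?s = "segre I d x"
  let ?q1 = "[:?s a, v a:] * [:?s a0, v a0:] ^ (d - 1)" and ?q2 = "PROD j:?D. [:?s (a0(j := a j)), v (a0(j := a j)):]"
  show "(?s a + ep * v a) * (?s a0 + ep * v a0) ^ (d - 1) - (PROD j:?D. ?s (a0(j := a j)) + ep * v (a0(j := a j))) = poly (?q1 - ?q2) ep" for ep
   by (simp only: poly_diff poly_mult poly_power poly_prod poly_pCons poly_0 mult_zero_right add_0_right)
  have "poly (pderiv ?q1) 0 = v a + of_nat (d - 1) * v a0 * ?s a" unfolding pderiv_mult poly_add poly_mult poly_pderiv_linear_power_0 by (simp add: segre_base pderiv_pCons mult_ac)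
  moreover have "poly (pderiv ?q2) 0 = (SUM j:?D. v (a0(j := a j)) * (PROD l:?D - {j}. x l (a l)))"
   unfolding poly_pderiv_prod_0 by (intro sum.cong refl arg_cong2[of _ _ _ _ "(*)"] prod.cong) (simp_all add: pderiv_pCons segre_slice)
  ultimately show "poly (pderiv (?q1 - ?q2)) 0 = v a + of_nat (d - 1) * v a0 * ?s a - (SUM j:?D. v (a0(j := a j)) * (PROD l:?D - {j}. x l (a l)))" unfolding pderiv_diff poly_diff by simp
 qed
 ultimately have "v a + of_nat (d - 1) * v a0 * segre I d x a - (SUM j:?D. v (a0(j := a j)) * (PROD l:?D - {j}. x l (a l))) = 0" by (rule dird_unique[symmetric])
 then show ?thesis by simp
qed

text \<open>A basis consists of the tensor itself and the \<open>d\<close> tensors obtained by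
  replacing one factor \<open>x j\<close> by the second direction \<open>w j\<close> of the tangent
  plane there. \<open>tangent_coordinate\<close> shows that nothing else is tangent.\<close>

lemma normalized_tangent_dim:
 assumes dim: "ALL x:\<Union>C. cvec.dim (tangent I C x) = 2"
 shows "cvec.dim (tangent A V (segre I d x)) = d + 1"
proof -
 let ?D = "{1..d}" and ?T = "tangent A V (segre I d x)"
 have "EX w. w : tangent I C (x j) & w ~= 0 & w (a0 j) = 0 &
   (ALL y:tangent I C (x j). EX mu. ALL i. y i = y (a0 j) * x j i + mu * w i)" if j: "j : ?D" for j
 proof -
  have xj: "x j : \<Union>C" using x j by blast
  have "tangent I C (x j) <= cspace I" unfolding cone_tangent_space_def by blast
  from plane_decomposition[OF fin_I this subspace_tangent dim[rule_format, OF xj] tangent_self[OF fin_I xj], of "a0 j"]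
  show ?thesis using cone_coord[OF xj] norm j by blast
 qed
 then have "ALL j:?D. EX w. w : tangent I C (x j) & w ~= 0 & w (a0 j) = 0 &
   (ALL y:tangent I C (x j). EX mu. ALL i. y i = y (a0 j) * x j i + mu * w i)" by blast
 from bchoice[OF this] obtain w where w0: "ALL j:?D. w j : tangent I C (x j) & w j ~= 0 & w j (a0 j) = 0 &
   (ALL y:tangent I C (x j). EX mu. ALL i. y i = y (a0 j) * x j i + mu * w j i)" ..
 then have w: "!!j. j : ?D ==> w j : tangent I C (x j)" "!!j. j : ?D ==> w j ~= 0" "!!j. j : ?D ==> w j (a0 j) = 0"
  and wy: "!!j y. j : ?D ==> y : tangent I C (x j) ==> EX mu. ALL i. y i = y (a0 j) * x j i + mu * w j i" by blast+
 define f where "f j = (if j = 0 then segre I d x else segre I d (x(j := w j)))" for j :: nat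
 have upd: "segre I d (x(j := w j)) a = w j (a j) * (PROD l:?D - {j}. x l (a l))" if j: "j : ?D" and a: "a : A" for j a
 proof -
  have "segre I d (x(j := w j)) a = (x(j := w j)) j (a j) * (PROD l:?D - {j}. (x(j := w j)) l (a l))" by (rule segre_arg[OF a j])
  also have "(PROD l:?D - {j}. (x(j := w j)) l (a l)) = (PROD l:?D - {j}. x l (a l))" by (rule prod.cong) auto
  finally show ?thesis by (simp only: fun_upd_same)
 qed
 have dec: "{..d} = insert 0 ?D" by auto
 have ind: "c j = 0" if c: "!!a. (SUM l:{..d}. c l * f l a) = 0" and j: "j : {..d}" for c j
 proof -
  have cs: "c 0 * segre I d x a + (SUM l:?D. c l * segre I d (x(l := w l)) a) = 0" for a
  proof -
   have "(SUM l:?D. c l * f l a) = (SUM l:?D. c l * segre I d (x(l := w l)) a)" by (rule sum.cong) (auto simp: f_def)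
   then show ?thesis using c[of a] unfolding dec by (simp add: f_def)
  qed
  \<comment> \<open>At the index \<open>a0\<close> all tensors with a replaced factor vanish because
    \<open>w l (a0 l) = 0\<close>, which isolates \<open>c 0\<close>. Changing the entry
    \<open>j\<close> to some \<open>i\<close> with \<open>w j i ~= 0\<close> then isolates
    \<open>c j\<close>.\<close>
  have "(SUM l:?D. c l * segre I d (x(l := w l)) a0) = 0" by (rule sum.neutral) (simp add: upd[OF _ a0] w(3))
  then have c0: "c 0 = 0" using cs[of a0] segre_base by simp
  show ?thesis
  proof (cases "j = 0")
   case True then show ?thesis using c0 by simp
  next
   case False
   then have jD: "j : ?D" using j by auto
   obtain i where i: "w j i ~= 0" using w(2)[OF jD] by (auto simp: fun_eq_iff)
   have iI: "i : I" using i w(1)[OF jD] unfolding cone_tangent_space_def coord_space_def by blast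
   let ?a = "a0(j := i)"
   have aA: "?a : A" using power_index_upd[OF a0 jD] iI by blast
   have "(SUM l:?D. c l * segre I d (x(l := w l)) ?a) = (SUM l:?D. if l = j then c l * w j i else 0)"
   proof (rule sum.cong[OF refl])
   fix l assume l: "l : ?D"
   show "c l * segre I d (x(l := w l)) ?a = (if l = j then c l * w j i else 0)"
   proof (cases "l = j")
   case True
   have "(PROD k:?D - {j}. x k (?a k)) = 1" by (rule prod.neutral) (use norm in simp)
   then show ?thesis using True upd[OF jD aA] by simp
   qed (simp add: upd[OF l aA] w(3)[OF l])
   qed
   then show ?thesis using cs[of ?a] c0 i jD by simp
  qed
 qed
 have fi: "inj_on f {..d}" "cvec.independent (f ` {..d})"
 proof (atomize (full), intro conjI)
  show "inj_on f {..d}"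
  proof (rule family_independent(1)[OF finite_atMost])
   fix c j assume a: "!!i. (SUM l<=d. c l * f l i) = 0" "j : {..d}"
   show "c j = 0" by (rule ind[OF a])
  qed
  show "cvec.independent (f ` {..d})"
  proof (rule family_independent(2)[OF finite_atMost])
   fix c j assume a: "!!i. (SUM l<=d. c l * f l i) = 0" "j : {..d}"
   show "c j = 0" by (rule ind[OF a])
  qed
 qed
 have sub: "f ` {..d} <= ?T"
 proof (rule image_subsetI)
  fix j assume j: "j : {..d}"
  show "f j : ?T"
  proof (cases "j = 0")
   case True then show ?thesis unfolding f_def using tangent_self[OF fin_A segre_in_cone[OF x] segre_coord] by simp
  next
   case False
   then have jD: "j : ?D" using j by auto
   show ?thesis unfolding f_def using False segre_tangent[OF x jD w(1)[OF jD]] by simp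
  qed
 qed
 have spn: "?T <= cvec.span (f ` {..d})"
 proof
  fix v assume v: "v : ?T"
  have "ALL j:?D. EX mu. ALL i. v (a0(j := i)) = v a0 * x j i + mu * w j i"
  proof
   fix j assume j: "j : ?D"
   from wy[OF j slice_tangent[OF j v]] show "EX mu. ALL i. v (a0(j := i)) = v a0 * x j i + mu * w j i" by simp
  qed
  from bchoice[OF this] obtain mu where mu: "ALL j:?D. ALL i. v (a0(j := i)) = v a0 * x j i + mu j * w j i" ..
  have va: "v a = v a0 * segre I d x a + (SUM j:?D. mu j * segre I d (x(j := w j)) a)" if a: "a : A" for a
  proof -
   have "(SUM j:?D. v (a0(j := a j)) * (PROD l:?D - {j}. x l (a l))) = (SUM j:?D. v a0 * segre I d x a + mu j * segre I d (x(j := w j)) a)"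
   proof (rule sum.cong[OF refl])
   fix j assume j: "j : ?D"
   show "v (a0(j := a j)) * (PROD l:?D - {j}. x l (a l)) = v a0 * segre I d x a + mu j * segre I d (x(j := w j)) a" unfolding mu[rule_format, OF j] upd[OF j a] segre_arg[OF a j] by (simp add: algebra_simps)
   qed
   also have "... = of_nat d * (v a0 * segre I d x a) + (SUM j:?D. mu j * segre I d (x(j := w j)) a)" unfolding sum.distrib by simp
   finally have "v a + of_nat (d - 1) * v a0 * segre I d x a = of_nat d * (v a0 * segre I d x a) + (SUM j:?D. mu j * segre I d (x(j := w j)) a)" using tangent_coordinate[OF v a] by simp
   \<comment> \<open>The \<open>d\<close> slices contribute the tensor \<open>d\<close> times, and
     \<open>tangent_coordinate\<close> removes \<open>d - 1\<close> copies, leaving one.\<close>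
   moreover have "(of_nat d :: 'k) = of_nat (d - 1) + 1" using d_pos by (cases d) simp_all
   ultimately show ?thesis by (simp add: algebra_simps)
  qed
  have "v = scal (v a0) (f 0) + (SUM j:?D. scal (mu j) (f j))"
  proof
   fix a
   have "(SUM j:?D. scal (mu j) (f j)) a = (SUM j:?D. mu j * segre I d (x(j := w j)) a)" unfolding sum_fun_apply by (rule sum.cong) (auto simp: f_def scal_def)
   moreover have "v a = v a0 * segre I d x a + (SUM j:?D. mu j * segre I d (x(j := w j)) a)"
   proof (cases "a : A")
   case False
   then have "v a = 0" using v unfolding cone_tangent_space_def coord_space_def by blast
   then show ?thesis using False by (simp add: segre_def)
   qed (rule va)
   ultimately show "v a = (scal (v a0) (f 0) + (SUM j:?D. scal (mu j) (f j))) a" by (simp add: f_def scal_def)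
  qed
  also have "... : cvec.span (f ` {..d})" by (intro cvec.span_add cvec.span_scale cvec.span_sum cvec.span_base) auto
  finally show "v : cvec.span (f ` {..d})" .
 qed
 have "card (f ` {..d}) = cvec.dim ?T" by (rule cvec.basis_card_eq_dim[OF sub spn fi(2)])
 then show ?thesis using card_image[OF fi(1)] by simp
qed

end

lemma power_tangent_dim:
 assumes dim: "ALL x:\<Union>C. cvec.dim (tangent I C x) = 2" and z: "z : \<Union>V"
 shows "cvec.dim (tangent A V z) = d + 1"
proof -
 obtain c y where y: "c ~= 0" "ALL j:{1..d}. y j : \<Union>C" "z = scal c (segre I d y)" by (rule cone_segre[OF z])
 have "ALL j:{1..d}. y j : cspace I & y j ~= 0" using y(2) cone_coord by blast
 from segre_nonzero_arg[OF this] obtain a0 where a0: "a0 : A" "!!j. j : {1..d} ==> y j (a0 j) ~= 0" by blast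
 \<comment> \<open>Each factor is rescaled to have entry 1 at \<open>a0 j\<close>. This multiplies
   the tensor by a scalar, along which the tangent space of the cone is constant.\<close>
 define x where "x j = scal (1 / y j (a0 j)) (y j)" for j
 have x: "ALL j:{1..d}. x j : \<Union>C"
 proof
  fix j assume j: "j : {1..d}"
  obtain p where p: "p : C" "y j : p" using y(2) j by blast
  have "x j : p" unfolding x_def by (rule scal_mem[OF C.in_proj[OF p(1)] p(2)]) (use a0(2)[OF j] in simp)
  then show "x j : \<Union>C" using p(1) by blast
 qed
 have n: "ALL j:{1..d}. x j (a0 j) = 1" using a0(2) by (simp add: x_def scal_def)
 let ?c = "c * (PROD j=1..d. y j (a0 j))"
 have "segre I d y = segre I d (%j. scal (y j (a0 j)) (x j))" by (rule segre_cong) (use a0(2) in "simp add: x_def scal_scal")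
 then have "z = scal ?c (segre I d x)" unfolding y(3) by (simp only: segre_scal scal_scal)
 moreover have "?c ~= 0" using y(1) a0(2) by simp
 ultimately show ?thesis using tangent_scal[OF fin_A, of ?c V "segre I d x"] normalized_tangent_dim[OF x a0(1) n dim] by simp
qed

end

section \<open>Dominance of the projection\<close>

lemma form_on_line:
 assumes "finite J" "hompf J n f" shows "EX q. ALL ep. f (%i. x i + ep * v i) = poly q ep" using assms dird_mv_eval[of J n _ x v] unfolding hompf_def dird_def by blast

lemma rg_coeff_prod:
 "finite B ==> p : V ==> (!!h. h : B ==> rg I V p (g h)) ==> rg I V p (%p. pcoeff (PROD h:B. [:1, g h p:]) k)"
proof (induction B arbitrary: k rule: finite_induct)
 case empty
 show ?case using rg_const[OF empty(1), of I "pcoeff 1 k"] by simp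
next
 case (insert b B)
 have IH: "rg I V p (%p. pcoeff (PROD h:B. [:1, g h p:]) k)" for k by (rule insert.IH[OF insert.prems(1)]) (rule insert.prems(2), blast)
 have e: "pcoeff (PROD h:insert b B. [:1, g h p:]) k =
   pcoeff (PROD h:B. [:1, g h p:]) k + (if k = 0 then 0 else g b p * pcoeff (PROD h:B. [:1, g h p:]) (k - 1))" for p unfolding prod.insert[OF insert.hyps] coeff_linear_mult by simp
 show ?case
 proof (cases "k = 0")
  case True
  show ?thesis unfolding e using IH[of 0] True by simp
 next
  case False
  have gb: "rg I V p (g b)" by (rule insert.prems(2)) simp
  show ?thesis unfolding e using rg_add[OF IH[of k] rg_mult[OF gb IH[of "k - 1"]]] False by simp
 qed
qed

text \<open>Surjectivity of the symmetric quotient on a chart: the polynomial with coefficients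
  \<open>y k\<close> splits, and since its constant term is nonzero each linear factor can be
  normalized to constant term 1.\<close>

lemma linear_factors:
 fixes y :: "nat => 'k::{alg_closed_field, field_char_0}"
 assumes y0: "y 0 ~= 0"
 shows "EX c v. ALL k<=d. y k = c * pcoeff (PROD j=1..d. [:1, v j:]) k"
proof -
 let ?F = "%z :: nat => 'k. SUM k<=d. y k * (z 0 ^ (d - k) * z 1 ^ k)"
 have "hompf {..1} d ?F"
 proof (rule hompf_sum, rule hompf_cmult)
  fix k assume k: "k : {..d}"
  have "hompf {..1} ((d - k) * 1 + k * 1) (%z :: nat => 'k. z 0 ^ (d - k) * z 1 ^ k)" by (rule hompf_mult[OF hompf_power[OF hompf_coord] hompf_power[OF hompf_coord]]) simp_all
  then show "hompf {..1} d (%z :: nat => 'k. z 0 ^ (d - k) * z 1 ^ k)" using k by simp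
 qed
 from binary_form_factor[OF this] obtain c al be where F: "ALL z. ?F z = c * (PROD i<d. al i * z 0 + be i * z 1)" by (elim exE)
 let ?Y = "SUM k<=d. Polynomial.monom (y k) k" and ?Z = "psmult c (PROD i<d. [:al i, be i:])"
 have "poly ?Y = poly ?Z"
 proof
  fix T
  have "poly ?Y T = ?F (%k. if k = 0 then 1 else T)" unfolding poly_sum poly_monom by simp
  also have "... = c * (PROD i<d. al i * 1 + be i * T)" using spec[OF F, of "%k. if k = 0 then 1 else T"] by simp
  also have "... = poly ?Z T" by (simp add: poly_prod mult.commute)
  finally show "poly ?Y T = poly ?Z T" .
 qed
 then have YZ: "?Y = ?Z" by (simp only: poly_eq_poly_eq_iff)
 have yk: "y k = pcoeff ?Z k" if "k <= d" for k
 proof -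
  have "pcoeff ?Y k = (SUM l<=d. if l = k then y l else 0)" unfolding coeff_sum coeff_monom ..
  then show ?thesis using that unfolding YZ by simp
 qed
 have "y 0 = poly ?Z 0" using yk[of 0] by (simp add: poly_0_coeff_0)
 then have "c * (PROD i<d. al i) ~= 0" using y0 by (simp add: poly_prod)
 then have al: "al i ~= 0" if "i < d" for i using that by (simp add: prod_zero_iff)
 let ?v = "%j. be (j - 1) / al (j - 1)"
 have "(PROD i<d. [:al i, be i:]) = (PROD i<d. psmult (al i) [:1, be i / al i:])" by (rule prod.cong[OF refl]) (use al in simp)
 also have "... = psmult (PROD i<d. al i) (PROD i<d. [:1, be i / al i:])" by (rule prod_smult)
 also have "(PROD i<d. [:1, be i / al i:]) = (PROD j=1..d. [:1, ?v j:])" by (rule prod.reindex_bij_witness[of _ "%j. j - 1" Suc]) auto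
 finally have p: "(PROD i<d. [:al i, be i:]) = psmult (PROD i<d. al i) (PROD j=1..d. [:1, ?v j:])" .
 have "ALL k<=d. y k = (c * (PROD i<d. al i)) * pcoeff (PROD j=1..d. [:1, ?v j:]) k" using yk unfolding p coeff_smult mult.assoc by blast
 then show ?thesis by (rule exI[of _ "c * (PROD i<d. al i)", OF exI[of _ ?v]])
qed

context power_galois
begin

text \<open>If \<open>H\<close> vanished on the image, it would vanish at the coefficients of
  \<open>\<Prod>j. (1 + v j T)\<close> for all \<open>v\<close> with entries among the infinitely
  many values of \<open>t 1 / t 0\<close>, hence for all \<open>v\<close>, one entry at a time.
  These coefficient vectors cover the chart \<open>y 0 ~= 0\<close> up to scalars, so
  \<open>H\<close> would be zero.\<close>

lemma dominant:
 assumes H: "hompf {..d} n H" and y: "H y ~= 0" shows "gen A V (%p. H (%k. PV.t k p) ~= 0)"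
proof (rule ccontr)
 assume "~ ?thesis"
 then have z: "gen A V (%p. H (%k. PV.t k p) = 0)" using V.ratl_zero_or_nonzero[OF PV.form_t_ratl[OF H]] by blast
 let ?D = "{1..d}" and ?u = "%q. PC.t 1 q / PC.t 0 q"
 define P where "P v = H (pcoeff (PROD j:?D. [:1, v j:]))" for v
 have u: "ratl I C ?u" by (rule PC.symf_ratl[OF symf_ratio])
 have "gen A V (%p. ALL j:?D. PC.t 0 (co I d p j) ~= 0)" by (rule V.gen_ball[OF finite_atLeastAtMost]) (rule gen_co[OF t0_nonzero])
 then have zu: "gen A V (%p. P (%j. ?u (co I d p j)) = 0)"
 proof (rule V.gen_mono3[OF _ z PV_t])
  fix p assume t0: "ALL j:?D. PC.t 0 (co I d p j) ~= 0" and h: "H (%k. PV.t k p) = 0"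
   and t: "ALL k<=d. PV.t k p = pcoeff (PROD j=1..d. tlin p j) k"
  let ?c = "PROD j:?D. PC.t 0 (co I d p j)"
  have "(PROD j:?D. tlin p j) = (PROD j:?D. psmult (PC.t 0 (co I d p j)) [:1, ?u (co I d p j):])" by (rule prod.cong[OF refl]) (use t0 in simp)
  also have "... = psmult ?c (PROD j:?D. [:1, ?u (co I d p j):])" by (rule prod_smult)
  finally have e: "(PROD j:?D. tlin p j) = psmult ?c (PROD j:?D. [:1, ?u (co I d p j):])" .
  have "H (%k. PV.t k p) = H (scal ?c (pcoeff (PROD j:?D. [:1, ?u (co I d p j):])))"
  proof (rule hompf_cong_on[OF H])
   fix k assume "k : {..d}"
   then have "PV.t k p = pcoeff (PROD j:?D. tlin p j) k" using t by blast
   then show "PV.t k p = scal ?c (pcoeff (PROD j:?D. [:1, ?u (co I d p j):])) k" unfolding e coeff_smult scal_def .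
  qed
  also have "... = ?c ^ n * P (%j. ?u (co I d p j))" unfolding P_def by (rule hompf_scale[OF H])
  finally show "P (%j. ?u (co I d p j)) = 0" using h t0 by simp
 qed
 let ?Xs = "{x : C. rg I C x ?u}"
 have Pc: "P v = P v'" if "!!j. j : ?D ==> v j = v' j" for v v'
 proof -
  have "(PROD j:?D. [:1, v j:]) = (PROD j:?D. [:1, v' j:])" by (rule prod.cong[OF refl]) (simp only: that)
  then show ?thesis unfolding P_def by (simp only:)
 qed
 have pw: "P (%j. ?u (q j)) = 0" if q: "ALL j:?D. q j : ?Xs" for q
 proof -
  have qC: "ALL j:?D. q j : C" using q by blast
  have pV: "mk I d q : V" by (rule mk_in_V[OF qC])
  have r: "rg A V (mk I d q) (%p. ?u (co I d p j))" if j: "j : ?D" for j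
  proof (rule rg_co[OF pV j])
   show "rg I C (co I d (mk I d q) j) ?u" unfolding co_mk[OF qC j] using q j by blast
  qed
  have "rg A V (mk I d q) (%p. H (%k. pcoeff (PROD j:?D. [:1, ?u (co I d p j):]) k))" by (rule rg_hompf[OF pV H]) (rule rg_coeff_prod[OF finite_atLeastAtMost pV r])
  from V.rg_zero[OF this zu[unfolded P_def]] have "P (%j. ?u (co I d (mk I d q) j)) = 0" unfolding P_def .
  moreover have "P (%j. ?u (co I d (mk I d q) j)) = P (%j. ?u (q j))" by (rule Pc) (simp only: co_mk[OF qC])
  ultimately show ?thesis by simp
 qed
 note nc = ratio_nonconstant
 have inf: "infinite (?u ` ?Xs)"
 proof
  assume fin: "finite (?u ` ?Xs)"
  let ?R = "PROD a:?u ` ?Xs. [:- a, 1:]"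
  have "gen I C (%x. poly ?R (?u x) = 0)"
  proof (rule C.gen_mono[OF C.ratl_gen[OF u]])
   fix x assume "x : C" "rg I C x ?u"
   then have m: "?u x : ?u ` ?Xs" by blast
   show "poly ?R (?u x) = 0" unfolding poly_prod by (rule prod_zero[OF fin], rule bexI[OF _ m]) simp
  qed
  moreover have "?R ~= 0" using fin by simp
  ultimately show False using C.root_const[OF u] nc by blast
 qed
 \<comment> \<open>The first \<open>k\<close> entries are arbitrary and the others are values of
   \<open>?u\<close>. Freeing one more entry uses that \<open>P\<close> is polynomial in it and
   vanishes at infinitely many places.\<close>
 have step: "k <= d ==> (ALL j:{k<..d}. v j : ?u ` ?Xs) ==> P v = 0" for k v
 proof (induction k arbitrary: v)
  case 0
  have "ALL j. EX q. j : ?D --> q : ?Xs & v j = ?u q"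
  proof
   fix j show "EX q. j : ?D --> q : ?Xs & v j = ?u q"
   proof (cases "j : ?D")
   case True
   then have "v j : ?u ` ?Xs" using 0(2) by simp
   then show ?thesis by blast
   qed blast
  qed
  from choice[OF this] obtain q where q: "ALL j. j : ?D --> q j : ?Xs & v j = ?u (q j)" ..
  have "P v = P (%j. ?u (q j))" by (rule Pc) (use q in blast)
  also have "... = 0" by (rule pw) (use q in blast)
  finally show ?case .
 next
  case (Suc k)
  let ?i = "Suc k"
  have i: "?i : ?D" using Suc.prems(1) by simp
  let ?Q = "PROD j:?D - {?i}. [:1, v j:]"
  have PT: "P (v(?i := T)) = H (%l. pcoeff ?Q l + T * (if l = 0 then 0 else pcoeff ?Q (l - 1)))" for T
  proof -
   have "(PROD j:?D. [:1, (v(?i := T)) j:]) = [:1, (v(?i := T)) ?i:] * (PROD j:?D - {?i}. [:1, (v(?i := T)) j:])" by (rule prod.remove[OF finite_atLeastAtMost i])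
   also have "(PROD j:?D - {?i}. [:1, (v(?i := T)) j:]) = ?Q" by (rule prod.cong) auto
   finally have e: "(PROD j:?D. [:1, (v(?i := T)) j:]) = [:1, T:] * ?Q" by (simp only: fun_upd_same)
   show ?thesis unfolding P_def e by (rule arg_cong[of _ _ H], rule ext) (simp add: coeff_linear_mult del: mult_pCons_left)
  qed
  obtain q where q: "ALL T. P (v(?i := T)) = poly q T" using form_on_line[OF finite_atMost H, of "pcoeff ?Q" "%l. if l = 0 then 0 else pcoeff ?Q (l - 1)"] unfolding PT by blast
  have "?u ` ?Xs <= {T. poly q T = 0}"
  proof
   fix T assume T: "T : ?u ` ?Xs"
   have "P (v(?i := T)) = 0"
   proof (rule Suc.IH)
   show "ALL j:{k<..d}. (v(?i := T)) j : ?u ` ?Xs"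
   proof
   fix j assume j: "j : {k<..d}"
   show "(v(?i := T)) j : ?u ` ?Xs"
   proof (cases "j = ?i")
   case True then show ?thesis using T by (simp only: fun_upd_same)
   next
   case False
   then have "j : {?i<..d}" using j by auto
   then have "v j : ?u ` ?Xs" using Suc.prems(2) by blast
   then show ?thesis unfolding fun_upd_other[OF False] .
   qed
   qed
   qed (use Suc.prems(1) in simp)
   then show "T : {T. poly q T = 0}" using q by simp
  qed
  then have q0: "q = 0" using inf poly_roots_finite[of q] finite_subset by blast
  have "P (v(?i := v ?i)) = poly q (v ?i)" by (rule spec[OF q])
  then show ?case unfolding fun_upd_triv q0 poly_0 .
 qed
 have P0: "P v = 0" for v by (rule step[of d]) auto
 obtain q where q: "ALL ep. H (%k. y k + ep * (if k = 0 then 1 else 0)) = poly q ep" using form_on_line[OF finite_atMost H, of y "%k. if k = 0 then 1 else 0"] by blast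
 \<comment> \<open>Moving \<open>y\<close> in the direction of the coordinate \<open>0\<close> leads
   into the chart for all parameters but one, and \<open>H\<close> is polynomial along this
   line.\<close>
 have "- {- y 0} <= {ep. poly q ep = 0}"
 proof
  fix ep assume ep: "ep : - {- y 0}"
  let ?y = "%k. y k + ep * (if k = 0 then 1 else 0)"
  have "?y 0 ~= 0" using ep by (auto simp: eq_neg_iff_add_eq_0 add.commute)
  from linear_factors[of ?y d, OF this] obtain c v where v: "ALL k<=d. ?y k = c * pcoeff (PROD j=1..d. [:1, v j:]) k" by blast
  have "H ?y = H (scal c (pcoeff (PROD j=1..d. [:1, v j:])))" by (rule hompf_cong_on[OF H]) (use v in "simp add: scal_def")
  also have "... = c ^ n * P v" unfolding P_def by (rule hompf_scale[OF H])
  finally show "ep : {ep. poly q ep = 0}" using q P0 by simp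
 qed
 moreover have "infinite (- {- y 0})" by (simp add: infinite_UNIV_char_0 Compl_eq_Diff_UNIV)
 ultimately have "q = 0" using poly_roots_finite[of q] finite_subset by blast
 then have "H (%k. y k + 0 * (if k = 0 then 1 else 0)) = 0" using q[rule_format, of 0] by simp
 then show False using y by simp
qed

lemma pullback_power: "pullback_field A V Jv PV.W0 PV.pi = KV" by (rule PV.pullback_eq_symf) (rule dominant)

end

section \<open>Galois embeddings\<close>

text \<open>Expanding the product over index tuples shows that each coefficient is a linear form in
  the Segre coordinates of \<open>x\<close>. This is why the quotient by the wreath product is a
  linear projection of the embedded power.\<close>

lemma coeff_power_form:
 fixes l0 l1 :: "nat => 'k::field" and x e :: "nat => nat => _"
 assumes e: "bij_betw e {..<M} (PiE {1..d} (%_. {..<N}))"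
 shows "(SUM m<M. pcoeff (PROD j=1..d. [:l0 (e m j), l1 (e m j):]) k * (PROD j=1..d. x j (e m j))) =
  pcoeff (PROD j=1..d. [:SUM i<N. l0 i * x j i, SUM i<N. l1 i * x j i:]) k"
proof -
 have pc: "[:SUM i<N. l0 i * x j i, SUM i<N. l1 i * x j i:] = (SUM i<N. psmult (x j i) [:l0 i, l1 i:])" for j
 proof (induction N)
  case (Suc N)
  show ?case unfolding sum.lessThan_Suc Suc.IH[symmetric] by (simp add: mult.commute)
 qed simp
 let ?h = "%a :: nat => nat. psmult (PROD j=1..d. x j (a j)) (PROD j=1..d. [:l0 (a j), l1 (a j):])"
 have "(PROD j=1..d. [:SUM i<N. l0 i * x j i, SUM i<N. l1 i * x j i:]) = (SUM a:PiE {1..d} (%_. {..<N}). PROD j=1..d. psmult (x j (a j)) [:l0 (a j), l1 (a j):])" unfolding pc by (rule prod_sum_PiE) simp_all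
 also have "... = (SUM a:PiE {1..d} (%_. {..<N}). ?h a)" unfolding prod_smult ..
 also have "... = (SUM m<M. ?h (e m))" by (rule sum.reindex_bij_betw[OF e, symmetric])
 finally show ?thesis by (simp only: coeff_sum coeff_smult mult.commute)
qed

lemma galois_group_compose:
 assumes R: "ring R" and K: "K <= carrier R" and s: "sg : carrier (galois_group R K)" and t: "ta : carrier (galois_group R K)"
 shows "compose (carrier R) sg ta : carrier (galois_group R K)"
proof -
 have s': "bij_betw sg (carrier R) (carrier R)" "sg : ring_hom R R" "ALL x:K. sg x = x"
  and t': "bij_betw ta (carrier R) (carrier R)" "ta : ring_hom R R" "ALL x:K. ta x = x" using s t unfolding galois_group_carrier by blast+
 have tc: "ta x : carrier R" if "x : carrier R" for x using bij_betwE[OF t'(1)] that by blast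
 have e: "compose (carrier R) sg ta x = sg (ta x)" if "x : carrier R" for x using that by (simp add: compose_def)
 show ?thesis unfolding galois_group_carrier
 proof (intro conjI ballI)
  show "compose (carrier R) sg ta : extensional (carrier R)" by (rule compose_extensional)
  show "bij_betw (compose (carrier R) sg ta) (carrier R) (carrier R)" by (rule bij_betw_compose[OF t'(1) s'(1)])
  show "compose (carrier R) sg ta x = x" if x: "x : K" for x using e[of x] K x s'(3) t'(3) by auto
  interpret R: ring R by (rule R)
  show "compose (carrier R) sg ta : ring_hom R R"
  proof (rule ring_hom_memI)
   show "compose (carrier R) sg ta \<one>\<^bsub>R\<^esub> = \<one>\<^bsub>R\<^esub>" unfolding e[OF R.one_closed] ring_hom_one[OF t'(2)] ring_hom_one[OF s'(2)] ..
   fix x y assume x: "x : carrier R" and y: "y : carrier R"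
   show "compose (carrier R) sg ta (x \<otimes>\<^bsub>R\<^esub> y) = compose (carrier R) sg ta x \<otimes>\<^bsub>R\<^esub> compose (carrier R) sg ta y"
   unfolding e[OF x] e[OF y] e[OF R.m_closed[OF x y]] ring_hom_mult[OF t'(2) x y] ring_hom_mult[OF s'(2) tc[OF x] tc[OF y]] ..
   show "compose (carrier R) sg ta (x \<oplus>\<^bsub>R\<^esub> y) = compose (carrier R) sg ta x \<oplus>\<^bsub>R\<^esub> compose (carrier R) sg ta y"
   unfolding e[OF x] e[OF y] e[OF R.a_closed[OF x y]] ring_hom_add[OF t'(2) x y] ring_hom_add[OF s'(2) tc[OF x] tc[OF y]] ..
  next
   show "compose (carrier R) sg ta x : carrier R" if x: "x : carrier R" for x unfolding e[OF x] by (rule ring_hom_closed[OF s'(2) tc[OF x]])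
  qed
 qed
qed

lemma galois_group_parametrization:
 assumes R: "ring R" and K: "K <= carrier R" and iso: "galois_group R K \<cong> G"
 obtains psi where "bij_betw psi (carrier G) (carrier (galois_group R K))"
  "!!g h x. g : carrier G ==> h : carrier G ==> x : carrier R ==> psi (g \<otimes>\<^bsub>G\<^esub> h) x = psi g (psi h x)"
proof -
 let ?Gm = "galois_group R K"
 obtain f where f: "f : hom ?Gm G" "bij_betw f (carrier ?Gm) (carrier G)" using iso unfolding is_iso_def iso_def by blast
 define psi where "psi = inv_into (carrier ?Gm) f"
 have b: "bij_betw psi (carrier G) (carrier ?Gm)" unfolding psi_def by (rule bij_betw_inv_into[OF f(2)])
 have c: "psi g : carrier ?Gm" if "g : carrier G" for g using bij_betwE[OF b] that by blast
 have fp: "f (psi g) = g" if "g : carrier G" for g unfolding psi_def by (rule bij_betw_inv_into_right[OF f(2) that])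
 have pf: "psi (f sg) = sg" if "sg : carrier ?Gm" for sg unfolding psi_def by (rule bij_betw_inv_into_left[OF f(2) that])
 show ?thesis
 proof (rule that[OF b])
  fix g h x assume a: "g : carrier G" "h : carrier G" "x : carrier R"
  have m: "psi g \<otimes>\<^bsub>?Gm\<^esub> psi h = compose (carrier R) (psi g) (psi h)" by (rule galois_group_mult[OF c[OF a(1)] c[OF a(2)]])
  have mc: "psi g \<otimes>\<^bsub>?Gm\<^esub> psi h : carrier ?Gm" unfolding m by (rule galois_group_compose[OF R K c[OF a(1)] c[OF a(2)]])
  have "f (psi g \<otimes>\<^bsub>?Gm\<^esub> psi h) = g \<otimes>\<^bsub>G\<^esub> h" using hom_mult[OF f(1) c[OF a(1)] c[OF a(2)]] fp a by simp
  then have "psi (g \<otimes>\<^bsub>G\<^esub> h) = psi g \<otimes>\<^bsub>?Gm\<^esub> psi h" using pf[OF mc] by simp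
  then show "psi (g \<otimes>\<^bsub>G\<^esub> h) x = psi g (psi h x)" unfolding m using a(3) by (simp add: compose_def)
 qed
qed

section \<open>From a very ample divisor to the data of a projected variety\<close>

context proj_variety
begin

lemma very_ample_functions:
 assumes va: "very_ample_via I V D ss"
 obtains dl s phi where "!!p. p : V ==> ratl I V (dl p) & D p = cls I V (dl p)" "!!i. i < length ss ==> ratl I V (s i)"
  "ss = map (%i. cls I V (s i)) [0..<length ss]" "isdiv I V dl"
  "!!i x. i < length ss ==> x : V ==> val I V (%y. s i y * dl x y) x (phi i x)"
proof -
 have div: "is_divisor I V D" and sb: "section_basis I V D ss" using va unfolding very_ample_via_def by blast+
 have "ALL p. EX f. p : V --> ratl I V f & D p = cls I V f"
 proof
  fix p show "EX f. p : V --> ratl I V f & D p = cls I V f"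
  proof (cases "p : V")
   case True
   then have "D p : carrier L" using div unfolding is_divisor_def by blast
   then show ?thesis using carrierE by blast
  qed blast
 qed
 from choice[OF this] obtain dl where d0: "ALL p. p : V --> ratl I V (dl p) & D p = cls I V (dl p)" ..
 have dl: "!!p. p : V ==> ratl I V (dl p) & D p = cls I V (dl p)" using d0 by blast
 have sc: "set ss <= carrier L" using sb unfolding section_basis_def by (intro L.independent_in_carrier) blast
 have "ALL i. EX f. i < length ss --> ratl I V f & ss ! i = cls I V f"
 proof
  fix i show "EX f. i < length ss --> ratl I V f & ss ! i = cls I V f"
  proof (cases "i < length ss")
   case True
   then have "ss ! i : carrier L" using sc nth_mem by blast
   then show ?thesis using carrierE by blast
  qed blast
 qed
 from choice[OF this] obtain s where s0: "ALL i. i < length ss --> ratl I V (s i) & ss ! i = cls I V (s i)" ..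
 have ss: "ss = map (%i. cls I V (s i)) [0..<length ss]" by (rule nth_equalityI) (use s0 in simp_all)
 have isd: "isdiv I V dl" by (rule iffD1[OF is_divisor_iff[where D = D and dl = dl] div]) (rule dl)
 have sr: "ALL i<length ss. ratl I V (s i)" using s0 by blast
 have "sect_basis I V dl (length ss) s" using section_basis_iff[where dl = dl and D = D and s = s and n = "length ss", OF dl sr] sb ss by simp
 then have sec: "ALL i<length ss. ALL x:V. EX c. val I V (%y. s i y * dl x y) x c" unfolding sect_basis_def sect_def by blast
 have v: "val I V (%y. s i y * dl x y) x (SOME c. val I V (%y. s i y * dl x y) x c)" if "i < length ss" "x : V" for i x by (rule someI_ex) (use sec that in blast)
 show ?thesis by (rule that[of dl s "%i x. SOME c. val I V (%y. s i y * dl x y) x c", OF dl _ ss isd v]) (use s0 in blast)+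
qed

text \<open>At a generic point the sections and the local equation are regular and the latter is a
  unit, so the trivialized values are the sections times one common nonzero scalar.\<close>

lemma sections_in_point:
 fixes n :: nat
 assumes dl: "isdiv I V dl" and s: "!!i. i < n ==> ratl I V (s i)"
  and phi: "!!i x. i < n ==> x : V ==> val I V (%y. s i y * dl x y) x (phi i x)"
 shows "gen I V (%p. (%i. if i : {..<n} then s i p else 0) : pt (%i. if i < n then phi i p else 0))"
proof -
 have r: "gen I V (%p. ALL i:{..<n}. rg I V p (s i))" by (rule gen_ball[OF finite_lessThan], rule ratl_gen[OF s]) simp
 show ?thesis
 proof (rule gen_mono2[OF r gen_unit[OF dl]])
  fix p assume p: "p : V" and rp: "ALL i:{..<n}. rg I V p (s i)" and "EX c. c ~= 0 & val I V (dl p) p c"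
  then obtain c where c: "c ~= 0" "val I V (dl p) p c" by blast
  have e: "phi i p = s i p * c" if i: "i < n" for i
  proof (rule val_unique[OF phi[OF i p]])
   show "val I V (%y. s i y * dl p y) p (s i p * c)" by (rule val_mult[OF val_rg c(2)]) (use rp i in blast)
  qed
  have "(%i. if i : {..<n} then s i p else 0) = scal (1 / c) (%i. if i < n then phi i p else 0)" using e c(1) by (simp add: scal_def fun_eq_iff)
  then show "(%i. if i : {..<n} then s i p else 0) : pt (%i. if i < n then phi i p else 0)" unfolding pt_def using c(1) by (intro CollectI exI[of _ "1 / c"]) simp
 qed
qed

lemma projected_variety_linsys:
 assumes pd: "projection_data {..<n} m l b" and dl: "!!p. p : V ==> D p = cls I V (dl p)" "isdiv I V dl"
  and s: "!!i. i < n ==> ratl I V (s i)"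
  and phi: "!!i x. i < n ==> x : V ==> val I V (%y. s i y * dl x y) x (phi i x)"
  and ce: "closed_embedding I V {..<n} (linsys_map I V D (map (%i. cls I V (s i)) [0..<n]))"
  and center: "!!p. p : V ==> EX k<=m. (SUM i<n. l k i * phi i p) ~= 0"
 shows "projected_variety I V {..<n} m l b (linsys_map I V D (map (%i. cls I V (s i)) [0..<n])) s"
proof -
 interpret P: projection_data "{..<n}" m l b by (rule pd)
 let ?f = "linsys_map I V D (map (%i. cls I V (s i)) [0..<n])" and ?z = "%p i. if i < n then phi i p else 0"
 have lin: "?f x = pt (?z x)" if x: "x : V" for x by (rule linsys_map_val[where s = s and dl = dl and c = "%i. phi i x", OF proj_variety_axioms x s _ _ phi[OF _ x]])
   (use dl x in "simp_all add: isdiv_def")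
 note E = closed_embeddingD[OF closed ce]
 show ?thesis
 proof (rule projected_variety.intro[OF proj_variety_axioms pd], rule projected_variety_axioms.intro)
  show "rmap_at I V {..<n} ?f p" if "p : V" for p by (rule E(2)[OF that])
  show "?f p : pspace {..<n}" if "p : V" for p using zclosed_subset[OF E(1)] that by blast
  show "?f p ~: P.W" if p: "p : V" for p
  proof
   assume "?f p : P.W"
   then obtain x where x: "x : P.E" "pt (?z p) = pt x" unfolding P.W_def lin[OF p] by blast
   obtain c where c: "?z p = scal c x" using x(2) unfolding pt_eq_iff by blast
   have "(SUM i<n. l k i * phi i p) = 0" if k: "k <= m" for k
   proof -
   have "(SUM i<n. l k i * phi i p) = lf {..<n} (l k) (?z p)" unfolding lf_def by (rule sum.cong) auto
   also have "... = 0" unfolding c lf_scal using x(1) k unfolding P.E_def by simp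
   finally show ?thesis .
   qed
   then show False using center[OF p] by blast
  qed
  show "ratl I V (s i)" if "i : {..<n}" for i using s that by simp
  show "gen I V (%p. (%i. if i : {..<n} then s i p else 0) : ?f p)" by (rule gen_mono[OF sections_in_point[OF dl(2) s phi]], assumption, assumption, assumption) (simp only: lin)
 qed
qed

end

theorem corollary1p3:
  fixes I :: "'i set"
    and C :: "('i, 'k::{alg_closed_field, field_char_0}) point set"
    and G :: "'g monoid"
    and d :: nat
  assumes "smooth_projective_curve I C"
    and "group G"
    and "possesses_galois_embedding I C G"
    and "d \<ge> 1"
  shows "possesses_galois_embedding (power_index I d) (variety_power I C d) (wreath_sym G d)"
proof -
 have fin_I: "finite I" and irr: "irreducible_closed I C" and dimC: "variety_dim I C = 1"
  and tan: "ALL x:\<Union>C. cvec.dim (tangent I C x) = 2" using assms(1) unfolding smooth_projective_curve_def smooth_projective_variety_def by auto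
 have sp: "segre_power I C d" by (rule segre_power.intro[OF fin_I irr assms(4)])
 interpret S: segre_power_char_0 I C d by (rule segre_power_char_0.intro[OF sp])
 obtain D ss W where va: "very_ample_via I C D ss"
  and gs: "galois_subspace I C (int (length ss) - 1) (linsys_map I C D ss) W G" using assms(3) unfolding possesses_galois_embedding_def by blast
 obtain dl s phi where dl: "!!p. p : C ==> ratl I C (dl p) & D p = cls I C (dl p)" and s0: "!!i. i < length ss ==> ratl I C (s i)"
  and ss0: "ss = map (%i. cls I C (s i)) [0..<length ss]" and isd: "isdiv I C dl"
  and phi0: "!!i x. i < length ss ==> x : C ==> val I C (%y. s i y * dl x y) x (phi i x)" by (rule S.C.very_ample_functions[OF va]) (rule that)
 define n where "n = length ss"
 note s = s0[folded n_def] and ss = ss0[folded n_def] and phi = phi0[folded n_def]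
 let ?f = "linsys_map I C D (map (%i. cls I C (s i)) [0..<n])"
 note va' = va[unfolded ss]
 have ce: "closed_embedding I C {..<n} ?f" using va' unfolding very_ample_via_def by simp
 have Jn: "{i. int i <= int n - 1} = {..<n}" by auto
 obtain W0 where W: "linear_subvariety {..<n} (int n - 2 - 1) W" "W Int ?f ` C = {}"
  and W0: "linear_subvariety {..<n} 1 W0" "W0 Int W = {}"
  and gal: "galois_extension (funfield I C) (pullback_field I C {..<n} W0 (%p. linear_projection W W0 (?f p)))"
   "galois_group (funfield I C) (pullback_field I C {..<n} W0 (%p. linear_projection W W0 (?f p))) \<cong> G" using gs unfolding galois_subspace_def Let_def n_def[symmetric] dimC ss[symmetric] Jn by auto
 obtain E where E: "cvec.subspace E" "E <= cspace {..<n}" "int (cvec.dim E) = int n - 2" "W = {pt x | x. x : E & x ~= 0}" using W(1) unfolding linear_subvariety_def by auto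
 obtain E0 where E0: "cvec.subspace E0" "E0 <= cspace {..<n}" "int (cvec.dim E0) = 2" "W0 = {pt x | x. x : E0 & x ~= 0}" using W0(1) unfolding linear_subvariety_def by auto
 have EE0: "E Int E0 <= {0}" using W0(2) unfolding E(4) E0(4) by blast
 have dims: "cvec.dim E + cvec.dim E0 = card {..<n}" "cvec.dim E0 = Suc 1" using E(3) E0(3) by simp_all
 obtain l b where b: "!!k. k <= 1 ==> b k : cspace {..<n}"
  and dual: "!!i k. i <= 1 ==> k <= 1 ==> lf {..<n} (l i) (b k) = (if i = k then 1 else 0)"
  and El: "E = {x : cspace {..<n}. ALL k<=1. lf {..<n} (l k) x = 0}" and E0b: "E0 = range (comb 1 b)" by (rule linear_decomposition[OF finite_lessThan E(1,2) E0(1,2) dims EE0]) (rule that)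
 have pd: "projection_data {..<n} 1 l b" by (rule projection_data.intro[OF finite_lessThan b dual])
 interpret P: projection_data "{..<n}" 1 l b by (rule pd)
 have PW: "P.W = W" "P.W0 = W0" unfolding P.W_def P.E_def P.W0_def P.E0_def E(4) E0(4) El E0b by (rule refl)+
 have lin: "?f x = pt (%i. if i < n then phi i x else 0)" if x: "x : C" for x by (rule linsys_map_val[where s = s and dl = dl and c = "%i. phi i x", OF S.C.proj_variety_axioms x s _ _ phi[OF _ x]])
   (use dl[OF x] in simp_all)
 have center: "EX k<=1. (SUM i<n. l k i * phi i p) ~= 0" if p: "p : C" for p
 proof (rule ccontr)
  let ?z = "%i. if i < n then phi i p else 0"
  assume a: "~ ?thesis"
  have "lf {..<n} (l k) ?z = (SUM i<n. l k i * phi i p)" for k unfolding lf_def by (rule sum.cong) auto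
  then have zE: "?z : E" using a unfolding El coord_space_def by auto
  have fp: "pt ?z : pspace {..<n}" using zclosed_subset[OF closed_embeddingD(1)[OF S.C.closed ce]] p lin[OF p] by blast
  have "?z ~= 0" by (rule proj_space_mem(2)[OF fp in_pt_self])
  then have "?f p : W" unfolding E(4) lin[OF p] using zE by blast
  then show False using W(2) p by blast
 qed
 have PCv: "projected_variety I C {..<n} 1 l b ?f s" by (rule S.C.projected_variety_linsys[where dl = dl and phi = phi, OF pd _ isd s phi ce center]) (use dl in blast)
 interpret PC: projected_variety I C "{..<n}" 1 l b ?f s by (rule PCv)
 let ?K = "pullback_field I C {..<n} W0 (%p. linear_projection W W0 (?f p))"
 have pie: "PC.pi = (%p. linear_projection W W0 (?f p))" unfolding PC.pi_def[abs_def] PW ..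
 have KL: "?K <= carrier (funfield I C)" using gal(1) unfolding galois_extension_def by (blast dest: subfieldE(3))
 \<comment> \<open>Dominance of the curve projection is not established at this stage; that all
   pulled back classes lie in the function field follows from \<open>?K\<close> being a subfield,
   which is part of the Galois assumption.\<close>
 have K: "?K = cls I C ` {f. PC.symf f}"
 proof
  show "?K <= cls I C ` {f. PC.symf f}" using PC.pullback_in_carrier KL unfolding PW(2) pie by blast
  show "cls I C ` {f. PC.symf f} <= ?K" using PC.symf_pullback unfolding PW(2) pie by blast
 qed
 have ringL: "ring (funfield I C)" by (rule S.C.L.ring_axioms)
 obtain psi where psi: "bij_betw psi (carrier G) (carrier (galois_group (funfield I C) ?K))"
  "!!g h x. g : carrier G ==> h : carrier G ==> x : carrier (funfield I C) ==> psi (g \<otimes>\<^bsub>G\<^esub> h) x = psi g (psi h x)" by (rule galois_group_parametrization[OF ringL KL gal(2)]) (rule that)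
 have gp: "galois_projection I C {..<n} 1 l b ?f s G psi" by (rule galois_projection.intro[OF PCv assms(2) galois_projection_axioms.intro[OF gal(1)[unfolded K] psi[unfolded K]]])
 interpret GP: galois_projection I C "{..<n}" 1 l b ?f s G psi by (rule gp)

 let ?P = "PiE {1..d} (%_. {..<n})"
 define M where "M = card ?P"
 have finP: "finite ?P" by (intro finite_PiE) auto
 obtain e where e: "bij_betw e {..<M} ?P" using ex_bij_betw_nat_finite[OF finP] unfolding M_def atLeast0LessThan by blast
 define D' where "D' = (%p. cls S.A S.V (S.pdiv dl p))"
 define sg where "sg m = S.psec s (e m)" for m
 let ?ss = "map (%m. cls S.A S.V (sg m)) [0..<M]" and ?phi = "%m p. PROD j=1..d. phi (e m j) (co I d p j)"
 note vp = S.very_ample_power[OF dl s va' phi e, folded D'_def sg_def]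
 have e_in: "e m : ?P" if "m < M" for m using bij_betwE[OF e] that by blast
 have rs: "ratl S.A S.V (sg m)" if m: "m < M" for m unfolding sg_def S.psec_def by (rule S.V.ratl_prod, rule S.ratl_co[OF s]) (use PiE_mem[OF e_in[OF m]] in simp_all)
 have vs: "val S.A S.V (%q. sg m q * S.pdiv dl p q) p (?phi m p)" if "m < M" "p : S.V" for m p unfolding sg_def by (rule S.psec_val[OF phi e_in[OF that(1)] that(2)])
 define lv where "lv k m = pcoeff (PROD j=1..d. [:l 0 (e m j), l 1 (e m j):]) k" for k m
 \<comment> \<open>The Segre tensor with first \<open>k\<close> factors \<open>b 1\<close> and the
   others \<open>b 0\<close>. Its product of linear polynomials is \<open>T ^ k\<close>, so these
   vectors are dual to the coefficient forms \<open>lv\<close>.\<close>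
 define bv where "bv k = reindex e M (segre {..<n} d (%j. if j <= k then b 1 else b 0))" for k
 have form: "(SUM m<M. lv k m * (PROD j=1..d. x j (e m j))) = pcoeff (PROD j=1..d. [:SUM i<n. l 0 i * x j i, SUM i<n. l 1 i * x j i:]) k" for k x unfolding lv_def by (rule coeff_power_form[OF e])
 have pdv: "projection_data {..<M} d lv bv"
 proof (rule projection_data.intro[OF finite_lessThan])
  interpret R: index_change e M ?P by (rule index_change.intro[OF e])
  show "bv k : cspace {..<M}" if "k <= d" for k unfolding bv_def by (rule R.reindex_coord)
  fix i k assume ik: "i <= d" "k <= d"
  let ?x = "%j. if j <= k then b 1 else b 0"
  have "lf {..<M} (lv i) (bv k) = (SUM m<M. lv i m * (PROD j=1..d. ?x j (e m j)))" unfolding lf_def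
  proof (rule sum.cong[OF refl])
   fix m assume "m : {..<M}"
   then have m: "m < M" by simp
   have "e m : power_index {..<n} d" using e_in[OF m] unfolding power_index_def .
   then show "lv i m * bv k m = lv i m * (PROD j=1..d. ?x j (e m j))" using m unfolding bv_def reindex_def segre_def by (simp only: if_True)
  qed
  also have "... = pcoeff (PROD j=1..d. [:SUM i<n. l 0 i * ?x j i, SUM i<n. l 1 i * ?x j i:]) i" by (rule form)
  also have "(PROD j=1..d. [:SUM i<n. l 0 i * ?x j i, SUM i<n. l 1 i * ?x j i:]) = (PROD j=1..d. if j <= k then [:0, 1:] else 1)"
  proof (rule prod.cong[OF refl])
   fix j :: nat
   have "(SUM i<n. l k' i * b k'' i) = (if k' = k'' then 1 else 0)" if "k' <= 1" "k'' <= 1" for k' k'' using dual[OF that] unfolding lf_def .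
   then show "[:SUM i<n. l 0 i * ?x j i, SUM i<n. l 1 i * ?x j i:] = (if j <= k then [:0, 1:] else 1)" by (simp add: one_pCons)
  qed
  also have "... = (PROD j:{1..k}. [:0, 1:])" by (rule prod.mono_neutral_cong_right) (use ik in auto)
  also have "... = Polynomial.monom 1 k" by (simp add: monom_altdef)
  also have "pcoeff (Polynomial.monom (1 :: 'k) k) i = (if i = k then 1 else 0)" by auto
  finally show "lf {..<M} (lv i) (bv k) = (if i = k then 1 else 0)" .
 qed
 let ?F = "linsys_map S.A S.V D' ?ss"
 have ceV: "closed_embedding S.A S.V {..<M} ?F" using vp(1) unfolding very_ample_via_def by simp
 \<comment> \<open>The center is missed because a product of nonzero linear polynomials is nonzero;
   its degree is at most \<open>d\<close>, so one of the coefficients up to \<open>d\<close>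
   survives.\<close>
 have centerV: "EX k<=d. (SUM m<M. lv k m * ?phi m p) ~= 0" if p: "p : S.V" for p
 proof (rule ccontr)
  let ?q = "PROD j=1..d. [:SUM i<n. l 0 i * phi i (co I d p j), SUM i<n. l 1 i * phi i (co I d p j):]"
  assume a: "~ ?thesis"
  have q: "(SUM m<M. lv k m * ?phi m p) = pcoeff ?q k" for k by (rule form[of k "%j i. phi i (co I d p j)"])
  have "?q = 0"
  proof (rule poly_eqI)
   fix k show "pcoeff ?q k = pcoeff 0 k"
   proof (cases "k <= d")
   case True
   then show ?thesis using a unfolding q by simp
   next
   case False
   have "Polynomial.degree ?q <= card {1..d}" by (rule degree_prod_linear) simp
   then show ?thesis using False by (simp add: coeff_eq_0)
   qed
  qed
  then obtain j where j: "j : {1..d}" "[:SUM i<n. l 0 i * phi i (co I d p j), SUM i<n. l 1 i * phi i (co I d p j):] = 0" unfolding prod_zero_iff[OF finite_atLeastAtMost] by blast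
  obtain k where k: "k <= 1" "(SUM i<n. l k i * phi i (co I d p j)) ~= 0" using center[OF S.co_in_C[OF p j(1)]] by blast
  then have "k = 0 \<or> k = 1" by auto
  then show False using j(2) k(2) by auto
 qed
 have PVv: "projected_variety S.A S.V {..<M} d lv bv ?F sg" by (rule S.V.projected_variety_linsys[where dl = "S.pdiv dl" and phi = ?phi, OF pdv _ vp(2) rs vs ceV centerV]) (simp only: D'_def)
 interpret PV: projected_variety S.A S.V "{..<M}" d lv bv ?F sg by (rule PVv)
 have t: "PV.t k p = pcoeff (PROD j=1..d. [:PC.t 0 (co I d p j), PC.t 1 (co I d p j):]) k" for k p unfolding PV.t_def PC.t_def sg_def S.psec_def by (rule form)
 have pg: "power_galois I C d {..<n} l b ?f s G psi {..<M} lv bv ?F sg"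
 proof (rule power_galois.intro[OF sp gp PVv], rule power_galois_axioms.intro)
  show "gen S.A S.V (%p. ALL k<=d. PV.t k p = pcoeff (PROD j=1..d. [:PC.t 0 (co I d p j), PC.t 1 (co I d p j):]) k)" by (rule S.V.gen_all) (simp only: t simp_thms)
  show "gen I C (%x. al * PC.t 0 x + be * PC.t 1 x ~= 0)" if "(al, be) ~= (0, 0)" for al be by (rule GP.nonconstant_of_dim[OF refl dimC that])
 qed
 interpret PG: power_galois I C d "{..<n}" l b ?f s G psi "{..<M}" lv bv ?F sg by (rule pg)
 have pieV: "PV.pi = (%p. linear_projection PV.W PV.W0 (?F p))" by (rule ext) (rule PV.pi_def)
 have JM: "{i. int i <= int (length ?ss) - 1} = {..<M}" by auto
 have "galois_subspace S.A S.V (int (length ?ss) - 1) ?F PV.W (wreath_sym G d)" unfolding galois_subspace_def Let_def JM PG.variety_dim_power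
 proof (intro conjI exI)
  show "linear_subvariety {..<M} (int (length ?ss) - 1 - int d - 1) PV.W" using PV.linear_subvariety_W by (simp add: algebra_simps)
  show "PV.W Int ?F ` S.V = {}" using PV.phi_center by blast
  show "linear_subvariety {..<M} (int d) PV.W0" by (rule PV.linear_subvariety_W0)
  show "PV.W0 Int PV.W = {}" by (rule PV.W_disjoint)
  show "galois_extension (funfield S.A S.V) (pullback_field S.A S.V {..<M} PV.W0 (%p. linear_projection PV.W PV.W0 (?F p)))"
   "galois_group (funfield S.A S.V) (pullback_field S.A S.V {..<M} PV.W0 (%p. linear_projection PV.W PV.W0 (?F p))) \<cong> wreath_sym G d"
   unfolding pieV[symmetric] PG.pullback_power by (rule PG.power_galois_extension)+
 qed
 moreover have "smooth_projective_variety S.A S.V" unfolding smooth_projective_variety_def PG.variety_dim_power using S.fin_A S.V_irreducible S.power_tangent_dim[OF tan] by blast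
 ultimately show ?thesis unfolding possesses_galois_embedding_def using vp(1) by blast
qed

end
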